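(* For any $\epsilon\in(0,1)$, there exists a polynomial-time randomized $(1+\epsilon)$-approximation algorithm for the (weighted) shortest path problem whose Lipschitz constant is $O(\epsilon^{-1}\log^3 n)$, where $n$ is the number of vertices of the input graph.
   Context: Weighted shortest path problem: given an undirected graph $G=(V,E)$, vertices $s,t\in V$ and $w\in\mathbb{R}_{\geq0}^E$, output an $s$-$t$ walk $P$ (a multiset of edges) of small length $\sum_{e\in P}w(e)$ (with multiplicity); a $(1+\epsilon)$-approximation outputs a walk of length at most $(1+\epsilon)$ times the minimum length of an $s$-$t$ path. A walk $P$ with weights $w$ is mapped to $\sum_{e\in P}w(e)\mathbf{1}_e$ (with multiplicity), $\mathbf{1}_e$ the indicator vector of $e$; $d_w((P,w),(P',w'))=\|\sum_{e\in P}w(e)\mathbf{1}_e-\sum_{e\in P'}w'(e)\mathbf{1}_e\|_1$, and for output distributions $\mathrm{EM}_\mathrm{w}((\mathcal{F},w),(\mathcal{F}',w'))$ is the minimum over couplings of the expected $d_w$. The Lipschitz constant of a randomized algorithm $\mathcal{A}$ on $G$ (with fixed $s,t$) is $\sup_{w\neq w'\in\mathbb{R}_{\geq0}^E}\mathrm{EM}_\mathrm{w}((\mathcal{A}(G,w),w),(\mathcal{A}(G,w'),w'))/\|w-w'\|_1$. *)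

theory Defs
  imports
    "HOL-Probability.Probability"
    "HOL-Computational_Algebra.Polynomial"
begin

section \<open>Graphs, walks and weights\<close>

text \<open>The vertex set of a graph with \<open>n\<close> vertices is \<open>{..<n}\<close>; edges are two-element sets.\<close>

definition ugraph :: "nat \<Rightarrow> nat set set \<Rightarrow> bool" where
  "ugraph n E \<longleftrightarrow> E \<subseteq> {{u, v} | u v. u < n \<and> v < n \<and> u \<noteq> v}"

type_synonym weight = "nat set \<Rightarrow> real"

definition weights :: "nat set set \<Rightarrow> weight set" where
  "weights E = (E \<rightarrow>\<^sub>E {0..})"

definition is_walk :: "nat set set \<Rightarrow> nat \<Rightarrow> nat \<Rightarrow> nat list \<Rightarrow> bool" where
  "is_walk E s t p \<longleftrightarrow>
     p \<noteq> [] \<and> hd p = s \<and> last p = t \<and> successively (\<lambda>u v. {u, v} \<in> E) p"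

definition is_path :: "nat set set \<Rightarrow> nat \<Rightarrow> nat \<Rightarrow> nat list \<Rightarrow> bool" where
  "is_path E s t p \<longleftrightarrow> is_walk E s t p \<and> distinct p"

definition walk_edges :: "nat list \<Rightarrow> nat set multiset" where
  "walk_edges p = mset (map2 (\<lambda>u v. {u, v}) p (tl p))"

definition walk_length :: "weight \<Rightarrow> nat set multiset \<Rightarrow> real" where
  "walk_length w P = (\<Sum>e\<in>#P. w e)"

definition min_path_length :: "nat set set \<Rightarrow> nat \<Rightarrow> nat \<Rightarrow> weight \<Rightarrow> real" where
  "min_path_length E s t w = Min {walk_length w (walk_edges p) | p. is_path E s t p}"

text \<open>An input graph with its terminals; a feasible solution has to exist.\<close>

definition sp_instance :: "nat \<Rightarrow> nat set set \<Rightarrow> nat \<Rightarrow> nat \<Rightarrow> bool" where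
  "sp_instance n E s t \<longleftrightarrow> ugraph n E \<and> s < n \<and> t < n \<and> (\<exists>p. is_walk E s t p)"


section \<open>Weighted earth mover's distance and Lipschitz constant\<close>

definition walk_vector :: "nat set multiset \<Rightarrow> weight \<Rightarrow> nat set \<Rightarrow> real" where
  "walk_vector P w = (\<lambda>e. \<Sum>f\<in>#P. w f * indicator {f} e)"

definition l1_dist :: "nat set set \<Rightarrow> (nat set \<Rightarrow> real) \<Rightarrow> (nat set \<Rightarrow> real) \<Rightarrow> real" where
  "l1_dist E x y = (\<Sum>e\<in>E. \<bar>x e - y e\<bar>)"

definition d_w ::
  "nat set set \<Rightarrow> nat set multiset \<times> weight \<Rightarrow> nat set multiset \<times> weight \<Rightarrow> real" where
  "d_w E = (\<lambda>(P, w) (P', w'). l1_dist E (walk_vector P w) (walk_vector P' w'))"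

definition EM_w ::
  "nat set set \<Rightarrow> nat set multiset pmf \<times> weight \<Rightarrow> nat set multiset pmf \<times> weight \<Rightarrow> ennreal"
  where
  "EM_w E = (\<lambda>(F, w) (F', w').
     INF Q \<in> {Q. map_pmf fst Q = F \<and> map_pmf snd Q = F'}.
       \<integral>\<^sup>+ (P, P'). ennreal (d_w E (P, w) (P', w')) \<partial>measure_pmf Q)"

definition lipschitz_const ::
  "nat set set \<Rightarrow> (weight \<Rightarrow> nat set multiset pmf) \<Rightarrow> ennreal" where
  "lipschitz_const E F =
     (SUP (w, w') \<in> {(w, w'). w \<in> weights E \<and> w' \<in> weights E \<and> w \<noteq> w'}.
        EM_w E (F w, w) (F w', w') / ennreal (l1_dist E w w'))"


section \<open>Randomized real RAM\<close>

text \<open>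
  Weights are arbitrary reals, so running time is measured on a real RAM: a fixed structured
  program acting on arrays of naturals and arrays of reals, each indexed by tuples of naturals
  (a scalar is the entry at \<open>[]\<close>), at unit cost per step.
  Naturals admit only addition and truncated subtraction, so that in \<open>T\<close> steps they
  stay below \<open>2 ^ O(T)\<close>; reals admit field operations and comparison, but no rounding,
  and the only constants in programs are naturals.  This rules out packing super-polynomial
  work into unit-cost steps by rounding or by large integers, and advice hidden in constants.
  Randomness is a coin whose bias is the value of a real expression (clamped to \<open>[0, 1]\<close> by
  \<open>bernoulli_pmf\<close>), i.e. the test \<open>U < p\<close> for a fresh uniform
  variate \<open>U\<close> on \<open>[0, 1]\<close>.
\<close>

type_synonym vname = string

type_synonym store = "(vname \<Rightarrow> nat list \<Rightarrow> nat) \<times> (vname \<Rightarrow> nat list \<Rightarrow> real)"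

datatype nexp =
    NConst nat
  | NGet vname "nexp list"
  | NAdd nexp nexp
  | NSub nexp nexp

datatype rexp =
    ROfNat nexp
  | RGet vname "nexp list"
  | RAdd rexp rexp
  | RSub rexp rexp
  | RMul rexp rexp
  | RDiv rexp rexp

datatype bexp =
    NLess nexp nexp
  | RLess rexp rexp
  | BNot bexp
  | BAnd bexp bexp

datatype com =
    NAssign vname "nexp list" nexp
  | RAssign vname "nexp list" rexp
  | Flip vname "nexp list" rexp
  | Seq com com
  | Cond bexp com com
  | Loop bexp com

fun nval :: "nexp \<Rightarrow> store \<Rightarrow> nat" where
  "nval (NConst k) \<sigma> = k"
| "nval (NGet x is) \<sigma> = fst \<sigma> x (map (\<lambda>i. nval i \<sigma>) is)"
| "nval (NAdd a b) \<sigma> = nval a \<sigma> + nval b \<sigma>"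
| "nval (NSub a b) \<sigma> = nval a \<sigma> - nval b \<sigma>"

fun rval :: "rexp \<Rightarrow> store \<Rightarrow> real" where
  "rval (ROfNat a) \<sigma> = real (nval a \<sigma>)"
| "rval (RGet x is) \<sigma> = snd \<sigma> x (map (\<lambda>i. nval i \<sigma>) is)"
| "rval (RAdd a b) \<sigma> = rval a \<sigma> + rval b \<sigma>"
| "rval (RSub a b) \<sigma> = rval a \<sigma> - rval b \<sigma>"
| "rval (RMul a b) \<sigma> = rval a \<sigma> * rval b \<sigma>"
| "rval (RDiv a b) \<sigma> = rval a \<sigma> / rval b \<sigma>"

fun bval :: "bexp \<Rightarrow> store \<Rightarrow> bool" where
  "bval (NLess a b) \<sigma> \<longleftrightarrow> nval a \<sigma> < nval b \<sigma>"
| "bval (RLess a b) \<sigma> \<longleftrightarrow> rval a \<sigma> < rval b \<sigma>"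
| "bval (BNot b) \<sigma> \<longleftrightarrow> \<not> bval b \<sigma>"
| "bval (BAnd a b) \<sigma> \<longleftrightarrow> bval a \<sigma> \<and> bval b \<sigma>"

definition nput :: "vname \<Rightarrow> nexp list \<Rightarrow> nat \<Rightarrow> store \<Rightarrow> store" where
  "nput x is k \<sigma> =
     ((fst \<sigma>)(x := (fst \<sigma> x)(map (\<lambda>i. nval i \<sigma>) is := k)), snd \<sigma>)"

definition rput :: "vname \<Rightarrow> nexp list \<Rightarrow> real \<Rightarrow> store \<Rightarrow> store" where
  "rput x is r \<sigma> =
     (fst \<sigma>, (snd \<sigma>)(x := (snd \<sigma> x)(map (\<lambda>i. nval i \<sigma>) is := r)))"

text \<open>
  A configuration is a stack of commands still to be executed together with a store;
  the empty stack means that the machine has halted.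
\<close>

type_synonym config = "com list \<times> store"

fun step :: "config \<Rightarrow> config pmf" where
  "step ([], \<sigma>) = return_pmf ([], \<sigma>)"
| "step (NAssign x is a # K, \<sigma>) = return_pmf (K, nput x is (nval a \<sigma>) \<sigma>)"
| "step (RAssign x is a # K, \<sigma>) = return_pmf (K, rput x is (rval a \<sigma>) \<sigma>)"
| "step (Flip x is a # K, \<sigma>) =
     map_pmf (\<lambda>h. (K, nput x is (if h then 1 else 0) \<sigma>)) (bernoulli_pmf (rval a \<sigma>))"
| "step (Seq c d # K, \<sigma>) = return_pmf (c # d # K, \<sigma>)"
| "step (Cond b c d # K, \<sigma>) = return_pmf ((if bval b \<sigma> then c else d) # K, \<sigma>)"
| "step (Loop b c # K, \<sigma>) =
     return_pmf (if bval b \<sigma> then c # Loop b c # K else K, \<sigma>)"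

definition run :: "nat \<Rightarrow> com \<Rightarrow> store \<Rightarrow> config pmf" where
  "run T c \<sigma> = ((\<lambda>D. bind_pmf D step) ^^ T) (return_pmf ([c], \<sigma>))"

definition halts_within :: "nat \<Rightarrow> com \<Rightarrow> store \<Rightarrow> bool" where
  "halts_within T c \<sigma> \<longleftrightarrow> (\<forall>\<kappa> \<in> set_pmf (run T c \<sigma>). fst \<kappa> = [])"

text \<open>
  Halted configurations are absorbing, so for a program with a worst-case time bound
  this is its distribution over final stores.
\<close>

definition final_store :: "com \<Rightarrow> store \<Rightarrow> store pmf" where
  "final_store c \<sigma> = map_pmf snd (run (LEAST T. halts_within T c \<sigma>) c \<sigma>)"


section \<open>Algorithms for the shortest path problem\<close>

text \<open>
  The accuracy parameter is handed to the program in a register, since programs contain no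
  real constants.
\<close>

definition sp_input ::
  "real \<Rightarrow> nat \<Rightarrow> nat set set \<Rightarrow> nat \<Rightarrow> nat \<Rightarrow> weight \<Rightarrow> store" where
  "sp_input \<epsilon> n E s t w =
     ((\<lambda>x is.
         if x = ''n'' \<and> is = [] then n
         else if x = ''s'' \<and> is = [] then s
         else if x = ''t'' \<and> is = [] then t
         else if x = ''E'' then
           (case is of [u, v] \<Rightarrow> if {u, v} \<in> E then 1 else 0 | _ \<Rightarrow> 0)
         else 0),
      (\<lambda>x is.
         if x = ''eps'' \<and> is = [] then \<epsilon>
         else if x = ''w'' then
           (case is of [u, v] \<Rightarrow> if {u, v} \<in> E then w {u, v} else 0 | _ \<Rightarrow> 0)
         else 0))"

text \<open>The output is a vertex sequence, stored in an array together with its length.\<close>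

definition sp_output :: "store \<Rightarrow> nat list" where
  "sp_output \<sigma> = map (\<lambda>i. fst \<sigma> ''out'' [i]) [0..<fst \<sigma> ''len'' []]"

definition sp_result ::
  "com \<Rightarrow> real \<Rightarrow> nat \<Rightarrow> nat set set \<Rightarrow> nat \<Rightarrow> nat \<Rightarrow> weight \<Rightarrow> nat list pmf" where
  "sp_result A \<epsilon> n E s t w = map_pmf sp_output (final_store A (sp_input \<epsilon> n E s t w))"

text \<open>The time bound is worst case, over all coin outcomes.\<close>

definition sp_poly_time :: "com \<Rightarrow> real \<Rightarrow> bool" where
  "sp_poly_time A \<epsilon> \<longleftrightarrow>
     (\<exists>q :: nat poly. \<forall>n E s t. sp_instance n E s t \<longrightarrow>
        (\<forall>w \<in> weights E. halts_within (poly q n) A (sp_input \<epsilon> n E s t w)))"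

definition sp_approximation :: "com \<Rightarrow> real \<Rightarrow> real \<Rightarrow> bool" where
  "sp_approximation A \<epsilon> \<alpha> \<longleftrightarrow>
     (\<forall>n E s t. sp_instance n E s t \<longrightarrow>
        (\<forall>w \<in> weights E. \<forall>p \<in> set_pmf (sp_result A \<epsilon> n E s t w).
           is_walk E s t p \<and>
           walk_length w (walk_edges p) \<le> \<alpha> * min_path_length E s t w))"

definition sp_lipschitz_const ::
  "com \<Rightarrow> real \<Rightarrow> nat \<Rightarrow> nat set set \<Rightarrow> nat \<Rightarrow> nat \<Rightarrow> ennreal" where
  "sp_lipschitz_const A \<epsilon> n E s t =
     lipschitz_const E (\<lambda>w. map_pmf walk_edges (sp_result A \<epsilon> n E s t w))"

end

theory Submission
  imports Defs
begin

text \<open>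
  To connect \<open>a\<close> and \<open>b\<close> at distance \<open>D\<close>, draw a radius \<open>\<rho>\<close> uniformly from a grid in \<open>[D/3, 2D/3]\<close>, draw an
  edge \<open>xy\<close> that approximately crosses that radius on an approximately shortest path, with a soft minimum
  over the excess length, and recurse on \<open>(a, x)\<close> and \<open>(y, b)\<close>.  Distances shrink by a factor \<open>3/4\<close> per
  level, so \<open>O(log (n/\<epsilon>))\<close> levels suffice once all weights are raised to about \<open>\<epsilon> OPT / n\<^sup>2\<close>.

  Lipschitz constant: when a single weight changes by \<open>\<delta>\<close>, the soft minimum at a node with relative slack
  \<open>\<kappa>\<close> moves in total variation by \<open>O(\<delta> log n / (\<kappa> D))\<close>, and a different choice there costs \<open>O(D)\<close>.
  Only nodes with an almost shortest path through the changed edge are affected at all.  Both children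
  of an affected node can be affected only if \<open>\<rho>\<close> is within \<open>O(\<kappa> D)\<close> of the distance of the edge, which has
  probability \<open>O(\<kappa>)\<close>; hence each level has \<open>O(1)\<close> affected nodes in expectation.

  Slack: the first \<open>O(log n)\<close> levels use \<open>\<kappa> = \<Theta>(\<epsilon> / log n)\<close>, which gives \<open>O(log\<^sup>3 n / \<epsilon>)\<close>.  Deeper
  levels exist only because \<open>\<epsilon>\<close> may be much smaller than \<open>1 / n\<close>; there \<open>\<kappa>\<close> grows geometrically, which is
  affordable because the segments at such a level have total length at most \<open>n (3/4)^i OPT\<close> plus the
  excess accumulated so far.
\<close>

section \<open>Walks and distances\<close>

text \<open>The growth rate \<open>7/6\<close> of the deep slacks meets three constraints. If a
  child notices the changed edge with tolerance \<open>10 * ep f\<close>, its parent notices it with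
  tolerance \<open>(1 + 3/4 * 10) * ep f\<close>, and \<open>8.5 * 7/6 < 10\<close>, so the
  tolerance can follow the slack of each level. The excess added by deep levels decays like
  \<open>(7/6 * 3/4) ^ k = (7/8) ^ k\<close>. And
  \<open>(7/6) ^ J1 \<le> (4/3) ^ J1 = O(1 / \<epsilon>)\<close>, so every slack stays below a
  constant. The raised weights depend on the optimum, so changing one weight can move all of them.
  Two weightings are therefore compared through mixtures of their raised versions, one edge at a
  time, while cost is measured with mixtures of the originals. This is done only if the l1 change is
  below a quarter of the optimum; otherwise both walks are short compared with the change and any
  coupling will do. In particular the sampler may be discontinuous where the optimum is 0. The
  recursion tree is expanded without sharing: for fixed \<epsilon> its depth is at most
  \<open>36 * lg n + J1\<close>, so its size is polynomial in \<open>n\<close>.\<close>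

abbreviation wlen :: "weight \<Rightarrow> nat list \<Rightarrow> real" where
  "wlen v p \<equiv> walk_length v (walk_edges p)"

definition conn :: "nat set set \<Rightarrow> nat \<Rightarrow> nat \<Rightarrow> bool" where
  "conn E a b \<longleftrightarrow> (\<exists>p. is_walk E a b p)"

lemma walk_edges_simps [simp]:
  "walk_edges [] = {#}" "walk_edges [a] = {#}"
  "walk_edges (a # b # p) = add_mset {a, b} (walk_edges (b # p))"
  by (simp_all add: walk_edges_def)

lemma walk_length_simps [simp]:
  "walk_length v {#} = 0" "walk_length v (add_mset e P) = v e + walk_length v P"
  "walk_length v (P + Q) = walk_length v P + walk_length v Q"
  by (simp_all add: walk_length_def)

lemma walk_edges_append:
  "p \<noteq> [] \<Longrightarrow> q \<noteq> [] \<Longrightarrow>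
   walk_edges (p @ q) = add_mset {last p, hd q} (walk_edges p + walk_edges q)"
proof (induction p)
  case (Cons a p)
  then show ?case by (cases p; cases q) auto
qed simp

lemma walk_edges_overlap:
  "walk_edges (p @ y # q) = walk_edges (p @ [y]) + walk_edges (y # q)"
proof (induction p)
  case (Cons a p)
  then show ?case by (cases p) auto
qed simp

lemma is_walk_singleton [simp]: "is_walk E a b [x] \<longleftrightarrow> x = a \<and> x = b"
  by (auto simp: is_walk_def)

lemma is_walk_append_iff:
  "p \<noteq> [] \<Longrightarrow> q \<noteq> [] \<Longrightarrow>
   is_walk E a b (p @ q) \<longleftrightarrow> is_walk E a (last p) p \<and> {last p, hd q} \<in> E \<and> is_walk E (hd q) b q"
  by (auto simp: is_walk_def successively_append_iff)

lemma is_walk_appendI: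
  "is_walk E a x p \<Longrightarrow> {x, y} \<in> E \<Longrightarrow> is_walk E y b q \<Longrightarrow> is_walk E a b (p @ q)"
  by (subst is_walk_append_iff) (auto simp: is_walk_def)

lemma wlen_append:
  "is_walk E a x p \<Longrightarrow> is_walk E y b q \<Longrightarrow> wlen v (p @ q) = wlen v p + v {x, y} + wlen v q"
  by (subst walk_edges_append) (auto simp: is_walk_def)

lemma is_walk_overlap:
  "is_walk E a b (p @ y # q) \<longleftrightarrow> is_walk E a y (p @ [y]) \<and> is_walk E y b (y # q)"
  by (cases "p = []"; cases q) (auto simp: is_walk_def successively_append_iff)

lemma walk_edges_subset: "is_walk E a b p \<Longrightarrow> set_mset (walk_edges p) \<subseteq> E"
proof (induction p arbitrary: a)
  case (Cons x p)
  then show ?case by (cases p) (auto simp: is_walk_def)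
qed (auto simp: is_walk_def)

lemma walk_length_nonneg: "set_mset P \<subseteq> E \<Longrightarrow> (\<forall>e\<in>E. 0 \<le> v e) \<Longrightarrow> 0 \<le> walk_length v P"
  by (induction P) auto

lemma walk_length_mono:
  "set_mset P \<subseteq> E \<Longrightarrow> (\<forall>e\<in>E. c e \<le> v e) \<Longrightarrow> walk_length c P \<le> walk_length v P"
  by (induction P) (auto intro: add_mono)

lemma wlen_nonneg: "is_walk E a b p \<Longrightarrow> (\<forall>e\<in>E. 0 \<le> v e) \<Longrightarrow> 0 \<le> wlen v p"
  by (rule walk_length_nonneg[OF walk_edges_subset])

text \<open>Cutting out the closed walk between two visits of a vertex leaves fewer vertices and,
  with nonnegative weights, no greater length. This makes the minimum over simple paths a lower
  bound for all walks.\<close>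

lemma ex_path_le_walk:
  assumes "is_walk E a b p" "\<forall>e\<in>E. 0 \<le> v e"
  shows "\<exists>q. is_path E a b q \<and> wlen v q \<le> wlen v p"
  using assms(1)
proof (induction "length p" arbitrary: p rule: less_induct)
  case less
  show ?case
  proof (cases "distinct p")
    case True
    then show ?thesis using less.prems by (auto simp: is_path_def)
  next
    case False
    then obtain xs ys zs y where p: "p = xs @ [y] @ ys @ [y] @ zs"
      using not_distinct_decomp by blast
    have w: "is_walk E a y (xs @ [y])" "is_walk E y b (y # ys @ y # zs)"
      using less.prems is_walk_overlap[of E a b xs y "ys @ y # zs"] by (auto simp: p)
    then have w2: "is_walk E y y (y # ys @ [y])" "is_walk E y b (y # zs)"
      using is_walk_overlap[of E y b "y # ys" y zs] by auto
    have "is_walk E a b (xs @ y # zs)"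
      using w w2 is_walk_overlap by blast
    moreover have "length (xs @ y # zs) < length p" by (simp add: p)
    ultimately obtain q where "is_path E a b q" "wlen v q \<le> wlen v (xs @ y # zs)"
      using less.hyps by blast
    moreover have "wlen v p = wlen v (xs @ y # zs) + wlen v (y # ys @ [y])"
      using walk_edges_overlap[of xs y "ys @ y # zs"] walk_edges_overlap[of "y # ys" y zs]
        walk_edges_overlap[of xs y zs] by (simp add: p)
    ultimately show ?thesis
      using wlen_nonneg[OF w2(1) assms(2)] by fastforce
  qed
qed

lemma conn_refl [simp, intro]: "conn E a a"
  unfolding conn_def by (rule exI[of _ "[a]"]) simp

lemma conn_edge: "conn E a x \<Longrightarrow> {x, y} \<in> E \<Longrightarrow> conn E y b \<Longrightarrow> conn E a b"
  unfolding conn_def using is_walk_appendI by blast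

lemma conn_edgeD: "conn E a x \<Longrightarrow> {x, y} \<in> E \<Longrightarrow> conn E a y"
  using conn_edge conn_refl by blast

lemma is_walk_join:
  assumes "is_walk E a x p" "is_walk E x b q"
  shows "is_walk E a b (p @ tl q)" "wlen v (p @ tl q) = wlen v p + wlen v q"
proof -
  obtain p' where p: "p = p' @ [x]" using assms(1) by (metis append_butlast_last_id is_walk_def)
  obtain q' where q: "q = x # q'" using assms(2) by (metis list.collapse is_walk_def)
  show "is_walk E a b (p @ tl q)" using assms is_walk_overlap[of E a b p' x q'] by (simp add: p q)
  show "wlen v (p @ tl q) = wlen v p + wlen v q" using walk_edges_overlap[of p' x q'] by (simp add: p q)
qed

lemma conn_trans: "conn E a x \<Longrightarrow> conn E x b \<Longrightarrow> conn E a b"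
  unfolding conn_def using is_walk_join by blast

lemma is_walk_rev: "is_walk E a b p \<Longrightarrow> is_walk E b a (rev p)"
  by (auto simp: is_walk_def hd_rev last_rev successively_rev insert_commute)

lemma conn_sym: "conn E a b \<Longrightarrow> conn E b a"
  unfolding conn_def using is_walk_rev by blast

section \<open>Shortest-path distances in a finite graph\<close>

locale graph =
  fixes n :: nat and E :: "nat set set"
  assumes ugraph: "ugraph n E"
begin

lemma edge_less: "{x, y} \<in> E \<Longrightarrow> x < n \<and> y < n \<and> x \<noteq> y"
  using ugraph by (fastforce simp: ugraph_def doubleton_eq_iff)

lemma edge_ex: "e \<in> E \<Longrightarrow> \<exists>x y. e = {x, y} \<and> x < n \<and> y < n \<and> x \<noteq> y"
  using ugraph by (auto simp: ugraph_def)

lemma finite_E: "finite E" and card_E: "card E \<le> n * n"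
proof -
  have "E \<subseteq> (\<lambda>(x, y). {x, y}) ` ({..<n} \<times> {..<n})"
    using ugraph by (auto simp: ugraph_def)
  moreover have "finite ((\<lambda>(x, y). {x, y}) ` ({..<n} \<times> {..<n}))" by simp
  moreover have "card ((\<lambda>(x, y). {x, y}) ` ({..<n} \<times> {..<n})) \<le> n * n"
    using card_image_le[of "{..<n} \<times> {..<n}"] by (simp add: card_cartesian_product)
  ultimately show "finite E" "card E \<le> n * n"
    using finite_subset card_mono le_trans by metis+
qed

text \<open>The start vertex is listed separately because the walk \<open>[a]\<close> exists even
  for \<open>a\<close> outside \<open>{..<n}\<close>.\<close>

lemma walk_vertices: "is_walk E a b p \<Longrightarrow> set p \<subseteq> insert a {..<n}"
proof (induction p arbitrary: a)
  case (Cons x p)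
  show ?case
  proof (cases p)
    case (Cons y q)
    then have "is_walk E y b p" "{x, y} \<in> E" "x = a" using Cons.prems by (auto simp: is_walk_def)
    then show ?thesis using Cons.IH[of y] edge_less[of x y] by auto
  qed (use Cons.prems in \<open>auto simp: is_walk_def\<close>)
qed (auto simp: is_walk_def)

lemma finite_paths: "finite {p. is_path E a b p}"
  by (rule finite_subset[OF _ finite_subset_distinct[of "insert a {..<n}"]])
     (use walk_vertices in \<open>auto simp: is_path_def\<close>)

abbreviation dist :: "weight \<Rightarrow> nat \<Rightarrow> nat \<Rightarrow> real" where
  "dist v a b \<equiv> min_path_length E a b v"

lemma finite_path_lengths: "finite {wlen v p | p. is_path E a b p}"
proof -
  have "{wlen v p | p. is_path E a b p} = wlen v ` {p. is_path E a b p}" by auto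
  then show ?thesis using finite_paths by simp
qed

lemma dist_attained:
  assumes "conn E a b" "\<forall>e\<in>E. 0 \<le> v e"
  obtains p where "is_path E a b p" "wlen v p = dist v a b"
proof -
  obtain p0 where "is_walk E a b p0" using assms(1) by (auto simp: conn_def)
  then obtain q where "is_path E a b q" using ex_path_le_walk[of E a b p0 v] assms(2) by blast
  then have "{wlen v p | p. is_path E a b p} \<noteq> {}" by auto
  then have "dist v a b \<in> {wlen v p | p. is_path E a b p}"
    unfolding min_path_length_def using finite_path_lengths by (rule Min_in[rotated])
  then show ?thesis using that by auto
qed

lemma dist_le_wlen:
  assumes "is_walk E a b p" "\<forall>e\<in>E. 0 \<le> v e"
  shows "dist v a b \<le> wlen v p"
proof -
  obtain q where q: "is_path E a b q" "wlen v q \<le> wlen v p" using assms ex_path_le_walk by blast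
  have "dist v a b \<le> wlen v q" unfolding min_path_length_def
    by (rule Min_le[OF finite_path_lengths]) (use q in auto)
  then show ?thesis using q by simp
qed

context
  fixes v :: weight
  assumes nonneg: "\<forall>e\<in>E. 0 \<le> v e"
begin

lemma dist_nonneg: "conn E a b \<Longrightarrow> 0 \<le> dist v a b"
proof -
  assume c: "conn E a b"
  obtain p where p: "is_path E a b p" "wlen v p = dist v a b" using dist_attained[OF c nonneg] by blast
  then have "is_walk E a b p" by (simp add: is_path_def)
  from wlen_nonneg[OF this nonneg] show ?thesis using p by simp
qed

lemma dist_refl [simp]: "dist v a a = 0"
proof -
  have "dist v a a \<le> wlen v [a]" by (rule dist_le_wlen) (simp_all add: nonneg)
  then show ?thesis using dist_nonneg[of a a] by simp
qed

lemma dist_triangle: "conn E a x \<Longrightarrow> conn E x b \<Longrightarrow> dist v a b \<le> dist v a x + dist v x b"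
proof -
  assume c: "conn E a x" "conn E x b"
  obtain p where p: "is_path E a x p" "wlen v p = dist v a x" using dist_attained[OF c(1) nonneg] by blast
  obtain q where q: "is_path E x b q" "wlen v q = dist v x b" using dist_attained[OF c(2) nonneg] by blast
  have "is_walk E a x p" "is_walk E x b q" using p q by (auto simp: is_path_def)
  from dist_le_wlen[OF is_walk_join(1)[OF this] nonneg] is_walk_join(2)[OF this, of v]
  show ?thesis using p q by simp
qed

lemma dist_edge: "{x, y} \<in> E \<Longrightarrow> dist v x y \<le> v {x, y}"
proof -
  assume "{x, y} \<in> E"
  then have "dist v x y \<le> wlen v [x, y]" by (intro dist_le_wlen) (auto simp: is_walk_def nonneg)
  then show ?thesis by simp
qed

lemma dist_triangle_edge:
  "conn E a x \<Longrightarrow> {x, y} \<in> E \<Longrightarrow> conn E y b \<Longrightarrow>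
   dist v a b \<le> dist v a x + v {x, y} + dist v y b"
proof -
  assume c: "conn E a x" "{x, y} \<in> E" "conn E y b"
  have xy: "conn E x y" using conn_edgeD[OF conn_refl c(2)] .
  have "dist v a b \<le> dist v a x + dist v x b" using dist_triangle[OF c(1) conn_trans[OF xy c(3)]] .
  also have "dist v x b \<le> dist v x y + dist v y b" using dist_triangle[OF xy c(3)] .
  finally show ?thesis using dist_edge[OF c(2)] by simp
qed

end

text \<open>This closes the recursion: distances shrink by \<open>3/4\<close> per level, so once
  their bound is below the least weight \<open>m\<close>, the two end points coincide.\<close>

lemma dist_ge_edge:
  assumes "conn E a b" "a \<noteq> b" "\<forall>e\<in>E. m \<le> v e" "0 \<le> m"
  shows "m \<le> dist v a b"
proof -
  have nn: "\<forall>e\<in>E. 0 \<le> v e" using assms(3,4) by fastforce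
  obtain p where p: "is_path E a b p" "wlen v p = dist v a b" using dist_attained[OF assms(1) nn] by blast
  then obtain x y q where q: "p = x # y # q" using assms(2)
    by (cases p; cases "tl p") (auto simp: is_path_def is_walk_def)
  have "{x, y} \<in> E" "is_walk E y b (y # q)" using p q by (auto simp: is_path_def is_walk_def)
  then have "m \<le> v {x, y}" "0 \<le> wlen v (y # q)" using assms(3) wlen_nonneg nn by blast+
  then show ?thesis using p(2) by (simp add: q)
qed

text \<open>The induction subtracts the first edge from \<open>\<rho>\<close>; the edge found is the
  one on which the prefix length passes \<open>\<rho>\<close>.\<close>

lemma walk_crossing:
  assumes "is_walk E a b p" "0 \<le> \<rho>" "\<rho> < wlen v p"
  shows "\<exists>p1 p2. p = p1 @ p2 \<and> p1 \<noteq> [] \<and> p2 \<noteq> [] \<and> wlen v p1 \<le> \<rho> \<and> \<rho> < wlen v p1 + v {last p1, hd p2}"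
  using assms
proof (induction p arbitrary: a \<rho>)
  case (Cons x p)
  then obtain y q where q: "p = y # q" by (cases p) auto
  show ?case
  proof (cases "\<rho> < v {x, y}")
    case True
    show ?thesis using True Cons.prems by (intro exI[of _ "[x]"] exI[of _ p]) (auto simp: q)
  next
    case False
    have "is_walk E y b p" using Cons.prems by (auto simp: is_walk_def q)
    moreover have "\<rho> - v {x, y} < wlen v p" using Cons.prems by (simp add: q)
    ultimately obtain p1 p2 where *: "p = p1 @ p2" "p1 \<noteq> []" "p2 \<noteq> []" "wlen v p1 \<le> \<rho> - v {x, y}"
      "\<rho> - v {x, y} < wlen v p1 + v {last p1, hd p2}"
      using Cons.IH[of y "\<rho> - v {x, y}"] False by auto
    then have "wlen v (x # p1) = v {x, y} + wlen v p1" by (cases p1) (auto simp: q)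
    then show ?thesis using * by (intro exI[of _ "x # p1"] exI[of _ p2]) auto
  qed
qed simp

text \<open>On a shortest path both parts around the crossing edge are shortest themselves. The edge
  found will have score \<open>0\<close>, which keeps the normaliser of the soft minimum at least
  \<open>1\<close>.\<close>

lemma dist_crossing:
  assumes "conn E a b" "\<forall>e\<in>E. 0 \<le> v e" "0 \<le> \<rho>" "\<rho> < dist v a b"
  obtains x y where "{x, y} \<in> E" "conn E a x" "conn E y b" "dist v a x \<le> \<rho>" "dist v y b \<le> dist v a b - \<rho>"
    "dist v a x + v {x, y} + dist v y b = dist v a b"
proof -
  obtain p where p: "is_path E a b p" "wlen v p = dist v a b" using dist_attained[OF assms(1,2)] by blast
  then obtain p1 p2 where *: "p = p1 @ p2" "p1 \<noteq> []" "p2 \<noteq> []" "wlen v p1 \<le> \<rho>"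
    "\<rho> < wlen v p1 + v {last p1, hd p2}"
    using walk_crossing[of a b p \<rho> v] assms by (auto simp: is_path_def)
  define x y where "x = last p1" "y = hd p2"
  have w: "is_walk E a x p1" "{x, y} \<in> E" "is_walk E y b p2"
    using p *(1-3) is_walk_append_iff by (auto simp: is_path_def x_y_def)
  have l: "wlen v p = wlen v p1 + v {x, y} + wlen v p2" using wlen_append w *(1) by blast
  have d: "dist v a x \<le> wlen v p1" "dist v y b \<le> wlen v p2" using dist_le_wlen assms(2) w by blast+
  have c: "conn E a x" "conn E y b" using w conn_def by auto
  have "dist v a b \<le> dist v a x + v {x, y} + dist v y b"
    using dist_triangle_edge[OF assms(2) c(1) w(2) c(2)] .
  then have eq: "dist v a x = wlen v p1" "dist v y b = wlen v p2" using l d p by auto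
  show ?thesis by (rule that[of x y]) (use w c eq l p * in \<open>auto simp: x_y_def\<close>)
qed

lemma walk_edges_subset_vertices: "e \<in># walk_edges p \<Longrightarrow> e \<subseteq> set p"
proof (induction p)
  case (Cons x p)
  then show ?case by (cases p) auto
qed simp

lemma count_walk_edges_distinct: "distinct p \<Longrightarrow> count (walk_edges p) e \<le> 1"
proof (induction p)
  case (Cons x p)
  show ?case
  proof (cases p)
    case (Cons y q)
    have "{x, y} \<notin># walk_edges p" using walk_edges_subset_vertices[of "{x, y}" p] Cons.prems by auto
    then show ?thesis using Cons.IH Cons.prems
      by (auto simp: Cons count_eq_zero_iff)
  qed simp
qed simp

lemma walk_length_sum:
  assumes "set_mset P \<subseteq> E"
  shows "walk_length v P = (\<Sum>e\<in>E. real (count P e) * v e)"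
  using assms
proof (induction P)
  case (add f P)
  have "(\<Sum>e\<in>E. real (count (add_mset f P) e) * v e) =
    (\<Sum>e\<in>E. (if e = f then v e else 0) + real (count P e) * v e)"
    by (intro sum.cong) (auto simp: algebra_simps)
  also have "\<dots> = v f + (\<Sum>e\<in>E. real (count P e) * v e)"
    using add.prems finite_E by (simp add: sum.distrib)
  finally show ?case using add by simp
qed simp

text \<open>A shortest path can be taken simple, so each edge counts at most once and the length of
  the path moves by at most the l1 change. Evaluating it under the other weights gives one
  inequality, symmetry the other.\<close>

lemma dist_l1:
  assumes "conn E a b" "\<forall>e\<in>E. 0 \<le> v e" "\<forall>e\<in>E. 0 \<le> v' e"
  shows "\<bar>dist v a b - dist v' a b\<bar> \<le> l1_dist E v v'"
proof -
  have *: "dist v' a b \<le> dist v a b + l1_dist E v v'"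
    if nn: "\<forall>e\<in>E. 0 \<le> v e" "\<forall>e\<in>E. 0 \<le> v' e" for v v'
  proof -
    obtain p where p: "is_path E a b p" "wlen v p = dist v a b" using dist_attained[OF assms(1) nn(1)] by blast
    then have s: "set_mset (walk_edges p) \<subseteq> E" using walk_edges_subset unfolding is_path_def by blast
    have "wlen v' p - wlen v p = (\<Sum>e\<in>E. real (count (walk_edges p) e) * (v' e - v e))"
      by (simp add: walk_length_sum[OF s] sum_subtractf right_diff_distrib)
    also have "\<dots> \<le> (\<Sum>e\<in>E. \<bar>v e - v' e\<bar>)"
    proof (rule sum_mono)
      fix e
      have "count (walk_edges p) e = 0 \<or> count (walk_edges p) e = 1"
        using count_walk_edges_distinct[of p e] p by (auto simp: is_path_def)
      then show "real (count (walk_edges p) e) * (v' e - v e) \<le> \<bar>v e - v' e\<bar>" by auto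
    qed
    finally have "wlen v' p \<le> dist v a b + l1_dist E v v'" using p by (simp add: l1_dist_def)
    moreover have "dist v' a b \<le> wlen v' p" using dist_le_wlen p nn by (auto simp: is_path_def)
    ultimately show ?thesis by simp
  qed
  have "l1_dist E v' v = l1_dist E v v'" by (simp add: l1_dist_def abs_minus_commute)
  then show ?thesis using *[of v v'] *[of v' v] assms by auto
qed

lemma dist_mono:
  assumes "conn E a b" "\<forall>e\<in>E. 0 \<le> v e" "\<forall>e\<in>E. v e \<le> v' e"
  shows "dist v a b \<le> dist v' a b"
proof -
  have nn: "\<forall>e\<in>E. 0 \<le> v' e" using assms by force
  obtain p where p: "is_path E a b p" "wlen v' p = dist v' a b" using dist_attained[OF assms(1) nn] by blast
  have "dist v a b \<le> wlen v p" using dist_le_wlen p assms(2) by (auto simp: is_path_def)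
  also have "\<dots> \<le> wlen v' p" using walk_length_mono[OF walk_edges_subset[of E a b p] assms(3)] p(1) by (simp add: is_path_def)
  finally show ?thesis using p by simp
qed

lemma path_length_le:
  assumes "is_path E a b p" "a < n" shows "length p \<le> n"
proof -
  have "set p \<subseteq> {..<n}" using assms walk_vertices by (fastforce simp: is_path_def)
  then have "card (set p) \<le> n" using card_mono[of "{..<n}" "set p"] by simp
  then show ?thesis using assms distinct_card by (fastforce simp: is_path_def)
qed

lemma size_walk_edges: "size (walk_edges p) = length p - 1"
  by (simp add: walk_edges_def)

end

section \<open>Couplings and reservoir sampling\<close>

text \<open>A certificate for an upper bound on the transport cost. Asserting one coupling, instead
  of bounding an infimum, lets such bounds compose without approximation arguments.\<close>

definition cpl :: "'a pmf \<Rightarrow> 'b pmf \<Rightarrow> ('a \<Rightarrow> 'b \<Rightarrow> ennreal) \<Rightarrow> ennreal \<Rightarrow> bool" where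
  "cpl M M' cost c \<longleftrightarrow> (\<exists>Q. map_pmf fst Q = M \<and> map_pmf snd Q = M' \<and>
     (\<integral>\<^sup>+ z. cost (fst z) (snd z) \<partial>measure_pmf Q) \<le> c)"

lemma cpl_mono: "cpl M M' cost c \<Longrightarrow> c \<le> c' \<Longrightarrow> cpl M M' cost c'"
  unfolding cpl_def using order_trans by blast

lemma cpl_sym:
  assumes "cpl M M' cost c" shows "cpl M' M (\<lambda>x y. cost y x) c"
proof -
  obtain Q where Q: "map_pmf fst Q = M" "map_pmf snd Q = M'"
    "(\<integral>\<^sup>+ z. cost (fst z) (snd z) \<partial>measure_pmf Q) \<le> c" using assms by (auto simp: cpl_def)
  show ?thesis unfolding cpl_def
    by (rule exI[of _ "map_pmf prod.swap Q"]) (use Q in \<open>simp add: pmf.map_comp o_def\<close>)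
qed

lemma cpl_bounded:
  assumes "\<And>x y. x \<in> set_pmf M \<Longrightarrow> y \<in> set_pmf M' \<Longrightarrow> cost x y \<le> c"
  shows "cpl M M' cost c"
proof -
  have "(\<integral>\<^sup>+ z. cost (fst z) (snd z) \<partial>measure_pmf (pair_pmf M M')) \<le>
      (\<integral>\<^sup>+ z. c \<partial>measure_pmf (pair_pmf M M'))"
    using assms by (intro nn_integral_mono_AE) (auto simp: AE_measure_pmf_iff)
  then show ?thesis unfolding cpl_def
    by (intro exI[of _ "pair_pmf M M'"]) (simp add: map_fst_pair_pmf map_snd_pair_pmf)
qed

text \<open>A coupling of the first draws is refined by a coupling of the continuations for each
  pair of outcomes; the costs average over the first coupling.\<close>

lemma cpl_bind_coupled:
  assumes "\<And>z. z \<in> set_pmf Q \<Longrightarrow> cpl (A (fst z)) (B (snd z)) cost (c z)"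
  shows "cpl (bind_pmf (map_pmf fst Q) A) (bind_pmf (map_pmf snd Q) B) cost (\<integral>\<^sup>+ z. c z \<partial>measure_pmf Q)"
proof -
  from assms obtain q where q: "\<And>z. z \<in> set_pmf Q \<Longrightarrow> map_pmf fst (q z) = A (fst z)"
    "\<And>z. z \<in> set_pmf Q \<Longrightarrow> map_pmf snd (q z) = B (snd z)"
    "\<And>z. z \<in> set_pmf Q \<Longrightarrow> (\<integral>\<^sup>+ x. cost (fst x) (snd x) \<partial>measure_pmf (q z)) \<le> c z"
    unfolding cpl_def by metis
  have "map_pmf fst (bind_pmf Q q) = bind_pmf (map_pmf fst Q) A"
    by (auto simp: map_bind_pmf bind_map_pmf q intro!: bind_pmf_cong)
  moreover have "map_pmf snd (bind_pmf Q q) = bind_pmf (map_pmf snd Q) B"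
    by (auto simp: map_bind_pmf bind_map_pmf q intro!: bind_pmf_cong)
  moreover have "(\<integral>\<^sup>+ x. cost (fst x) (snd x) \<partial>measure_pmf (bind_pmf Q q)) \<le> (\<integral>\<^sup>+ z. c z \<partial>measure_pmf Q)"
    by (auto simp: AE_measure_pmf_iff q intro!: nn_integral_mono_AE)
  ultimately show ?thesis unfolding cpl_def by blast
qed

lemma cpl_bind:
  assumes "\<And>i. i \<in> set_pmf M \<Longrightarrow> cpl (A i) (B i) cost (c i)"
  shows "cpl (bind_pmf M A) (bind_pmf M B) cost (\<integral>\<^sup>+ i. c i \<partial>measure_pmf M)"
proof -
  have "cpl (bind_pmf (map_pmf fst (map_pmf (\<lambda>i. (i, i)) M)) A) (bind_pmf (map_pmf snd (map_pmf (\<lambda>i. (i, i)) M)) B)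
    cost (\<integral>\<^sup>+ z. c (fst z) \<partial>measure_pmf (map_pmf (\<lambda>i. (i, i)) M))"
    by (rule cpl_bind_coupled) (use assms in auto)
  then show ?thesis by (simp add: pmf.map_comp o_def)
qed

text \<open>The gluing construction: a pair from the first coupling is extended by a third
  component, drawn from the second coupling conditioned on the common middle value. The edge-by-edge
  comparison of two weightings rests on it.\<close>

lemma cpl_trans:
  assumes "cpl M1 M2 cost12 c12" "cpl M2 M3 cost23 c23"
    "\<And>x y z. x \<in> set_pmf M1 \<Longrightarrow> y \<in> set_pmf M2 \<Longrightarrow> z \<in> set_pmf M3 \<Longrightarrow> cost13 x z \<le> cost12 x y + cost23 y z"
  shows "cpl M1 M3 cost13 (c12 + c23)"
proof -
  obtain Q where Q: "map_pmf fst Q = M1" "map_pmf snd Q = M2"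
    "(\<integral>\<^sup>+ z. cost12 (fst z) (snd z) \<partial>measure_pmf Q) \<le> c12" using assms(1) by (auto simp: cpl_def)
  obtain R where R: "map_pmf fst R = M2" "map_pmf snd R = M3"
    "(\<integral>\<^sup>+ z. cost23 (fst z) (snd z) \<partial>measure_pmf R) \<le> c23" using assms(2) by (auto simp: cpl_def)
  have ne: "set_pmf R \<inter> {q. fst q = y} \<noteq> {}" if "y \<in> set_pmf M2" for y
    using that unfolding R(1)[symmetric] by auto
  have neQ: "set_pmf R \<inter> {q. fst q = snd p} \<noteq> {}" if "p \<in> set_pmf Q" for p
    using that ne unfolding Q(2)[symmetric] by auto
  define T where "T = bind_pmf Q (\<lambda>p. map_pmf (Pair (fst p)) (cond_pmf R {q. fst q = snd p}))"
  have "map_pmf snd T = bind_pmf Q (\<lambda>p. cond_pmf R {q. fst q = snd p})"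
    by (simp add: T_def map_bind_pmf pmf.map_comp o_def)
  also have "\<dots> = bind_pmf M2 (\<lambda>y. cond_pmf R {q. fst q = y})"
    unfolding Q(2)[symmetric] by (simp add: bind_map_pmf)
  \<comment> \<open>Drawing the middle value from its marginal and then conditioning on it recovers
    \<open>R\<close>.\<close>
  also have "\<dots> = R"
  proof (rule bind_cond_pmf_cancel)
    show "set_pmf R \<inter> {q. fst q = y} \<noteq> {}" if "y \<in> set_pmf M2" for y by (rule ne[OF that])
    show "set_pmf M2 \<inter> {y. fst q = y} \<noteq> {}" if "q \<in> set_pmf R" for q
      using that unfolding R(1)[symmetric] by auto
    show "measure (measure_pmf R) {q. fst q = y} = measure (measure_pmf M2) {y. fst q = y}"
      if "y \<in> set_pmf M2" "q \<in> set_pmf R" "fst q = y" for y q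
    proof -
      have *: "{y. fst q = y} = {y}" "fst -` {y} = {q. fst q = y}" using that by auto
      show ?thesis unfolding R(1)[symmetric] *(1) measure_map_pmf *(2) ..
    qed
  qed
  finally have TR: "map_pmf snd T = R" .
  have "map_pmf (\<lambda>t. (fst t, fst (snd t))) T =
      bind_pmf Q (\<lambda>p. map_pmf (\<lambda>q. (fst p, fst q)) (cond_pmf R {q. fst q = snd p}))"
    by (simp add: T_def map_bind_pmf pmf.map_comp o_def)
  also have "\<dots> = bind_pmf Q (\<lambda>p. map_pmf (\<lambda>q. p) (cond_pmf R {q. fst q = snd p}))"
    by (intro bind_pmf_cong refl map_pmf_cong) (auto simp: neQ)
  also have "\<dots> = Q" by (simp add: map_pmf_const bind_return_pmf')
  finally have TQ: "map_pmf (\<lambda>t. (fst t, fst (snd t))) T = Q" .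
  have s: "fst t \<in> set_pmf M1 \<and> fst (snd t) \<in> set_pmf M2 \<and> snd (snd t) \<in> set_pmf M3" if "t \<in> set_pmf T" for t
  proof -
    have "snd t \<in> set_pmf R" "(fst t, fst (snd t)) \<in> set_pmf Q"
      using that unfolding TR[symmetric] TQ[symmetric] by auto
    then show ?thesis unfolding R(1,2)[symmetric] Q(1)[symmetric] by force
  qed
  have "map_pmf fst (map_pmf (\<lambda>t. (fst t, snd (snd t))) T) = map_pmf fst Q"
    unfolding TQ[symmetric] by (simp add: pmf.map_comp o_def)
  moreover have "map_pmf snd (map_pmf (\<lambda>t. (fst t, snd (snd t))) T) = map_pmf snd R"
    unfolding TR[symmetric] by (simp add: pmf.map_comp o_def)
  moreover have "(\<integral>\<^sup>+ z. cost13 (fst z) (snd z) \<partial>measure_pmf (map_pmf (\<lambda>t. (fst t, snd (snd t))) T)) \<le> c12 + c23"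
  proof -
    have "(\<integral>\<^sup>+ z. cost13 (fst z) (snd z) \<partial>measure_pmf (map_pmf (\<lambda>t. (fst t, snd (snd t))) T)) \<le>
      (\<integral>\<^sup>+ t. cost12 (fst t) (fst (snd t)) + cost23 (fst (snd t)) (snd (snd t)) \<partial>measure_pmf T)"
      using s assms(3) by (auto simp: AE_measure_pmf_iff intro!: nn_integral_mono_AE)
    also have "\<dots> = (\<integral>\<^sup>+ z. cost12 (fst z) (snd z) \<partial>measure_pmf (map_pmf (\<lambda>t. (fst t, fst (snd t))) T)) +
       (\<integral>\<^sup>+ z. cost23 (fst z) (snd z) \<partial>measure_pmf (map_pmf snd T))"
      by (simp add: nn_integral_add)
    also have "\<dots> \<le> c12 + c23" unfolding TQ TR by (intro add_mono Q(3) R(3))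
    finally show ?thesis .
  qed
  ultimately show ?thesis unfolding cpl_def Q(1) R(2) by blast
qed

text \<open>The two halves are coupled independently of each other; \<open>c\<close> pays for what
  lies between them, later the split edge.\<close>

lemma cpl_pair:
  assumes "cpl M1 M1' cost1 c1" "cpl M2 M2' cost2 c2"
    "\<And>x y x' y'. x \<in> set_pmf M1 \<Longrightarrow> y \<in> set_pmf M2 \<Longrightarrow> x' \<in> set_pmf M1' \<Longrightarrow> y' \<in> set_pmf M2' \<Longrightarrow>
       cost (f x y) (f x' y') \<le> cost1 x x' + cost2 y y' + c"
  shows "cpl (map_pmf (\<lambda>(x, y). f x y) (pair_pmf M1 M2)) (map_pmf (\<lambda>(x, y). f x y) (pair_pmf M1' M2'))
    cost (c1 + c2 + c)"
proof -
  obtain Q where Q: "map_pmf fst Q = M1" "map_pmf snd Q = M1'"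
    "(\<integral>\<^sup>+ z. cost1 (fst z) (snd z) \<partial>measure_pmf Q) \<le> c1" using assms(1) by (auto simp: cpl_def)
  obtain R where R: "map_pmf fst R = M2" "map_pmf snd R = M2'"
    "(\<integral>\<^sup>+ z. cost2 (fst z) (snd z) \<partial>measure_pmf R) \<le> c2" using assms(2) by (auto simp: cpl_def)
  let ?T = "map_pmf (\<lambda>(p, q). (f (fst p) (fst q), f (snd p) (snd q))) (pair_pmf Q R)"
  have s: "fst p \<in> set_pmf M1" "snd p \<in> set_pmf M1'" if "p \<in> set_pmf Q" for p
    using that unfolding Q(1,2)[symmetric] by auto
  have s2: "fst p \<in> set_pmf M2" "snd p \<in> set_pmf M2'" if "p \<in> set_pmf R" for p
    using that unfolding R(1,2)[symmetric] by auto
  have "map_pmf fst ?T = map_pmf (\<lambda>(x, y). f x y) (pair_pmf M1 M2)"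
    unfolding Q(1)[symmetric] R(1)[symmetric]
    by (simp add: pair_map_pmf1 pair_map_pmf2 pmf.map_comp o_def case_prod_beta')
  moreover have "map_pmf snd ?T = map_pmf (\<lambda>(x, y). f x y) (pair_pmf M1' M2')"
    unfolding Q(2)[symmetric] R(2)[symmetric]
    by (simp add: pair_map_pmf1 pair_map_pmf2 pmf.map_comp o_def case_prod_beta')
  moreover have "(\<integral>\<^sup>+ z. cost (fst z) (snd z) \<partial>measure_pmf ?T) \<le> c1 + c2 + c"
  proof -
    have "(\<integral>\<^sup>+ z. cost (fst z) (snd z) \<partial>measure_pmf ?T) \<le>
      (\<integral>\<^sup>+ z. cost1 (fst (fst z)) (snd (fst z)) + cost2 (fst (snd z)) (snd (snd z)) + c \<partial>measure_pmf (pair_pmf Q R))"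
      using assms(3) s s2 by (auto simp: AE_measure_pmf_iff case_prod_beta' intro!: nn_integral_mono_AE)
    also have "\<dots> = (\<integral>\<^sup>+ z. cost1 (fst z) (snd z) \<partial>measure_pmf (map_pmf fst (pair_pmf Q R))) +
        (\<integral>\<^sup>+ z. cost2 (fst z) (snd z) \<partial>measure_pmf (map_pmf snd (pair_pmf Q R))) + c"
      by (simp add: nn_integral_add)
    also have "\<dots> \<le> c1 + c2 + c"
      unfolding map_fst_pair_pmf map_snd_pair_pmf by (intro add_mono Q(3) R(3) order_refl)
    finally show ?thesis .
  qed
  ultimately show ?thesis unfolding cpl_def by blast
qed

text \<open>The common part \<open>min p q\<close> stays on the diagonal and the two remainders are
  matched by a normalised product. The off-diagonal mass is at most the total variation distance,
  which is half of the sum on the right; the spare factor \<open>2\<close> is given away.\<close>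

lemma ex_maximal_coupling:
  fixes p q :: "'a pmf"
  assumes fin: "finite Z" and Zp: "set_pmf p \<subseteq> Z" and Zq: "set_pmf q \<subseteq> Z"
  shows "\<exists>Q. map_pmf fst Q = p \<and> map_pmf snd Q = q \<and>
    measure (measure_pmf Q) {z. fst z \<noteq> snd z} \<le> (\<Sum>z\<in>Z. \<bar>pmf p z - pmf q z\<bar>)"
proof (cases "p = q")
  case True
  have "map_pmf fst (map_pmf (\<lambda>z. (z, z)) p) = p" "map_pmf snd (map_pmf (\<lambda>z. (z, z)) p) = q"
    using True by (simp_all add: pmf.map_comp o_def)
  moreover have "measure (measure_pmf (map_pmf (\<lambda>z. (z, z)) p)) {z. fst z \<noteq> snd z} \<le> (\<Sum>z\<in>Z. \<bar>pmf p z - pmf q z\<bar>)"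
    by (simp add: vimage_def sum_nonneg)
  ultimately show ?thesis by blast
next
  case False
  define m where "m z = min (pmf p z) (pmf q z)" for z
  define T where "T = (\<Sum>z\<in>Z. pmf p z - m z)"
  have sp: "(\<Sum>z\<in>Z. pmf p z) = 1" and sq: "(\<Sum>z\<in>Z. pmf q z) = 1"
    using sum_pmf_eq_1[OF fin Zp] sum_pmf_eq_1[OF fin Zq] by simp_all
  have Tq: "(\<Sum>z\<in>Z. pmf q z - m z) = T" unfolding T_def using sp sq by (simp add: sum_subtractf)
  have nn: "0 \<le> pmf p z - m z" "0 \<le> pmf q z - m z" "0 \<le> m z" for z by (auto simp: m_def)
  \<comment> \<open>\<open>T\<close> normalises the product of the remainders; it vanishes only for
    equal distributions, which are handled separately.\<close>
  have "T \<noteq> 0"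
  proof
    assume "T = 0"
    then have "\<forall>z\<in>Z. pmf p z = m z" "\<forall>z\<in>Z. pmf q z = m z"
      using sum_nonneg_eq_0_iff[OF fin, of "\<lambda>z. pmf p z - m z"] sum_nonneg_eq_0_iff[OF fin, of "\<lambda>z. pmf q z - m z"]
        nn Tq by (auto simp: T_def)
    moreover have "pmf p z = 0" "pmf q z = 0" if "z \<notin> Z" for z
      using that Zp Zq by (metis pmf_eq_0_set_pmf subsetD)+
    ultimately have "pmf p z = pmf q z" for z by (cases "z \<in> Z") auto
    then show False using False pmf_eqI by blast
  qed
  then have T: "0 < T" using sum_nonneg[of Z "\<lambda>z. pmf p z - m z"] nn by (force simp: T_def)
  have out: "pmf p z = 0" "pmf q z = 0" "m z = 0" if "z \<notin> Z" for z
  proof -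
    show "pmf p z = 0" "pmf q z = 0" using that Zp Zq by (metis pmf_eq_0_set_pmf subsetD)+
    then show "m z = 0" by (simp add: m_def)
  qed
  define h where "h x = (if fst x = snd x then m (fst x) else 0) +
    (pmf p (fst x) - m (fst x)) * (pmf q (snd x) - m (snd x)) / T" for x
  have hnn: "0 \<le> h x" for x unfolding h_def using nn T by auto
  have hout: "h x = 0" if "x \<notin> Z \<times> Z" for x using that out by (cases x) (auto simp: h_def)
  have row: "(\<Sum>y\<in>Z. h (x, y)) = pmf p x" for x
  proof (cases "x \<in> Z")
    case True
    have "(\<Sum>y\<in>Z. h (x, y)) = (\<Sum>y\<in>Z. if x = y then m x else 0) + (pmf p x - m x) / T * (\<Sum>y\<in>Z. pmf q y - m y)"
      by (simp add: h_def sum.distrib sum_distrib_left cong: if_cong)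
    also have "\<dots> = pmf p x" unfolding Tq using True T fin by simp
    finally show ?thesis .
  qed (auto simp: h_def out intro!: sum.neutral)
  have col: "(\<Sum>x\<in>Z. h (x, y)) = pmf q y" for y
  proof (cases "y \<in> Z")
    case True
    have "(\<Sum>x\<in>Z. h (x, y)) = (\<Sum>x\<in>Z. if x = y then m x else 0) + (\<Sum>x\<in>Z. pmf p x - m x) * ((pmf q y - m y) / T)"
      by (simp add: h_def sum.distrib sum_distrib_right sum_divide_distrib cong: if_cong)
    also have "\<dots> = pmf q y" unfolding T_def[symmetric] using True T fin by simp
    finally show ?thesis .
  qed (auto simp: h_def out intro!: sum.neutral)
  have "(\<integral>\<^sup>+x. ennreal (h x) \<partial>count_space UNIV) = (\<integral>\<^sup>+x. ennreal (h x) \<partial>count_space (Z \<times> Z))"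
    by (subst nn_integral_count_space_indicator)
       (auto simp: hout indicator_def intro!: nn_integral_cong)
  also have "\<dots> = ennreal (\<Sum>x\<in>Z \<times> Z. h x)"
    using fin hnn by (simp add: nn_integral_count_space_finite)
  also have "(\<Sum>x\<in>Z \<times> Z. h x) = (\<Sum>x\<in>Z. \<Sum>y\<in>Z. h (x, y))" by (simp add: sum.cartesian_product)
  finally have h1: "(\<integral>\<^sup>+x. ennreal (h x) \<partial>count_space UNIV) = 1" by (simp add: row sp)
  define Q where "Q = embed_pmf h"
  have Q: "pmf Q x = h x" for x unfolding Q_def by (rule pmf_embed_pmf[OF hnn h1])
  have sQ: "set_pmf Q \<subseteq> Z \<times> Z"
  proof
    fix x assume "x \<in> set_pmf Q"
    then have "h x \<noteq> 0" by (simp add: set_pmf_iff Q)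
    then show "x \<in> Z \<times> Z" using hout by blast
  qed
  have meas: "measure (measure_pmf Q) A = sum h (A \<inter> Z \<times> Z)" for A
  proof -
    have "measure (measure_pmf Q) A = measure (measure_pmf Q) (A \<inter> (Z \<times> Z))"
      using sQ by (intro measure_pmf.finite_measure_eq_AE) (auto simp: AE_measure_pmf_iff)
    then show ?thesis using fin by (simp add: measure_measure_pmf_finite Q)
  qed
  have "map_pmf fst Q = p"
  proof (rule pmf_eqI)
    fix x
    have "fst -` {x} \<inter> Z \<times> Z = (if x \<in> Z then Pair x ` Z else {})" by auto
    then have "pmf (map_pmf fst Q) x = (if x \<in> Z then \<Sum>y\<in>Z. h (x, y) else 0)"
      by (simp add: pmf_map meas sum.reindex inj_on_def)
    then show "pmf (map_pmf fst Q) x = pmf p x" using row out by auto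
  qed
  moreover have "map_pmf snd Q = q"
  proof (rule pmf_eqI)
    fix y
    have "snd -` {y} \<inter> Z \<times> Z = (if y \<in> Z then (\<lambda>x. (x, y)) ` Z else {})" by auto
    then have "pmf (map_pmf snd Q) y = (if y \<in> Z then \<Sum>x\<in>Z. h (x, y) else 0)"
      by (simp add: pmf_map meas sum.reindex inj_on_def)
    then show "pmf (map_pmf snd Q) y = pmf q y" using col out by auto
  qed
  moreover have "measure (measure_pmf Q) {z. fst z \<noteq> snd z} \<le> (\<Sum>z\<in>Z. \<bar>pmf p z - pmf q z\<bar>)"
  proof -
    have "measure (measure_pmf Q) {z. fst z \<noteq> snd z} =
        (\<Sum>x\<in>{z. fst z \<noteq> snd z} \<inter> Z \<times> Z. (pmf p (fst x) - m (fst x)) * (pmf q (snd x) - m (snd x)) / T)"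
      unfolding meas by (intro sum.cong) (auto simp: h_def)
    also have "\<dots> \<le> (\<Sum>x\<in>Z \<times> Z. (pmf p (fst x) - m (fst x)) * (pmf q (snd x) - m (snd x)) / T)"
      using fin nn T by (intro sum_mono2) auto
    also have "\<dots> = (\<Sum>x\<in>Z. \<Sum>y\<in>Z. (pmf p x - m x) * (pmf q y - m y) / T)"
      by (simp add: sum.cartesian_product case_prod_beta')
    also have "\<dots> = (\<Sum>x\<in>Z. (pmf p x - m x) * ((\<Sum>y\<in>Z. pmf q y - m y) / T))"
      by (simp add: sum_distrib_left sum_divide_distrib)
    also have "\<dots> = T" unfolding Tq using T by (simp add: T_def)
    also have "\<dots> \<le> (\<Sum>z\<in>Z. \<bar>pmf p z - pmf q z\<bar>)" unfolding T_def by (intro sum_mono) (auto simp: m_def)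
    finally show ?thesis .
  qed
  ultimately show ?thesis by blast
qed

text \<open>Equal draws continue with their own coupling, unequal draws pay the crude bound
  \<open>m\<close>, and the maximal coupling makes the latter rare.\<close>

lemma cpl_bind_tv:
  assumes fin: "finite Z" "set_pmf p \<subseteq> Z" "set_pmf q \<subseteq> Z"
    and same: "\<And>z. z \<in> set_pmf p \<Longrightarrow> z \<in> set_pmf q \<Longrightarrow> cpl (A z) (B z) cost (c z)"
    and diff: "\<And>z z' x y. z \<in> set_pmf p \<Longrightarrow> z' \<in> set_pmf q \<Longrightarrow> x \<in> set_pmf (A z) \<Longrightarrow> y \<in> set_pmf (B z') \<Longrightarrow> cost x y \<le> m"
  shows "cpl (bind_pmf p A) (bind_pmf q B) cost
    ((\<integral>\<^sup>+ z. c z \<partial>measure_pmf p) + m * ennreal (\<Sum>z\<in>Z. \<bar>pmf p z - pmf q z\<bar>))"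
proof -
  obtain Q where Q: "map_pmf fst Q = p" "map_pmf snd Q = q"
    "measure (measure_pmf Q) {z. fst z \<noteq> snd z} \<le> (\<Sum>z\<in>Z. \<bar>pmf p z - pmf q z\<bar>)"
    using ex_maximal_coupling[OF fin] by blast
  have s: "fst z \<in> set_pmf p" "snd z \<in> set_pmf q" if "z \<in> set_pmf Q" for z
    using that unfolding Q(1,2)[symmetric] by auto
  let ?c = "\<lambda>z. if fst z = snd z then c (fst z) else m"
  have *: "cpl (A (fst z)) (B (snd z)) cost (?c z)" if "z \<in> set_pmf Q" for z
  proof (cases "fst z = snd z")
    case True
    then show ?thesis using same[of "fst z"] s[OF that] by simp
  next
    case False
    then show ?thesis using cpl_bounded[of "A (fst z)" "B (snd z)" cost m] diff s[OF that] by auto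
  qed
  have "(\<integral>\<^sup>+ z. ?c z \<partial>measure_pmf Q) \<le> (\<integral>\<^sup>+ z. c (fst z) + m * indicator {z. fst z \<noteq> snd z} z \<partial>measure_pmf Q)"
    by (intro nn_integral_mono) auto
  also have "\<dots> = (\<integral>\<^sup>+ z. c z \<partial>measure_pmf (map_pmf fst Q)) + m * emeasure (measure_pmf Q) {z. fst z \<noteq> snd z}"
    by (simp add: nn_integral_add nn_integral_cmult)
  also have "\<dots> \<le> (\<integral>\<^sup>+ z. c z \<partial>measure_pmf p) + m * ennreal (\<Sum>z\<in>Z. \<bar>pmf p z - pmf q z\<bar>)"
    unfolding Q(1) measure_pmf.emeasure_eq_measure by (intro add_mono mult_mono ennreal_leI Q(3)) auto
  finally show ?thesis
    using cpl_mono[OF cpl_bind_coupled[of Q A B cost ?c, OF *]] unfolding Q(1,2) by simp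
qed

text \<open>Reservoir sampling needs one coin per candidate; the state is the total weight seen so far and the current sample.\<close>

definition rstep :: "('a \<Rightarrow> real) \<Rightarrow> 'a \<Rightarrow> real \<times> 'a \<Rightarrow> (real \<times> 'a) pmf" where
  "rstep g z = (\<lambda>(S, r). map_pmf (\<lambda>h. (S + g z, if h then z else r)) (bernoulli_pmf (g z / (S + g z))))"

primrec iterM :: "(nat \<Rightarrow> 'a \<Rightarrow> 'a pmf) \<Rightarrow> nat \<Rightarrow> 'a \<Rightarrow> 'a pmf" where
  "iterM N 0 x = return_pmf x"
| "iterM N (Suc k) x = bind_pmf (iterM N k x) (N k)"

text \<open>The first component is deterministic. While the total weight is \<open>0\<close> the
  sample is still the initial value \<open>d\<close>, since the coin then has bias
  \<open>0 / 0 = 0\<close>.\<close>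

definition reservoir :: "('a \<Rightarrow> real) \<Rightarrow> 'a set \<Rightarrow> 'a \<Rightarrow> (real \<times> 'a) pmf \<Rightarrow> bool" where
  "reservoir g A d M \<longleftrightarrow> (\<exists>R. M = map_pmf (Pair (sum g A)) R \<and>
     (\<forall>z. pmf R z = (if sum g A = 0 then indicator {d} z else indicator A z * g z / sum g A)))"

lemma pmf_bind_bernoulli:
  "0 \<le> q \<Longrightarrow> q \<le> 1 \<Longrightarrow> pmf (bind_pmf (bernoulli_pmf q) f) y = q * pmf (f True) y + (1 - q) * pmf (f False) y"
  by (simp add: pmf_bind algebra_simps)

lemma reservoir_init: "reservoir g {} d (return_pmf (0, d))"
  unfolding reservoir_def by (rule exI[of _ "return_pmf d"]) (auto simp: indicator_def)

lemma reservoir_step: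
  assumes M: "reservoir g A d M" and A: "finite A" "z \<notin> A" and nn: "\<And>x. 0 \<le> g x"
  shows "reservoir g (insert z A) d (bind_pmf M (rstep g z))"
proof -
  obtain R where R: "M = map_pmf (Pair (sum g A)) R"
    "\<And>z. pmf R z = (if sum g A = 0 then indicator {d} z else indicator A z * g z / sum g A)"
    using M by (auto simp: reservoir_def)
  define S where "S = sum g A"
  have S: "0 \<le> S" unfolding S_def by (intro sum_nonneg nn)
  define q where "q = g z / (S + g z)"
  have q: "0 \<le> q" "q \<le> 1" using S nn[of z] by (auto simp: q_def divide_simps)
  define R' where "R' = bind_pmf (bernoulli_pmf q) (\<lambda>h. if h then return_pmf z else R)"
  have "bind_pmf M (rstep g z) = bind_pmf R (\<lambda>r. bind_pmf (bernoulli_pmf q) (\<lambda>h. return_pmf (S + g z, if h then z else r)))"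
    by (simp add: R(1) S_def[symmetric] rstep_def bind_map_pmf q_def) (simp add: map_pmf_def)
  \<comment> \<open>The coin for the new candidate does not look at the current sample, so the two
    draws commute and the new sample is a two-point mixture.\<close>
  also have "\<dots> = bind_pmf (bernoulli_pmf q) (\<lambda>h. bind_pmf R (\<lambda>r. return_pmf (S + g z, if h then z else r)))"
    by (rule bind_commute_pmf)
  also have "\<dots> = map_pmf (Pair (S + g z)) R'"
    unfolding R'_def map_bind_pmf
    by (intro bind_pmf_cong) (auto simp: map_pmf_def bind_return_pmf)
  finally have 1: "bind_pmf M (rstep g z) = map_pmf (Pair (sum g (insert z A))) R'"
    using A by (simp add: S_def add.commute)
  have 2: "pmf R' y = (if sum g (insert z A) = 0 then indicator {d} y else indicator (insert z A) y * g y / sum g (insert z A))" for y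
  proof -
    have p: "pmf R' y = q * indicator {y} z + (1 - q) * pmf R y"
      unfolding R'_def by (subst pmf_bind_bernoulli[OF q]) (auto simp: indicator_def pmf_return)
    have s: "sum g (insert z A) = S + g z" using A by (simp add: S_def add.commute)
    \<comment> \<open>Two degenerate totals are isolated: division by zero gives
      \<open>q = 0\<close>, and the first positive weight gives \<open>q = 1\<close>.\<close>
    consider "S + g z = 0" | "S = 0" "g z > 0" | "S > 0" using S nn[of z] by linarith
    then show ?thesis
    proof cases
      case 1
      then have "S = 0" "g z = 0" using S nn[of z] by linarith+
      then show ?thesis using p s R(2)[of y] by (simp add: q_def S_def)
    next
      case 2
      have "g y = 0" if "y \<in> A" using 2 that A(1) nn by (auto simp: S_def sum_nonneg_eq_0_iff)
      then show ?thesis using 2 p s by (auto simp: q_def indicator_def)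
    next
      case 3
      have "1 - q = S / (S + g z)" using 3 nn[of z] by (simp add: q_def field_simps)
      then show ?thesis using 3 p s R(2)[of y] A(2) nn[of z]
        by (auto simp: q_def S_def[symmetric] indicator_def)
    qed
  qed
  show ?thesis unfolding reservoir_def using 1 2 by blast
qed

lemma bind_iterM_Suc: "bind_pmf M (iterM N (Suc k)) = bind_pmf (bind_pmf M (iterM N k)) (N k)"
  by (simp add: bind_assoc_pmf cong: bind_pmf_cong)

lemma reservoir_iterM:
  assumes "reservoir g A d M" "finite A" "\<And>x. 0 \<le> g x" "inj_on f {..<k}" "f ` {..<k} \<inter> A = {}"
  shows "reservoir g (A \<union> f ` {..<k}) d (bind_pmf M (iterM (\<lambda>i. rstep g (f i)) k))"
  using assms(4,5)
proof (induction k)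
  case 0
  then show ?case using assms(1) by (simp add: bind_return_pmf')
next
  case (Suc k)
  have "reservoir g (A \<union> f ` {..<k}) d (bind_pmf M (iterM (\<lambda>i. rstep g (f i)) k))"
    by (rule Suc.IH) (use Suc.prems in \<open>auto simp: inj_on_def lessThan_Suc\<close>)
  moreover have "f k \<notin> A \<union> f ` {..<k}" using Suc.prems by (fastforce simp: inj_on_def)
  ultimately have "reservoir g (insert (f k) (A \<union> f ` {..<k})) d
     (bind_pmf (bind_pmf M (iterM (\<lambda>i. rstep g (f i)) k)) (rstep g (f k)))"
    using assms by (intro reservoir_step) auto
  then show ?case unfolding bind_iterM_Suc by (simp add: lessThan_Suc)
qed

text \<open>Reservoir sampling with equal weights, because the machine offers only biased
  coins.\<close>

definition uniform :: "nat \<Rightarrow> nat pmf" where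
  "uniform N = map_pmf snd (iterM (rstep (\<lambda>_. 1)) N (0, 0))"

definition select :: "(nat \<times> nat \<Rightarrow> real) \<Rightarrow> nat \<Rightarrow> (nat \<times> nat) pmf" where
  "select g n = map_pmf snd (iterM (\<lambda>x. iterM (\<lambda>y. rstep g (x, y)) n) n (0, (0, 0)))"

lemma uniform_eq:
  assumes "0 < N" shows "uniform N = pmf_of_set {..<N}"
proof (rule pmf_eqI)
  fix i
  have "reservoir (\<lambda>_. 1) ({} \<union> (\<lambda>i. i) ` {..<N}) 0 (bind_pmf (return_pmf (0, 0)) (iterM (rstep (\<lambda>_. 1)) N))"
    using reservoir_iterM[OF reservoir_init, of "\<lambda>_. 1" "\<lambda>i. i" N 0] by (simp add: inj_on_def)
  then show "pmf (uniform N) i = pmf (pmf_of_set {..<N}) i"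
    using assms lessThan_empty_iff by (auto simp: reservoir_def uniform_def bind_return_pmf pmf.map_comp o_def)
qed

lemma pmf_select:
  assumes nn: "\<And>x. 0 \<le> g x" and pos: "0 < (\<Sum>z\<in>{..<n} \<times> {..<n}. g z)"
  shows "pmf (select g n) z = (if z \<in> {..<n} \<times> {..<n} then g z / (\<Sum>z\<in>{..<n} \<times> {..<n}. g z) else 0)"
proof -
  have "reservoir g ({..<k} \<times> {..<n}) (0, 0) (iterM (\<lambda>x. iterM (\<lambda>y. rstep g (x, y)) n) k (0, (0, 0)))" for k
  proof (induction k)
    case 0
    then show ?case using reservoir_init by simp
  next
    case (Suc k)
    have "reservoir g ({..<k} \<times> {..<n} \<union> Pair k ` {..<n}) (0, 0)
       (bind_pmf (iterM (\<lambda>x. iterM (\<lambda>y. rstep g (x, y)) n) k (0, (0, 0))) (iterM (\<lambda>y. rstep g (k, y)) n))"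
      using Suc nn by (intro reservoir_iterM) (auto simp: inj_on_def)
    moreover have "{..<k} \<times> {..<n} \<union> Pair k ` {..<n} = {..<Suc k} \<times> {..<n}" by auto
    ultimately show ?case by simp
  qed
  from this[of n] show ?thesis using pos
    by (cases z) (auto simp: reservoir_def select_def pmf.map_comp o_def indicator_def)
qed

section \<open>The recursive walk sampler\<close>

text \<open>The excess of the best \<open>a\<close>-\<open>b\<close> walk through the edge \<open>z\<close>, with a penalty if \<open>z\<close> misses the radius \<open>\<rho>\<close>.\<close>

definition score :: "nat set set \<Rightarrow> weight \<Rightarrow> nat \<Rightarrow> nat \<Rightarrow> real \<Rightarrow> nat \<times> nat \<Rightarrow> real" where
  "score E v a b \<rho> z =
     (min_path_length E a (fst z) v + v {fst z, snd z} + min_path_length E (snd z) b v - min_path_length E a b v)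
     + max 0 (min_path_length E a (fst z) v - \<rho>)
     + max 0 (min_path_length E (snd z) b v - (min_path_length E a b v - \<rho>))"

text \<open>Reachability is tested for \<open>fst z\<close> only: in an undirected graph it carries
  over along the edge to \<open>snd z\<close> and, if \<open>a\<close> and \<open>b\<close> are
  connected, to \<open>b\<close>.\<close>

definition gain :: "nat set set \<Rightarrow> weight \<Rightarrow> real \<Rightarrow> nat \<Rightarrow> nat \<Rightarrow> real \<Rightarrow> nat \<times> nat \<Rightarrow> real" where
  "gain E v \<kappa> a b \<rho> z =
     (if {fst z, snd z} \<in> E \<and> conn E a (fst z)
      then max 0 (1 - score E v a b \<rho> z / (\<kappa> * min_path_length E a b v)) else 0)"

text \<open>The grid is finite because it is sampled with coins. It scales with \<open>D\<close>, so
  each radius moves by no more than the distance does.\<close>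

definition radius :: "real \<Rightarrow> nat \<Rightarrow> nat \<Rightarrow> real" where
  "radius D N i = D * (real N + real i) / (3 * real N)"

text \<open>A node with fuel \<open>Suc f\<close> has \<open>f\<close> levels below it and uses the
  slack \<open>ep f\<close>. Without fuel the output \<open>[a]\<close> is a walk to
  \<open>b\<close> only if \<open>a = b\<close>; the invariant
  \<open>dist v a b * (3/4) ^ f < m\<close> guarantees this.\<close>

primrec gen :: "nat set set \<Rightarrow> nat \<Rightarrow> weight \<Rightarrow> nat \<Rightarrow> nat \<Rightarrow> (nat \<Rightarrow> real) \<Rightarrow> nat \<Rightarrow> nat \<Rightarrow> nat \<Rightarrow> nat list pmf" where
  "gen E n v K N ep 0 a b = return_pmf [a]"
| "gen E n v K N ep (Suc f) a b =
     (if a = b then return_pmf [a] else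
      bind_pmf (uniform N) (\<lambda>i.
        bind_pmf (select (\<lambda>z. gain E v (ep f) a b (radius (min_path_length E a b v) N i) z ^ K) n) (\<lambda>z.
          map_pmf (\<lambda>(l, r). l @ r)
            (pair_pmf (gen E n v K N ep f a (fst z)) (gen E n v K N ep f (snd z) b)))))"

text \<open>
  A walk known only up to its unresolved segments: \<open>cs\<close> lists their end points, \<open>W\<close> is the total weight
  of the edges between them.
\<close>

inductive chain :: "nat set set \<Rightarrow> weight \<Rightarrow> nat \<Rightarrow> nat \<Rightarrow> (nat \<times> nat) list \<Rightarrow> real \<Rightarrow> bool" for E v where
  chain_one: "chain E v a b [(a, b)] 0"
| chain_cons: "chain E v y b cs W \<Longrightarrow> {x, y} \<in> E \<Longrightarrow> chain E v a b ((a, x) # cs) (v {x, y} + W)"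

lemma chain_append:
  "chain E v a x cs W \<Longrightarrow> {x, y} \<in> E \<Longrightarrow> chain E v y b ds X \<Longrightarrow> chain E v a b (cs @ ds) (W + v {x, y} + X)"
proof (induction rule: chain.induct)
  case (chain_one a x)
  then show ?case using chain_cons[of E v y b ds X x a] by simp
next
  case (chain_cons y' b' cs W x' a)
  then show ?case using chain.chain_cons[of E v y' b "cs @ ds" "W + v {b', y} + X" x' a]
    by (simp add: add.assoc)
qed

lemma chain_nonneg: "chain E v a b cs W \<Longrightarrow> \<forall>e\<in>E. 0 \<le> v e \<Longrightarrow> 0 \<le> W"
  by (induction rule: chain.induct) auto

text \<open>The tool for cutting a chain at a later occurrence of its start vertex; the dropped
  edges have nonnegative weight, so \<open>W\<close> cannot grow.\<close>

lemma chain_suffix: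
  assumes "chain E v a b cs W" "\<forall>e\<in>E. 0 \<le> v e" "a' \<in> fst ` set cs"
  shows "\<exists>cs' W'. chain E v a' b cs' W' \<and> W' \<le> W \<and> set cs' \<subseteq> set cs \<and> length cs' \<le> length cs"
  using assms
proof (induction rule: chain.induct)
  case (chain_one a b)
  then show ?case using chain.chain_one[of E v a b] by (intro exI[of _ "[(a, b)]"] exI[of _ 0]) auto
next
  case (chain_cons y b cs W x a)
  show ?case
  proof (cases "a' = a")
    case True
    then show ?thesis using chain.chain_cons[OF chain_cons.hyps] by blast
  next
    case False
    then obtain cs' W' where "chain E v a' b cs' W'" "W' \<le> W" "set cs' \<subseteq> set cs" "length cs' \<le> length cs"
      using chain_cons.IH chain_cons.prems by auto
    then show ?thesis using chain_cons.hyps(2) chain_cons.prems(1) by (intro exI[of _ cs'] exI[of _ W']) auto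
  qed
qed

section \<open>Counting grid points and stability of the soft minimum\<close>

lemma card_nat_interval:
  assumes "finite A" "\<And>i. i \<in> A \<Longrightarrow> l \<le> real i \<and> real i \<le> l + d" "0 \<le> d"
  shows "real (card A) \<le> d + 1"
proof (cases "A = {}")
  case False
  define i0 where "i0 = Min A"
  have "A \<subseteq> {i0..i0 + nat \<lfloor>d\<rfloor>}"
  proof
    fix i assume i: "i \<in> A"
    have "i0 \<in> A" "i0 \<le> i" using i False assms(1) by (auto simp: i0_def)
    then have "real (i - i0) \<le> d" using assms(2)[of i] assms(2)[of i0] i by (simp add: of_nat_diff)
    then have "i - i0 \<le> nat \<lfloor>d\<rfloor>" by (simp add: le_nat_floor)
    then show "i \<in> {i0..i0 + nat \<lfloor>d\<rfloor>}" using \<open>i0 \<le> i\<close> by auto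
  qed
  then have "card A \<le> nat \<lfloor>d\<rfloor> + 1" using card_mono[of "{i0..i0 + nat \<lfloor>d\<rfloor>}" A] by simp
  then show ?thesis using assms(3) by linarith
qed (use assms in auto)

text \<open>Factoring the difference gives \<open>K\<close> mixed monomials, each bounded by the
  pure power of the larger base. Adding both powers spares later arguments the case
  distinction.\<close>

lemma power_diff_le:
  fixes a b :: real
  assumes "0 \<le> a" "0 \<le> b"
  shows "\<bar>a ^ K - b ^ K\<bar> \<le> real K * \<bar>a - b\<bar> * (a ^ (K - 1) + b ^ (K - 1))"
proof -
  have *: "b ^ (K - Suc i) * a ^ i \<le> a ^ (K - 1) + b ^ (K - 1)" if "i < K" for i
  proof -
    have e: "K - 1 = (K - Suc i) + i" using that by simp
    show ?thesis
    proof (cases "a \<le> b")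
      case True
      then have "b ^ (K - Suc i) * a ^ i \<le> b ^ (K - Suc i) * b ^ i" using assms by (intro mult_left_mono power_mono) auto
      also have "\<dots> = b ^ (K - 1)" unfolding e power_add ..
      finally show ?thesis using zero_le_power[OF assms(1), of "K - 1"] by linarith
    next
      case False
      then have "b ^ (K - Suc i) * a ^ i \<le> a ^ (K - Suc i) * a ^ i" using assms by (intro mult_right_mono power_mono) auto
      also have "\<dots> = a ^ (K - 1)" unfolding e power_add ..
      finally show ?thesis using zero_le_power[OF assms(2), of "K - 1"] by linarith
    qed
  qed
  have "\<bar>a ^ K - b ^ K\<bar> = \<bar>a - b\<bar> * (\<Sum>i<K. b ^ (K - Suc i) * a ^ i)"
    unfolding power_diff_sumr2 abs_mult using assms by (simp add: sum_nonneg)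
  also have "\<dots> \<le> \<bar>a - b\<bar> * (\<Sum>i<K. a ^ (K - 1) + b ^ (K - 1))"
    by (intro mult_left_mono sum_mono *) auto
  finally show ?thesis by (simp add: algebra_simps)
qed

text \<open>Only the normaliser of \<open>f\<close> appears on the right, so by symmetry the larger
  of the two can be chosen.\<close>

lemma normalized_diff_le:
  fixes f f' :: "'a \<Rightarrow> real"
  assumes fin: "finite Z" and nn: "\<And>z. z \<in> Z \<Longrightarrow> 0 \<le> f z" "\<And>z. z \<in> Z \<Longrightarrow> 0 \<le> f' z"
    and S: "0 < sum f Z" "0 < sum f' Z"
  shows "(\<Sum>z\<in>Z. \<bar>f z / sum f Z - f' z / sum f' Z\<bar>) \<le> 2 * (\<Sum>z\<in>Z. \<bar>f z - f' z\<bar>) / sum f Z"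
proof -
  define s s' where "s = sum f Z" "s' = sum f' Z"
  have pos: "0 < s" "0 < s'" using S by (auto simp: s_s'_def)
  have "\<bar>f z / s - f' z / s'\<bar> \<le> \<bar>f z - f' z\<bar> / s + f' z * (\<bar>s' - s\<bar> / (s * s'))" if "z \<in> Z" for z
  proof -
    have "f z / s - f' z / s' = (f z - f' z) / s + f' z * ((s' - s) / (s * s'))"
      using pos by (simp add: field_simps)
    then have "\<bar>f z / s - f' z / s'\<bar> \<le> \<bar>(f z - f' z) / s\<bar> + \<bar>f' z * ((s' - s) / (s * s'))\<bar>"
      using abs_triangle_ineq by metis
    then show ?thesis using pos nn that by (simp add: abs_mult abs_divide)
  qed
  then have "(\<Sum>z\<in>Z. \<bar>f z / s - f' z / s'\<bar>) \<le> (\<Sum>z\<in>Z. \<bar>f z - f' z\<bar> / s + f' z * (\<bar>s' - s\<bar> / (s * s')))"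
    by (rule sum_mono)
  also have "\<dots> = (\<Sum>z\<in>Z. \<bar>f z - f' z\<bar>) / s + s' * (\<bar>s' - s\<bar> / (s * s'))"
    unfolding sum.distrib sum_divide_distrib[symmetric] sum_distrib_right[symmetric] s_s'_def(2)[symmetric] ..
  also have "s' * (\<bar>s' - s\<bar> / (s * s')) = \<bar>s' - s\<bar> / s" using pos by simp
  also have "\<bar>s' - s\<bar> \<le> (\<Sum>z\<in>Z. \<bar>f z - f' z\<bar>)"
    using sum_abs[of "\<lambda>z. f' z - f z" Z] by (simp add: s_s'_def sum_subtractf abs_minus_commute)
  finally show ?thesis using pos by (simp add: s_s'_def divide_right_mono)
qed

text \<open>
  The \<open>K\<close>-th power is a soft minimum that needs no exponential function and vanishes beyond the slack.  Since
  \<open>card Z \<le> 2 ^ (K - 1)\<close>, the terms below \<open>1/2\<close> contribute at most \<open>1\<close> to the sum of the \<open>(K - 1)\<close>-st powers.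
\<close>

lemma softmin_tv:
  fixes y y' :: "'a \<Rightarrow> real"
  assumes fin: "finite Z" and y: "\<And>z. z \<in> Z \<Longrightarrow> 0 \<le> y z \<and> y z \<le> 1" "\<And>z. z \<in> Z \<Longrightarrow> 0 \<le> y' z \<and> y' z \<le> 1"
    and S: "1 \<le> (\<Sum>z\<in>Z. y z ^ K)" "1 \<le> (\<Sum>z\<in>Z. y' z ^ K)"
    and \<tau>: "\<And>z. z \<in> Z \<Longrightarrow> \<bar>y z - y' z\<bar> \<le> \<tau>" and K: "0 < K" "card Z \<le> 2 ^ (K - 1)"
  shows "(\<Sum>z\<in>Z. \<bar>y z ^ K / (\<Sum>z\<in>Z. y z ^ K) - y' z ^ K / (\<Sum>z\<in>Z. y' z ^ K)\<bar>) \<le> 12 * real K * \<tau>"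
proof -
  have low: "(\<Sum>z\<in>Z. u z ^ (K - 1)) \<le> 3 * (\<Sum>z\<in>Z. u z ^ K)"
    if u: "\<And>z. z \<in> Z \<Longrightarrow> 0 \<le> u z" "1 \<le> (\<Sum>z\<in>Z. u z ^ K)" for u :: "'a \<Rightarrow> real"
  proof -
    have "u z ^ (K - 1) \<le> 2 * u z ^ K + (1/2) ^ (K - 1)" if "z \<in> Z" for z
    proof (cases "u z < 1/2")
      case True
      then have "u z ^ (K - 1) \<le> (1/2) ^ (K - 1)" using u(1)[OF that] by (intro power_mono) auto
      moreover have "0 \<le> u z ^ K" using u(1)[OF that] by simp
      ultimately show ?thesis by linarith
    next
      case False
      then have "u z ^ (K - 1) * 1 \<le> u z ^ (K - 1) * (2 * u z)" using u(1)[OF that] by (intro mult_left_mono) auto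
      also have "\<dots> = 2 * u z ^ K" using K(1) by (simp add: power_eq_if)
      finally have "u z ^ (K - 1) \<le> 2 * u z ^ K" by simp
      moreover have "0 \<le> (1/2 :: real) ^ (K - 1)" by simp
      ultimately show ?thesis by linarith
    qed
    then have "(\<Sum>z\<in>Z. u z ^ (K - 1)) \<le> (\<Sum>z\<in>Z. 2 * u z ^ K + (1/2) ^ (K - 1))" by (rule sum_mono)
    also have "\<dots> = 2 * (\<Sum>z\<in>Z. u z ^ K) + real (card Z) * (1/2) ^ (K - 1)"
      by (simp add: sum.distrib sum_distrib_left)
    also have "real (card Z) * (1/2) ^ (K - 1) \<le> real (2 ^ (K - 1)) * (1/2) ^ (K - 1)"
      using K(2) by (intro mult_right_mono of_nat_mono) auto
    also have "real (2 ^ (K - 1)) = (2::real) ^ (K - 1)" by simp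
    also have "(2::real) ^ (K - 1) * (1/2) ^ (K - 1) = 1" by (simp add: power_mult_distrib[symmetric])
    finally show ?thesis using u(2) by linarith
  qed
  define s s' A where "s = (\<Sum>z\<in>Z. y z ^ K)" "s' = (\<Sum>z\<in>Z. y' z ^ K)" "A = (\<Sum>z\<in>Z. \<bar>y z ^ K - y' z ^ K\<bar>)"
  have pos: "1 \<le> s" "1 \<le> s'" using S by (auto simp: s_s'_A_def)
  have \<tau>0: "0 \<le> \<tau>"
  proof -
    obtain z where "z \<in> Z" using pos(1) by (cases "Z = {}") (auto simp: s_s'_A_def)
    then show ?thesis using \<tau>[of z] by linarith
  qed
  have "A \<le> (\<Sum>z\<in>Z. real K * \<tau> * (y z ^ (K - 1) + y' z ^ (K - 1)))"
    unfolding s_s'_A_def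
  proof (rule sum_mono)
    fix z assume z: "z \<in> Z"
    have "\<bar>y z ^ K - y' z ^ K\<bar> \<le> real K * \<bar>y z - y' z\<bar> * (y z ^ (K - 1) + y' z ^ (K - 1))"
      using power_diff_le y z by blast
    also have "\<dots> \<le> real K * \<tau> * (y z ^ (K - 1) + y' z ^ (K - 1))"
      using \<tau>[OF z] y z by (intro mult_right_mono mult_left_mono add_nonneg_nonneg zero_le_power) auto
    finally show "\<bar>y z ^ K - y' z ^ K\<bar> \<le> \<dots>" .
  qed
  also have "\<dots> = real K * \<tau> * ((\<Sum>z\<in>Z. y z ^ (K - 1)) + (\<Sum>z\<in>Z. y' z ^ (K - 1)))"
    by (simp add: sum_distrib_left sum.distrib distrib_left)
  also have "\<dots> \<le> real K * \<tau> * (3 * s + 3 * s')"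
    using low[of y] low[of y'] y S \<tau>0 by (intro mult_left_mono add_mono) (auto simp: s_s'_A_def)
  finally have A: "A \<le> 3 * (real K * \<tau>) * (s + s')" by (simp add: algebra_simps)
  have 1: "(\<Sum>z\<in>Z. \<bar>y z ^ K / s - y' z ^ K / s'\<bar>) \<le> 2 * A / s"
    unfolding s_s'_A_def using S y by (intro normalized_diff_le fin) auto
  have 2: "(\<Sum>z\<in>Z. \<bar>y z ^ K / s - y' z ^ K / s'\<bar>) \<le> 2 * A / s'"
  proof -
    have "(\<Sum>z\<in>Z. \<bar>y' z ^ K / s' - y z ^ K / s\<bar>) \<le> 2 * (\<Sum>z\<in>Z. \<bar>y' z ^ K - y z ^ K\<bar>) / s'"
      unfolding s_s'_A_def using S y by (intro normalized_diff_le fin) auto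
    then show ?thesis by (simp add: s_s'_A_def(3) abs_minus_commute)
  qed
  have K0: "0 \<le> real K * \<tau>" using \<tau>0 by simp
  \<comment> \<open>Dividing by the larger normaliser \<open>t\<close> absorbs
    \<open>s + s' \<le> 2 * t\<close>, so no bound on the ratio of the two sums is required.\<close>
  have fin2: "2 * A / t \<le> 12 * real K * \<tau>" if "1 \<le> t" "s + s' \<le> 2 * t" for t
  proof -
    have "2 * A \<le> 6 * (real K * \<tau>) * (s + s')" using A by linarith
    also have "\<dots> \<le> 6 * (real K * \<tau>) * (2 * t)" using that K0 by (intro mult_left_mono) auto
    finally show ?thesis using that by (simp add: field_simps)
  qed
  show ?thesis unfolding s_s'_A_def(1,2)[symmetric]
    using 1 2 fin2[of s] fin2[of s'] pos by (cases "s' \<le> s") auto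
qed

text \<open>Writing the clamp as \<open>1 - min s d / d\<close> reduces the comparison of quotients
  to their numerators. The denominator is the larger \<open>d'\<close>, which later cancels against
  the walk length paid when two selections differ.\<close>

lemma gain_scaling:
  fixes s s' d d' :: real
  assumes "0 < d" "d \<le> d'" "0 \<le> s" "0 \<le> s'"
  shows "\<bar>max 0 (1 - s / d) - max 0 (1 - s' / d')\<bar> \<le> (\<bar>s - s'\<bar> + 2 * (d' - d)) / d'"
proof -
  define t t' where "t = min s d / d" "t' = min s' d' / d'"
  have d': "0 < d'" using assms by simp
  have 1: "max 0 (1 - s / d) = 1 - t" using assms by (auto simp: t_t'_def max_def min_def divide_simps)
  have 2: "max 0 (1 - s' / d') = 1 - t'" using assms d' by (auto simp: t_t'_def max_def min_def divide_simps)
  have t: "0 \<le> t" "t \<le> 1" using assms by (auto simp: t_t'_def min_def divide_simps)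
  have "(t' - t) * d' = (t' * d' - t * d) - t * (d' - d)" by (simp add: algebra_simps)
  also have "t' * d' = min s' d'" using d' by (simp add: t_t'_def)
  also have "t * d = min s d" using assms by (simp add: t_t'_def)
  finally have "\<bar>(t' - t) * d'\<bar> \<le> \<bar>min s' d' - min s d\<bar> + \<bar>t * (d' - d)\<bar>" by linarith
  also have "\<bar>t * (d' - d)\<bar> \<le> d' - d" using t assms by (simp add: abs_mult mult_left_le_one_le)
  also have "\<bar>min s' d' - min s d\<bar> \<le> \<bar>s - s'\<bar> + (d' - d)" using assms by (auto simp: min_def)
  finally have "\<bar>t' - t\<bar> * d' \<le> \<bar>s - s'\<bar> + 2 * (d' - d)" using d' by (simp add: abs_mult)
  then have "\<bar>t' - t\<bar> \<le> (\<bar>s - s'\<bar> + 2 * (d' - d)) / d'" using d' by (simp add: pos_le_divide_eq)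
  then show ?thesis unfolding 1 2 by (simp add: abs_minus_commute)
qed

text \<open>\<open>n * n\<close> bounds the number of candidate pairs in the soft minimum. Slack at
  most \<open>1/12\<close> gives the shrinking factor \<open>2/3 + 1/12 = 3/4\<close>, and the ratio
  \<open>7/6\<close> of consecutive slacks is what \<open>ep_step\<close> consumes.\<close>

locale walk_gen = graph +
  fixes K N :: nat and ep :: "nat \<Rightarrow> real"
  assumes K: "0 < K" "n * n \<le> 2 ^ (K - 1)" and N: "0 < N"
    and ep: "0 < ep f" "ep f \<le> 1/12" "ep f \<le> 7/6 * ep (Suc f)"
begin

abbreviation "G v f a b \<equiv> gen E n v K N ep f a b"

text \<open>Cutting the chain at repeated start vertices leaves at most one segment per vertex.\<close>

lemma chain_dist:
  assumes "chain E v a b cs W" "\<forall>e\<in>E. 0 \<le> v e" "\<And>x y. (x, y) \<in> set cs \<Longrightarrow> conn E x y \<and> dist v x y \<le> d" "0 \<le> d"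
  shows "conn E a b \<and> dist v a b \<le> real (card (fst ` set cs)) * d + W"
  using assms(1,3)
proof (induction "length cs" arbitrary: a cs W rule: less_induct)
  case less
  from less.prems(1) show ?case
  proof cases
    case chain_one
    then show ?thesis using less.prems(2)[of a b] by simp
  next
    case (chain_cons y ds X x)
    have ax: "conn E a x" "dist v a x \<le> d" using less.prems(2)[of a x] chain_cons by auto
    show ?thesis
    proof (cases "a \<in> fst ` set ds")
      case True
      obtain cs' W' where s: "chain E v a b cs' W'" "W' \<le> W" "set cs' \<subseteq> set cs" "length cs' < length cs"
      proof -
        have ya: "chain E v y b ds X" by (rule chain_cons)
        obtain cs' W' where s: "chain E v a b cs' W'" "W' \<le> X" "set cs' \<subseteq> set ds" "length cs' \<le> length ds"
          using chain_suffix[OF ya assms(2) True] by blast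
        have "W' \<le> W" using s(2) chain_cons assms(2) by fastforce
        then show ?thesis using that[OF s(1)] s(3,4) chain_cons(1) by auto
      qed
      have "conn E a b \<and> dist v a b \<le> real (card (fst ` set cs')) * d + W'"
        using less.hyps[OF s(4,1)] s(3) less.prems(2) by blast
      moreover have "real (card (fst ` set cs')) * d \<le> real (card (fst ` set cs)) * d"
        using s(3) assms(4) by (intro mult_right_mono) (auto intro!: card_mono)
      ultimately show ?thesis using s(2) by linarith
    next
      case False
      have IH: "conn E y b \<and> dist v y b \<le> real (card (fst ` set ds)) * d + X"
        using less.hyps[of ds y X] chain_cons less.prems(2) by auto
      have "conn E a b" using conn_edge ax(1) chain_cons IH by blast
      moreover have "dist v a b \<le> dist v a x + v {x, y} + dist v y b"
        using dist_triangle_edge[OF assms(2) ax(1)] chain_cons IH by blast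
      moreover have "real (card (fst ` set cs)) = real (card (fst ` set ds)) + 1"
        using False chain_cons by simp
      ultimately show ?thesis using IH ax chain_cons by (simp add: distrib_right)
    qed
  qed
qed

context
  fixes v :: weight and m :: real
  assumes m: "0 < m" "\<forall>e\<in>E. m \<le> v e"
begin

lemma v_nonneg: "\<forall>e\<in>E. 0 \<le> v e"
  using m by force

lemma dist_pos: "conn E a b \<Longrightarrow> a \<noteq> b \<Longrightarrow> 0 < dist v a b"
  using dist_ge_edge[of a b m v] m by force

lemma candidate_conn: "conn E a b \<Longrightarrow> {x, y} \<in> E \<Longrightarrow> conn E a x \<Longrightarrow> conn E y b"
  by (meson conn_edgeD conn_sym conn_trans)

lemma score_nonneg:
  assumes "conn E a b" "{fst z, snd z} \<in> E" "conn E a (fst z)"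
  shows "0 \<le> score E v a b \<rho> z"
  using dist_triangle_edge[OF v_nonneg assms(3,2) candidate_conn[OF assms]] by (simp add: score_def)

lemma gain_range:
  assumes "conn E a b" "a \<noteq> b" "0 < \<kappa>"
  shows "0 \<le> gain E v \<kappa> a b \<rho> z \<and> gain E v \<kappa> a b \<rho> z \<le> 1"
  using score_nonneg[OF assms(1), of z \<rho>] dist_pos[OF assms(1,2)] assms(3) by (auto simp: gain_def)

lemma gain_sum_ge_1:
  assumes "conn E a b" "a \<noteq> b" "0 < \<kappa>" "0 \<le> \<rho>" "\<rho> < dist v a b"
  shows "1 \<le> (\<Sum>z\<in>{..<n} \<times> {..<n}. gain E v \<kappa> a b \<rho> z ^ K)"
proof -
  obtain x y where xy: "{x, y} \<in> E" "conn E a x" "conn E y b" "dist v a x \<le> \<rho>" "dist v y b \<le> dist v a b - \<rho>"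
    "dist v a x + v {x, y} + dist v y b = dist v a b"
    using dist_crossing[OF assms(1) v_nonneg assms(4,5)] by metis
  have "score E v a b \<rho> (x, y) = 0" using xy by (simp add: score_def)
  then have "gain E v \<kappa> a b \<rho> (x, y) ^ K = 1" using xy by (simp add: gain_def)
  moreover have "(x, y) \<in> {..<n} \<times> {..<n}" using edge_less[OF xy(1)] by simp
  ultimately show ?thesis
    using member_le_sum[of "(x, y)" "{..<n} \<times> {..<n}" "\<lambda>z. gain E v \<kappa> a b \<rho> z ^ K"]
      gain_range[OF assms(1-3)] by simp
qed

lemma radius_bounds:
  "i < N \<Longrightarrow> 0 < D \<Longrightarrow> D / 3 \<le> radius D N i \<and> radius D N i \<le> 2 * D / 3"
  using N by (auto simp: radius_def field_simps)

text \<open>What a positive gain guarantees. The length bounds and the propagation of relevance use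
  only this, not the selection probabilities.\<close>

definition good :: "real \<Rightarrow> real \<Rightarrow> nat \<Rightarrow> nat \<Rightarrow> nat \<Rightarrow> nat \<Rightarrow> bool" where
  "good \<kappa> \<rho> a b x y \<longleftrightarrow> {x, y} \<in> E \<and> conn E a x \<and> conn E y b \<and>
     dist v a x + v {x, y} + dist v y b \<le> (1 + \<kappa>) * dist v a b \<and>
     dist v a x \<le> \<rho> + \<kappa> * dist v a b \<and> dist v y b \<le> dist v a b - \<rho> + \<kappa> * dist v a b"

lemma gain_pos_good:
  assumes "conn E a b" "a \<noteq> b" "0 < \<kappa>" "gain E v \<kappa> a b \<rho> z \<noteq> 0"
  shows "good \<kappa> \<rho> a b (fst z) (snd z)"
proof -
  have e: "{fst z, snd z} \<in> E" "conn E a (fst z)" and pos: "0 < 1 - score E v a b \<rho> z / (\<kappa> * dist v a b)"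
    using assms(4) by (auto simp: gain_def split: if_splits)
  have yb: "conn E (snd z) b" using candidate_conn[OF assms(1) e] .
  have "score E v a b \<rho> z < \<kappa> * dist v a b"
    using pos dist_pos[OF assms(1,2)] assms(3) by (simp add: field_simps)
  moreover have "dist v a b \<le> dist v a (fst z) + v {fst z, snd z} + dist v (snd z) b"
    using dist_triangle_edge[OF v_nonneg e(2,1) yb] .
  ultimately show ?thesis using e yb unfolding good_def score_def
    by (auto simp: algebra_simps max_def split: if_splits)
qed

lemma good_bounds:
  assumes "good \<kappa> \<rho> a b x y" "\<kappa> \<le> 1/12" "dist v a b / 3 \<le> \<rho>" "\<rho> \<le> 2 * dist v a b / 3" "0 \<le> dist v a b"
  shows "dist v a x \<le> 3/4 * dist v a b" "dist v y b \<le> 3/4 * dist v a b"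
proof -
  have "\<kappa> * dist v a b \<le> 1/12 * dist v a b" using assms(2,5) by (rule mult_right_mono)
  then show "dist v a x \<le> 3/4 * dist v a b" "dist v y b \<le> 3/4 * dist v a b"
    using assms unfolding good_def by (linarith, linarith)
qed

abbreviation "sel f a b i \<equiv> select (\<lambda>z. gain E v (ep f) a b (radius (dist v a b) N i) z ^ K) n"

lemma pmf_sel:
  assumes "conn E a b" "a \<noteq> b" "i < N"
  shows "pmf (sel f a b i) z = (if z \<in> {..<n} \<times> {..<n}
    then gain E v (ep f) a b (radius (dist v a b) N i) z ^ K /
      (\<Sum>z\<in>{..<n} \<times> {..<n}. gain E v (ep f) a b (radius (dist v a b) N i) z ^ K) else 0)"
proof -
  have D: "0 < dist v a b" by (rule dist_pos[OF assms(1,2)])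
  have r: "0 \<le> radius (dist v a b) N i" "radius (dist v a b) N i < dist v a b"
    using radius_bounds[OF assms(3) D] D by linarith+
  show ?thesis
    using gain_range[OF assms(1,2) ep(1)] gain_sum_ge_1[OF assms(1,2) ep(1)[of f] r]
    by (intro pmf_select zero_le_power) (auto intro: less_le_trans[OF zero_less_one])
qed

lemma set_sel:
  assumes "conn E a b" "a \<noteq> b" "i < N" "z \<in> set_pmf (sel f a b i)"
  shows "z \<in> {..<n} \<times> {..<n}" "good (ep f) (radius (dist v a b) N i) a b (fst z) (snd z)"
    "dist v a (fst z) \<le> 3/4 * dist v a b" "dist v (snd z) b \<le> 3/4 * dist v a b"
proof -
  have D: "0 < dist v a b" by (rule dist_pos[OF assms(1,2)])
  have nz: "pmf (sel f a b i) z \<noteq> 0" using assms(4) by (simp add: set_pmf_iff)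
  then show "z \<in> {..<n} \<times> {..<n}" using pmf_sel[OF assms(1-3)] by metis
  have "gain E v (ep f) a b (radius (dist v a b) N i) z \<noteq> 0"
    using nz pmf_sel[OF assms(1-3), of f z] K(1) by (auto split: if_splits simp: zero_power)
  then show g: "good (ep f) (radius (dist v a b) N i) a b (fst z) (snd z)"
    using gain_pos_good[OF assms(1,2) ep(1)] by blast
  show "dist v a (fst z) \<le> 3/4 * dist v a b" "dist v (snd z) b \<le> 3/4 * dist v a b"
    using good_bounds[OF g ep(2)] radius_bounds[OF assms(3) D] D by auto
qed

lemma gen_SucE:
  assumes "p \<in> set_pmf (G v (Suc f) a b)" "a \<noteq> b" "conn E a b"
  obtains i x y l r where "i < N" "(x, y) \<in> set_pmf (sel f a b i)" "l \<in> set_pmf (G v f a x)" "r \<in> set_pmf (G v f y b)" "p = l @ r"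
    "good (ep f) (radius (dist v a b) N i) a b x y" "dist v a x \<le> 3/4 * dist v a b" "dist v y b \<le> 3/4 * dist v a b"
proof -
  have "set_pmf (uniform N) = {..<N}" using N by (simp add: uniform_eq lessThan_empty_iff)
  then obtain i z l r where *: "i < N" "z \<in> set_pmf (sel f a b i)" "l \<in> set_pmf (G v f a (fst z))" "r \<in> set_pmf (G v f (snd z) b)" "p = l @ r"
    using assms(1,2) by auto
  show ?thesis by (rule that[of i "fst z" "snd z" l r]) (use * set_sel[OF assms(3,2) *(1,2)] in auto)
qed

text \<open>The product bound is crude but holds for every outcome. It caps the damage when two
  coupled runs select different edges; the sharp bound is \<open>gen_wlen\<close>.\<close>

lemma gen_walk:
  assumes "conn E a b" "dist v a b * (3/4) ^ f < m" "p \<in> set_pmf (G v f a b)"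
  shows "is_walk E a b p \<and> wlen v p \<le> (\<Prod>i<f. 1 + ep i) * dist v a b"
  using assms
proof (induction f arbitrary: a b p)
  case 0
  then have "a = b" using dist_ge_edge[of a b m v] m by force
  then show ?case using 0 v_nonneg by simp
next
  case (Suc f)
  show ?case
  proof (cases "a = b")
    case True
    then show ?thesis using Suc v_nonneg by simp
  next
    case False
    obtain i x y l r where *: "l \<in> set_pmf (G v f a x)" "r \<in> set_pmf (G v f y b)" "p = l @ r"
      "good (ep f) (radius (dist v a b) N i) a b x y" "dist v a x \<le> 3/4 * dist v a b" "dist v y b \<le> 3/4 * dist v a b"
      using gen_SucE[OF Suc.prems(3) False Suc.prems(1)] by metis
    have g: "{x, y} \<in> E" "conn E a x" "conn E y b" "dist v a x + v {x, y} + dist v y b \<le> (1 + ep f) * dist v a b"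
      using *(4) by (auto simp: good_def)
    have c: "d * (3/4) ^ f < m" if "d \<le> 3/4 * dist v a b" for d
    proof -
      have "d * (3/4) ^ f \<le> 3/4 * dist v a b * (3/4) ^ f" using that by (intro mult_right_mono) auto
      also have "\<dots> = dist v a b * (3/4) ^ Suc f" by simp
      finally show ?thesis using Suc.prems(2) by linarith
    qed
    have l: "is_walk E a x l" "wlen v l \<le> (\<Prod>i<f. 1 + ep i) * dist v a x"
      using Suc.IH[OF g(2) c *(1)] *(5) by auto
    have r: "is_walk E y b r" "wlen v r \<le> (\<Prod>i<f. 1 + ep i) * dist v y b"
      using Suc.IH[OF g(3) c *(2)] *(6) by auto
    have P: "1 \<le> (\<Prod>i<f. 1 + ep i)" using ep(1) by (intro prod_ge_1) (simp add: less_imp_le)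
    have "wlen v p = wlen v l + v {x, y} + wlen v r" using *(3) wlen_append[OF l(1) r(1)] by simp
    also have "\<dots> \<le> (\<Prod>i<f. 1 + ep i) * dist v a x + (\<Prod>i<f. 1 + ep i) * v {x, y} + (\<Prod>i<f. 1 + ep i) * dist v y b"
      using l(2) r(2) g(1) P v_nonneg by (intro add_mono) (auto simp: mult_le_cancel_right1)
    also have "\<dots> = (\<Prod>i<f. 1 + ep i) * (dist v a x + v {x, y} + dist v y b)" by (simp add: algebra_simps)
    also have "\<dots> \<le> (\<Prod>i<f. 1 + ep i) * ((1 + ep f) * dist v a b)"
      using P g(4) by (intro mult_left_mono) auto
    finally show ?thesis using is_walk_appendI[OF l(1) g(1) r(1)] *(3) by (simp add: mult.assoc)
  qed
qed

end

end

section \<open>Length of the sampled walk\<close>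

context walk_gen
begin

lemma chain_fst:
  "chain E v a b cs W \<Longrightarrow> fst ` set cs \<subseteq> insert a {..<n}"
proof (induction rule: chain.induct)
  case (chain_cons y b cs W x a)
  then show ?case using edge_less[of x y] by auto
qed simp

abbreviation seg_sum :: "weight \<Rightarrow> (nat \<times> nat) list \<Rightarrow> real" where
  "seg_sum v cs \<equiv> (\<Sum>(x, y)\<leftarrow>cs. dist v x y)"

text \<open>One outcome of the recursion is read off level by level as chains. Descending one level
  adds excess only in proportion to the segments that are still unresolved; edges already fixed gain
  no further excess, which the product bound of \<open>gen_walk\<close> ignores.\<close>

lemma gen_levels:
  assumes m: "0 < m" "\<forall>e\<in>E. m \<le> v e"
    and "conn E a b" "dist v a b * (3/4) ^ f < m" "p \<in> set_pmf (G v f a b)"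
  shows "\<exists>cs W. (\<forall>i\<le>f. chain E v a b (cs i) (W i) \<and>
      (\<forall>z\<in>set (cs i). conn E (fst z) (snd z) \<and> dist v (fst z) (snd z) \<le> (3/4) ^ i * dist v a b)) \<and>
    cs 0 = [(a, b)] \<and> W 0 = 0 \<and>
    (\<forall>i<f. seg_sum v (cs (Suc i)) + W (Suc i) \<le> seg_sum v (cs i) + W i + ep (f - Suc i) * seg_sum v (cs i)) \<and>
    wlen v p \<le> seg_sum v (cs f) + W f"
  using assms(3-)
proof (induction f arbitrary: a b p)
  case 0
  have nn: "\<forall>e\<in>E. 0 \<le> v e" using m by force
  have "a = b" using 0 dist_ge_edge[of a b m v] m by force
  then show ?case using 0 dist_refl[OF nn]
    by (intro exI[of _ "\<lambda>_. [(a, b)]"] exI[of _ "\<lambda>_. 0"]) (auto intro: chain_one)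
next
  case (Suc f)
  have nn: "\<forall>e\<in>E. 0 \<le> v e" using m by force
  show ?case
  proof (cases "a = b")
    case True
    \<comment> \<open>A finished branch is padded with the zero-length segment
      \<open>(a, a)\<close>, so that all branches have equally many levels.\<close>
    then show ?thesis using Suc dist_refl[OF nn]
      by (intro exI[of _ "\<lambda>_. [(a, b)]"] exI[of _ "\<lambda>_. 0"]) (auto intro: chain_one)
  next
    case False
    obtain i x y l r where *: "l \<in> set_pmf (G v f a x)" "r \<in> set_pmf (G v f y b)" "p = l @ r"
      "good v (ep f) (radius (dist v a b) N i) a b x y" "dist v a x \<le> 3/4 * dist v a b" "dist v y b \<le> 3/4 * dist v a b"
      using gen_SucE[OF m Suc.prems(3) False Suc.prems(1)] by metis
    have g: "{x, y} \<in> E" "conn E a x" "conn E y b" "dist v a x + v {x, y} + dist v y b \<le> (1 + ep f) * dist v a b"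
      using *(4) by (auto simp: good_def[OF m])
    have c: "d * (3/4) ^ f < m" if "d \<le> 3/4 * dist v a b" for d
    proof -
      have "d * (3/4) ^ f \<le> 3/4 * dist v a b * (3/4) ^ f" using that by (intro mult_right_mono) auto
      also have "\<dots> = dist v a b * (3/4) ^ Suc f" by simp
      finally show ?thesis using Suc.prems(2) by linarith
    qed
    obtain cl Wl where L: "\<And>i. i \<le> f \<Longrightarrow> chain E v a x (cl i) (Wl i)"
      "\<And>i z. i \<le> f \<Longrightarrow> z \<in> set (cl i) \<Longrightarrow> conn E (fst z) (snd z) \<and> dist v (fst z) (snd z) \<le> (3/4) ^ i * dist v a x"
      "cl 0 = [(a, x)]" "Wl 0 = 0"
      "\<And>i. i < f \<Longrightarrow> seg_sum v (cl (Suc i)) + Wl (Suc i) \<le> seg_sum v (cl i) + Wl i + ep (f - Suc i) * seg_sum v (cl i)"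
      "wlen v l \<le> seg_sum v (cl f) + Wl f"
      using Suc.IH[OF g(2) c[OF *(5)] *(1)] by blast
    obtain cr Wr where R: "\<And>i. i \<le> f \<Longrightarrow> chain E v y b (cr i) (Wr i)"
      "\<And>i z. i \<le> f \<Longrightarrow> z \<in> set (cr i) \<Longrightarrow> conn E (fst z) (snd z) \<and> dist v (fst z) (snd z) \<le> (3/4) ^ i * dist v y b"
      "cr 0 = [(y, b)]" "Wr 0 = 0"
      "\<And>i. i < f \<Longrightarrow> seg_sum v (cr (Suc i)) + Wr (Suc i) \<le> seg_sum v (cr i) + Wr i + ep (f - Suc i) * seg_sum v (cr i)"
      "wlen v r \<le> seg_sum v (cr f) + Wr f"
      using Suc.IH[OF g(3) c[OF *(6)] *(2)] by blast
    define cs where "cs = case_nat [(a, b)] (\<lambda>j. cl j @ cr j)"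
    define W where "W = case_nat 0 (\<lambda>j. Wl j + v {x, y} + Wr j)"
    have "chain E v a b (cs i) (W i)" if "i \<le> Suc f" for i
      using that L(1) R(1) chain_append[OF _ g(1)] by (cases i) (auto simp: cs_def W_def intro: chain_one)
    moreover have "conn E (fst z) (snd z) \<and> dist v (fst z) (snd z) \<le> (3/4) ^ i * dist v a b"
      if "i \<le> Suc f" "z \<in> set (cs i)" for i z
    proof (cases i)
      case 0
      then show ?thesis using that Suc.prems(1) by (simp add: cs_def)
    next
      case (Suc j)
      have "(3/4) ^ j * d \<le> (3/4) ^ Suc j * dist v a b" if "d \<le> 3/4 * dist v a b" for d
        using mult_left_mono[OF that, of "(3/4) ^ j"] by (simp add: mult.assoc mult.left_commute)
      note le = this[OF *(5)] this[OF *(6)]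
      have "z \<in> set (cl j) \<or> z \<in> set (cr j)" "j \<le> f" using that by (auto simp: Suc cs_def)
      then show ?thesis
        using L(2)[of j z] R(2)[of j z] le unfolding Suc by (meson order_trans)
    qed
    moreover have "seg_sum v (cs (Suc i)) + W (Suc i) \<le> seg_sum v (cs i) + W i + ep (Suc f - Suc i) * seg_sum v (cs i)"
      if "i < Suc f" for i
    proof (cases i)
      case 0
      then show ?thesis using g(4) L(3,4) R(3,4) by (simp add: cs_def W_def algebra_simps)
    next
      case (Suc j)
      then show ?thesis using L(5)[of j] R(5)[of j] that by (simp add: cs_def W_def algebra_simps)
    qed
    moreover have "wlen v p \<le> seg_sum v (cs (Suc f)) + W (Suc f)"
    proof -
      have "wlen v p = wlen v l + v {x, y} + wlen v r"
        using *(3) wlen_append gen_walk[OF m g(2) c[OF *(5)] *(1)] gen_walk[OF m g(3) c[OF *(6)] *(2)] by blast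
      then show ?thesis using L(6) R(6) by (simp add: cs_def W_def)
    qed
    ultimately show ?thesis by (intro exI[of _ cs] exI[of _ W]) (auto simp: cs_def W_def)
  qed
qed

text \<open>The excess \<open>X i\<close> accumulated down to level \<open>i\<close> satisfies a
  linear recurrence whose source term is the slack times the unresolved length. The product of the
  factors \<open>1 + ep\<close> solves it and is at most \<open>2\<close> by assumption.\<close>

lemma gen_wlen:
  assumes m: "0 < m" "\<forall>e\<in>E. m \<le> v e"
    and ab: "conn E a b" "a < n" "dist v a b * (3/4) ^ f < m" "p \<in> set_pmf (G v f a b)"
    and P2: "(\<Prod>i<f. 1 + ep i) \<le> 2"
  shows "wlen v p \<le> (1 + 2 * (\<Sum>i<f. ep (f - Suc i) * min 1 (real n * (3/4) ^ i))) * dist v a b"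
proof -
  have nn: "\<forall>e\<in>E. 0 \<le> v e" using m by force
  define D where "D = dist v a b"
  have D: "0 \<le> D" unfolding D_def using dist_nonneg[OF nn ab(1)] .
  obtain cs W where L: "\<And>i. i \<le> f \<Longrightarrow> chain E v a b (cs i) (W i)"
      "\<And>i z. i \<le> f \<Longrightarrow> z \<in> set (cs i) \<Longrightarrow> conn E (fst z) (snd z) \<and> dist v (fst z) (snd z) \<le> (3/4) ^ i * dist v a b"
      "cs 0 = [(a, b)]" "W 0 = 0"
      "\<And>i. i < f \<Longrightarrow> seg_sum v (cs (Suc i)) + W (Suc i) \<le> seg_sum v (cs i) + W i + ep (f - Suc i) * seg_sum v (cs i)"
      "wlen v p \<le> seg_sum v (cs f) + W f"
    using gen_levels[OF m ab(1,3,4)] by blast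
  define X where "X i = seg_sum v (cs i) + W i - D" for i
  define c where "c i = min 1 (real n * (3/4) ^ i)" for i :: nat
  \<comment> \<open>Two lower bounds on \<open>W i\<close> give the two arguments of the minimum:
    nonnegativity yields the \<open>1\<close>, the chain estimate yields
    \<open>n * (3/4) ^ i\<close>.\<close>
  have S: "seg_sum v (cs i) \<le> X i + c i * D" if "i \<le> f" for i
  proof -
    have W0: "0 \<le> W i" using chain_nonneg[OF L(1)[OF that] nn] .
    have "dist v a b \<le> real (card (fst ` set (cs i))) * ((3/4) ^ i * dist v a b) + W i"
      using chain_dist[OF L(1)[OF that] nn, of "(3/4) ^ i * dist v a b"] L(2)[OF that] D by (fastforce simp: D_def)
    moreover have "card (fst ` set (cs i)) \<le> n"
    proof -
      have "fst ` set (cs i) \<subseteq> {..<n}" using chain_fst[OF L(1)[OF that]] ab(2) by auto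
      from card_mono[OF _ this] show ?thesis by simp
    qed
    then have "real (card (fst ` set (cs i))) * ((3/4) ^ i * dist v a b) \<le> real n * ((3/4) ^ i * dist v a b)"
      using D by (intro mult_right_mono) (auto simp: D_def)
    ultimately have "D \<le> real n * (3/4) ^ i * D + W i" unfolding D_def mult.assoc by linarith
    then show ?thesis using W0 unfolding X_def c_def by (auto simp: min_def)
  qed
  have X: "X j \<le> (\<Prod>i<j. 1 + ep (f - Suc i)) * ((\<Sum>i<j. ep (f - Suc i) * c i) * D)" if "j \<le> f" for j
    using that
  proof (induction j)
    case 0
    then show ?case using L(3,4) by (simp add: X_def D_def)
  next
    case (Suc j)
    let ?P = "\<Prod>i<j. 1 + ep (f - Suc i)" and ?T = "(\<Sum>i<j. ep (f - Suc i) * c i) * D" and ?e = "ep (f - Suc j)"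
    have e0: "0 < ?e" by (rule ep)
    have P1: "1 \<le> ?P" using ep(1) by (intro prod_ge_1) (simp add: less_imp_le)
    have "X (Suc j) \<le> X j + ?e * seg_sum v (cs j)" using L(5)[of j] Suc.prems by (simp add: X_def)
    also have "\<dots> \<le> X j + ?e * (X j + c j * D)" using S[of j] Suc.prems e0 by simp
    also have "\<dots> = (1 + ?e) * X j + ?e * c j * D" by (simp add: algebra_simps)
    also have "(1 + ?e) * X j \<le> (1 + ?e) * (?P * ?T)" using Suc e0 by (intro mult_left_mono) auto
    also have "?e * c j * D \<le> (1 + ?e) * ?P * (?e * c j * D)"
    proof -
      have "1 \<le> (1 + ?e) * ?P" using P1 e0 mult_mono[of 1 "1 + ?e" 1 ?P] by simp
      moreover have "0 \<le> ?e * c j * D" using e0 D by (simp add: c_def)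
      ultimately show ?thesis using mult_right_mono[of 1 "(1 + ?e) * ?P"] by simp
    qed
    finally show ?case by (simp add: algebra_simps)
  qed
  have T0: "0 \<le> (\<Sum>i<f. ep (f - Suc i) * c i) * D"
    using D ep(1) by (intro mult_nonneg_nonneg sum_nonneg) (auto simp: c_def less_imp_le)
  have "wlen v p \<le> D + X f" using L(6) by (simp add: X_def)
  also have "X f \<le> (\<Prod>i<f. 1 + ep i) * ((\<Sum>i<f. ep (f - Suc i) * c i) * D)"
    using X[of f] prod.nat_diff_reindex[of "\<lambda>i. 1 + ep i" f] by simp
  also have "\<dots> \<le> 2 * ((\<Sum>i<f. ep (f - Suc i) * c i) * D)" using P2 T0 by (rule mult_right_mono)
  finally show ?thesis by (simp add: D_def c_def algebra_simps)
qed

end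

section \<open>The distance between weighted walks\<close>

context graph
begin

abbreviation "wdist c c' p p' \<equiv> d_w E (walk_edges p, c) (walk_edges p', c')"

lemma walk_vector_simps [simp]:
  "walk_vector {#} c e = 0"
  "walk_vector (add_mset f P) c e = c f * indicator {f} e + walk_vector P c e"
  "walk_vector (P + Q) c e = walk_vector P c e + walk_vector Q c e"
  by (simp_all add: walk_vector_def)

lemma d_w_nonneg: "0 \<le> d_w E (P, c) (Q, c')"
  by (simp add: d_w_def l1_dist_def sum_nonneg)

lemma d_w_le_length:
  assumes "set_mset P \<subseteq> E" "set_mset Q \<subseteq> E" "\<forall>e\<in>E. 0 \<le> c e" "\<forall>e\<in>E. 0 \<le> c' e"
  shows "d_w E (P, c) (Q, c') \<le> walk_length c P + walk_length c' Q"
proof -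
  have v: "(\<Sum>e\<in>E. walk_vector P c e) = walk_length c P" if "set_mset P \<subseteq> E" for P c
    using that
  proof (induction P)
    case (add f P)
    then show ?case using finite_E by (simp add: sum.distrib indicator_def if_distrib sum.delta' cong: if_cong)
  qed simp
  have p: "0 \<le> walk_vector P c e" if "set_mset P \<subseteq> E" "\<forall>e\<in>E. 0 \<le> c e" for P c e
    using that by (induction P) (auto simp: indicator_def)
  have "d_w E (P, c) (Q, c') \<le> (\<Sum>e\<in>E. walk_vector P c e + walk_vector Q c' e)"
    unfolding d_w_def l1_dist_def prod.case
    using p[OF assms(1,3)] p[OF assms(2,4)] by (intro sum_mono) (smt (verit))
  then show ?thesis using v assms by (simp add: sum.distrib)
qed

lemma d_w_triangle: "d_w E (P, c) (R, c'') \<le> d_w E (P, c) (Q, c') + d_w E (Q, c') (R, c'')"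
  unfolding d_w_def l1_dist_def prod.case sum.distrib[symmetric] by (intro sum_mono) linarith

lemma d_w_sym: "d_w E (P, c) (Q, c') = d_w E (Q, c') (P, c)"
  by (simp add: d_w_def l1_dist_def abs_minus_commute)

lemma d_w_add: "d_w E (P + P2, c) (Q + Q2, c') \<le> d_w E (P, c) (Q, c') + d_w E (P2, c) (Q2, c')"
  unfolding d_w_def l1_dist_def prod.case sum.distrib[symmetric] by (intro sum_mono) simp

lemma d_w_add_mset:
  assumes "f \<in> E"
  shows "d_w E (add_mset f P, c) (add_mset f Q, c') \<le> \<bar>c f - c' f\<bar> + d_w E (P, c) (Q, c')"
proof -
  have "d_w E (add_mset f P, c) (add_mset f Q, c') \<le>
    (\<Sum>e\<in>E. (if e = f then \<bar>c f - c' f\<bar> else 0) + \<bar>walk_vector P c e - walk_vector Q c' e\<bar>)"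
    unfolding d_w_def l1_dist_def prod.case by (intro sum_mono) (auto simp: indicator_def)
  also have "\<dots> = \<bar>c f - c' f\<bar> + d_w E (P, c) (Q, c')"
    using assms finite_E by (simp add: sum.distrib d_w_def l1_dist_def)
  finally show ?thesis .
qed

lemma wdist_append:
  assumes "is_walk E a x l" "is_walk E a x l'" "{x, y} \<in> E" "is_walk E y b r" "is_walk E y b r'"
  shows "wdist c c' (l @ r) (l' @ r') \<le> wdist c c' l l' + wdist c c' r r' + \<bar>c {x, y} - c' {x, y}\<bar>"
proof -
  have e: "walk_edges (l @ r) = add_mset {x, y} (walk_edges l + walk_edges r)"
    "walk_edges (l' @ r') = add_mset {x, y} (walk_edges l' + walk_edges r')"
    using assms by (auto simp: walk_edges_append is_walk_def)
  show ?thesis unfolding e using d_w_add_mset[OF assms(3), of "walk_edges l + walk_edges r" c "walk_edges l' + walk_edges r'" c']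
      d_w_add[of "walk_edges l" "walk_edges r" c "walk_edges l'" "walk_edges r'" c'] by linarith
qed

lemma edge_in_walk_split:
  "e \<in># walk_edges p \<Longrightarrow> \<exists>p1 p2. p = p1 @ p2 \<and> p1 \<noteq> [] \<and> p2 \<noteq> [] \<and> e = {last p1, hd p2}"
proof (induction p)
  case (Cons x p)
  then obtain y q where q: "p = y # q" by (cases p) auto
  show ?case
  proof (cases "e = {x, y}")
    case True
    then show ?thesis by (intro exI[of _ "[x]"] exI[of _ p]) (simp add: q)
  next
    case False
    then obtain p1 p2 where "p = p1 @ p2" "p1 \<noteq> []" "p2 \<noteq> []" "e = {last p1, hd p2}"
      using Cons q by auto
    then show ?thesis by (intro exI[of _ "x # p1"] exI[of _ p2]) auto
  qed
qed simp

end

section \<open>Increasing the weight of one edge\<close>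

context walk_gen
begin

text \<open>Coupling cost per unit of change of one weight. \<open>432 = 4 * 12 * 9\<close>:
  differing selections cost at most \<open>4 * D'\<close>, and their probability is at most
  \<open>12 * K\<close> times the gain change \<open>9 * \<delta> / (ep f * D')\<close>. The
  \<open>1\<close> pays for selecting the changed edge itself. Both children are affected for at
  most \<open>6 * N * (10 * ep (Suc f)) + 1\<close> of the \<open>N\<close> radii.\<close>

primrec \<beta> :: "nat \<Rightarrow> real" where
  "\<beta> 0 = 0"
| "\<beta> (Suc f) = 432 * real K / ep f + 1 + \<beta> f * (1 + 60 * ep (Suc f) + 1 / real N)"

lemma \<beta>_nonneg: "0 \<le> \<beta> f"
proof (induction f)
  case (Suc f)
  then show ?case using ep(1)[of f] ep(1)[of "Suc f"] by (auto intro!: add_nonneg_nonneg mult_nonneg_nonneg)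
qed simp

end

text \<open>\<open>v\<close> and \<open>v'\<close> drive the sampler, \<open>c\<close> and
  \<open>c'\<close> measure the cost. They are separate because the intermediate \<open>v\<close> of
  the later comparison mixes two raised weightings and need not be the raised version of
  \<open>c\<close>. Letting \<open>e\<close> increase is no restriction, as couplings can be
  mirrored.\<close>

locale edge_step = walk_gen +
  fixes v v' c c' :: weight and e :: "nat set" and \<delta> m :: real
  assumes e: "e \<in> E" and m: "0 < m" "\<forall>x\<in>E. m \<le> v x"
    and up: "v e \<le> v' e" "v' e \<le> v e + \<delta>" and off: "\<forall>x\<in>E. x \<noteq> e \<longrightarrow> v' x = v x"
    and c: "\<forall>x\<in>E. 0 \<le> c x \<and> c x \<le> v x" "\<forall>x\<in>E. 0 \<le> c' x \<and> c' x \<le> v' x"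
    and c_off: "\<forall>x\<in>E. x \<noteq> e \<longrightarrow> c' x = c x" and c_e: "\<bar>c e - c' e\<bar> \<le> \<delta>"
begin

lemma mono: "\<forall>x\<in>E. v x \<le> v' x"
  using up off by force

lemma m': "\<forall>x\<in>E. m \<le> v' x"
  using m(2) mono by force

lemma nn: "\<forall>x\<in>E. 0 \<le> v x" and nn': "\<forall>x\<in>E. 0 \<le> v' x"
  using m m' by force+

lemma \<delta>: "0 \<le> \<delta>"
  using c_e by simp

lemma l1: "l1_dist E v v' \<le> \<delta>"
proof -
  have "l1_dist E v v' = (\<Sum>x\<in>E. if x = e then \<bar>v e - v' e\<bar> else 0)"
    unfolding l1_dist_def using off by (intro sum.cong) auto
  also have "\<dots> = \<bar>v e - v' e\<bar>" using e finite_E by simp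
  finally show ?thesis using up by simp
qed

lemma dist_step:
  assumes "conn E a b" shows "dist v a b \<le> dist v' a b" "dist v' a b \<le> dist v a b + \<delta>"
  using dist_mono[OF assms nn mono] dist_l1[OF assms nn nn'] l1 by auto

text \<open>The nodes that can notice a change of the weight of \<open>e\<close>; \<open>v\<close> is the smaller of the two weightings.\<close>

definition rel :: "real \<Rightarrow> nat \<Rightarrow> nat \<Rightarrow> bool" where
  "rel \<gamma> a b \<longleftrightarrow> (\<exists>x y. e = {x, y} \<and> conn E a x \<and> conn E y b \<and>
     dist v a x + v e + dist v y b \<le> (1 + \<gamma>) * dist v a b)"

text \<open>A shortest path for \<open>v\<close> that avoids \<open>e\<close> keeps its length under
  \<open>v'\<close>, and distances cannot decrease.\<close>

lemma dist_changed:
  assumes "conn E a b" "dist v' a b \<noteq> dist v a b"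
  shows "\<exists>x y. e = {x, y} \<and> conn E a x \<and> conn E y b \<and> dist v a x + v e + dist v y b \<le> dist v a b"
proof -
  obtain p where p: "is_path E a b p" "wlen v p = dist v a b" using dist_attained[OF assms(1) nn] by blast
  then have w: "is_walk E a b p" by (simp add: is_path_def)
  have "e \<in># walk_edges p"
  proof (rule ccontr)
    assume ne: "\<not> e \<in># walk_edges p"
    have "wlen v' p = wlen v p" unfolding walk_length_def
    proof (rule arg_cong[where f = sum_mset], rule image_mset_cong)
      fix x assume "x \<in># walk_edges p"
      then have "x \<in> E" "x \<noteq> e" using walk_edges_subset[OF w] ne by auto
      then show "v' x = v x" using off by simp
    qed
    then have "dist v' a b \<le> dist v a b" using dist_le_wlen[OF w nn'] p by simp
    then show False using dist_step(1)[OF assms(1)] assms(2) by simp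
  qed
  then obtain p1 p2 where s: "p = p1 @ p2" "p1 \<noteq> []" "p2 \<noteq> []" "e = {last p1, hd p2}"
    using edge_in_walk_split by blast
  have ws: "is_walk E a (last p1) p1" "is_walk E (hd p2) b p2"
    using w s is_walk_append_iff by auto
  have "dist v a (last p1) + v e + dist v (hd p2) b \<le> wlen v p1 + v e + wlen v p2"
    using dist_le_wlen[OF ws(1) nn] dist_le_wlen[OF ws(2) nn] by simp
  also have "\<dots> = dist v a b" using wlen_append[OF ws, of v] s p by simp
  finally show ?thesis using s ws by (auto simp: conn_def)
qed

text \<open>The almost shortest walk of the child through \<open>e\<close>, continued along the rest
  of the split, serves the parent; the slacks add up. Read backwards, an irrelevant node has
  irrelevant children, so nothing below it costs anything.\<close>

lemma rel_extend_right:
  assumes "conn E a b" "good v \<kappa> \<rho> a b x y" "rel \<gamma> a x" "\<kappa> * dist v a b + \<gamma> * dist v a x \<le> \<gamma>' * dist v a b"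
  shows "rel \<gamma>' a b"
proof -
  obtain p q where pq: "e = {p, q}" "conn E a p" "conn E q x" "dist v a p + v e + dist v q x \<le> (1 + \<gamma>) * dist v a x"
    using assms(3) by (auto simp: rel_def)
  have g: "{x, y} \<in> E" "conn E y b" "dist v a x + v {x, y} + dist v y b \<le> (1 + \<kappa>) * dist v a b"
    using assms(2) by (auto simp: good_def[OF m])
  have "dist v q b \<le> dist v q x + v {x, y} + dist v y b" using dist_triangle_edge[OF nn pq(3) g(1,2)] .
  then have "dist v a p + v e + dist v q b \<le> (1 + \<gamma>') * dist v a b"
    using pq(4) g(3) assms(4) by (simp add: algebra_simps)
  then show ?thesis unfolding rel_def using pq conn_edge[OF pq(3) g(1,2)] by blast
qed

lemma rel_extend_left:
  assumes "conn E a b" "good v \<kappa> \<rho> a b x y" "rel \<gamma> y b" "\<kappa> * dist v a b + \<gamma> * dist v y b \<le> \<gamma>' * dist v a b"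
  shows "rel \<gamma>' a b"
proof -
  obtain p q where pq: "e = {p, q}" "conn E y p" "conn E q b" "dist v y p + v e + dist v q b \<le> (1 + \<gamma>) * dist v y b"
    using assms(3) by (auto simp: rel_def)
  have g: "{x, y} \<in> E" "conn E a x" "dist v a x + v {x, y} + dist v y b \<le> (1 + \<kappa>) * dist v a b"
    using assms(2) by (auto simp: good_def[OF m])
  have "dist v a p \<le> dist v a x + v {x, y} + dist v y p" using dist_triangle_edge[OF nn g(2,1) pq(2)] .
  then have "dist v a p + v e + dist v q b \<le> (1 + \<gamma>') * dist v a b"
    using pq(4) g(3) assms(4) by (simp add: algebra_simps)
  then show ?thesis unfolding rel_def using pq conn_edge[OF g(2,1) pq(2)] by blast
qed

lemma rel_self:
  assumes "conn E a b" "good v \<kappa> \<rho> a b x y" "{x, y} = e" "\<kappa> * dist v a b \<le> \<gamma> * dist v a b"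
  shows "rel \<gamma> a b"
  using assms unfolding rel_def by (intro exI[of _ x] exI[of _ y]) (auto simp: good_def[OF m] algebra_simps)

lemma dist_changed_rel:
  assumes "conn E a b" "dist v' a b \<noteq> dist v a b" "0 \<le> \<gamma>"
  shows "rel \<gamma> a b"
proof -
  obtain x y where "e = {x, y}" "conn E a x" "conn E y b" "dist v a x + v e + dist v y b \<le> dist v a b"
    using dist_changed[OF assms(1,2)] by blast
  moreover have "0 \<le> \<gamma> * dist v a b" using dist_nonneg[OF nn assms(1)] assms(3) by simp
  ultimately show ?thesis unfolding rel_def by (intro exI[of _ x] exI[of _ y]) (auto simp: algebra_simps)
qed

text \<open>While the distance of \<open>a\<close> and \<open>b\<close> is unchanged, scores can
  only increase, so zero gains stay zero. A positive gain means a \<open>good\<close> edge, and a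
  change of any term of its score would make the node relevant.\<close>

lemma gain_eq_of_not_rel:
  assumes ab: "conn E a b" "a \<noteq> b" and nr: "\<not> rel \<gamma> a b" and \<kappa>: "0 < \<kappa>" "\<kappa> \<le> \<gamma>"
  shows "dist v' a b = dist v a b" "gain E v' \<kappa> a b \<rho> z = gain E v \<kappa> a b \<rho> z"
proof -
  show D: "dist v' a b = dist v a b" using dist_changed_rel[OF ab(1)] nr \<kappa> by force
  have D0: "0 < dist v a b" by (rule dist_pos[OF m ab])
  show "gain E v' \<kappa> a b \<rho> z = gain E v \<kappa> a b \<rho> z"
  proof (cases "{fst z, snd z} \<in> E \<and> conn E a (fst z)")
    case True
    then have z: "{fst z, snd z} \<in> E" "conn E a (fst z)" by auto
    have yb: "conn E (snd z) b" using candidate_conn[OF m ab(1) z] .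
    have le: "score E v a b \<rho> z \<le> score E v' a b \<rho> z"
      unfolding score_def D using dist_step(1)[OF z(2)] dist_step(1)[OF yb] mono z(1)
      by (intro add_mono diff_mono max.mono) auto
    show ?thesis
    proof (cases "gain E v \<kappa> a b \<rho> z = 0")
      case True
      then have "1 - score E v a b \<rho> z / (\<kappa> * dist v a b) \<le> 0" using z by (auto simp: gain_def)
      moreover have "score E v a b \<rho> z / (\<kappa> * dist v a b) \<le> score E v' a b \<rho> z / (\<kappa> * dist v a b)"
        using le D0 \<kappa> by (intro divide_right_mono) auto
      ultimately have "gain E v' \<kappa> a b \<rho> z = 0" unfolding gain_def D by auto
      then show ?thesis using True by simp
    next
      case False
      have g: "good v \<kappa> \<rho> a b (fst z) (snd z)" using gain_pos_good[OF m ab \<kappa>(1) False] .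
      have k: "\<kappa> * dist v a b \<le> \<gamma> * dist v a b" using \<kappa> D0 by simp
      have "dist v' a (fst z) = dist v a (fst z)"
      proof (rule ccontr)
        assume "dist v' a (fst z) \<noteq> dist v a (fst z)"
        then have "rel 0 a (fst z)" using dist_changed_rel[OF z(2)] by simp
        then show False using rel_extend_right[OF ab(1) g, of 0 \<gamma>] nr k by simp
      qed
      moreover have "dist v' (snd z) b = dist v (snd z) b"
      proof (rule ccontr)
        assume "dist v' (snd z) b \<noteq> dist v (snd z) b"
        then have "rel 0 (snd z) b" using dist_changed_rel[OF yb] by simp
        then show False using rel_extend_left[OF ab(1) g, of 0 \<gamma>] nr k by simp
      qed
      moreover have "v' {fst z, snd z} = v {fst z, snd z}"
      proof -
        have "{fst z, snd z} \<noteq> e" using rel_self[OF ab(1) g _ k] nr by blast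
        then show ?thesis using off z(1) by simp
      qed
      ultimately have "score E v' a b \<rho> z = score E v a b \<rho> z" by (simp add: score_def D)
      then show ?thesis by (simp add: gain_def D)
    qed
  qed (auto simp: gain_def)
qed

text \<open>All distances, the edge weight and the radius grow by an amount between \<open>0\<close>
  and \<open>\<delta>\<close>. With signs taken into account this gives at most
  \<open>6 * \<delta>\<close>, so \<open>8\<close> is generous.\<close>

lemma score_step:
  assumes ab: "conn E a b" and z: "{fst z, snd z} \<in> E" "conn E a (fst z)" and i: "i < N"
  shows "\<bar>score E v a b (radius (dist v a b) N i) z - score E v' a b (radius (dist v' a b) N i) z\<bar> \<le> 8 * \<delta>"
proof -
  have yb: "conn E (snd z) b" using candidate_conn[OF m ab z] .
  define u where "u = (real N + real i) / (3 * real N)"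
  have u: "0 \<le> u" "u \<le> 1" using i N by (auto simp: u_def field_simps)
  have r: "radius D N i = D * u" for D by (simp add: radius_def u_def)
  have "(dist v' a b - dist v a b) * u \<le> \<delta> * 1" "0 \<le> (dist v' a b - dist v a b) * u"
    using dist_step[OF ab] u \<delta> by (intro mult_mono mult_nonneg_nonneg; simp)+
  then have "radius (dist v' a b) N i \<le> radius (dist v a b) N i + \<delta>" "radius (dist v a b) N i \<le> radius (dist v' a b) N i"
    by (auto simp: r algebra_simps)
  moreover have "v {fst z, snd z} \<le> v' {fst z, snd z}" "v' {fst z, snd z} \<le> v {fst z, snd z} + \<delta>"
    using mono off up z(1) \<delta> by (cases "{fst z, snd z} = e"; auto)+
  moreover have "\<bar>max 0 p - max 0 q\<bar> \<le> \<bar>p - q\<bar>" for p q :: real by (simp add: max_def)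
  note M = this[of "dist v a (fst z) - radius (dist v a b) N i" "dist v' a (fst z) - radius (dist v' a b) N i"]
    this[of "dist v (snd z) b - (dist v a b - radius (dist v a b) N i)" "dist v' (snd z) b - (dist v' a b - radius (dist v' a b) N i)"]
  define A A' B B' where "A = max 0 (dist v a (fst z) - radius (dist v a b) N i)"
    "A' = max 0 (dist v' a (fst z) - radius (dist v' a b) N i)"
    "B = max 0 (dist v (snd z) b - (dist v a b - radius (dist v a b) N i))"
    "B' = max 0 (dist v' (snd z) b - (dist v' a b - radius (dist v' a b) N i))"
  note M = M[folded A_A'_B_B'_def]
  ultimately show ?thesis using dist_step[OF ab] dist_step[OF z(2)] dist_step[OF yb] \<delta> M
    unfolding score_def A_A'_B_B'_def[symmetric] by (simp only: abs_le_iff) linarith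
qed

lemma gain_step:
  assumes ab: "conn E a b" "a \<noteq> b" and i: "i < N"
  shows "\<bar>gain E v (ep f) a b (radius (dist v a b) N i) z - gain E v' (ep f) a b (radius (dist v' a b) N i) z\<bar>
     \<le> 9 * \<delta> / (ep f * dist v' a b)"
proof (cases "{fst z, snd z} \<in> E \<and> conn E a (fst z)")
  case True
  then have z: "{fst z, snd z} \<in> E" "conn E a (fst z)" by auto
  let ?s = "score E v a b (radius (dist v a b) N i) z" and ?s' = "score E v' a b (radius (dist v' a b) N i) z"
  let ?d = "ep f * dist v a b" and ?d' = "ep f * dist v' a b"
  have D: "0 < dist v a b" "dist v a b \<le> dist v' a b" using dist_pos[OF m ab] dist_step[OF ab(1)] by auto
  have d: "0 < ?d" "?d \<le> ?d'" using D ep[of f] by auto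
  have "?d' - ?d = ep f * (dist v' a b - dist v a b)" by (simp add: algebra_simps)
  also have "\<dots> \<le> 1/12 * \<delta>" using ep[of f] D dist_step[OF ab(1)] by (intro mult_mono) auto
  finally have "\<bar>?s - ?s'\<bar> + 2 * (?d' - ?d) \<le> 8 * \<delta> + 2 * (1/12 * \<delta>)"
    using score_step[OF ab(1) z i] by (intro add_mono mult_left_mono) auto
  also have "\<dots> \<le> 9 * \<delta>" using \<delta> by simp
  finally have "\<bar>?s - ?s'\<bar> + 2 * (?d' - ?d) \<le> 9 * \<delta>" .
  then have "(\<bar>?s - ?s'\<bar> + 2 * (?d' - ?d)) / ?d' \<le> 9 * \<delta> / ?d'" using d by (intro divide_right_mono) auto
  moreover have "\<bar>max 0 (1 - ?s / ?d) - max 0 (1 - ?s' / ?d')\<bar> \<le> (\<bar>?s - ?s'\<bar> + 2 * (?d' - ?d)) / ?d'"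
    using gain_scaling[OF d] score_nonneg[OF m ab(1) z] score_nonneg[OF m(1) m' ab(1) z] by blast
  ultimately show ?thesis using z by (simp add: gain_def)
next
  case False
  have "0 \<le> dist v' a b" using dist_nonneg[OF nn' ab(1)] .
  then show ?thesis using False \<delta> ep(1)[of f] by (auto simp: gain_def)
qed

lemma sel_tv:
  assumes ab: "conn E a b" "a \<noteq> b" and i: "i < N"
  shows "(\<Sum>z\<in>{..<n} \<times> {..<n}. \<bar>pmf (sel v f a b i) z - pmf (sel v' f a b i) z\<bar>)
    \<le> 108 * real K * \<delta> / (ep f * dist v' a b)"
proof -
  have D: "0 < dist v a b" "0 < dist v' a b" using dist_pos[OF m ab] dist_pos[OF m(1) m' ab] by auto
  have r: "0 \<le> radius d N i" "radius d N i < d" if "0 < d" for d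
    using radius_bounds[OF m i that] that by linarith+
  have "(\<Sum>z\<in>{..<n} \<times> {..<n}. \<bar>pmf (sel v f a b i) z - pmf (sel v' f a b i) z\<bar>) \<le>
     12 * real K * (9 * \<delta> / (ep f * dist v' a b))"
    unfolding pmf_sel[OF m ab i] pmf_sel[OF m(1) m' ab i]
    using softmin_tv[of "{..<n} \<times> {..<n}" "gain E v (ep f) a b (radius (dist v a b) N i)"
        "gain E v' (ep f) a b (radius (dist v' a b) N i)" K "9 * \<delta> / (ep f * dist v' a b)"]
      gain_range[OF m ab ep(1)] gain_range[OF m(1) m' ab ep(1)]
      gain_sum_ge_1[OF m ab ep(1) r[OF D(1)]] gain_sum_ge_1[OF m(1) m' ab ep(1) r[OF D(2)]]
      gain_step[OF ab i, of f] K by (simp add: card_cartesian_product)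
  then show ?thesis by simp
qed

text \<open>If the left child notices \<open>e\<close>, then \<open>e\<close> is not much farther
  from \<open>a\<close> than \<open>\<rho>\<close>; if the right child does, it is not much nearer.
  One fixed end point \<open>w\<close> of \<open>e\<close> serves for all radii.\<close>

lemma rel_both_radius:
  assumes ab: "conn E a b" and g: "good v \<kappa> \<rho> a b x y" and \<gamma>: "0 \<le> \<gamma>"
    and r: "rel \<gamma> a x" "rel \<gamma> y b" and b: "dist v a x \<le> 3/4 * dist v a b" "dist v y b \<le> 3/4 * dist v a b"
    and \<gamma>': "\<kappa> + 3/4 * \<gamma> \<le> \<gamma>'" and w: "w \<in> e"
  shows "\<bar>dist v a w - \<rho>\<bar> \<le> \<gamma>' * dist v a b"
proof -
  have D: "0 \<le> dist v a b" using dist_nonneg[OF nn ab] .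
  obtain p q where pq: "e = {p, q}" "conn E a p" "conn E q x" "dist v a p + v e + dist v q x \<le> (1 + \<gamma>) * dist v a x"
    using r(1) by (auto simp: rel_def)
  have ve: "0 \<le> v e" using nn e by blast
  have aw: "conn E a w \<and> dist v a w \<le> (1 + \<gamma>) * dist v a x"
  proof -
    have "w = p \<or> w = q" using w pq(1) by auto
    moreover have "dist v a q \<le> dist v a p + v e"
      using dist_triangle_edge[OF nn pq(2), of q q] pq(1) e dist_refl[OF nn] by auto
    moreover have "conn E a q" using conn_edgeD[OF pq(2), of q] pq(1) e by simp
    moreover have "0 \<le> dist v q x" using dist_nonneg[OF nn pq(3)] .
    ultimately show ?thesis using pq(2,4) ve by auto
  qed
  obtain p' q' where pq': "e = {p', q'}" "conn E y p'" "conn E q' b" "dist v y p' + v e + dist v q' b \<le> (1 + \<gamma>) * dist v y b"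
    using r(2) by (auto simp: rel_def)
  have wb: "conn E w b \<and> dist v w b \<le> (1 + \<gamma>) * dist v y b"
  proof -
    have "w = p' \<or> w = q'" using w pq'(1) by auto
    moreover have "dist v p' b \<le> v e + dist v q' b"
      using dist_triangle_edge[OF nn conn_refl[of E p'] _ pq'(3)] pq'(1) e dist_refl[OF nn] by auto
    moreover have "conn E p' b" using conn_edge[OF conn_refl _ pq'(3), of p'] pq'(1) e by simp
    moreover have "0 \<le> dist v y p'" using dist_nonneg[OF nn pq'(2)] .
    ultimately show ?thesis using pq'(3,4) ve by auto
  qed
  have "dist v a b \<le> dist v a w + dist v w b" using dist_triangle[OF nn] aw wb by blast
  moreover have "\<gamma> * dist v a x \<le> \<gamma> * (3/4 * dist v a b)" "\<gamma> * dist v y b \<le> \<gamma> * (3/4 * dist v a b)"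
    using \<gamma> b by (intro mult_left_mono; simp)+
  moreover have "(\<kappa> + 3/4 * \<gamma>) * dist v a b \<le> \<gamma>' * dist v a b" using \<gamma>' D by (rule mult_right_mono)
  ultimately show ?thesis using aw wb g by (auto simp: good_def[OF m] algebra_simps abs_le_iff)
qed

text \<open>The grid has spacing \<open>D / (3 * N)\<close> and the window has width
  \<open>2 * \<gamma> * D\<close>.\<close>

lemma card_window:
  assumes "0 < D" "0 \<le> \<gamma>"
  shows "real (card {i. i < N \<and> \<bar>d - radius D N i\<bar> \<le> \<gamma> * D}) \<le> 6 * real N * \<gamma> + 1"
proof (rule card_nat_interval)
  fix i assume "i \<in> {i. i < N \<and> \<bar>d - radius D N i\<bar> \<le> \<gamma> * D}"
  then have i: "\<bar>d - radius D N i\<bar> \<le> \<gamma> * D" by simp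
  have r: "radius D N i = D * (real N + real i) / (3 * real N)" by (simp add: radius_def)
  have "\<bar>(d - radius D N i) * (3 * real N) / D\<bar> = \<bar>d - radius D N i\<bar> * (3 * real N) / D"
    using assms by (simp add: abs_mult)
  also have "\<dots> \<le> \<gamma> * D * (3 * real N) / D"
    using i assms by (intro divide_right_mono mult_right_mono) auto
  finally have "\<bar>(d - radius D N i) * (3 * real N) / D\<bar> \<le> \<gamma> * D * (3 * real N) / D" .
  moreover have "(d - radius D N i) * (3 * real N) / D = d * 3 * real N / D - real N - real i"
    using assms N unfolding r by (simp add: field_simps)
  moreover have "\<gamma> * D * (3 * real N) / D = 3 * real N * \<gamma>" using assms by simp
  ultimately have "\<bar>d * 3 * real N / D - real N - real i\<bar> \<le> 3 * real N * \<gamma>" by simp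
  then show "d * 3 * real N / D - real N - 3 * real N * \<gamma> \<le> real i \<and>
    real i \<le> d * 3 * real N / D - real N - 3 * real N * \<gamma> + 6 * real N * \<gamma>"
    unfolding abs_le_iff by (simp add: algebra_simps)
qed (use assms in auto)

abbreviation "cost p p' \<equiv> ennreal (wdist c c' p p')"

lemma cost_le:
  assumes "is_walk E a b p" "is_walk E x y q"
  shows "wdist c c' p q \<le> wlen v p + wlen v' q"
proof -
  have s: "set_mset (walk_edges p) \<subseteq> E" "set_mset (walk_edges q) \<subseteq> E" using assms walk_edges_subset by auto
  have "wdist c c' p q \<le> wlen c p + wlen c' q" by (rule d_w_le_length[OF s]) (use c in auto)
  moreover have "wlen c p \<le> wlen v p" by (rule walk_length_mono[OF s(1)]) (use c in auto)
  moreover have "wlen c' q \<le> wlen v' q" by (rule walk_length_mono[OF s(2)]) (use c in auto)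
  ultimately show ?thesis by linarith
qed

text \<open>This fixes the tolerance at \<open>10\<close> slacks: it reproduces itself from level to
  level because \<open>(1 + 3/4 * 10) * 7/6 < 10\<close>.\<close>

lemma ep_step: "ep f + 3/4 * (10 * ep f) \<le> 10 * ep (Suc f)"
  using ep(3)[of f] ep(1)[of "Suc f"] by linarith

lemma valid_child:
  assumes "D * (3/4) ^ Suc f < m" "d \<le> 3/4 * D" shows "d * (3/4) ^ f < m"
proof -
  have "d * (3/4) ^ f \<le> 3/4 * D * (3/4) ^ f" using assms(2) by (intro mult_right_mono) auto
  also have "\<dots> = D * (3/4) ^ Suc f" by simp
  finally show ?thesis using assms(1) by linarith
qed

lemma valid_lower:
  assumes "conn E a b" "dist v' a b * (3/4) ^ f < m" shows "dist v a b * (3/4) ^ f < m"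
proof -
  have "dist v a b * (3/4) ^ f \<le> dist v' a b * (3/4) ^ f" using dist_step[OF assms(1)] by (intro mult_right_mono) auto
  then show ?thesis using assms(2) by linarith
qed

text \<open>One node with a fixed radius. A relevant node pays for differing selections, for
  selecting \<open>e\<close> itself and for its relevant children, of which there are two only if
  the radius is close to the distance of \<open>w\<close>. An irrelevant node pays nothing, since
  the selections agree and no child is relevant.\<close>

lemma node_cpl:
  assumes ab: "conn E a b" "a \<noteq> b" and i: "i < N"
    and valid: "dist v' a b * (3/4) ^ Suc f < m" and P2: "(\<Prod>i<Suc f. 1 + ep i) \<le> 2"
    and IH: "\<And>a b. conn E a b \<Longrightarrow> dist v' a b * (3/4) ^ f < m \<Longrightarrow>
       cpl (G v f a b) (G v' f a b) cost (ennreal (\<beta> f * \<delta> * of_bool (rel (10 * ep f) a b)))"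
    and w: "w \<in> e"
  shows "cpl (bind_pmf (sel v f a b i) (\<lambda>z. map_pmf (\<lambda>(l, r). l @ r) (pair_pmf (G v f a (fst z)) (G v f (snd z) b))))
     (bind_pmf (sel v' f a b i) (\<lambda>z. map_pmf (\<lambda>(l, r). l @ r) (pair_pmf (G v' f a (fst z)) (G v' f (snd z) b)))) cost
     (ennreal ((\<delta> * (432 * real K / ep f + 1) + \<beta> f * \<delta> *
        (1 + of_bool (\<bar>dist v a w - radius (dist v a b) N i\<bar> \<le> 10 * ep (Suc f) * dist v a b)))
        * of_bool (rel (10 * ep (Suc f)) a b)))"
proof -
  define R where "R = rel (10 * ep f)"
  define \<gamma> where "\<gamma> = 10 * ep (Suc f)"
  have e0: "0 < ep f" "0 < \<gamma>" using ep(1) by (auto simp: \<gamma>_def)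
  have ef\<gamma>: "ep f \<le> \<gamma>" using ep(3)[of f] ep(1)[of "Suc f"] by (simp add: \<gamma>_def)
  have D: "0 < dist v a b" "dist v a b \<le> dist v' a b" using dist_pos[OF m ab] dist_step[OF ab(1)] by auto
  have valid0: "dist v a b * (3/4) ^ Suc f < m" using valid_lower[OF ab(1) valid] .
  let ?A = "\<lambda>z. map_pmf (\<lambda>(l, r). l @ r) (pair_pmf (G v f a (fst z)) (G v f (snd z) b))"
  let ?B = "\<lambda>z. map_pmf (\<lambda>(l, r). l @ r) (pair_pmf (G v' f a (fst z)) (G v' f (snd z) b))"
  let ?c = "\<lambda>z. \<beta> f * \<delta> * (of_bool (R a (fst z)) + of_bool (R (snd z) b)) + \<delta> * of_bool ({fst z, snd z} = e)"
  have sets: "z \<in> {..<n} \<times> {..<n}" "good v (ep f) (radius (dist v a b) N i) a b (fst z) (snd z)"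
    "dist v a (fst z) \<le> 3/4 * dist v a b" "dist v (snd z) b \<le> 3/4 * dist v a b" if "z \<in> set_pmf (sel v f a b i)" for z
    using set_sel[OF m ab i that] by auto
  have sets': "z \<in> {..<n} \<times> {..<n}" "good v' (ep f) (radius (dist v' a b) N i) a b (fst z) (snd z)"
    "dist v' a (fst z) \<le> 3/4 * dist v' a b" "dist v' (snd z) b \<le> 3/4 * dist v' a b" if "z \<in> set_pmf (sel v' f a b i)" for z
    using set_sel[OF m(1) m' ab i that] by auto
  have iU: "i \<in> set_pmf (uniform N)" using i N by (simp add: uniform_eq lessThan_empty_iff)
  have inA: "p \<in> set_pmf (G v (Suc f) a b)" if "z \<in> set_pmf (sel v f a b i)" "p \<in> set_pmf (?A z)" for z p
    using that ab(2) iU by (auto intro!: bexI[of _ i] bexI[of _ z])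
  have inB: "p \<in> set_pmf (G v' (Suc f) a b)" if "z \<in> set_pmf (sel v' f a b i)" "p \<in> set_pmf (?B z)" for z p
    using that ab(2) iU by (auto intro!: bexI[of _ i] bexI[of _ z])
  have "cpl (bind_pmf (sel v f a b i) ?A) (bind_pmf (sel v' f a b i) ?B) cost
     ((\<integral>\<^sup>+ z. ennreal (?c z) \<partial>measure_pmf (sel v f a b i)) + ennreal (4 * dist v' a b) *
        ennreal (\<Sum>z\<in>{..<n} \<times> {..<n}. \<bar>pmf (sel v f a b i) z - pmf (sel v' f a b i) z\<bar>))"
  proof (rule cpl_bind_tv)
    fix z assume z: "z \<in> set_pmf (sel v f a b i)" "z \<in> set_pmf (sel v' f a b i)"
    obtain x y where xy: "z = (x, y)" by (cases z)
    have g: "{x, y} \<in> E" "conn E a x" "conn E y b" using sets(2)[OF z(1)] by (auto simp: good_def[OF m] xy)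
    have va: "dist v' a x * (3/4) ^ f < m" "dist v' y b * (3/4) ^ f < m"
      using valid_child[OF valid] sets'(3,4)[OF z(2)] by (auto simp: xy)
    have cl: "cpl (G v f a x) (G v' f a x) cost (ennreal (\<beta> f * \<delta> * of_bool (R a x)))"
      unfolding R_def using IH[OF g(2) va(1)] .
    have cr: "cpl (G v f y b) (G v' f y b) cost (ennreal (\<beta> f * \<delta> * of_bool (R y b)))"
      unfolding R_def using IH[OF g(3) va(2)] .
    have "cpl (map_pmf (\<lambda>(l, r). l @ r) (pair_pmf (G v f a x) (G v f y b)))
       (map_pmf (\<lambda>(l, r). l @ r) (pair_pmf (G v' f a x) (G v' f y b))) cost
       (ennreal (\<beta> f * \<delta> * of_bool (R a x)) + ennreal (\<beta> f * \<delta> * of_bool (R y b)) + ennreal (\<delta> * of_bool ({x, y} = e)))"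
    proof (rule cpl_pair[OF cl cr])
      fix l r l' r'
      assume *: "l \<in> set_pmf (G v f a x)" "r \<in> set_pmf (G v f y b)" "l' \<in> set_pmf (G v' f a x)" "r' \<in> set_pmf (G v' f y b)"
      have ws: "is_walk E a x l" "is_walk E y b r"
        using gen_walk[OF m g(2) valid_lower[OF g(2) va(1)] *(1)] gen_walk[OF m g(3) valid_lower[OF g(3) va(2)] *(2)] by auto
      have ws': "is_walk E a x l'" "is_walk E y b r'"
        using gen_walk[OF m(1) m' g(2) va(1) *(3)] gen_walk[OF m(1) m' g(3) va(2) *(4)] by auto
      have "\<bar>c {x, y} - c' {x, y}\<bar> \<le> \<delta> * of_bool ({x, y} = e)" using c_off c_e g(1) by auto
      then have "wdist c c' (l @ r) (l' @ r') \<le> wdist c c' l l' + wdist c c' r r' + \<delta> * of_bool ({x, y} = e)"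
        using wdist_append[OF ws(1) ws'(1) g(1) ws(2) ws'(2), of c c'] by linarith
      then show "cost (l @ r) (l' @ r') \<le> cost l l' + cost r r' + ennreal (\<delta> * of_bool ({x, y} = e))"
        using \<delta> by (simp add: d_w_nonneg ennreal_leI flip: ennreal_plus)
    qed
    then show "cpl (?A z) (?B z) cost (ennreal (?c z))"
      using \<delta> \<beta>_nonneg[of f] by (simp add: xy distrib_left flip: ennreal_plus)
  next
    fix z z' p q
    assume *: "z \<in> set_pmf (sel v f a b i)" "z' \<in> set_pmf (sel v' f a b i)" "p \<in> set_pmf (?A z)" "q \<in> set_pmf (?B z')"
    have p: "is_walk E a b p" "wlen v p \<le> (\<Prod>i<Suc f. 1 + ep i) * dist v a b"
      using gen_walk[OF m ab(1) valid0 inA[OF *(1,3)]] by auto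
    have q: "is_walk E a b q" "wlen v' q \<le> (\<Prod>i<Suc f. 1 + ep i) * dist v' a b"
      using gen_walk[OF m(1) m' ab(1) valid inB[OF *(2,4)]] by auto
    \<comment> \<open>Each walk is at most twice as long as its distance, so both together are at
      most \<open>4 * dist v' a b\<close>.\<close>
    have "(\<Prod>i<Suc f. 1 + ep i) * d \<le> 2 * d" if "0 < d" for d using P2 that by (intro mult_right_mono) auto
    from this[of "dist v a b"] this[of "dist v' a b"] show "cost p q \<le> ennreal (4 * dist v' a b)"
      using cost_le[OF p(1) q(1)] p(2) q(2) D by (intro ennreal_leI) linarith
  qed (use sets(1) sets'(1) in auto)
  moreover have "(\<integral>\<^sup>+ z. ennreal (?c z) \<partial>measure_pmf (sel v f a b i)) + ennreal (4 * dist v' a b) *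
        ennreal (\<Sum>z\<in>{..<n} \<times> {..<n}. \<bar>pmf (sel v f a b i) z - pmf (sel v' f a b i) z\<bar>) \<le>
     ennreal ((\<delta> * (432 * real K / ep f + 1) + \<beta> f * \<delta> *
        (1 + of_bool (\<bar>dist v a w - radius (dist v a b) N i\<bar> \<le> \<gamma> * dist v a b))) * of_bool (rel \<gamma> a b))"
    (is "_ + _ * ennreal ?T \<le> ennreal (?Q * _)")
  proof (cases "rel \<gamma> a b")
    case True
    have Q1: "(\<integral>\<^sup>+ z. ennreal (?c z) \<partial>measure_pmf (sel v f a b i)) \<le>
      (\<integral>\<^sup>+ z. ennreal (\<delta> + \<beta> f * \<delta> * (1 + of_bool (\<bar>dist v a w - radius (dist v a b) N i\<bar> \<le> \<gamma> * dist v a b))) \<partial>measure_pmf (sel v f a b i))"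
    proof (intro nn_integral_mono_AE, unfold AE_measure_pmf_iff, intro ballI ennreal_leI)
      fix z assume z: "z \<in> set_pmf (sel v f a b i)"
      have "\<bar>dist v a w - radius (dist v a b) N i\<bar> \<le> \<gamma> * dist v a b" if "R a (fst z)" "R (snd z) b"
        using rel_both_radius[OF ab(1) sets(2)[OF z] _ that[unfolded R_def] sets(3,4)[OF z] ep_step w] ep(1)[of f]
        by (simp add: \<gamma>_def)
      then have "of_bool (R a (fst z)) + of_bool (R (snd z) b) \<le>
          (1 + of_bool (\<bar>dist v a w - radius (dist v a b) N i\<bar> \<le> \<gamma> * dist v a b) :: real)" by auto
      then have "\<beta> f * \<delta> * (of_bool (R a (fst z)) + of_bool (R (snd z) b)) \<le>
          \<beta> f * \<delta> * (1 + of_bool (\<bar>dist v a w - radius (dist v a b) N i\<bar> \<le> \<gamma> * dist v a b))"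
        using \<beta>_nonneg \<delta> by (intro mult_left_mono) auto
      then show "?c z \<le> \<delta> + \<beta> f * \<delta> * (1 + of_bool (\<bar>dist v a w - radius (dist v a b) N i\<bar> \<le> \<gamma> * dist v a b))"
        using \<delta> by (auto simp: of_bool_def)
    qed
    have "4 * dist v' a b * ?T \<le> 4 * dist v' a b * (108 * real K * \<delta> / (ep f * dist v' a b))"
      using sel_tv[OF ab i, of f] D by (intro mult_left_mono) auto
    also have "\<dots> = 432 * real K * \<delta> / ep f" using D by simp
    finally have Q2: "ennreal (4 * dist v' a b) * ennreal ?T \<le> ennreal (432 * real K * \<delta> / ep f)"
      using D by (simp add: ennreal_leI sum_nonneg flip: ennreal_mult)
    have nn1: "0 \<le> \<delta> + \<beta> f * \<delta> * (1 + of_bool (\<bar>dist v a w - radius (dist v a b) N i\<bar> \<le> \<gamma> * dist v a b))"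
      "0 \<le> 432 * real K * \<delta> / ep f"
      using \<delta> \<beta>_nonneg[of f] e0 by auto
    show ?thesis using True order_trans[OF add_mono[OF Q1 Q2]] nn1
      by (simp add: algebra_simps flip: ennreal_plus)
  next
    case False
    have "sel v' f a b i = sel v f a b i"
      using gain_eq_of_not_rel[OF ab False e0(1) ef\<gamma>] by simp
    moreover have "(\<integral>\<^sup>+ z. ennreal (?c z) \<partial>measure_pmf (sel v f a b i)) = (\<integral>\<^sup>+ z. 0 \<partial>measure_pmf (sel v f a b i))"
    proof (intro nn_integral_cong_AE, unfold AE_measure_pmf_iff, intro ballI)
      fix z assume z: "z \<in> set_pmf (sel v f a b i)"
      have k: "ep f * dist v a b + 10 * ep f * d \<le> \<gamma> * dist v a b" if "d \<le> 3/4 * dist v a b" for d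
      proof -
        have "10 * ep f * d \<le> 10 * ep f * (3/4 * dist v a b)" using that e0 by (intro mult_left_mono) auto
        moreover have "(ep f + 3/4 * (10 * ep f)) * dist v a b \<le> \<gamma> * dist v a b"
          unfolding \<gamma>_def using ep_step D by (intro mult_right_mono) auto
        ultimately show ?thesis by (simp add: algebra_simps)
      qed
      have "\<not> R a (fst z)"
        using rel_extend_right[OF ab(1) sets(2)[OF z] _ k[OF sets(3)[OF z]]] False by (auto simp: R_def)
      moreover have "\<not> R (snd z) b"
        using rel_extend_left[OF ab(1) sets(2)[OF z] _ k[OF sets(4)[OF z]]] False by (auto simp: R_def)
      moreover have "{fst z, snd z} \<noteq> e"
        using rel_self[OF ab(1) sets(2)[OF z], of \<gamma>] False ef\<gamma> D by auto
      ultimately show "ennreal (?c z) = 0" by simp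
    qed
    ultimately show ?thesis using False by simp
  qed
  ultimately show ?thesis unfolding \<gamma>_def using cpl_mono by blast
qed

text \<open>Averaging over the radius turns the window indicator into
  \<open>60 * ep (Suc f) + 1 / N\<close>. The fuel invariant is assumed for the larger weighting
  \<open>v'\<close> and passes to \<open>v\<close>.\<close>

lemma gen_cpl:
  assumes "conn E a b" "dist v' a b * (3/4) ^ f < m" "(\<Prod>i<f. 1 + ep i) \<le> 2"
  shows "cpl (G v f a b) (G v' f a b) cost (ennreal (\<beta> f * \<delta> * of_bool (rel (10 * ep f) a b)))"
  using assms
proof (induction f arbitrary: a b)
  case 0
  have "cpl (return_pmf [a]) (return_pmf [a]) cost 0"
    by (rule cpl_bounded) (simp add: d_w_def l1_dist_def)
  then show ?case by simp
next
  case (Suc f)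
  show ?case
  proof (cases "a = b")
    case True
    have "cpl (return_pmf [a]) (return_pmf [a]) cost 0"
      by (rule cpl_bounded) (simp add: d_w_def l1_dist_def)
    then show ?thesis using True cpl_mono by fastforce
  next
    case False
    have D: "0 < dist v a b" using dist_pos[OF m Suc.prems(1) False] .
    obtain w where w: "w \<in> e" using edge_ex[OF e] by blast
    define W where "W = {i. i < N \<and> \<bar>dist v a w - radius (dist v a b) N i\<bar> \<le> 10 * ep (Suc f) * dist v a b}"
    define R where "R = (of_bool (rel (10 * ep (Suc f)) a b) :: real)"
    have "(\<Prod>i<f. 1 + ep i) \<le> (\<Prod>i<Suc f. 1 + ep i)"
    proof -
      have "1 \<le> (\<Prod>i<f. 1 + ep i)" using ep(1) by (intro prod_ge_1) (simp add: less_imp_le)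
      then show ?thesis using ep(1)[of f] by (simp add: mult_le_cancel_left1)
    qed
    then have IH: "\<And>a b. conn E a b \<Longrightarrow> dist v' a b * (3/4) ^ f < m \<Longrightarrow>
       cpl (G v f a b) (G v' f a b) cost (ennreal (\<beta> f * \<delta> * of_bool (rel (10 * ep f) a b)))"
      using Suc.IH Suc.prems(3) by auto
    define q where "q i = \<delta> * (432 * real K / ep f + 1) + \<beta> f * \<delta> * (1 + of_bool (i \<in> W))" for i
    have q0: "0 \<le> q i" for i unfolding q_def using \<delta> \<beta>_nonneg[of f] ep(1)[of f] by auto
    have A: "cpl (bind_pmf (uniform N) (\<lambda>i. bind_pmf (sel v f a b i) (\<lambda>z. map_pmf (\<lambda>(l, r). l @ r) (pair_pmf (G v f a (fst z)) (G v f (snd z) b)))))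
      (bind_pmf (uniform N) (\<lambda>i. bind_pmf (sel v' f a b i) (\<lambda>z. map_pmf (\<lambda>(l, r). l @ r) (pair_pmf (G v' f a (fst z)) (G v' f (snd z) b))))) cost
      (\<integral>\<^sup>+ i. ennreal (q i * R) \<partial>measure_pmf (uniform N))"
    proof (rule cpl_bind)
      fix i assume "i \<in> set_pmf (uniform N)"
      then have i: "i < N" using N by (simp add: uniform_eq lessThan_empty_iff)
      from node_cpl[OF Suc.prems(1) False i Suc.prems(2,3) IH w] i
      show "cpl (bind_pmf (sel v f a b i) (\<lambda>z. map_pmf (\<lambda>(l, r). l @ r) (pair_pmf (G v f a (fst z)) (G v f (snd z) b))))
        (bind_pmf (sel v' f a b i) (\<lambda>z. map_pmf (\<lambda>(l, r). l @ r) (pair_pmf (G v' f a (fst z)) (G v' f (snd z) b)))) cost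
        (ennreal (q i * R))" by (simp add: q_def R_def W_def)
    qed
    have B: "(\<integral>\<^sup>+ i. ennreal (q i * R) \<partial>measure_pmf (uniform N)) \<le> ennreal (\<beta> (Suc f) * \<delta> * R)"
    proof -
      have "(\<integral>\<^sup>+ i. ennreal (q i * R) \<partial>measure_pmf (uniform N)) = (\<Sum>i<N. ennreal (q i * R)) / real N"
        using N unfolding uniform_eq[OF N]
        by (subst nn_integral_pmf_of_set) (auto simp: lessThan_empty_iff ennreal_of_nat_eq_real_of_nat)
      also have "\<dots> = ennreal ((\<Sum>i<N. q i * R) / real N)"
        using q0 N by (simp add: R_def sum_nonneg divide_ennreal)
      also have "(\<Sum>i<N. q i * R) / real N \<le> \<beta> (Suc f) * \<delta> * R"
      proof -
        have "(\<Sum>i<N. q i) = real N * (\<delta> * (432 * real K / ep f + 1) + \<beta> f * \<delta>) + \<beta> f * \<delta> * (\<Sum>i<N. of_bool (i \<in> W))"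
          by (simp add: q_def sum.distrib sum_distrib_left distrib_left)
        also have "(\<Sum>i<N. of_bool (i \<in> W)) = real (card W)"
        proof -
          have "{..<N} \<inter> {i. i \<in> W} = W" by (auto simp: W_def)
          then show ?thesis by (simp add: of_bool_def sum.If_cases)
        qed
        also have "\<beta> f * \<delta> * real (card W) \<le> \<beta> f * \<delta> * (6 * real N * (10 * ep (Suc f)) + 1)"
          unfolding W_def using \<delta> \<beta>_nonneg D ep(1)[of "Suc f"] by (intro mult_left_mono card_window) auto
        also have "real N * (\<delta> * (432 * real K / ep f + 1) + \<beta> f * \<delta>) + \<beta> f * \<delta> * (6 * real N * (10 * ep (Suc f)) + 1) =
            real N * (\<beta> (Suc f) * \<delta>)" using N by (simp add: algebra_simps)
        finally have "(\<Sum>i<N. q i) \<le> real N * (\<beta> (Suc f) * \<delta>)" by simp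
        then have "(\<Sum>i<N. q i) / real N \<le> \<beta> (Suc f) * \<delta>"
          using N by (subst pos_divide_le_eq) (simp_all add: mult.commute del: \<beta>.simps)
        then have "(\<Sum>i<N. q i) / real N * R \<le> \<beta> (Suc f) * \<delta> * R" by (rule mult_right_mono) (simp add: R_def)
        then show ?thesis by (simp add: sum_distrib_right)
      qed
      finally show ?thesis by (simp add: ennreal_leI)
    qed
    show ?thesis using cpl_mono[OF A B] False by (simp add: R_def del: \<beta>.simps)
  qed
qed

end

section \<open>Choice of the parameters\<close>

text \<open>The binary logarithm rounded up, but at least \<open>1\<close> so that it may occur in a
  denominator.\<close>

definition lg :: "nat \<Rightarrow> nat" where
  "lg n = (LEAST L. 1 \<le> L \<and> n \<le> 2 ^ L)"

lemma lg: "1 \<le> lg n" "n \<le> 2 ^ lg n"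
proof -
  have "1 \<le> Suc n \<and> n \<le> 2 ^ Suc n" using less_exp[of "Suc n"] by linarith
  from LeastI[of "\<lambda>L. 1 \<le> L \<and> n \<le> 2 ^ L", OF this] show "1 \<le> lg n" "n \<le> 2 ^ lg n" by (auto simp: lg_def)
qed

lemma lg_eqI:
  assumes "1 \<le> L" "n \<le> 2 ^ L" "L = 1 \<or> 2 ^ (L - 1) < n" shows "lg n = L"
  unfolding lg_def
proof (rule Least_equality)
  fix M assume M: "1 \<le> M \<and> n \<le> 2 ^ M"
  show "L \<le> M"
  proof (rule ccontr)
    assume "\<not> L \<le> M"
    then have "M \<le> L - 1" "L \<noteq> 1" using M by auto
    then have "(2::nat) ^ M \<le> 2 ^ (L - 1)" by (intro power_increasing) auto
    then show False using M assms(3) \<open>L \<noteq> 1\<close> by linarith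
  qed
qed (use assms in auto)

lemma two_power_lg_le: "1 \<le> n \<Longrightarrow> 2 ^ lg n \<le> 2 * n"
proof -
  assume n: "1 \<le> n"
  show ?thesis
  proof (cases "lg n = 1")
    case False
    then have l: "1 \<le> lg n - 1" "lg n - 1 < lg n" using lg(1)[of n] by auto
    have "\<not> (1 \<le> lg n - 1 \<and> n \<le> 2 ^ (lg n - 1))"
      using not_less_Least[of "lg n - 1" "\<lambda>L. 1 \<le> L \<and> n \<le> 2 ^ L"] l(2) by (simp add: lg_def)
    then have "2 ^ (lg n - 1) < n" using l by simp
    then show ?thesis using l by (cases "lg n") auto
  qed (use n in auto)
qed

text \<open>From \<open>2 ^ lg n \<le> 2 * n \<le> n * n\<close> and
  \<open>2/3 \<le> ln 2\<close>.\<close>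

lemma lg_le_ln: "2 \<le> n \<Longrightarrow> real (lg n) \<le> 3 * ln (real n)"
proof -
  assume n: "2 \<le> n"
  have "2 ^ lg n \<le> n * n" using two_power_lg_le[of n] n by (meson le_trans mult_le_mono1 one_le_numeral order_trans)
  then have "(2::real) ^ lg n \<le> real n * real n" by (metis of_nat_le_iff of_nat_mult of_nat_numeral of_nat_power)
  then have "ln ((2::real) ^ lg n) \<le> ln (real n * real n)" using n by (subst ln_le_cancel_iff) auto
  then have "real (lg n) * ln 2 \<le> 2 * ln (real n)" using n by (simp add: ln_realpow ln_mult)
  moreover have "real (lg n) * (2/3) \<le> real (lg n) * ln 2" using ln2_ge_two_thirds by (intro mult_left_mono) auto
  ultimately show ?thesis by linarith
qed

text \<open>
  If the optimum is \<open>0\<close>, edges of positive weight become so heavy that no approximately shortest walk uses them.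
\<close>

definition smoothed :: "nat \<Rightarrow> nat set set \<Rightarrow> nat \<Rightarrow> nat \<Rightarrow> real \<Rightarrow> weight \<Rightarrow> weight" where
  "smoothed n E s t \<epsilon> w e =
     (if e \<notin> E then 0
      else if 0 < min_path_length E s t w then w e + \<epsilon> * min_path_length E s t w / (4 * real n * real n)
      else if 0 < w e then 4 * real n else 1)"

text \<open>Here \<open>f\<close> is the number of levels below the node, so the slack grows only in the last \<open>J1\<close> levels.\<close>

definition slack :: "real \<Rightarrow> nat \<Rightarrow> nat \<Rightarrow> nat \<Rightarrow> real" where
  "slack \<epsilon> J1 n f = \<epsilon> / (100 * real (36 * lg n)) * (7/6) ^ (J1 - f)"

text \<open>\<open>K = 2 * lg n + 1\<close> makes \<open>2 ^ (K - 1)\<close> at least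
  \<open>n * n\<close>. There are as many radii as levels, so the factors \<open>1 + 1 / N\<close>
  multiply to at most \<open>exp 1\<close>. After \<open>36 * lg n\<close> levels distances have
  dropped by more than \<open>n * n\<close>, and \<open>J1\<close> further levels gain the factor
  \<open>\<epsilon>\<close>.\<close>

definition sp_spec :: "nat \<Rightarrow> real \<Rightarrow> nat \<Rightarrow> nat set set \<Rightarrow> nat \<Rightarrow> nat \<Rightarrow> weight \<Rightarrow> nat list pmf" where
  "sp_spec J1 \<epsilon> n E s t w = gen E n (smoothed n E s t \<epsilon> w) (2 * lg n + 1) (36 * lg n + J1) (slack \<epsilon> J1 n) (36 * lg n + J1) s t"

text \<open>Three levels more than halve a distance, as \<open>(3/4) ^ 3 < 1/2\<close>. Of the
  \<open>12 * lg n\<close> halvings, \<open>2 * lg n\<close> pay for \<open>n * n\<close> and at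
  least ten give the \<open>1024\<close>.\<close>

lemma power_lg_small: "(3/4 :: real) ^ (36 * lg n) * (real n * real n) * 1024 \<le> 1"
proof -
  have "(3/4 :: real) ^ (36 * lg n) = ((3/4) ^ 3) ^ (12 * lg n)" by (simp flip: power_mult)
  also have "\<dots> \<le> (1/2) ^ (12 * lg n)" by (intro power_mono) (auto simp: power3_eq_cube)
  also have "\<dots> = (1/2) ^ lg n * (1/2) ^ lg n * (1/2) ^ (10 * lg n)" by (simp flip: power_add)
  also have "(1/2 :: real) ^ (10 * lg n) \<le> (1/2) ^ 10" using lg(1)[of n] by (intro power_decreasing) auto
  also have "(1/2 :: real) ^ 10 = 1/1024" by (simp add: power_divide)
  finally have 1: "(3/4 :: real) ^ (36 * lg n) \<le> (1/2) ^ lg n * (1/2) ^ lg n * (1/1024)" by simp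
  have n: "real n * (1/2) ^ lg n \<le> 1"
  proof -
    have "real n \<le> 2 ^ lg n" using lg(2)[of n] by (metis of_nat_le_iff of_nat_numeral of_nat_power)
    then show ?thesis by (simp add: power_divide field_simps)
  qed
  have "(3/4 :: real) ^ (36 * lg n) * (real n * real n) * 1024 \<le> (1/2) ^ lg n * (1/2) ^ lg n * (1/1024) * (real n * real n) * 1024"
    using 1 by (intro mult_right_mono) auto
  also have "\<dots> = (real n * (1/2) ^ lg n) * (real n * (1/2) ^ lg n)" by simp
  also have "\<dots> \<le> 1 * 1" using n by (intro mult_mono) auto
  finally show ?thesis by simp
qed

lemma geometric_sum_le:
  fixes q :: real assumes "0 \<le> q" "q < 1" shows "(\<Sum>i<k. q ^ i) \<le> 1 / (1 - q)"
  using assms by (simp add: sum_gp_strict divide_right_mono)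

lemma growing_sum_le: "(\<Sum>f<J1. (7/6 :: real) ^ (J1 - f)) \<le> 7 * (7/6) ^ J1"
proof -
  have "(\<Sum>f<J1. (7/6 :: real) ^ (J1 - f)) = (\<Sum>f<J1. (7/6) ^ J1 * (6/7) ^ f)"
    by (intro sum.cong refl) (simp add: power_diff power_divide field_simps)
  also have "\<dots> = (7/6) ^ J1 * (\<Sum>f<J1. (6/7) ^ f)" by (simp add: sum_distrib_left)
  also have "\<dots> \<le> (7/6) ^ J1 * 7" using geometric_sum_le[of "6/7" J1] by (intro mult_left_mono) auto
  finally show ?thesis by simp
qed

lemma shrinking_sum_le: "(\<Sum>f<J1. (6/7 :: real) ^ (J1 - f)) \<le> 7"
proof -
  have "(\<Sum>f<J1. (6/7 :: real) ^ (J1 - f)) \<le> (\<Sum>f<J1. (6/7) ^ (J1 - Suc f))"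
    by (intro sum_mono power_decreasing) auto
  also have "\<dots> = (\<Sum>f<J1. (6/7) ^ f)" by (rule sum.nat_diff_reindex)
  also have "\<dots> \<le> 7" using geometric_sum_le[of "6/7" J1] by simp
  finally show ?thesis .
qed

text \<open>\<open>J1\<close> is about the logarithm of \<open>1 / \<epsilon>\<close> to base
  \<open>4/3\<close>. It does not depend on the graph, so it can enter the program as a
  constant.\<close>

locale instance_params = graph +
  fixes s t J1 :: nat and \<epsilon> :: real
  assumes st: "s < n" "t < n" "conn E s t"
    and eps: "0 < \<epsilon>" "\<epsilon> < 1" and J1: "(3/4) ^ J1 \<le> \<epsilon>" "\<epsilon> \<le> 4/3 * (3/4) ^ J1"
begin

definition "J0 = 36 * lg n"
definition "J = J0 + J1"
abbreviation "sl \<equiv> slack \<epsilon> J1 n"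
definition "base = \<epsilon> / (100 * real J0)"

lemma sl_eq: "sl f = base * (7/6) ^ (J1 - f)"
  by (simp add: slack_def base_def J0_def)

lemma J0_ge: "36 \<le> real J0"
  using lg(1)[of n] by (simp add: J0_def)

lemma base_pos: "0 < base" and base_J0: "base * real J0 = \<epsilon> / 100" and base_le: "base \<le> \<epsilon> / 3600"
  using eps J0_ge by (auto simp: base_def field_simps)

lemma n_pos: "1 \<le> real n"
  using st by linarith

text \<open>\<open>(7/6) ^ J1 \<le> (4/3) ^ J1 \<le> 4 / (3 * \<epsilon>)\<close> by the upper bound
  on \<open>\<epsilon>\<close>, and \<open>base\<close> carries a factor \<open>\<epsilon>\<close>
  to compensate.\<close>

lemma base_growth: "base * (7/6) ^ J1 \<le> 1/2700"
proof -
  have "(7/6 :: real) ^ J1 \<le> (4/3) ^ J1" by (intro power_mono) auto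
  then have "base * (7/6) ^ J1 \<le> (\<epsilon> / 3600) * (4/3) ^ J1"
    using base_le base_pos eps by (intro mult_mono) auto
  also have "\<dots> \<le> (4/3 * (3/4) ^ J1 / 3600) * (4/3) ^ J1"
    using J1(2) by (intro mult_right_mono divide_right_mono) auto
  also have "\<dots> = 1/2700 * ((3/4) ^ J1 * (4/3) ^ J1)" by simp
  also have "\<dots> = 1/2700" by (simp flip: power_mult_distrib)
  finally show ?thesis .
qed

sublocale walk_gen n E "2 * lg n + 1" J sl
proof
  have "n * n \<le> 2 ^ lg n * 2 ^ lg n" using lg(2) by (intro mult_mono) auto
  then show "n * n \<le> 2 ^ (2 * lg n + 1 - 1)" by (simp add: mult_2 power_add)
  show "0 < J" using lg(1)[of n] by (simp add: J_def J0_def)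
  show "0 < sl f" for f using base_pos by (simp add: sl_eq)
  show "sl f \<le> 1/12" for f
  proof -
    have "base * (7/6) ^ (J1 - f) \<le> base * (7/6) ^ J1"
      using base_pos by (intro mult_left_mono power_increasing) auto
    then show ?thesis using base_growth by (simp add: sl_eq)
  qed
  show "sl f \<le> 7/6 * sl (Suc f)" for f
  proof -
    have "(7/6 :: real) ^ (J1 - f) \<le> (7/6) ^ Suc (J1 - Suc f)" by (intro power_increasing) auto
    then have "base * (7/6) ^ (J1 - f) \<le> base * (7/6) ^ Suc (J1 - Suc f)"
      using base_pos by (intro mult_left_mono) auto
    then show ?thesis by (simp add: sl_eq)
  qed
qed simp

text \<open>The growing slacks form a geometric sum of at most \<open>7 / 2700\<close>, the constant
  ones add up to \<open>\<epsilon> / 100\<close>.\<close>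

lemma sl_sum: "(\<Sum>f<J. sl f) \<le> 1/50"
proof -
  have "(\<Sum>f<J. sl f) = (\<Sum>f<J1. sl f) + (\<Sum>f\<in>{J1..<J}. sl f)"
    by (subst sum.atLeastLessThan_concat[of 0 J1 J, symmetric, unfolded atLeast0LessThan]) (auto simp: J_def)
  also have "(\<Sum>f<J1. sl f) = base * (\<Sum>f<J1. (7/6) ^ (J1 - f))" by (simp add: sl_eq sum_distrib_left)
  also have "\<dots> \<le> base * (7 * (7/6) ^ J1)" using base_pos growing_sum_le by (intro mult_left_mono) auto
  also have "(\<Sum>f\<in>{J1..<J}. sl f) = (\<Sum>f\<in>{J1..<J}. base)" by (intro sum.cong) (auto simp: sl_eq)
  also have "\<dots> = base * real J0" by (simp add: J_def)
  finally show ?thesis using base_growth base_J0 eps by simp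
qed

lemma prod_sl: "(\<Prod>i<J. 1 + sl i) \<le> 2"
proof -
  have "(\<Prod>i<J. 1 + sl i) \<le> (\<Prod>i<J. exp (sl i))"
    using ep(1) by (intro prod_mono) (auto simp: less_imp_le add_nonneg_pos)
  also have "\<dots> = exp (\<Sum>i<J. sl i)" by (simp add: exp_sum)
  also have "\<dots> \<le> exp (1/50)" using sl_sum by simp
  also have "\<dots> \<le> 2"
  proof -
    have "exp (1/50 :: real) \<le> 1 + 2 * \<bar>1/50\<bar>" using exp_bound_lemma[of "1/50 :: real"] by simp
    then show ?thesis by simp
  qed
  finally show ?thesis .
qed

text \<open>Counted from the root, the first \<open>J0\<close> levels have slack \<open>base\<close>
  and contribute at most \<open>\<epsilon> / 100\<close>. Beyond them the slack grows by
  \<open>7/6\<close> per level while the segments shrink by \<open>3/4\<close>: a geometric series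
  with ratio \<open>7/8\<close>.\<close>

lemma excess_sum: "(\<Sum>i<J. sl (J - Suc i) * min 1 (real n * (3/4) ^ i)) \<le> \<epsilon> / 50"
proof -
  let ?h = "\<lambda>i. sl (J - Suc i) * min 1 (real n * (3/4) ^ i)"
  have "(\<Sum>i<J. ?h i) = (\<Sum>i<J0. ?h i) + (\<Sum>i\<in>{J0..<J}. ?h i)"
    by (subst sum.atLeastLessThan_concat[of 0 J0 J, symmetric, unfolded atLeast0LessThan]) (auto simp: J_def)
  also have "(\<Sum>i<J0. ?h i) \<le> (\<Sum>i<J0. base)"
  proof (rule sum_mono)
    fix i assume "i \<in> {..<J0}"
    then have "J1 - (J - Suc i) = 0" by (simp add: J_def)
    then show "?h i \<le> base" using base_pos by (simp add: sl_eq mult_left_le)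
  qed
  also have "(\<Sum>i<J0. base) = \<epsilon> / 100" using base_J0 by (simp add: mult.commute)
  also have "(\<Sum>i\<in>{J0..<J}. ?h i) = (\<Sum>k<J1. ?h (J0 + k))"
    using sum.shift_bounds_nat_ivl[of ?h 0 J0 J1] by (simp add: J_def atLeast0LessThan add.commute)
  also have "\<dots> \<le> (\<Sum>k<J1. base * (7/6) * (7/8) ^ k)"
  proof (rule sum_mono)
    fix k assume "k \<in> {..<J1}"
    then have k: "J1 - (J - Suc (J0 + k)) = Suc k" by (simp add: J_def)
    have n1: "real n * (3/4) ^ J0 \<le> 1"
    proof -
      have "real n * (3/4) ^ J0 * 1 \<le> real n * (3/4) ^ J0 * real n" using n_pos by (intro mult_left_mono) auto
      also have "\<dots> \<le> 1"
        using power_lg_small[of n] mult_nonneg_nonneg[of "(3/4) ^ J0" "real n * real n"] by (simp add: J0_def mult_ac)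
      finally show ?thesis by simp
    qed
    have "?h (J0 + k) \<le> sl (J - Suc (J0 + k)) * (real n * (3/4) ^ (J0 + k))"
      using ep(1) by (intro mult_left_mono) (auto simp: less_imp_le)
    also have "\<dots> = base * (7/6) ^ Suc k * ((real n * (3/4) ^ J0) * (3/4) ^ k)"
      unfolding sl_eq k by (simp add: power_add mult.assoc)
    also have "\<dots> \<le> base * (7/6) ^ Suc k * (1 * (3/4) ^ k)"
      using n1 base_pos by (intro mult_left_mono mult_right_mono) auto
    also have "\<dots> = base * (7/6) * ((7/6) ^ k * (3/4) ^ k)" by simp
    also have "(7/6 :: real) ^ k * (3/4) ^ k = (7/8) ^ k" by (simp flip: power_mult_distrib)
    finally show "?h (J0 + k) \<le> base * (7/6) * (7/8) ^ k" .
  qed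
  also have "\<dots> = base * (7/6) * (\<Sum>k<J1. (7/8) ^ k)" by (simp add: sum_distrib_left)
  also have "\<dots> \<le> base * (7/6) * 8" using geometric_sum_le[of "7/8" J1] base_pos by (intro mult_left_mono) auto
  finally show ?thesis using base_le eps by simp
qed

text \<open>The factors of the recursion multiply to at most \<open>exp (60 / 50 + 1)\<close>, which
  is below \<open>27\<close>. In the remaining sum of \<open>1 / sl f\<close> the deep levels form a
  geometric series, so the \<open>J0\<close> shallow terms dominate: the total is at most
  \<open>2 * J0 / base\<close>, and \<open>259200 = 200 * 36 * 36\<close>.\<close>

lemma beta_le: "\<beta> J \<le> 27 * 433 * 3 * 259200 * real (lg n) ^ 3 / \<epsilon>"
proof -
  let ?K = "real (2 * lg n + 1)"
  have A: "432 * ?K / sl f + 1 \<le> 433 * ?K / sl f" for f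
  proof -
    have "sl f \<le> ?K" using ep(2)[of f] by simp
    then have "1 \<le> ?K / sl f" using ep(1)[of f] by simp
    then show ?thesis by (simp add: add_divide_distrib)
  qed
  have B: "\<beta> k \<le> (\<Prod>f<k. 1 + 60 * sl (Suc f) + 1 / real J) * (\<Sum>f<k. 433 * ?K / sl f)" for k
  proof (induction k)
    case 0
    show ?case unfolding \<beta>.simps(1) by simp
  next
    case (Suc k)
    let ?P = "\<Prod>f<k. 1 + 60 * sl (Suc f) + 1 / real J" and ?S = "\<Sum>f<k. 433 * ?K / sl f"
    let ?g = "1 + 60 * sl (Suc k) + 1 / real J"
    have g: "1 \<le> ?g" using ep(1)[of "Suc k"] by simp
    have P: "1 \<le> ?P" using ep(1) by (intro prod_ge_1) (simp add: less_imp_le add_nonneg_nonneg)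
    have "1 * 1 \<le> ?P * ?g" using P g by (intro mult_mono) auto
    then have Pg: "1 \<le> ?P * ?g" by simp
    have "\<beta> (Suc k) \<le> 433 * ?K / sl k + ?P * ?S * ?g"
      unfolding \<beta>.simps(2) using A[of k] mult_right_mono[OF Suc, of ?g] g by linarith
    also have "433 * ?K / sl k \<le> ?P * ?g * (433 * ?K / sl k)"
      using Pg ep(1)[of k] mult_right_mono[OF Pg, of "433 * ?K / sl k"] by simp
    finally show ?case by (simp add: algebra_simps)
  qed
  have P: "(\<Prod>f<J. 1 + 60 * sl (Suc f) + 1 / real J) \<le> 27"
  proof -
    have "(\<Prod>f<J. 1 + 60 * sl (Suc f) + 1 / real J) \<le> (\<Prod>f<J. exp (60 * sl (Suc f) + 1 / real J))"
    proof (intro prod_mono conjI)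
      fix f
      show "0 \<le> 1 + 60 * sl (Suc f) + 1 / real J" using ep(1)[of "Suc f"] by simp
      show "1 + 60 * sl (Suc f) + 1 / real J \<le> exp (60 * sl (Suc f) + 1 / real J)"
        using exp_ge_add_one_self[of "60 * sl (Suc f) + 1 / real J"] by linarith
    qed
    also have "\<dots> = exp (60 * (\<Sum>f<J. sl (Suc f)) + 1)"
      using N by (simp add: exp_sum[symmetric] sum.distrib sum_distrib_left)
    also have "\<dots> \<le> exp 3"
    proof -
      have "(\<Sum>f<J. sl (Suc f)) \<le> (\<Sum>f<J. sl f)"
        using base_pos by (intro sum_mono) (auto simp: sl_eq intro!: mult_left_mono power_increasing)
      then show ?thesis using sl_sum by simp
    qed
    also have "exp (3::real) = exp 1 * exp 1 * exp 1" by (simp flip: exp_add)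
    also have "\<dots> \<le> 3 * 3 * 3" using exp_le by (intro mult_mono) auto
    finally show ?thesis by simp
  qed
  have S: "(\<Sum>f<J. 1 / sl f) \<le> 259200 * real (lg n) ^ 2 / \<epsilon>"
  proof -
    have inv: "1 / sl f = (6/7) ^ (J1 - f) / base" for f by (simp add: sl_eq power_divide)
    have "(\<Sum>f<J. 1 / sl f) = (\<Sum>f<J1. 1 / sl f) + (\<Sum>f\<in>{J1..<J}. 1 / sl f)"
      by (subst sum.atLeastLessThan_concat[of 0 J1 J, symmetric, unfolded atLeast0LessThan]) (auto simp: J_def)
    also have "(\<Sum>f<J1. 1 / sl f) = (\<Sum>f<J1. (6/7) ^ (J1 - f)) / base" by (simp only: inv sum_divide_distrib)
    also have "\<dots> \<le> 7 / base" using shrinking_sum_le base_pos by (intro divide_right_mono) auto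
    also have "(\<Sum>f\<in>{J1..<J}. 1 / sl f) = (\<Sum>f\<in>{J1..<J}. 1 / base)" by (intro sum.cong) (auto simp: sl_eq)
    also have "\<dots> = real J0 / base" by (simp add: J_def)
    also have "7 / base + real J0 / base \<le> 2 * real J0 / base"
      using J0_ge base_pos by (simp add: add_divide_distrib[symmetric] divide_right_mono)
    also have "\<dots> = 200 * real J0 * real J0 / \<epsilon>" using J0_ge eps by (simp add: base_def field_simps)
    also have "\<dots> = 259200 * real (lg n) ^ 2 / \<epsilon>" by (simp add: J0_def power2_eq_square)
    finally show ?thesis by simp
  qed
  have K3: "?K \<le> 3 * real (lg n)" using lg(1)[of n] by simp
  have "(\<Sum>f<J. 433 * ?K / sl f) = 433 * ?K * (\<Sum>f<J. 1 / sl f)" by (simp add: sum_distrib_left)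
  also have "\<dots> \<le> 433 * (3 * real (lg n)) * (259200 * real (lg n) ^ 2 / \<epsilon>)"
    using S K3 ep(1) by (intro mult_mono mult_nonneg_nonneg sum_nonneg) (auto simp: less_imp_le)
  finally have T: "(\<Sum>f<J. 433 * ?K / sl f) \<le> 433 * (3 * real (lg n)) * (259200 * real (lg n) ^ 2 / \<epsilon>)" .
  have "\<beta> J \<le> 27 * (433 * (3 * real (lg n)) * (259200 * real (lg n) ^ 2 / \<epsilon>))"
    using order_trans[OF B[of J] mult_mono[OF P T]] ep(1) by (simp add: sum_nonneg less_imp_le)
  then show ?thesis by (simp add: power3_eq_cube power2_eq_square)
qed

end

section \<open>Approximation and Lipschitz constant of the sampler\<close>

context instance_params
begin

abbreviation "opt w \<equiv> dist w s t"
abbreviation "sm w \<equiv> smoothed n E s t \<epsilon> w"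

lemma sp_spec_eq: "sp_spec J1 \<epsilon> n E s t w = G (sm w) J s t"
  by (simp add: sp_spec_def J_def J0_def)

lemma weightsD: "w \<in> weights E \<Longrightarrow> \<forall>e\<in>E. 0 \<le> w e" "w \<in> weights E \<Longrightarrow> e \<notin> E \<Longrightarrow> w e = undefined"
  by (auto simp: weights_def PiE_def extensional_def)

lemma sm_pos_eq: "0 < opt w \<Longrightarrow> e \<in> E \<Longrightarrow> sm w e = w e + \<epsilon> * opt w / (4 * real n * real n)"
  by (simp add: smoothed_def)

lemma opt_nonneg: "w \<in> weights E \<Longrightarrow> 0 \<le> opt w"
  using dist_nonneg[OF weightsD(1) st(3)] .

lemma card_E_le: "real (card E) \<le> real n * real n"
  using card_E by (metis of_nat_le_iff of_nat_mult)

lemma l1_sm: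
  assumes w: "w \<in> weights E" "0 < opt w"
  shows "l1_dist E w (sm w) \<le> \<epsilon> * opt w / 4"
proof -
  have nn: "0 \<le> \<epsilon> * opt w / (4 * real n * real n)" using w eps by simp
  have "l1_dist E w (sm w) = (\<Sum>e\<in>E. \<epsilon> * opt w / (4 * real n * real n))"
    unfolding l1_dist_def
  proof (rule sum.cong)
    fix e assume "e \<in> E"
    then show "\<bar>w e - sm w e\<bar> = \<epsilon> * opt w / (4 * real n * real n)"
      unfolding sm_pos_eq[OF w(2) \<open>e \<in> E\<close>] using nn by linarith
  qed simp
  also have "\<dots> = real (card E) * (\<epsilon> * opt w / (4 * real n * real n))" by simp
  also have "\<dots> \<le> (real n * real n) * (\<epsilon> * opt w / (4 * real n * real n))"
    using card_E_le nn by (rule mult_right_mono)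
  also have "\<dots> = \<epsilon> * opt w / 4" using n_pos by simp
  finally show ?thesis .
qed

lemma dist_sm_le:
  assumes w: "w \<in> weights E" "0 < opt w"
  shows "dist (sm w) s t \<le> (1 + \<epsilon> / 4) * opt w"
proof -
  have nn: "\<forall>e\<in>E. 0 \<le> sm w e" using w weightsD(1)[OF w(1)] eps by (auto simp: sm_pos_eq)
  have "dist (sm w) s t \<le> opt w + l1_dist E w (sm w)"
    using dist_l1[OF st(3) weightsD(1)[OF w(1)] nn] by linarith
  then show ?thesis using l1_sm[OF w] by (simp add: algebra_simps)
qed

text \<open>The factor \<open>3/4\<close> leaves room for the comparison of nearby weightings, where
  the other optimum is only known to be at least \<open>3/4\<close> of \<open>x\<close>.\<close>

lemma valid_main:
  assumes "0 < x" "d \<le> 2 * x" shows "d * (3/4) ^ J < 3/4 * (\<epsilon> * x / (4 * real n * real n))"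
proof -
  have "d * (3/4) ^ J \<le> 2 * x * (3/4) ^ J" using assms by (intro mult_right_mono) auto
  also have "\<dots> = 2 * x * ((3/4) ^ J0 * (3/4) ^ J1)" by (simp add: J_def power_add)
  also have "\<dots> \<le> 2 * x * ((3/4) ^ J0 * \<epsilon>)" using J1(1) assms by (intro mult_left_mono) auto
  also have "(3/4) ^ J0 \<le> 1 / (1024 * (real n * real n))"
    using power_lg_small[of n] n_pos by (simp add: J0_def field_simps)
  then have "2 * x * ((3/4) ^ J0 * \<epsilon>) \<le> 2 * x * (1 / (1024 * (real n * real n)) * \<epsilon>)"
    using assms eps by (intro mult_left_mono mult_right_mono) auto
  also have "\<dots> < 3/4 * (\<epsilon> * x / (4 * real n * real n))"
    using assms eps n_pos by (simp add: field_simps)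
  finally show ?thesis .
qed

text \<open>Raising the weights costs a factor \<open>1 + \<epsilon> / 4\<close> in the optimum and
  the recursion a factor \<open>1 + \<epsilon> / 25\<close>; measured with the original weights the
  walk only gets shorter.\<close>

lemma approx_pos:
  assumes w: "w \<in> weights E" "0 < opt w" and p: "p \<in> set_pmf (sp_spec J1 \<epsilon> n E s t w)"
  shows "is_walk E s t p \<and> wlen w p \<le> (1 + \<epsilon>) * opt w"
proof -
  define \<eta> where "\<eta> = \<epsilon> * opt w / (4 * real n * real n)"
  have \<eta>: "0 < \<eta>" using w eps n_pos by (simp add: \<eta>_def)
  have m: "\<forall>e\<in>E. \<eta> \<le> sm w e" using w weightsD(1)[OF w(1)] by (auto simp: sm_pos_eq \<eta>_def)
  have nn: "\<forall>e\<in>E. 0 \<le> sm w e" using m \<eta> by force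
  have d: "dist (sm w) s t \<le> (1 + \<epsilon> / 4) * opt w" using dist_sm_le[OF w] .
  also have "\<dots> \<le> 2 * opt w" using eps w by (intro mult_right_mono) auto
  finally have v: "dist (sm w) s t * (3/4) ^ J < \<eta>"
    using valid_main[OF w(2)] \<eta> by (fastforce simp: \<eta>_def)
  have pw: "is_walk E s t p" using gen_walk[OF \<eta> m st(3) v] p by (simp add: sp_spec_eq)
  have "wlen w p \<le> wlen (sm w) p"
    by (rule walk_length_mono[OF walk_edges_subset[OF pw]]) (use w eps in \<open>auto simp: sm_pos_eq\<close>)
  also have "\<dots> \<le> (1 + 2 * (\<Sum>i<J. sl (J - Suc i) * min 1 (real n * (3/4) ^ i))) * dist (sm w) s t"
    using gen_wlen[OF \<eta> m st(3,1) v _ prod_sl] p by (simp add: sp_spec_eq)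
  also have "\<dots> \<le> (1 + 2 * (\<epsilon> / 50)) * ((1 + \<epsilon> / 4) * opt w)"
    using excess_sum d eps w dist_nonneg[OF nn st(3)] by (intro mult_mono) auto
  also have "\<dots> = ((1 + 2 * (\<epsilon> / 50)) * (1 + \<epsilon> / 4)) * opt w" by simp
  also have "\<dots> \<le> (1 + \<epsilon>) * opt w"
  proof (rule mult_right_mono)
    have "\<epsilon> * \<epsilon> \<le> \<epsilon>" using eps by (simp add: mult_left_le)
    moreover have "(1 + 2 * (\<epsilon> / 50)) * (1 + \<epsilon> / 4) = 1 + \<epsilon> / 25 + \<epsilon> / 4 + \<epsilon> * \<epsilon> / 100" by (simp add: field_simps)
    ultimately show "(1 + 2 * (\<epsilon> / 50)) * (1 + \<epsilon> / 4) \<le> 1 + \<epsilon>" using eps by linarith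
  qed (use w in auto)
  finally show ?thesis using pw by blast
qed

text \<open>A zero-weight path has raised length at most \<open>n\<close>, so the sampled walk stays
  below \<open>4 * n\<close>, the raised weight of any single edge of positive weight.\<close>

lemma approx_zero:
  assumes w: "w \<in> weights E" "opt w = 0" and p: "p \<in> set_pmf (sp_spec J1 \<epsilon> n E s t w)"
  shows "is_walk E s t p \<and> wlen w p = 0"
proof -
  have smv: "sm w e = (if 0 < w e then 4 * real n else 1)" if "e \<in> E" for e using that w by (simp add: smoothed_def)
  have m: "\<forall>e\<in>E. 1 \<le> sm w e" using n_pos by (auto simp: smv)
  have nn: "\<forall>e\<in>E. 0 \<le> sm w e" using m by force
  have z: "\<forall>e\<in>#P. w e = 0" if "set_mset P \<subseteq> E" "walk_length w P \<le> 0" for P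
    using that
  proof (induction P)
    case (add e P)
    have P: "set_mset P \<subseteq> E" "e \<in> E" using add.prems by auto
    have "0 \<le> w e" using weightsD(1)[OF w(1)] P by blast
    moreover have "0 \<le> walk_length w P" using walk_length_nonneg[OF P(1) weightsD(1)[OF w(1)]] .
    moreover have "w e + walk_length w P \<le> 0" using add.prems by simp
    ultimately have "w e = 0" "walk_length w P \<le> 0" by linarith+
    then show ?case using add.IH P(1) by simp
  qed simp
  obtain q where q: "is_path E s t q" "wlen w q = 0" using dist_attained[OF st(3) weightsD(1)[OF w(1)]] w(2) by metis
  then have qw: "is_walk E s t q" by (simp add: is_path_def)
  have "dist (sm w) s t \<le> wlen (sm w) q" using dist_le_wlen[OF qw nn] .
  also have "\<dots> = (\<Sum>e\<in>#walk_edges q. 1)" unfolding walk_length_def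
  proof (rule arg_cong[where f = sum_mset], rule image_mset_cong)
    fix e assume e: "e \<in># walk_edges q"
    then have "e \<in> E" using walk_edges_subset[OF qw] by auto
    moreover have "w e = 0" using z[OF walk_edges_subset[OF qw]] q(2) e by simp
    ultimately show "sm w e = 1" by (simp add: smv)
  qed
  also have "\<dots> \<le> real n" using path_length_le[OF q(1) st(1)] by (simp add: size_walk_edges)
  finally have d: "dist (sm w) s t \<le> real n" .
  have v: "dist (sm w) s t * (3/4) ^ J < 1"
  proof -
    have "(3/4 :: real) ^ J \<le> (3/4) ^ J0" by (intro power_decreasing) (auto simp: J_def)
    then have "dist (sm w) s t * (3/4) ^ J \<le> real n * (3/4) ^ J0" using d by (intro mult_mono) auto
    also have "\<dots> \<le> real n * real n * (3/4) ^ J0" using n_pos by (intro mult_right_mono) auto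
    also have "\<dots> < 1" using power_lg_small[of n] n_pos by (simp add: J0_def mult_ac)
    finally show ?thesis .
  qed
  have pw: "is_walk E s t p" using gen_walk[OF zero_less_one m st(3) v] p by (simp add: sp_spec_eq)
  have "wlen (sm w) p \<le> (1 + 2 * (\<Sum>i<J. sl (J - Suc i) * min 1 (real n * (3/4) ^ i))) * dist (sm w) s t"
    using gen_wlen[OF zero_less_one m st(3,1) v _ prod_sl] p by (simp add: sp_spec_eq)
  also have "\<dots> \<le> (1 + 2 * (\<epsilon> / 50)) * real n"
    using excess_sum d eps dist_nonneg[OF nn st(3)] by (intro mult_mono) auto
  also have "\<dots> < 4 * real n" using eps n_pos by simp
  finally have lt: "wlen (sm w) p < 4 * real n" .
  have "w e = 0" if e: "e \<in># walk_edges p" for e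
  proof (rule ccontr)
    assume "w e \<noteq> 0"
    have eE: "e \<in> E" using walk_edges_subset[OF pw] e by auto
    then have "sm w e = 4 * real n" using \<open>w e \<noteq> 0\<close> weightsD(1)[OF w(1)] by (auto simp: smv)
    moreover obtain P where P: "walk_edges p = add_mset e P" using e by (metis multi_member_split)
    moreover have "0 \<le> walk_length (sm w) P" using walk_edges_subset[OF pw] P by (intro walk_length_nonneg[OF _ nn]) auto
    ultimately show False using lt by simp
  qed
  then have "image_mset w (walk_edges p) = image_mset (\<lambda>_. 0) (walk_edges p)" by (intro image_mset_cong)
  then have "wlen w p = 0" by (simp add: walk_length_def)
  then show ?thesis using pw by blast
qed

lemma spec_approx:
  assumes w: "w \<in> weights E" and p: "p \<in> set_pmf (sp_spec J1 \<epsilon> n E s t w)"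
  shows "is_walk E s t p" "wlen w p \<le> (1 + \<epsilon>) * opt w"
  using approx_pos[OF w _ p] approx_zero[OF w _ p] opt_nonneg[OF w] by force+

text \<open>The factor \<open>3\<close> arises because raised and original weights together change
  by at most three times the l1 distance.\<close>

definition "lip = 3 * (27 * 433 * 3 * 259200 * real (lg n) ^ 3 / \<epsilon>)"

lemma lip_ge: "18 \<le> lip"
proof -
  have "1 \<le> real (lg n) ^ 3" using lg(1)[of n] by simp
  then have "1 \<le> real (lg n) ^ 3 / \<epsilon>" using eps by (simp add: field_simps)
  then show ?thesis by (simp add: lip_def)
qed

text \<open>Any coupling will do: with \<open>\<delta>\<close> the l1 distance, both walks are at
  most twice their optimum and \<open>opt w' \<le> opt w + \<delta>\<close>, which totals
  \<open>4 * opt w + 2 * \<delta> \<le> 18 * \<delta>\<close>. The case \<open>opt w = 0\<close>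
  always falls here.\<close>

lemma spec_lipschitz_far:
  assumes w: "w \<in> weights E" "w' \<in> weights E" and far: "opt w / 4 \<le> l1_dist E w w'"
  shows "cpl (sp_spec J1 \<epsilon> n E s t w) (sp_spec J1 \<epsilon> n E s t w') (\<lambda>p p'. ennreal (wdist w w' p p'))
    (ennreal (lip * l1_dist E w w'))"
proof (rule cpl_bounded, rule ennreal_leI)
  fix p q assume p: "p \<in> set_pmf (sp_spec J1 \<epsilon> n E s t w)" and q: "q \<in> set_pmf (sp_spec J1 \<epsilon> n E s t w')"
  note P = spec_approx[OF w(1) p] and Q = spec_approx[OF w(2) q]
  have 1: "wdist w w' p q \<le> wlen w p + wlen w' q"
    using d_w_le_length[OF walk_edges_subset[OF P(1)] walk_edges_subset[OF Q(1)]] weightsD(1) w by blast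
  have 2: "wlen w p + wlen w' q \<le> 2 * opt w + 2 * opt w'"
  proof -
    have "(1 + \<epsilon>) * x \<le> 2 * x" if "0 \<le> x" for x using eps that by (intro mult_right_mono) auto
    from this[OF opt_nonneg[OF w(1)]] this[OF opt_nonneg[OF w(2)]] show ?thesis using P(2) Q(2) by linarith
  qed
  have 3: "opt w' \<le> opt w + l1_dist E w w'" using dist_l1[OF st(3) weightsD(1)[OF w(1)] weightsD(1)[OF w(2)]] by linarith
  have "wdist w w' p q \<le> 18 * l1_dist E w w'" using 1 2 3 far by linarith
  also have "\<dots> \<le> lip * l1_dist E w w'" using lip_ge by (intro mult_right_mono) (auto simp: l1_dist_def sum_nonneg)
  finally show "wdist w w' p q \<le> lip * l1_dist E w w'" .
qed

text \<open>A hybrid argument: \<open>V F\<close> takes the raised weights of \<open>w'\<close> on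
  \<open>F\<close> and those of \<open>w\<close> elsewhere, so consecutive hybrids differ in one
  edge. The optimum inside the raised weights is evaluated only at the two ends.\<close>

lemma spec_lipschitz_near:
  assumes w: "w \<in> weights E" "w' \<in> weights E" and near: "l1_dist E w w' < opt w / 4"
  shows "cpl (sp_spec J1 \<epsilon> n E s t w) (sp_spec J1 \<epsilon> n E s t w') (\<lambda>p p'. ennreal (wdist w w' p p'))
    (ennreal (lip * l1_dist E w w'))"
proof -
  define \<delta> where "\<delta> = l1_dist E w w'"
  have \<delta>0: "0 \<le> \<delta>" by (simp add: \<delta>_def l1_dist_def sum_nonneg)
  have oo: "\<bar>opt w - opt w'\<bar> \<le> \<delta>" unfolding \<delta>_def using dist_l1[OF st(3) weightsD(1)[OF w(1)] weightsD(1)[OF w(2)]] .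
  have o: "0 < opt w" "3/4 * opt w \<le> opt w'" "0 < opt w'" using near oo \<delta>0 by (auto simp: \<delta>_def)
  define h where "h = \<epsilon> / (4 * real n * real n)"
  have h: "0 < h" using eps n_pos by (simp add: h_def)
  have hn: "h * (real n * real n) = \<epsilon> / 4" using n_pos by (simp add: h_def)
  have sm: "sm w e = w e + h * opt w" "sm w' e = w' e + h * opt w'" if "e \<in> E" for e
    using that o by (simp_all add: sm_pos_eq h_def)
  \<comment> \<open>A lower bound for both raised weightings, hence for all hybrids, since
    \<open>opt w'\<close> is at least \<open>3/4 * opt w\<close>.\<close>
  define m where "m = 3/4 * (h * opt w)"
  have m: "0 < m" using h o by (simp add: m_def)
  have m1: "m \<le> h * opt w" "m \<le> h * opt w'"
  proof -
    show "m \<le> h * opt w" using h o by (simp add: m_def)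
    show "m \<le> h * opt w'" unfolding m_def using mult_left_mono[OF o(2), of h] h by simp
  qed
  define mix where "mix F x x' e = (if e \<in> F then x' e else x e)" for F :: "nat set set" and x x' :: weight and e
  define V where "V F = mix F (sm w) (sm w')" for F
  define C where "C F = mix F w w'" for F
  have Vm: "\<forall>x\<in>E. m \<le> V F x" for F
    using m1 weightsD(1)[OF w(1)] weightsD(1)[OF w(2)] by (fastforce simp: V_def mix_def sm)
  have CV: "\<forall>x\<in>E. 0 \<le> C F x \<and> C F x \<le> V F x" for F
    using weightsD(1)[OF w(1)] weightsD(1)[OF w(2)] h o by (auto simp: V_def C_def mix_def sm)
  define \<delta>e where "\<delta>e e = \<bar>sm w e - sm w' e\<bar> + \<bar>w e - w' e\<bar>" for e
  have \<delta>e: "\<delta>e e \<le> 2 * \<bar>w e - w' e\<bar> + h * \<delta>" if "e \<in> E" for e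
  proof -
    have "\<bar>h * opt w - h * opt w'\<bar> = h * \<bar>opt w - opt w'\<bar>" using h by (simp add: abs_mult flip: right_diff_distrib)
    also have "\<dots> \<le> h * \<delta>" using oo h by (intro mult_left_mono) auto
    finally have "\<bar>h * opt w - h * opt w'\<bar> \<le> h * \<delta>" .
    moreover have "\<bar>w e + h * opt w - (w' e + h * opt w')\<bar> \<le> \<bar>w e - w' e\<bar> + \<bar>h * opt w - h * opt w'\<bar>"
      using abs_triangle_ineq[of "w e - w' e" "h * opt w - h * opt w'"] by (simp add: algebra_simps)
    ultimately have "\<bar>w e + h * opt w - (w' e + h * opt w')\<bar> \<le> \<bar>w e - w' e\<bar> + h * \<delta>" by (rule order_trans[OF _ add_left_mono, rotated])
    then show ?thesis unfolding \<delta>e_def sm[OF that] mult_2 by (rule add_right_mono[of _ _ "\<bar>w e - w' e\<bar>", THEN order_trans]) simp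
  qed
  have card: "real (card E) * (h * \<delta>) \<le> \<epsilon> / 4 * \<delta>"
  proof -
    have "real (card E) * (h * \<delta>) \<le> (real n * real n) * (h * \<delta>)"
      using card_E_le h \<delta>0 by (intro mult_right_mono) auto
    also have "\<dots> = h * (real n * real n) * \<delta>" by simp
    finally show ?thesis unfolding hn .
  qed
  have e4: "\<epsilon> / 4 * \<delta> \<le> 1 * \<delta>" using eps \<delta>0 by (intro mult_right_mono) auto
  \<comment> \<open>Original and raised weights contribute \<open>\<delta>\<close> each. A change of
    the optimum moves every raised weight by up to \<open>h * \<delta>\<close> more, which over at
    most \<open>n * n\<close> edges adds \<open>\<epsilon> / 4 * \<delta>\<close>.\<close>
  have sum\<delta>: "(\<Sum>e\<in>E. \<delta>e e) \<le> 3 * \<delta>"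
  proof -
    have "(\<Sum>e\<in>E. \<delta>e e) \<le> (\<Sum>e\<in>E. 2 * \<bar>w e - w' e\<bar> + h * \<delta>)" by (intro sum_mono \<delta>e)
    also have "\<dots> = 2 * \<delta> + real (card E) * (h * \<delta>)" by (simp add: sum.distrib \<delta>_def l1_dist_def sum_distrib_left)
    finally show ?thesis using card e4 by linarith
  qed
  \<comment> \<open>Every hybrid is within l1 distance \<open>opt w\<close> of \<open>w\<close>, so
    its shortest distance is at most \<open>2 * opt w\<close> and the available levels
    suffice.\<close>
  have valid: "dist (V F) s t * (3/4) ^ J < m" if "F \<subseteq> E" for F
  proof -
    have nnV: "\<forall>x\<in>E. 0 \<le> V F x" for F
    proof
      fix x assume "x \<in> E"
      then show "0 \<le> V F x" using bspec[OF Vm[of F]] m by (meson less_imp_le order_trans)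
    qed
    have "l1_dist E w (V F) \<le> (\<Sum>e\<in>E. \<bar>w e - w' e\<bar> + h * (opt w + \<delta>))"
      unfolding l1_dist_def
    proof (rule sum_mono)
      fix e assume e: "e \<in> E"
      have "h * opt w' \<le> h * (opt w + \<delta>)" "h * opt w \<le> h * (opt w + \<delta>)"
        using oo h \<delta>0 by (intro mult_left_mono; simp)+
      note le = this mult_pos_pos[OF h o(1)] mult_pos_pos[OF h o(3)]
      show "\<bar>w e - V F e\<bar> \<le> \<bar>w e - w' e\<bar> + h * (opt w + \<delta>)"
      proof (cases "e \<in> F")
        case True
        have "\<bar>w e - (w' e + h * opt w')\<bar> \<le> \<bar>w e - w' e\<bar> + \<bar>h * opt w'\<bar>"
          using abs_triangle_ineq4[of "w e - w' e" "h * opt w'"] by (simp only: diff_diff_eq)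
        then show ?thesis using True e le by (simp only: V_def mix_def sm if_True abs_of_pos)
      next
        case False
        have "\<bar>w e - (w e + h * opt w)\<bar> = h * opt w" using le by simp
        then show ?thesis using False e le abs_ge_zero[of "w e - w' e"] by (simp only: V_def mix_def sm if_False)
      qed
    qed
    also have "\<dots> = \<delta> + real (card E) * (h * (opt w + \<delta>))" by (simp add: sum.distrib \<delta>_def l1_dist_def)
    also have "real (card E) * (h * (opt w + \<delta>)) \<le> (real n * real n) * (h * (opt w + \<delta>))"
      using card_E_le h \<delta>0 o by (intro mult_right_mono) auto
    also have "\<dots> = h * (real n * real n) * (opt w + \<delta>)" by simp
    also have "\<dots> \<le> 1/4 * (opt w + \<delta>)" unfolding hn using eps o \<delta>0 by (intro mult_right_mono) auto
    finally have "l1_dist E w (V F) \<le> \<delta> + 1/4 * (opt w + \<delta>)" by simp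
    moreover have "4 * \<delta> \<le> opt w" using near by (simp add: \<delta>_def)
    ultimately have "l1_dist E w (V F) \<le> opt w" unfolding distrib_left using o(1) by linarith
    then have "dist (V F) s t \<le> 2 * opt w"
      using dist_l1[OF st(3) weightsD(1)[OF w(1)] nnV, of F] by linarith
    from valid_main[OF o(1) this] show ?thesis by (simp add: m_def h_def)
  qed
  have "cpl (G (V {}) J s t) (G (V F) J s t) (\<lambda>p p'. ennreal (wdist (C {}) (C F) p p')) (ennreal (\<beta> J * (\<Sum>e\<in>F. \<delta>e e)))"
    if "finite F" "F \<subseteq> E" for F
    using that
  proof (induction F rule: finite_induct)
    case empty
    have "cpl (return_pmf x) (return_pmf x) (\<lambda>p p'. ennreal (wdist (C {}) (C {}) p p')) 0" for x
      by (rule cpl_bounded) (simp add: d_w_def l1_dist_def)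
    then have "cpl (bind_pmf (G (V {}) J s t) return_pmf) (bind_pmf (G (V {}) J s t) return_pmf)
       (\<lambda>p p'. ennreal (wdist (C {}) (C {}) p p')) (\<integral>\<^sup>+ x. 0 \<partial>measure_pmf (G (V {}) J s t))"
      by (intro cpl_bind)
    then show ?case by (simp add: bind_return_pmf')
  next
    case (insert e F)
    then have eE: "e \<in> E" and FE: "F \<subseteq> E" by auto
    let ?V = "V F" and ?V' = "V (insert e F)" and ?C = "C F" and ?C' = "C (insert e F)"
    have eV: "?V e = sm w e" "?V' e = sm w' e" "?C e = w e" "?C' e = w' e"
      using insert.hyps by (simp_all add: V_def C_def mix_def)
    have off: "\<forall>x\<in>E. x \<noteq> e \<longrightarrow> ?V' x = ?V x" "\<forall>x\<in>E. x \<noteq> e \<longrightarrow> ?C' x = ?C x"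
      by (auto simp: V_def C_def mix_def)
    have \<delta>e0: "0 \<le> \<delta>e e" by (simp add: \<delta>e_def)
    have step: "cpl (G ?V J s t) (G ?V' J s t) (\<lambda>p p'. ennreal (wdist ?C ?C' p p')) (ennreal (\<beta> J * \<delta>e e))"
    proof (cases "sm w e \<le> sm w' e")
      case True
      interpret st1: edge_step n E "2 * lg n + 1" J sl ?V ?V' ?C ?C' e "\<delta>e e" m
        by unfold_locales (use eE m Vm True eV off CV in \<open>auto simp: \<delta>e_def\<close>)
      have "cpl (G ?V J s t) (G ?V' J s t) (\<lambda>p p'. ennreal (wdist ?C ?C' p p'))
         (ennreal (\<beta> J * \<delta>e e * of_bool (st1.rel (10 * sl J) s t)))"
        using st1.gen_cpl[OF st(3) valid prod_sl] insert.prems by blast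
      then show ?thesis by (rule cpl_mono) (use \<beta>_nonneg[of J] \<delta>e0 in \<open>auto intro!: ennreal_leI\<close>)
    next
      \<comment> \<open>The raised weight of \<open>e\<close> decreases here, so the two sides
        exchange roles and the coupling is mirrored.\<close>
      case False
      interpret st2: edge_step n E "2 * lg n + 1" J sl ?V' ?V ?C' ?C e "\<delta>e e" m
        by unfold_locales (use eE m Vm False eV off CV in \<open>auto simp: \<delta>e_def abs_minus_commute\<close>)
      have "cpl (G ?V' J s t) (G ?V J s t) (\<lambda>p p'. ennreal (wdist ?C' ?C p p'))
         (ennreal (\<beta> J * \<delta>e e * of_bool (st2.rel (10 * sl J) s t)))"
        using st2.gen_cpl[OF st(3) valid prod_sl] FE by blast
      then have "cpl (G ?V' J s t) (G ?V J s t) (\<lambda>p p'. ennreal (wdist ?C' ?C p p')) (ennreal (\<beta> J * \<delta>e e))"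
        by (rule cpl_mono) (use \<beta>_nonneg[of J] \<delta>e0 in \<open>auto intro!: ennreal_leI\<close>)
      from cpl_sym[OF this] show ?thesis by (simp add: d_w_sym)
    qed
    have "cpl (G (V {}) J s t) (G ?V' J s t) (\<lambda>p p'. ennreal (wdist (C {}) ?C' p p'))
       (ennreal (\<beta> J * (\<Sum>e\<in>F. \<delta>e e)) + ennreal (\<beta> J * \<delta>e e))"
      by (rule cpl_trans[OF insert.IH[OF FE] step])
         (simp add: d_w_nonneg d_w_triangle ennreal_leI flip: ennreal_plus)
    moreover have "ennreal (\<beta> J * (\<Sum>e\<in>F. \<delta>e e)) + ennreal (\<beta> J * \<delta>e e) = ennreal (\<beta> J * (\<Sum>e\<in>insert e F. \<delta>e e))"
    proof -
      have "0 \<le> \<beta> J * (\<Sum>e\<in>F. \<delta>e e)" "0 \<le> \<beta> J * \<delta>e e"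
        using \<beta>_nonneg[of J] by (auto intro!: mult_nonneg_nonneg sum_nonneg simp: \<delta>e_def)
      then show ?thesis using insert.hyps by (simp add: distrib_left add.commute flip: ennreal_plus)
    qed
    ultimately show ?case by simp
  qed
  from this[OF finite_E order_refl]
  have A: "cpl (G (V {}) J s t) (G (V E) J s t) (\<lambda>p p'. ennreal (wdist (C {}) (C E) p p')) (ennreal (\<beta> J * (\<Sum>e\<in>E. \<delta>e e)))" .
  \<comment> \<open>Equality as functions includes arguments outside \<open>E\<close>: raised
    weights are \<open>0\<close> there, and both original weightings are
    \<open>undefined\<close>.\<close>
  have eqs: "V {} = sm w" "C {} = w" "V E = sm w'" "C E = w'"
    using weightsD(2)[OF w(1)] weightsD(2)[OF w(2)]
    by (auto simp: V_def C_def mix_def fun_eq_iff smoothed_def)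
  have B: "\<beta> J * (\<Sum>e\<in>E. \<delta>e e) \<le> lip * l1_dist E w w'"
  proof -
    have "\<beta> J * (\<Sum>e\<in>E. \<delta>e e) \<le> (27 * 433 * 3 * 259200 * real (lg n) ^ 3 / \<epsilon>) * (3 * \<delta>)"
      using beta_le sum\<delta> \<beta>_nonneg[of J] eps by (intro mult_mono sum_nonneg) (auto simp: \<delta>e_def)
    then show ?thesis by (simp add: lip_def \<delta>_def)
  qed
  show ?thesis using cpl_mono[OF A ennreal_leI[OF B]] unfolding eqs sp_spec_eq .
qed

lemma spec_lipschitz:
  assumes "w \<in> weights E" "w' \<in> weights E"
  shows "cpl (sp_spec J1 \<epsilon> n E s t w) (sp_spec J1 \<epsilon> n E s t w') (\<lambda>p p'. ennreal (wdist w w' p p'))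
    (ennreal (lip * l1_dist E w w'))"
  using spec_lipschitz_far[OF assms] spec_lipschitz_near[OF assms] by linarith

lemma spec_lipschitz_const:
  "lipschitz_const E (\<lambda>w. map_pmf walk_edges (sp_spec J1 \<epsilon> n E s t w)) \<le> ennreal lip"
  unfolding lipschitz_const_def
proof (rule SUP_least, clarify)
  fix w w' assume w: "w \<in> weights E" "w' \<in> weights E" "w \<noteq> w'"
  have pos: "0 < l1_dist E w w'"
  proof -
    obtain e where e: "w e \<noteq> w' e" using w(3) by auto
    then have "e \<in> E" using weightsD(2)[OF w(1)] weightsD(2)[OF w(2)] by metis
    then have "\<bar>w e - w' e\<bar> \<le> l1_dist E w w'"
      unfolding l1_dist_def using finite_E by (intro member_le_sum) auto
    then show ?thesis using e by linarith
  qed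
  obtain Q where Q: "map_pmf fst Q = sp_spec J1 \<epsilon> n E s t w" "map_pmf snd Q = sp_spec J1 \<epsilon> n E s t w'"
    "(\<integral>\<^sup>+ z. ennreal (wdist w w' (fst z) (snd z)) \<partial>measure_pmf Q) \<le> ennreal (lip * l1_dist E w w')"
    using spec_lipschitz[OF w(1,2)] by (auto simp: cpl_def)
  let ?Q = "map_pmf (map_prod walk_edges walk_edges) Q"
  have "EM_w E (map_pmf walk_edges (sp_spec J1 \<epsilon> n E s t w), w) (map_pmf walk_edges (sp_spec J1 \<epsilon> n E s t w'), w') \<le>
     (\<integral>\<^sup>+ (P, P'). ennreal (d_w E (P, w) (P', w')) \<partial>measure_pmf ?Q)"
    unfolding EM_w_def prod.case
    by (rule INF_lower) (simp add: pmf.map_comp o_def fst_map_prod snd_map_prod flip: Q(1,2))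
  also have "\<dots> \<le> ennreal (lip * l1_dist E w w')"
    using Q(3) by (simp add: case_prod_beta' fst_map_prod snd_map_prod)
  finally have "EM_w E (map_pmf walk_edges (sp_spec J1 \<epsilon> n E s t w), w) (map_pmf walk_edges (sp_spec J1 \<epsilon> n E s t w'), w')
      / ennreal (l1_dist E w w') \<le> ennreal (lip * l1_dist E w w') / ennreal (l1_dist E w w')"
    by (rule divide_right_mono_ennreal)
  also have "\<dots> = ennreal lip" using pos lip_ge by (simp add: divide_ennreal)
  finally show "EM_w E (map_pmf walk_edges (sp_spec J1 \<epsilon> n E s t w), w) (map_pmf walk_edges (sp_spec J1 \<epsilon> n E s t w'), w')
      / ennreal (l1_dist E w w') \<le> ennreal lip" .
qed

end

section \<open>A program logic for the real RAM\<close>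

definition stepn :: "nat \<Rightarrow> config \<Rightarrow> config pmf" where
  "stepn T \<kappa> = ((\<lambda>D. bind_pmf D step) ^^ T) (return_pmf \<kappa>)"

lemma run_eq_stepn: "run T c \<sigma> = stepn T ([c], \<sigma>)"
  by (simp add: run_def stepn_def)

lemma step_funpow: "((\<lambda>D. bind_pmf D step) ^^ T) D = bind_pmf D (stepn T)"
proof (induction T arbitrary: D)
  case 0
  then show ?case by (simp add: stepn_def bind_return_pmf')
next
  case (Suc T)
  have "((\<lambda>D. bind_pmf D step) ^^ Suc T) D = bind_pmf (bind_pmf D step) (stepn T)" for D
    using Suc[of "bind_pmf D step"] by (simp add: funpow_Suc_right del: funpow.simps)
  note * = this
  have "stepn (Suc T) \<kappa> = bind_pmf (step \<kappa>) (stepn T)" for \<kappa>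
    using *[of "return_pmf \<kappa>"] unfolding stepn_def[of "Suc T", symmetric] by (simp add: bind_return_pmf)
  then have "stepn (Suc T) = (\<lambda>\<kappa>. bind_pmf (step \<kappa>) (stepn T))" by (rule ext)
  then show ?case unfolding * by (simp add: bind_assoc_pmf)
qed

lemma stepn_0 [simp]: "stepn 0 \<kappa> = return_pmf \<kappa>"
  by (simp add: stepn_def)

lemma stepn_Suc: "stepn (Suc T) \<kappa> = bind_pmf (step \<kappa>) (stepn T)"
  using step_funpow[of T "step \<kappa>"]
  by (simp add: stepn_def[of "Suc T"] funpow_Suc_right bind_return_pmf del: funpow.simps)

lemma stepn_add: "stepn (S + T) \<kappa> = bind_pmf (stepn S \<kappa>) (stepn T)"
proof (induction S arbitrary: \<kappa>)
  case (Suc S)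
  have "stepn (S + T) = (\<lambda>\<kappa>. bind_pmf (stepn S \<kappa>) (stepn T))" using Suc by (rule ext)
  then show ?case by (simp add: stepn_Suc bind_assoc_pmf)
qed (simp add: bind_return_pmf)

lemma stepn_halted [simp]: "stepn T ([], \<sigma>) = return_pmf ([], \<sigma>)"
  by (induction T) (simp_all add: stepn_Suc bind_return_pmf)

text \<open>The exact distribution of halted configurations after \<open>T\<close> steps. As these
  are absorbing, it persists for every larger \<open>T\<close>, so time bounds may be rounded up
  freely.\<close>

definition halts_with :: "config \<Rightarrow> store pmf \<Rightarrow> nat \<Rightarrow> bool" where
  "halts_with \<kappa> M T \<longleftrightarrow> stepn T \<kappa> = map_pmf (Pair []) M"

lemma halts_with_mono:
  assumes "halts_with \<kappa> M T" "T \<le> T'" shows "halts_with \<kappa> M T'"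
proof -
  obtain S where "T' = T + S" using assms(2) le_Suc_ex by blast
  then show ?thesis using assms(1)
    by (simp add: halts_with_def stepn_add bind_map_pmf) (simp add: map_pmf_def)
qed

lemma halts_with_unique:
  assumes "halts_with \<kappa> M T" "halts_with \<kappa> M' T'" shows "M = M'"
proof -
  have "halts_with \<kappa> M (max T T')" "halts_with \<kappa> M' (max T T')" using assms halts_with_mono by auto
  then have "map_pmf (Pair ([] :: com list)) M = map_pmf (Pair []) M'" by (simp add: halts_with_def)
  then have "map_pmf snd (map_pmf (Pair ([] :: com list)) M) = map_pmf snd (map_pmf (Pair ([] :: com list)) M')" by simp
  then show ?thesis by (simp add: pmf.map_comp o_def)
qed

lemma halts_with_step:
  assumes "\<And>\<kappa>'. \<kappa>' \<in> set_pmf (step \<kappa>) \<Longrightarrow> halts_with \<kappa>' (G \<kappa>') T"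
  shows "halts_with \<kappa> (bind_pmf (step \<kappa>) G) (Suc T)"
  using assms unfolding halts_with_def stepn_Suc map_bind_pmf by (intro bind_pmf_cong) auto

text \<open>Continuation style: \<open>K\<close> is the rest of the stack and \<open>G\<close> the
  distribution that it produces. Commands run on a stack, so a rule for \<open>c\<close> has to hold
  on top of every stack; time bounds then simply add.\<close>

definition triple :: "com \<Rightarrow> store \<Rightarrow> store pmf \<Rightarrow> nat \<Rightarrow> bool" where
  "triple c \<sigma> D T \<longleftrightarrow> (\<forall>K G B. (\<forall>\<sigma>'\<in>set_pmf D. halts_with (K, \<sigma>') (G \<sigma>') B) \<longrightarrow>
     halts_with (c # K, \<sigma>) (bind_pmf D G) (T + B))"

lemma tripleI:
  "(\<And>K G B. (\<And>\<sigma>'. \<sigma>' \<in> set_pmf D \<Longrightarrow> halts_with (K, \<sigma>') (G \<sigma>') B) \<Longrightarrow>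
     halts_with (c # K, \<sigma>) (bind_pmf D G) (T + B)) \<Longrightarrow> triple c \<sigma> D T"
  by (auto simp: triple_def)

lemma tripleD:
  "triple c \<sigma> D T \<Longrightarrow> (\<And>\<sigma>'. \<sigma>' \<in> set_pmf D \<Longrightarrow> halts_with (K, \<sigma>') (G \<sigma>') B) \<Longrightarrow>
     halts_with (c # K, \<sigma>) (bind_pmf D G) (T + B)"
  by (auto simp: triple_def)

lemma triple_halts: "triple c \<sigma> D T \<Longrightarrow> halts_with ([c], \<sigma>) D T"
  using tripleD[of c \<sigma> D T "[]" return_pmf 0] by (simp add: halts_with_def bind_return_pmf')

lemma triple_unique: "triple c \<sigma> D T \<Longrightarrow> triple c \<sigma> D' T' \<Longrightarrow> D = D'"
  using triple_halts halts_with_unique by blast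

lemma triple_mono: "triple c \<sigma> D T \<Longrightarrow> T \<le> T' \<Longrightarrow> triple c \<sigma> D T'"
  unfolding triple_def using halts_with_mono by (meson add_le_mono1)

lemma triple_det_step:
  assumes "\<And>K. step (c # K, \<sigma>) = return_pmf (K, \<sigma>')"
  shows "triple c \<sigma> (return_pmf \<sigma>') 1"
proof (rule tripleI)
  fix K G B assume "\<And>\<sigma>''. \<sigma>'' \<in> set_pmf (return_pmf \<sigma>') \<Longrightarrow> halts_with (K, \<sigma>'') (G \<sigma>'') B"
  then show "halts_with (c # K, \<sigma>) (bind_pmf (return_pmf \<sigma>') G) (1 + B)"
    using halts_with_step[of "(c # K, \<sigma>)" "\<lambda>\<kappa>. G (snd \<kappa>)" B] assms by (simp add: bind_return_pmf)
qed

lemma triple_Flip: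
  "triple (Flip x is a) \<sigma> (map_pmf (\<lambda>h. nput x is (if h then 1 else 0) \<sigma>) (bernoulli_pmf (rval a \<sigma>))) 1"
proof (rule tripleI)
  fix K G B
  assume *: "\<And>\<sigma>'. \<sigma>' \<in> set_pmf (map_pmf (\<lambda>h. nput x is (if h then 1 else 0) \<sigma>) (bernoulli_pmf (rval a \<sigma>))) \<Longrightarrow> halts_with (K, \<sigma>') (G \<sigma>') B"
  have "halts_with \<kappa> (G (snd \<kappa>)) B" if "\<kappa> \<in> set_pmf (step (Flip x is a # K, \<sigma>))" for \<kappa>
  proof -
    from that obtain h where "h \<in> set_pmf (bernoulli_pmf (rval a \<sigma>))" "\<kappa> = (K, nput x is (if h then 1 else 0) \<sigma>)" by auto
    then show ?thesis using *[of "nput x is (if h then 1 else 0) \<sigma>"] by simp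
  qed
  then show "halts_with (Flip x is a # K, \<sigma>) (bind_pmf (map_pmf (\<lambda>h. nput x is (if h then 1 else 0) \<sigma>) (bernoulli_pmf (rval a \<sigma>))) G) (1 + B)"
    using halts_with_step[of "(Flip x is a # K, \<sigma>)" "\<lambda>\<kappa>. G (snd \<kappa>)" B] by (simp add: bind_map_pmf)
qed

lemma triple_Seq:
  assumes c: "triple c \<sigma> D T" and d: "\<And>\<sigma>'. \<sigma>' \<in> set_pmf D \<Longrightarrow> triple d \<sigma>' (D2 \<sigma>') T2"
  shows "triple (Seq c d) \<sigma> (bind_pmf D D2) (T + T2 + 1)"
proof (rule tripleI)
  fix K G B assume *: "\<And>\<sigma>'. \<sigma>' \<in> set_pmf (bind_pmf D D2) \<Longrightarrow> halts_with (K, \<sigma>') (G \<sigma>') B"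
  have "halts_with (d # K, \<sigma>') (bind_pmf (D2 \<sigma>') G) (T2 + B)" if "\<sigma>' \<in> set_pmf D" for \<sigma>'
    using * that by (intro tripleD[OF d[OF that]]) auto
  from tripleD[OF c this] have "halts_with (c # d # K, \<sigma>) (bind_pmf D (\<lambda>\<sigma>'. bind_pmf (D2 \<sigma>') G)) (T + (T2 + B))" .
  then show "halts_with (Seq c d # K, \<sigma>) (bind_pmf (bind_pmf D D2) G) (T + T2 + 1 + B)"
    using halts_with_step[of "(Seq c d # K, \<sigma>)" "\<lambda>_. bind_pmf (bind_pmf D D2) G" "T + (T2 + B)"]
    by (simp add: bind_return_pmf bind_assoc_pmf add_ac)
qed

lemma triple_Cond:
  assumes "triple (if bval b \<sigma> then c else d) \<sigma> D T"
  shows "triple (Cond b c d) \<sigma> D (T + 1)"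
proof (rule tripleI)
  fix K G B assume *: "\<And>\<sigma>'. \<sigma>' \<in> set_pmf D \<Longrightarrow> halts_with (K, \<sigma>') (G \<sigma>') B"
  show "halts_with (Cond b c d # K, \<sigma>) (bind_pmf D G) (T + 1 + B)"
    using halts_with_step[of "(Cond b c d # K, \<sigma>)" "\<lambda>_. bind_pmf D G" "T + B"] tripleD[OF assms *]
    by (simp add: bind_return_pmf add_ac)
qed

lemma triple_Loop_False: "\<not> bval b \<sigma> \<Longrightarrow> triple (Loop b c) \<sigma> (return_pmf \<sigma>) 1"
  by (rule triple_det_step) simp

lemma triple_Loop_True:
  assumes b: "bval b \<sigma>" and c: "triple c \<sigma> D T"
    and l: "\<And>\<sigma>'. \<sigma>' \<in> set_pmf D \<Longrightarrow> triple (Loop b c) \<sigma>' (D2 \<sigma>') T2"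
  shows "triple (Loop b c) \<sigma> (bind_pmf D D2) (T + T2 + 1)"
proof (rule tripleI)
  fix K G B assume *: "\<And>\<sigma>'. \<sigma>' \<in> set_pmf (bind_pmf D D2) \<Longrightarrow> halts_with (K, \<sigma>') (G \<sigma>') B"
  have "halts_with (Loop b c # K, \<sigma>') (bind_pmf (D2 \<sigma>') G) (T2 + B)" if "\<sigma>' \<in> set_pmf D" for \<sigma>'
    using * that by (intro tripleD[OF l[OF that]]) auto
  from tripleD[OF c this] have "halts_with (c # Loop b c # K, \<sigma>) (bind_pmf D (\<lambda>\<sigma>'. bind_pmf (D2 \<sigma>') G)) (T + (T2 + B))" .
  then show "halts_with (Loop b c # K, \<sigma>) (bind_pmf (bind_pmf D D2) G) (T + T2 + 1 + B)"
    using halts_with_step[of "(Loop b c # K, \<sigma>)" "\<lambda>_. bind_pmf (bind_pmf D D2) G" "T + (T2 + B)"] b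
    by (simp add: bind_return_pmf bind_assoc_pmf add_ac)
qed

section \<open>Frame conditions: what a command leaves unchanged\<close>

definition eqv :: "vname set \<Rightarrow> vname set \<Rightarrow> store \<Rightarrow> store \<Rightarrow> bool" where
  "eqv X Y \<sigma> \<sigma>' \<longleftrightarrow> (\<forall>z. z \<notin> X \<longrightarrow> fst \<sigma>' z = fst \<sigma> z) \<and> (\<forall>z. z \<notin> Y \<longrightarrow> snd \<sigma>' z = snd \<sigma> z)"

fun modN :: "com \<Rightarrow> vname set" where
  "modN (NAssign x _ _) = {x}"
| "modN (RAssign x _ _) = {}"
| "modN (Flip x _ _) = {x}"
| "modN (Seq c d) = modN c \<union> modN d"
| "modN (Cond _ c d) = modN c \<union> modN d"
| "modN (Loop _ c) = modN c"

fun modR :: "com \<Rightarrow> vname set" where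
  "modR (NAssign x _ _) = {}"
| "modR (RAssign x _ _) = {x}"
| "modR (Flip x _ _) = {}"
| "modR (Seq c d) = modR c \<union> modR d"
| "modR (Cond _ c d) = modR c \<union> modR d"
| "modR (Loop _ c) = modR c"

lemma eqv_refl [simp]: "eqv X Y \<sigma> \<sigma>"
  by (simp add: eqv_def)

lemma eqv_trans: "eqv X Y \<sigma> \<sigma>' \<Longrightarrow> eqv X Y \<sigma>' \<sigma>'' \<Longrightarrow> eqv X Y \<sigma> \<sigma>''"
  by (simp add: eqv_def)

lemma eqv_mono: "eqv X Y \<sigma> \<sigma>' \<Longrightarrow> X \<subseteq> X' \<Longrightarrow> Y \<subseteq> Y' \<Longrightarrow> eqv X' Y' \<sigma> \<sigma>'"
  by (auto simp: eqv_def)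

lemma eqvD: "eqv X Y \<sigma> \<sigma>' \<Longrightarrow> z \<notin> X \<Longrightarrow> fst \<sigma>' z = fst \<sigma> z" "eqv X Y \<sigma> \<sigma>' \<Longrightarrow> z \<notin> Y \<Longrightarrow> snd \<sigma>' z = snd \<sigma> z"
  by (auto simp: eqv_def)

lemma step_frame:
  assumes "\<forall>c\<in>set (fst \<kappa>). modN c \<subseteq> X \<and> modR c \<subseteq> Y" "eqv X Y \<sigma> (snd \<kappa>)" "\<kappa>' \<in> set_pmf (step \<kappa>)"
  shows "(\<forall>c\<in>set (fst \<kappa>'). modN c \<subseteq> X \<and> modR c \<subseteq> Y) \<and> eqv X Y \<sigma> (snd \<kappa>')"
  using assms by (cases \<kappa> rule: step.cases) (auto simp: eqv_def nput_def rput_def split: if_splits)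

lemma stepn_frame:
  assumes "\<forall>c\<in>set (fst \<kappa>). modN c \<subseteq> X \<and> modR c \<subseteq> Y" "eqv X Y \<sigma> (snd \<kappa>)" "\<kappa>' \<in> set_pmf (stepn T \<kappa>)"
  shows "eqv X Y \<sigma> (snd \<kappa>')"
  using assms
proof (induction T arbitrary: \<kappa>)
  case (Suc T)
  then obtain \<kappa>1 where k: "\<kappa>1 \<in> set_pmf (step \<kappa>)" "\<kappa>' \<in> set_pmf (stepn T \<kappa>1)" by (auto simp: stepn_Suc)
  then show ?case using Suc.IH[of \<kappa>1] step_frame[OF Suc.prems(1,2) k(1)] by blast
qed simp

lemma triple_frame:
  assumes "triple c \<sigma> D T" "\<sigma>' \<in> set_pmf D" shows "eqv (modN c) (modR c) \<sigma> \<sigma>'"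
proof -
  have "([], \<sigma>') \<in> set_pmf (stepn T ([c], \<sigma>))"
    using triple_halts[OF assms(1)] assms(2) by (simp add: halts_with_def)
  from stepn_frame[OF _ _ this, of "modN c" "modR c" \<sigma>] show ?thesis by simp
qed

text \<open>\<open>M\<close> is the distribution of an abstract result, related by \<open>R\<close> to the final store.\<close>

definition sim :: "nat \<Rightarrow> com \<Rightarrow> store \<Rightarrow> 'a pmf \<Rightarrow> (store \<Rightarrow> 'a \<Rightarrow> bool) \<Rightarrow> bool" where
  "sim T c \<sigma> M R \<longleftrightarrow> (\<exists>D. triple c \<sigma> D T \<and> rel_pmf R D M)"

lemma rel_pmf_strong:
  "rel_pmf R D M \<Longrightarrow> (\<And>x y. x \<in> set_pmf D \<Longrightarrow> y \<in> set_pmf M \<Longrightarrow> R x y \<Longrightarrow> R' x y) \<Longrightarrow> rel_pmf R' D M"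
  by (rule pmf.rel_mono_strong)

text \<open>Besides weakening, this hands over what a postcondition need not state: the abstract
  result lies in the support, and only assigned variables have changed.\<close>

lemma sim_weaken:
  assumes "sim T c \<sigma> M R" "T \<le> T'"
    "\<And>\<sigma>' x. R \<sigma>' x \<Longrightarrow> x \<in> set_pmf M \<Longrightarrow> eqv (modN c) (modR c) \<sigma> \<sigma>' \<Longrightarrow> R' \<sigma>' x"
  shows "sim T' c \<sigma> M R'"
proof -
  obtain D where D: "triple c \<sigma> D T" "rel_pmf R D M" using assms(1) by (auto simp: sim_def)
  have "rel_pmf R' D M" by (rule rel_pmf_strong[OF D(2)]) (use assms(3) triple_frame[OF D(1)] in blast)
  then show ?thesis using triple_mono[OF D(1) assms(2)] by (auto simp: sim_def)
qed

lemma sim_det_step: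
  assumes "\<And>K. step (c # K, \<sigma>) = return_pmf (K, \<sigma>')" "R \<sigma>' y"
  shows "sim 1 c \<sigma> (return_pmf y) R"
  unfolding sim_def using triple_det_step[OF assms(1)] assms(2) by (intro exI[of _ "return_pmf \<sigma>'"]) simp

lemma sim_Flip:
  assumes "\<And>h. R (nput x is (if h then 1 else 0) \<sigma>) h"
  shows "sim 1 (Flip x is a) \<sigma> (bernoulli_pmf (rval a \<sigma>)) R"
  unfolding sim_def
proof (intro exI conjI)
  show "rel_pmf R (map_pmf (\<lambda>h. nput x is (if h then 1 else 0) \<sigma>) (bernoulli_pmf (rval a \<sigma>))) (bernoulli_pmf (rval a \<sigma>))"
    unfolding pmf.rel_map by (rule rel_pmf_reflI) (rule assms)
qed (rule triple_Flip)

text \<open>The second command is simulated for each related pair, but its store distribution has to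
  be a function of the store alone. It is, because a command determines its distribution; the choice
  in \<open>D2\<close> therefore serves every abstract result related to the same store.\<close>

lemma sim_bind_aux:
  assumes R: "rel_pmf R D M" and d: "\<And>\<sigma>' y. R \<sigma>' y \<Longrightarrow> \<sigma>' \<in> set_pmf D \<Longrightarrow> y \<in> set_pmf M \<Longrightarrow> sim T2 d \<sigma>' (N y) R2"
  obtains D2 where "\<And>\<sigma>'. \<sigma>' \<in> set_pmf D \<Longrightarrow> triple d \<sigma>' (D2 \<sigma>') T2" "rel_pmf R2 (bind_pmf D D2) (bind_pmf M N)"
proof -
  define D2 where "D2 \<sigma>' = (SOME D'. triple d \<sigma>' D' T2)" for \<sigma>'
  have tr: "triple d \<sigma>' (D2 \<sigma>') T2 \<and> rel_pmf R2 (D2 \<sigma>') (N y)" if "R \<sigma>' y" "\<sigma>' \<in> set_pmf D" "y \<in> set_pmf M" for \<sigma>' y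
  proof -
    have "sim T2 d \<sigma>' (N y) R2" by (rule d[OF that])
    then obtain D' where D': "triple d \<sigma>' D' T2" "rel_pmf R2 D' (N y)" by (auto simp: sim_def)
    have "triple d \<sigma>' (D2 \<sigma>') T2" unfolding D2_def using D'(1) by (rule someI)
    then show ?thesis using triple_unique[OF D'(1)] D'(2) by auto
  qed
  have ex: "\<exists>y\<in>set_pmf M. R \<sigma>' y" if "\<sigma>' \<in> set_pmf D" for \<sigma>'
    using rel_setD1[OF rel_pmf_imp_rel_set[OF R] that] .
  have "rel_pmf (\<lambda>\<sigma>' y. triple d \<sigma>' (D2 \<sigma>') T2 \<and> rel_pmf R2 (D2 \<sigma>') (N y)) D M"
    by (rule rel_pmf_strong[OF R]) (use tr in blast)
  then have "rel_pmf R2 (bind_pmf D D2) (bind_pmf M N)" by (rule rel_pmf_bindI) blast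
  then show ?thesis using that tr ex by blast
qed

lemma sim_Seq:
  assumes c: "sim T1 c \<sigma> M R"
    and d: "\<And>\<sigma>' y. R \<sigma>' y \<Longrightarrow> y \<in> set_pmf M \<Longrightarrow> eqv (modN c) (modR c) \<sigma> \<sigma>' \<Longrightarrow> sim T2 d \<sigma>' (N y) R2"
  shows "sim (T1 + T2 + 1) (Seq c d) \<sigma> (bind_pmf M N) R2"
proof -
  obtain D where D: "triple c \<sigma> D T1" "rel_pmf R D M" using c by (auto simp: sim_def)
  obtain D2 where D2: "\<And>\<sigma>'. \<sigma>' \<in> set_pmf D \<Longrightarrow> triple d \<sigma>' (D2 \<sigma>') T2" "rel_pmf R2 (bind_pmf D D2) (bind_pmf M N)"
    using sim_bind_aux[OF D(2), of T2 d N R2] d triple_frame[OF D(1)] by blast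
  show ?thesis unfolding sim_def using triple_Seq[OF D(1) D2(1)] D2(2) by blast
qed

lemma sim_Seq_det:
  assumes c: "sim T1 c \<sigma> (return_pmf ()) (\<lambda>\<sigma>' _. P \<sigma>')"
    and d: "\<And>\<sigma>'. P \<sigma>' \<Longrightarrow> eqv (modN c) (modR c) \<sigma> \<sigma>' \<Longrightarrow> sim T2 d \<sigma>' M R2"
  shows "sim (T1 + T2 + 1) (Seq c d) \<sigma> M R2"
  using sim_Seq[OF c, of T2 d "\<lambda>_. M" R2] d by (simp add: bind_return_pmf)

lemma sim_Cond:
  assumes "bval b \<sigma> \<Longrightarrow> sim T c \<sigma> M R" "\<not> bval b \<sigma> \<Longrightarrow> sim T d \<sigma> M R"
  shows "sim (T + 1) (Cond b c d) \<sigma> M R"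
proof -
  have "sim T (if bval b \<sigma> then c else d) \<sigma> M R" using assms by simp
  then show ?thesis unfolding sim_def using triple_Cond by blast
qed

lemma sim_Loop_False: "\<not> bval b \<sigma> \<Longrightarrow> R \<sigma> y \<Longrightarrow> sim 1 (Loop b c) \<sigma> (return_pmf y) R"
  unfolding sim_def using triple_Loop_False by (intro exI[of _ "return_pmf \<sigma>"]) simp

lemma sim_Loop_True:
  assumes b: "bval b \<sigma>" and c: "sim T1 c \<sigma> M R"
    and d: "\<And>\<sigma>' y. R \<sigma>' y \<Longrightarrow> y \<in> set_pmf M \<Longrightarrow> eqv (modN c) (modR c) \<sigma> \<sigma>' \<Longrightarrow> sim T2 (Loop b c) \<sigma>' (N y) R2"
  shows "sim (T1 + T2 + 1) (Loop b c) \<sigma> (bind_pmf M N) R2"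
proof -
  obtain D where D: "triple c \<sigma> D T1" "rel_pmf R D M" using c by (auto simp: sim_def)
  obtain D2 where D2: "\<And>\<sigma>'. \<sigma>' \<in> set_pmf D \<Longrightarrow> triple (Loop b c) \<sigma>' (D2 \<sigma>') T2" "rel_pmf R2 (bind_pmf D D2) (bind_pmf M N)"
    using sim_bind_aux[OF D(2), of T2 "Loop b c" N R2] d triple_frame[OF D(1)] by blast
  show ?thesis unfolding sim_def using triple_Loop_True[OF b D(1) D2(1)] D2(2) by blast
qed

lemma sim_Loop_True_det:
  assumes "bval b \<sigma>" "sim T1 c \<sigma> (return_pmf ()) (\<lambda>\<sigma>' _. P \<sigma>')"
    "\<And>\<sigma>'. P \<sigma>' \<Longrightarrow> eqv (modN c) (modR c) \<sigma> \<sigma>' \<Longrightarrow> sim T2 (Loop b c) \<sigma>' M R2"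
  shows "sim (T1 + T2 + 1) (Loop b c) \<sigma> M R2"
  using sim_Loop_True[OF assms(1,2), of T2 "\<lambda>_. M" R2] assms(3) by (simp add: bind_return_pmf)

text \<open>\<open>final_store\<close> stops at the least halting time; running on until
  \<open>T\<close> changes nothing because halted configurations are absorbing.\<close>

lemma sim_final:
  assumes "sim T c \<sigma> M (\<lambda>\<sigma>' y. out \<sigma>' = y)"
  shows "halts_within T c \<sigma>" "map_pmf out (final_store c \<sigma>) = M"
proof -
  obtain D where D: "triple c \<sigma> D T" "rel_pmf (\<lambda>\<sigma>' y. out \<sigma>' = y) D M" using assms by (auto simp: sim_def)
  have h: "stepn T ([c], \<sigma>) = map_pmf (Pair []) D" using triple_halts[OF D(1)] by (simp add: halts_with_def)
  show hw: "halts_within T c \<sigma>" by (auto simp: halts_within_def run_eq_stepn h)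
  define S where "S = (LEAST T. halts_within T c \<sigma>)"
  have S: "halts_within S c \<sigma>" "S \<le> T" unfolding S_def using hw by (auto intro: LeastI Least_le)
  obtain U where U: "T = S + U" using S(2) le_Suc_ex by blast
  have "stepn T ([c], \<sigma>) = bind_pmf (stepn S ([c], \<sigma>)) (stepn U)" by (simp add: U stepn_add)
  also have "\<dots> = bind_pmf (stepn S ([c], \<sigma>)) return_pmf"
  proof (rule bind_pmf_cong)
    fix \<kappa> assume "\<kappa> \<in> set_pmf (stepn S ([c], \<sigma>))"
    then have "fst \<kappa> = []" using S(1) by (auto simp: halts_within_def run_eq_stepn)
    then show "stepn U \<kappa> = return_pmf \<kappa>" by (cases \<kappa>) auto
  qed simp
  finally have "stepn S ([c], \<sigma>) = map_pmf (Pair []) D" by (simp add: h bind_return_pmf')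
  then have "final_store c \<sigma> = D" unfolding final_store_def S_def[symmetric] run_eq_stepn by (simp add: pmf.map_comp o_def)
  moreover have "map_pmf out D = M"
  proof -
    have "rel_pmf (=) (map_pmf out D) M" using D(2) by (simp add: pmf.rel_map)
    then show ?thesis by (simp add: pmf.rel_eq)
  qed
  ultimately show "map_pmf out (final_store c \<sigma>) = M" by simp
qed

section \<open>Straight-line code, evaluated by rewriting\<close>

fun straight :: "com \<Rightarrow> bool" where
  "straight (NAssign _ _ _) = True"
| "straight (RAssign _ _ _) = True"
| "straight (Seq c d) = (straight c \<and> straight d)"
| "straight (Cond _ c d) = (straight c \<and> straight d)"
| "straight _ = False"

fun exec :: "com \<Rightarrow> store \<Rightarrow> store" where
  "exec (NAssign x is a) \<sigma> = nput x is (nval a \<sigma>) \<sigma>"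
| "exec (RAssign x is a) \<sigma> = rput x is (rval a \<sigma>) \<sigma>"
| "exec (Seq c d) \<sigma> = exec d (exec c \<sigma>)"
| "exec (Cond b c d) \<sigma> = (if bval b \<sigma> then exec c \<sigma> else exec d \<sigma>)"
| "exec c \<sigma> = \<sigma>"

text \<open>For a conditional both branches are added instead of taking the maximum, since an upper
  bound is enough.\<close>

fun time :: "com \<Rightarrow> nat" where
  "time (Seq c d) = time c + time d + 1"
| "time (Cond b c d) = time c + time d + 1"
| "time c = 1"

lemma sim_straight: "straight c \<Longrightarrow> R (exec c \<sigma>) y \<Longrightarrow> sim (time c) c \<sigma> (return_pmf y) R"
proof (induction c arbitrary: \<sigma> R)
  case (Seq c d)
  have "sim (time c) c \<sigma> (return_pmf ()) (\<lambda>\<sigma>' _. \<sigma>' = exec c \<sigma>)"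
  proof -
    have "sim (time c) c \<sigma> (return_pmf y) (\<lambda>\<sigma>' _. \<sigma>' = exec c \<sigma>)" using Seq by auto
    then obtain D where D: "triple c \<sigma> D (time c)" "rel_pmf (\<lambda>\<sigma>' _. \<sigma>' = exec c \<sigma>) D (return_pmf y)"
      by (auto simp: sim_def)
    then have "rel_pmf (\<lambda>\<sigma>' _. \<sigma>' = exec c \<sigma>) D (return_pmf ())" by (simp add: rel_pmf_return_pmf2)
    then show ?thesis using D(1) by (auto simp: sim_def)
  qed
  from sim_Seq_det[OF this, of "time d" d "return_pmf y" R] show ?case using Seq by auto
next
  case (Cond b c d)
  have "sim (time c + time d) c \<sigma> (return_pmf y) R" if "bval b \<sigma>"
    using sim_weaken[OF Cond.IH(1)[of R \<sigma>]] Cond.prems that by auto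
  moreover have "sim (time c + time d) d \<sigma> (return_pmf y) R" if "\<not> bval b \<sigma>"
    using sim_weaken[OF Cond.IH(2)[of R \<sigma>]] Cond.prems that by auto
  ultimately have "sim (time c + time d + 1) (Cond b c d) \<sigma> (return_pmf y) R" by (rule sim_Cond)
  then show ?case by simp
next
  case (NAssign x "is" a)
  then show ?case using sim_det_step[of "NAssign x is a" \<sigma> "nput x is (nval a \<sigma>) \<sigma>" R y] by simp
next
  case (RAssign x "is" a)
  then show ?case using sim_det_step[of "RAssign x is a" \<sigma> "rput x is (rval a \<sigma>) \<sigma>" R y] by simp
qed auto

text \<open>The bound is evaluated anew in each round; \<open>sim_For\<close> asks for a constant
  value on all stores that differ only in variables assigned by the loop.\<close>

definition For :: "vname \<Rightarrow> nexp \<Rightarrow> com \<Rightarrow> com" where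
  "For i bnd body = Seq (NAssign i [] (NConst 0))
     (Loop (NLess (NGet i []) bnd) (Seq body (NAssign i [] (NAdd (NGet i []) (NConst 1)))))"

lemma mod_For [simp]: "modN (For i bnd body) = insert i (modN body)" "modR (For i bnd body) = modR body"
  by (auto simp: For_def)

text \<open>Peels off the first round, as the loop does, whereas \<open>iterM\<close> peels off the
  last one, as the reservoir induction does.\<close>

primrec iterFrom :: "(nat \<Rightarrow> 'a \<Rightarrow> 'a pmf) \<Rightarrow> nat \<Rightarrow> nat \<Rightarrow> 'a \<Rightarrow> 'a pmf" where
  "iterFrom N k 0 x = return_pmf x"
| "iterFrom N k (Suc j) x = bind_pmf (N k x) (iterFrom N (Suc k) j)"

lemma iterFrom_snoc: "iterFrom N k (Suc j) x = bind_pmf (iterFrom N k j x) (N (k + j))"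
proof (induction j arbitrary: k x)
  case 0
  have "iterFrom N (Suc k) 0 = return_pmf" by (rule ext) simp
  then show ?case by (simp add: bind_return_pmf bind_return_pmf')
next
  case (Suc j)
  have "iterFrom N (Suc k) (Suc j) = (\<lambda>x. bind_pmf (iterFrom N (Suc k) j x) (N (Suc k + j)))"
    using Suc by (intro ext)
  then show ?case by (subst iterFrom.simps(2)) (simp add: bind_assoc_pmf)
qed

lemma iterM_eq_iterFrom: "iterM N m x = iterFrom N 0 m x"
proof (induction m)
  case (Suc m)
  then show ?case using iterFrom_snoc[of N 0 m x] by simp
qed simp

text \<open>By \<open>stable\<close> the invariant survives any assignment to the counter, so it
  refers to the round through \<open>k\<close> and not through the store.\<close>

lemma sim_For:
  assumes init: "I 0 \<sigma> x"
    and stable: "\<And>k \<sigma>' x j. I k \<sigma>' x \<Longrightarrow> I k (nput i [] j \<sigma>') x"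
    and i: "i \<notin> modN body"
    and bnd: "\<And>\<sigma>'. eqv (insert i (modN body)) (modR body) \<sigma> \<sigma>' \<Longrightarrow> nval bnd \<sigma>' = m"
    and body: "\<And>k \<sigma>' x. k < m \<Longrightarrow> fst \<sigma>' i [] = k \<Longrightarrow> eqv (insert i (modN body)) (modR body) \<sigma> \<sigma>' \<Longrightarrow> I k \<sigma>' x \<Longrightarrow>
       sim T body \<sigma>' (N k x) (\<lambda>\<sigma>'' x'. I (Suc k) \<sigma>'' x')"
  shows "sim (m * (T + 3) + 3) (For i bnd body) \<sigma> (iterM N m x) (\<lambda>\<sigma>' x'. I m \<sigma>' x')"
proof -
  let ?F = "eqv (insert i (modN body)) (modR body) \<sigma>"
  let ?inc = "NAssign i [] (NAdd (NGet i []) (NConst 1))"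
  let ?L = "Loop (NLess (NGet i []) bnd) (Seq body ?inc)"
  have loop: "sim (j * (T + 3) + 1) ?L \<sigma>' (iterFrom N k j x) (\<lambda>\<sigma>' x'. I m \<sigma>' x')"
    if "k + j = m" "fst \<sigma>' i [] = k" "?F \<sigma>'" "I k \<sigma>' x" for k j \<sigma>' x
    using that
  proof (induction j arbitrary: k \<sigma>' x)
    case 0
    then have "\<not> bval (NLess (NGet i []) bnd) \<sigma>'" "I m \<sigma>' x" using bnd[of \<sigma>'] by auto
    from sim_Loop_False[where R = "I m", OF this] show ?case by simp
  next
    case (Suc j)
    have b: "bval (NLess (NGet i []) bnd) \<sigma>'" using Suc.prems bnd[of \<sigma>'] by simp
    have "sim (T + 1 + 1) (Seq body ?inc) \<sigma>' (bind_pmf (N k x) return_pmf)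
       (\<lambda>\<sigma>'' x'. I (Suc k) \<sigma>'' x' \<and> fst \<sigma>'' i [] = Suc k \<and> ?F \<sigma>'')"
    proof (rule sim_Seq)
      show "sim T body \<sigma>' (N k x) (\<lambda>\<sigma>'' x'. I (Suc k) \<sigma>'' x')"
        using body Suc.prems by auto
    next
      fix \<sigma>'' y assume *: "I (Suc k) \<sigma>'' y" "eqv (modN body) (modR body) \<sigma>' \<sigma>''"
      have "fst \<sigma>'' i [] = k" using eqvD(1)[OF *(2) i] Suc.prems(2) by simp
      then have "sim (time ?inc) ?inc \<sigma>'' (return_pmf y) (\<lambda>\<sigma>'' x'. I (Suc k) \<sigma>'' x' \<and> fst \<sigma>'' i [] = Suc k \<and> ?F \<sigma>'')"
        using stable[OF *(1)] eqv_trans[OF Suc.prems(3) eqv_mono[OF *(2)]]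
        by (intro sim_straight) (auto simp: nput_def eqv_def)
      then show "sim 1 ?inc \<sigma>'' (return_pmf y) (\<lambda>\<sigma>'' x'. I (Suc k) \<sigma>'' x' \<and> fst \<sigma>'' i [] = Suc k \<and> ?F \<sigma>'')" by simp
    qed
    then have c: "sim (T + 2) (Seq body ?inc) \<sigma>' (N k x)
       (\<lambda>\<sigma>'' x'. I (Suc k) \<sigma>'' x' \<and> fst \<sigma>'' i [] = Suc k \<and> ?F \<sigma>'')" by (simp add: bind_return_pmf')
    have "sim ((T + 2) + (j * (T + 3) + 1) + 1) ?L \<sigma>' (bind_pmf (N k x) (iterFrom N (Suc k) j)) (\<lambda>\<sigma>' x'. I m \<sigma>' x')"
      by (rule sim_Loop_True[OF b c]) (use Suc in auto)
    moreover have "(T + 2) + (j * (T + 3) + 1) + 1 = Suc j * (T + 3) + 1" by simp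
    ultimately show ?case by (simp only: iterFrom.simps)
  qed
  have ini: "sim (time (NAssign i [] (NConst 0))) (NAssign i [] (NConst 0)) \<sigma> (return_pmf ())
     (\<lambda>\<sigma>' _. I 0 \<sigma>' x \<and> fst \<sigma>' i [] = 0 \<and> ?F \<sigma>')"
    using stable[OF init] by (intro sim_straight) (auto simp: nput_def eqv_def)
  have "sim (time (NAssign i [] (NConst 0)) + (m * (T + 3) + 1) + 1) (For i bnd body) \<sigma> (iterM N m x) (\<lambda>\<sigma>' x'. I m \<sigma>' x')"
    unfolding For_def iterM_eq_iterFrom by (rule sim_Seq_det[OF ini]) (rule loop, auto)
  moreover have "time (NAssign i [] (NConst 0)) + (m * (T + 3) + 1) + 1 = m * (T + 3) + 3" by simp
  ultimately show ?thesis by (simp only:)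
qed

lemma iterM_return: "iterM (\<lambda>_. return_pmf) m x = return_pmf x"
  by (induction m) (simp_all add: bind_return_pmf)

lemma sim_For_det:
  assumes init: "I 0 \<sigma>"
    and stable: "\<And>k \<sigma>' j. I k \<sigma>' \<Longrightarrow> I k (nput i [] j \<sigma>')"
    and i: "i \<notin> modN body"
    and bnd: "\<And>\<sigma>'. eqv (insert i (modN body)) (modR body) \<sigma> \<sigma>' \<Longrightarrow> nval bnd \<sigma>' = m"
    and body: "\<And>k \<sigma>'. k < m \<Longrightarrow> fst \<sigma>' i [] = k \<Longrightarrow> eqv (insert i (modN body)) (modR body) \<sigma> \<sigma>' \<Longrightarrow> I k \<sigma>' \<Longrightarrow>
       sim T body \<sigma>' (return_pmf ()) (\<lambda>\<sigma>'' _. I (Suc k) \<sigma>'')"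
  shows "sim (m * (T + 3) + 3) (For i bnd body) \<sigma> (return_pmf ()) (\<lambda>\<sigma>' _. I m \<sigma>')"
  using sim_For[where I = "\<lambda>k \<sigma> _. I k \<sigma>" and N = "\<lambda>_. return_pmf" and x = "()" and T = T, OF init stable i bnd] body
  by (simp add: iterM_return)

section \<open>Arrays and all-pairs distances\<close>

lemma sim_map:
  assumes "sim T c \<sigma> M R" "\<And>\<sigma>' x. R \<sigma>' x \<Longrightarrow> R' \<sigma>' (f x)"
  shows "sim T c \<sigma> (map_pmf f M) R'"
proof -
  obtain D where D: "triple c \<sigma> D T" "rel_pmf R D M" using assms(1) by (auto simp: sim_def)
  have "rel_pmf (\<lambda>\<sigma>' x. R' \<sigma>' (f x)) D M" by (rule rel_pmf_strong[OF D(2)]) (rule assms(2))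
  then have "rel_pmf R' D (map_pmf f M)" by (simp add: pmf.rel_map)
  then show ?thesis using D(1) by (auto simp: sim_def)
qed

abbreviation (input) nvar :: "vname \<Rightarrow> nexp" where "nvar x \<equiv> NGet x []"
abbreviation (input) rvar :: "vname \<Rightarrow> rexp" where "rvar x \<equiv> RGet x []"
abbreviation (input) rnum :: "nat \<Rightarrow> rexp" where "rnum k \<equiv> ROfNat (NConst k)"
abbreviation (input) npos :: "nexp \<Rightarrow> bexp" where "npos a \<equiv> NLess (NConst 0) a"
abbreviation (input) skip :: com where "skip \<equiv> NAssign ''skip'' [] (NConst 0)"
abbreviation (input) set_n :: "vname \<Rightarrow> nexp \<Rightarrow> com" where "set_n x a \<equiv> NAssign x [] a"
abbreviation (input) set_r :: "vname \<Rightarrow> rexp \<Rightarrow> com" where "set_r x a \<equiv> RAssign x [] a"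

definition env :: "nat \<Rightarrow> nat set set \<Rightarrow> store \<Rightarrow> bool" where
  "env n E \<sigma> \<longleftrightarrow> fst \<sigma> ''n'' [] = n \<and> (\<forall>x y. 0 < fst \<sigma> ''E'' [x, y] \<longleftrightarrow> {x, y} \<in> E)"

definition vals :: "vname \<Rightarrow> nat set set \<Rightarrow> weight \<Rightarrow> store \<Rightarrow> bool" where
  "vals a E v \<sigma> \<longleftrightarrow> (\<forall>x y. {x, y} \<in> E \<longrightarrow> snd \<sigma> a [x, y] = v {x, y})"

text \<open>The flags in \<open>''r''\<close> take the place of infinite distances; the entry of
  \<open>''d''\<close> for an unreachable pair is arbitrary.\<close>

definition table :: "nat \<Rightarrow> nat set set \<Rightarrow> weight \<Rightarrow> store \<Rightarrow> bool" where
  "table n E v \<sigma> \<longleftrightarrow> (\<forall>u<n. \<forall>y<n. (0 < fst \<sigma> ''r'' [u, y] \<longleftrightarrow> conn E u y) \<and>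
     (conn E u y \<longrightarrow> snd \<sigma> ''d'' [u, y] = min_path_length E u y v))"

lemma vals_eqv: "vals a E v \<sigma> \<Longrightarrow> eqv X Y \<sigma> \<sigma>' \<Longrightarrow> a \<notin> Y \<Longrightarrow> vals a E v \<sigma>'"
  by (simp add: vals_def eqv_def)

text \<open>Naturals can only be added and subtracted, so \<open>2 ^ L\<close> is produced by
  doubling and \<open>36 * L\<close> is accumulated along with it.\<close>

definition lg_com :: com where
  "lg_com = Seq (Seq (set_n ''p'' (NConst 2)) (Seq (set_n ''L'' (NConst 1)) (set_n ''J'' (NConst 36))))
     (Loop (NLess (nvar ''p'') (nvar ''n''))
       (Seq (set_n ''p'' (NAdd (nvar ''p'') (nvar ''p'')))
         (Seq (set_n ''L'' (NAdd (nvar ''L'') (NConst 1))) (set_n ''J'' (NAdd (nvar ''J'') (NConst 36))))))"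

lemma sim_lg:
  assumes n: "fst \<sigma> ''n'' [] = n"
  shows "sim (6 * lg n + 7) lg_com \<sigma> (return_pmf ()) (\<lambda>\<sigma>' _. fst \<sigma>' ''L'' [] = lg n \<and> fst \<sigma>' ''J'' [] = 36 * lg n)"
proof -
  let ?init = "Seq (set_n ''p'' (NConst 2)) (Seq (set_n ''L'' (NConst 1)) (set_n ''J'' (NConst 36)))"
  let ?body = "Seq (set_n ''p'' (NAdd (nvar ''p'') (nvar ''p'')))
         (Seq (set_n ''L'' (NAdd (nvar ''L'') (NConst 1))) (set_n ''J'' (NAdd (nvar ''J'') (NConst 36))))"
  let ?I = "\<lambda>L \<sigma>. fst \<sigma> ''n'' [] = n \<and> fst \<sigma> ''p'' [] = 2 ^ L \<and> fst \<sigma> ''L'' [] = L \<and> fst \<sigma> ''J'' [] = 36 * L \<and>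
     1 \<le> L \<and> (L = 1 \<or> 2 ^ (L - 1) < n)"
  let ?P = "\<lambda>\<sigma>' (_ :: unit). fst \<sigma>' ''L'' [] = lg n \<and> fst \<sigma>' ''J'' [] = 36 * lg n"
  have loop: "sim (6 * j + 1) (Loop (NLess (nvar ''p'') (nvar ''n'')) ?body) \<sigma> (return_pmf ()) ?P"
    if "?I L \<sigma>" "lg n - L = j" for L \<sigma> j
    using that
  proof (induction j arbitrary: L \<sigma>)
    case 0
    have "n \<le> 2 ^ lg n" by (rule lg)
    also have "(2::nat) ^ lg n \<le> 2 ^ L" using 0 by (intro power_increasing) auto
    finally have le: "n \<le> 2 ^ L" .
    have "lg n = L" using 0 le by (intro lg_eqI) auto
    then show ?case using 0 le sim_Loop_False[of "NLess (nvar ''p'') (nvar ''n'')" \<sigma> ?P "()" ?body] by simp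
  next
    case (Suc j)
    show ?case
    proof (cases "n \<le> 2 ^ L")
      case True
      then have "lg n = L" using Suc.prems by (intro lg_eqI) auto
      then show ?thesis using Suc.prems by simp
    next
      case False
      have b: "bval (NLess (nvar ''p'') (nvar ''n'')) \<sigma>" using False Suc.prems(1) by simp
      have c: "sim (time ?body) ?body \<sigma> (return_pmf ()) (\<lambda>\<sigma>' _. ?I (Suc L) \<sigma>')"
        using Suc.prems(1) False by (intro sim_straight) (auto simp: nput_def)
      have "sim (time ?body + (6 * j + 1) + 1) (Loop (NLess (nvar ''p'') (nvar ''n'')) ?body) \<sigma> (return_pmf ()) ?P"
        by (rule sim_Loop_True_det[OF b c]) (use Suc in auto)
      then show ?thesis by (rule sim_weaken) auto
    qed
  qed
  have c: "sim (time ?init) ?init \<sigma> (return_pmf ()) (\<lambda>\<sigma>' _. ?I 1 \<sigma>')"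
    using n by (intro sim_straight) (auto simp: nput_def)
  have "sim (time ?init + (6 * (lg n - 1) + 1) + 1) lg_com \<sigma> (return_pmf ()) ?P"
    unfolding lg_com_def by (rule sim_Seq_det[OF c]) (rule loop, auto)
  then show ?thesis by (rule sim_weaken) auto
qed

definition grid :: "com \<Rightarrow> com" where
  "grid c = For ''x'' (nvar ''n'') (For ''y'' (nvar ''n'') c)"

lemma mod_grid [simp]: "modN (grid c) = insert ''x'' (insert ''y'' (modN c))" "modR (grid c) = modR c"
  by (auto simp: grid_def)

definition grid_time :: "nat \<Rightarrow> nat \<Rightarrow> nat" where
  "grid_time n t = n * (n * (t + 3) + 3 + 3) + 3"

text \<open>\<open>P\<close> is indexed by the set of visited cells, which hides the order of
  traversal from the cell argument.\<close>

lemma sim_grid: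
  assumes n: "fst \<sigma> ''n'' [] = n" and nm: "''n'' \<notin> modN c" "''x'' \<notin> modN c" "''y'' \<notin> modN c"
    and init: "P {} \<sigma>"
    and stable: "\<And>A \<sigma>' j. P A \<sigma>' \<Longrightarrow> P A (nput ''x'' [] j \<sigma>')" "\<And>A \<sigma>' j. P A \<sigma>' \<Longrightarrow> P A (nput ''y'' [] j \<sigma>')"
    and cell: "\<And>A \<sigma>' x y. x < n \<Longrightarrow> y < n \<Longrightarrow> fst \<sigma>' ''x'' [] = x \<Longrightarrow> fst \<sigma>' ''y'' [] = y \<Longrightarrow>
       eqv (insert ''x'' (insert ''y'' (modN c))) (modR c) \<sigma> \<sigma>' \<Longrightarrow> P A \<sigma>' \<Longrightarrow>
       sim t c \<sigma>' (return_pmf ()) (\<lambda>\<sigma>'' _. P (insert (x, y) A) \<sigma>'')"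
  shows "sim (grid_time n t) (grid c) \<sigma> (return_pmf ()) (\<lambda>\<sigma>' _. P ({..<n} \<times> {..<n}) \<sigma>')"
proof -
  have "sim (n * ((n * (t + 3) + 3) + 3) + 3) (For ''x'' (nvar ''n'') (For ''y'' (nvar ''n'') c)) \<sigma> (return_pmf ())
    (\<lambda>\<sigma>' _. P ({..<n} \<times> {..<n}) \<sigma>')"
  proof (rule sim_For_det[where I = "\<lambda>k \<sigma>'. P ({..<k} \<times> {..<n}) \<sigma>'"])
    fix x \<sigma>'
    assume x: "x < n" "fst \<sigma>' ''x'' [] = x" "P ({..<x} \<times> {..<n}) \<sigma>'"
      and f: "eqv (insert ''x'' (modN (For ''y'' (nvar ''n'') c))) (modR (For ''y'' (nvar ''n'') c)) \<sigma> \<sigma>'"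
    have n': "fst \<sigma>' ''n'' [] = n" using f nm n by (simp add: eqv_def)
    have "sim (n * (t + 3) + 3) (For ''y'' (nvar ''n'') c) \<sigma>' (return_pmf ())
       (\<lambda>\<sigma>'' _. P ({..<x} \<times> {..<n} \<union> {x} \<times> {..<n}) \<sigma>'')"
    proof (rule sim_For_det[where I = "\<lambda>k \<sigma>''. P ({..<x} \<times> {..<n} \<union> {x} \<times> {..<k}) \<sigma>''"])
      fix y \<sigma>''
      assume y: "y < n" "fst \<sigma>'' ''y'' [] = y" "P ({..<x} \<times> {..<n} \<union> {x} \<times> {..<y}) \<sigma>''"
        and g: "eqv (insert ''y'' (modN c)) (modR c) \<sigma>' \<sigma>''"
      have "fst \<sigma>'' ''x'' [] = x" using g nm x by (simp add: eqv_def)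
      moreover have "eqv (insert ''x'' (insert ''y'' (modN c))) (modR c) \<sigma> \<sigma>''"
      proof (rule eqv_trans)
        show "eqv (insert ''x'' (insert ''y'' (modN c))) (modR c) \<sigma> \<sigma>'" using f by simp
        show "eqv (insert ''x'' (insert ''y'' (modN c))) (modR c) \<sigma>' \<sigma>''" by (rule eqv_mono[OF g]) auto
      qed
      ultimately have "sim t c \<sigma>'' (return_pmf ()) (\<lambda>\<sigma>'' _. P (insert (x, y) ({..<x} \<times> {..<n} \<union> {x} \<times> {..<y})) \<sigma>'')"
        using cell[OF x(1) y(1)] y by blast
      moreover have "insert (x, y) ({..<x} \<times> {..<n} \<union> {x} \<times> {..<y}) = {..<x} \<times> {..<n} \<union> {x} \<times> {..<Suc y}" by auto
      ultimately show "sim t c \<sigma>'' (return_pmf ()) (\<lambda>\<sigma>'' _. P ({..<x} \<times> {..<n} \<union> {x} \<times> {..<Suc y}) \<sigma>'')" by simp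
    qed (use x stable nm n' in \<open>auto simp: eqv_def\<close>)
    moreover have "{..<x} \<times> {..<n} \<union> {x} \<times> {..<n} = {..<Suc x} \<times> {..<n}" by auto
    ultimately show "sim (n * (t + 3) + 3) (For ''y'' (nvar ''n'') c) \<sigma>' (return_pmf ()) (\<lambda>\<sigma>'' _. P ({..<Suc x} \<times> {..<n}) \<sigma>'')" by simp
  qed (use init stable nm n in \<open>auto simp: eqv_def\<close>)
  then show ?thesis by (simp add: grid_def grid_time_def)
qed

section \<open>All-pairs distances by repeated edge relaxation\<close>

definition init_com :: com where
  "init_com = Cond (BAnd (BNot (NLess (nvar ''x'') (nvar ''y''))) (BNot (NLess (nvar ''y'') (nvar ''x''))))
     (Seq (NAssign ''r'' [nvar ''x'', nvar ''y''] (NConst 1)) (RAssign ''d'' [nvar ''x'', nvar ''y''] (rnum 0)))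
     (NAssign ''r'' [nvar ''x'', nvar ''y''] (NConst 0))"

text \<open>The nested negations read: \<open>y\<close> is not reached yet, or only by a longer
  walk. The old entry counts only if its flag is set.\<close>

definition relax_com :: com where
  "relax_com = Cond (BAnd (npos (NGet ''E'' [nvar ''x'', nvar ''y''])) (BAnd (npos (NGet ''r'' [nvar ''u'', nvar ''x'']))
       (BNot (BAnd (npos (NGet ''r'' [nvar ''u'', nvar ''y'']))
         (BNot (RLess (RAdd (RGet ''d'' [nvar ''u'', nvar ''x'']) (RGet ''v'' [nvar ''x'', nvar ''y''])) (RGet ''d'' [nvar ''u'', nvar ''y''])))))))
     (Seq (NAssign ''r'' [nvar ''u'', nvar ''y''] (NConst 1))
       (RAssign ''d'' [nvar ''u'', nvar ''y''] (RAdd (RGet ''d'' [nvar ''u'', nvar ''x'']) (RGet ''v'' [nvar ''x'', nvar ''y'']))))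
     skip"

lemma time_init: "time init_com = 5" and time_relax: "time relax_com = 5"
  by (simp_all add: init_com_def relax_com_def)

definition bf_com :: com where
  "bf_com = Seq (grid init_com) (For ''i'' (nvar ''n'') (For ''u'' (nvar ''n'') (grid relax_com)))"

definition bf_time :: "nat \<Rightarrow> nat" where
  "bf_time n = grid_time n 5 + (n * (n * (grid_time n 5 + 3) + 3 + 3) + 3) + 1"

lemma mod_bf: "modN bf_com = {''x'', ''y'', ''u'', ''i'', ''r'', ''skip''}" "modR bf_com = {''d''}"
  by (auto simp: bf_com_def init_com_def relax_com_def)

context graph
begin

text \<open>Updates happen in place, so entries can run ahead of the round: some walk attains each
  of them, and they are at most as long as any walk with at most \<open>i\<close> edges.
  \<open>Done\<close> records the one-edge extensions already tried in the current round.\<close>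

definition bf_inv :: "weight \<Rightarrow> nat \<Rightarrow> (nat \<times> nat \<times> nat) set \<Rightarrow> store \<Rightarrow> bool" where
  "bf_inv v i Done \<sigma> \<longleftrightarrow>
     (\<forall>u<n. \<forall>y<n. 0 < fst \<sigma> ''r'' [u, y] \<longrightarrow> (\<exists>p. is_walk E u y p \<and> wlen v p = snd \<sigma> ''d'' [u, y])) \<and>
     (\<forall>u<n. \<forall>y p. is_walk E u y p \<and> length p \<le> Suc i \<longrightarrow> 0 < fst \<sigma> ''r'' [u, y] \<and> snd \<sigma> ''d'' [u, y] \<le> wlen v p) \<and>
     (\<forall>u x y p. (u, x, y) \<in> Done \<and> {x, y} \<in> E \<and> is_walk E u x p \<and> length p \<le> Suc i \<longrightarrow>
        0 < fst \<sigma> ''r'' [u, y] \<and> snd \<sigma> ''d'' [u, y] \<le> wlen v p + v {x, y})"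

lemma bf_inv_cong:
  "bf_inv v i Done \<sigma> \<Longrightarrow> fst \<sigma>' ''r'' = fst \<sigma> ''r'' \<Longrightarrow> snd \<sigma>' ''d'' = snd \<sigma> ''d'' \<Longrightarrow> bf_inv v i Done \<sigma>'"
  by (simp add: bf_inv_def)

lemma bf_inv_nput: "x \<noteq> ''r'' \<Longrightarrow> bf_inv v i Done (nput x is k \<sigma>) = bf_inv v i Done \<sigma>"
  by (auto simp: bf_inv_def nput_def)

lemma relax_step:
  assumes inv: "bf_inv v i Done \<sigma>" and env: "env n E \<sigma>" "vals ''v'' E v \<sigma>"
    and u: "u < n" "fst \<sigma> ''u'' [] = u" "fst \<sigma> ''x'' [] = x" "fst \<sigma> ''y'' [] = y"
  shows "bf_inv v i (insert (u, x, y) Done) (exec relax_com \<sigma>)"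
proof -
  let ?r = "\<lambda>u y. fst \<sigma> ''r'' [u, y]" and ?d = "\<lambda>u y. snd \<sigma> ''d'' [u, y]"
  have S: "\<And>u y. u < n \<Longrightarrow> y < n \<Longrightarrow> 0 < ?r u y \<Longrightarrow> \<exists>p. is_walk E u y p \<and> wlen v p = ?d u y"
    and P: "\<And>u y p. u < n \<Longrightarrow> is_walk E u y p \<Longrightarrow> length p \<le> Suc i \<Longrightarrow> 0 < ?r u y \<and> ?d u y \<le> wlen v p"
    and Q: "\<And>u x y p. (u, x, y) \<in> Done \<Longrightarrow> {x, y} \<in> E \<Longrightarrow> is_walk E u x p \<Longrightarrow> length p \<le> Suc i \<Longrightarrow>
        0 < ?r u y \<and> ?d u y \<le> wlen v p + v {x, y}"
    using inv unfolding bf_inv_def by blast+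
  define c where "c \<longleftrightarrow> {x, y} \<in> E \<and> 0 < ?r u x \<and> \<not> (0 < ?r u y \<and> \<not> ?d u x + snd \<sigma> ''v'' [x, y] < ?d u y)"
  have cv: "bval (BAnd (npos (NGet ''E'' [nvar ''x'', nvar ''y''])) (BAnd (npos (NGet ''r'' [nvar ''u'', nvar ''x'']))
       (BNot (BAnd (npos (NGet ''r'' [nvar ''u'', nvar ''y'']))
         (BNot (RLess (RAdd (RGet ''d'' [nvar ''u'', nvar ''x'']) (RGet ''v'' [nvar ''x'', nvar ''y''])) (RGet ''d'' [nvar ''u'', nvar ''y'']))))))) \<sigma> \<longleftrightarrow> c"
    using env(1) u by (simp add: c_def env_def)
  show ?thesis
  proof (cases c)
    case True
    have xy: "{x, y} \<in> E" "0 < ?r u x" using True by (auto simp: c_def)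
    have lt: "x < n" "y < n" using edge_less[OF xy(1)] by auto
    have ve: "snd \<sigma> ''v'' [x, y] = v {x, y}" using env(2) xy(1) by (simp add: vals_def)
    define \<sigma>' where "\<sigma>' = exec relax_com \<sigma>"
    have r': "fst \<sigma>' ''r'' = (fst \<sigma> ''r'')([u, y] := 1)" and d': "snd \<sigma>' ''d'' = (snd \<sigma> ''d'')([u, y] := ?d u x + v {x, y})"
      unfolding \<sigma>'_def relax_com_def exec.simps cv using True u ve by (auto simp: nput_def rput_def)
    obtain p where p: "is_walk E u x p" "wlen v p = ?d u x" using S[OF u(1) lt(1) xy(2)] by blast
    have w: "is_walk E u y (p @ [y])" "wlen v (p @ [y]) = ?d u x + v {x, y}"
      using is_walk_appendI[OF p(1) xy(1)] wlen_append[OF p(1), of y y "[y]" v] p(2) by simp_all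
    have less: "snd \<sigma>' ''d'' [a, b] \<le> ?d a b" if "0 < ?r a b" for a b
      using True that ve by (auto simp: d' c_def)
    have rpos: "0 < fst \<sigma>' ''r'' [a, b]" if "0 < ?r a b" for a b using that by (simp add: r')
    have "bf_inv v i (insert (u, x, y) Done) \<sigma>'"
      unfolding bf_inv_def
    proof (intro conjI allI impI)
      fix a b assume "a < n" "b < n" "0 < fst \<sigma>' ''r'' [a, b]"
      then show "\<exists>p. is_walk E a b p \<and> wlen v p = snd \<sigma>' ''d'' [a, b]"
        using S[of a b] w by (cases "a = u \<and> b = y") (auto simp: r' d')
    next
      fix a b q assume "a < n" "is_walk E a b q \<and> length q \<le> Suc i"
      then have "0 < ?r a b" "?d a b \<le> wlen v q" using P by auto
      then show "0 < fst \<sigma>' ''r'' [a, b]" "snd \<sigma>' ''d'' [a, b] \<le> wlen v q" using less[of a b] rpos[of a b] by auto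
    next
      fix a b b' q
      assume *: "(a, b, b') \<in> insert (u, x, y) Done \<and> {b, b'} \<in> E \<and> is_walk E a b q \<and> length q \<le> Suc i"
      have "0 < fst \<sigma>' ''r'' [a, b'] \<and> snd \<sigma>' ''d'' [a, b'] \<le> wlen v q + v {b, b'}"
      proof (cases "(a, b, b') \<in> Done")
        case True
        then have "0 < ?r a b'" "?d a b' \<le> wlen v q + v {b, b'}" using Q * by auto
        then show ?thesis using less[of a b'] rpos[of a b'] by auto
      next
        case False
        then have "a = u" "b = x" "b' = y" using * by auto
        moreover have "?d u x \<le> wlen v q" using P[OF u(1), of x q] * calculation by auto
        ultimately show ?thesis by (simp add: r' d')
      qed
      then show "0 < fst \<sigma>' ''r'' [a, b']" "snd \<sigma>' ''d'' [a, b'] \<le> wlen v q + v {b, b'}" by auto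
    qed
    then show ?thesis by (simp add: \<sigma>'_def)
  next
    case False
    have e: "exec relax_com \<sigma> = exec skip \<sigma>" unfolding relax_com_def exec.simps cv using False by simp
    have "bf_inv v i (insert (u, x, y) Done) \<sigma>"
      unfolding bf_inv_def
    proof (intro conjI)
      show "\<forall>a b b' q. (a, b, b') \<in> insert (u, x, y) Done \<and> {b, b'} \<in> E \<and> is_walk E a b q \<and> length q \<le> Suc i \<longrightarrow>
        0 < ?r a b' \<and> ?d a b' \<le> wlen v q + v {b, b'}"
      proof (intro allI impI)
        fix a b b' q
        assume *: "(a, b, b') \<in> insert (u, x, y) Done \<and> {b, b'} \<in> E \<and> is_walk E a b q \<and> length q \<le> Suc i"
        show "0 < ?r a b' \<and> ?d a b' \<le> wlen v q + v {b, b'}"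
        proof (cases "(a, b, b') \<in> Done")
          case True
          then show ?thesis using Q * by auto
        next
          case nd: False
          then have eq: "a = u" "b = x" "b' = y" using * by auto
          have "0 < ?r u x" "?d u x \<le> wlen v q" using P[OF u(1), of x q] * eq by auto
          moreover have "snd \<sigma> ''v'' [x, y] = v {x, y}" using env(2) * eq by (simp add: vals_def)
          ultimately show ?thesis using False * eq by (auto simp: c_def)
        qed
      qed
    qed (use S P in blast)+
    then show ?thesis unfolding e by (rule bf_inv_cong) (auto simp: nput_def)
  qed
qed

text \<open>A walk with one more edge is a walk covered before the round followed by its last edge,
  and that extension has been relaxed.\<close>

lemma bf_inv_round:
  assumes "bf_inv v i ({..<n} \<times> {..<n} \<times> {..<n}) \<sigma>" shows "bf_inv v (Suc i) {} \<sigma>"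
proof -
  have P: "\<And>u y p. u < n \<Longrightarrow> is_walk E u y p \<Longrightarrow> length p \<le> Suc i \<Longrightarrow> 0 < fst \<sigma> ''r'' [u, y] \<and> snd \<sigma> ''d'' [u, y] \<le> wlen v p"
    and Q: "\<And>u x y p. u < n \<Longrightarrow> {x, y} \<in> E \<Longrightarrow> is_walk E u x p \<Longrightarrow> length p \<le> Suc i \<Longrightarrow>
        0 < fst \<sigma> ''r'' [u, y] \<and> snd \<sigma> ''d'' [u, y] \<le> wlen v p + v {x, y}"
  proof -
    fix u y p assume "u < n" "is_walk E u y p" "length p \<le> Suc i"
    then show "0 < fst \<sigma> ''r'' [u, y] \<and> snd \<sigma> ''d'' [u, y] \<le> wlen v p"
      using assms unfolding bf_inv_def by blast
  next
    fix u x y p assume *: "u < n" "{x, y} \<in> E" "is_walk E u x p" "length p \<le> Suc i"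
    have "(u, x, y) \<in> {..<n} \<times> {..<n} \<times> {..<n}" using * edge_less[OF *(2)] by simp
    then show "0 < fst \<sigma> ''r'' [u, y] \<and> snd \<sigma> ''d'' [u, y] \<le> wlen v p + v {x, y}"
      using assms *(2-4) unfolding bf_inv_def by blast
  qed
  have "0 < fst \<sigma> ''r'' [u, y] \<and> snd \<sigma> ''d'' [u, y] \<le> wlen v p"
    if u: "u < n" and p: "is_walk E u y p" "length p \<le> Suc (Suc i)" for u y p
  proof (cases "length p \<le> Suc i")
    case False
    obtain q z where q: "p = q @ [z]" using p(1) by (metis is_walk_def rev_exhaust)
    have qn: "q \<noteq> []" using False q by auto
    have z: "z = y" using p(1) q by (simp add: is_walk_def)
    have w: "is_walk E u (last q) q" "{last q, y} \<in> E" using p(1) qn is_walk_append_iff[OF qn, of "[y]" E u y] by (auto simp: q z)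
    then have "0 < fst \<sigma> ''r'' [u, y] \<and> snd \<sigma> ''d'' [u, y] \<le> wlen v q + v {last q, y}"
      using Q[OF u w(2,1)] p(2) q by simp
    then show ?thesis using wlen_append[OF w(1), of y y "[y]" v] by (simp add: q z)
  qed (use P u p in blast)
  moreover have "\<forall>u<n. \<forall>y<n. 0 < fst \<sigma> ''r'' [u, y] \<longrightarrow> (\<exists>p. is_walk E u y p \<and> wlen v p = snd \<sigma> ''d'' [u, y])"
    using assms unfolding bf_inv_def by (rule conjunct1)
  ultimately show ?thesis unfolding bf_inv_def by blast
qed

text \<open>Shortest paths are simple and thus have at most \<open>n\<close> vertices, so
  \<open>n\<close> rounds suffice.\<close>

lemma bf_inv_table:
  assumes inv: "bf_inv v n {} \<sigma>" and nn: "\<forall>e\<in>E. 0 \<le> v e"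
  shows "table n E v \<sigma>"
  unfolding table_def
proof (intro allI impI conjI)
  fix u y assume u: "u < n" "y < n"
  have S: "\<exists>p. is_walk E u y p \<and> wlen v p = snd \<sigma> ''d'' [u, y]" if "0 < fst \<sigma> ''r'' [u, y]"
    using inv u that unfolding bf_inv_def by blast
  have P: "0 < fst \<sigma> ''r'' [u, y] \<and> snd \<sigma> ''d'' [u, y] \<le> dist v u y" if "conn E u y"
  proof -
    obtain p where p: "is_path E u y p" "wlen v p = dist v u y" using dist_attained[OF \<open>conn E u y\<close> nn] by blast
    then have "is_walk E u y p \<and> length p \<le> Suc n" using path_length_le[OF p(1) u(1)] by (simp add: is_path_def)
    then show ?thesis using inv u(1) p(2) unfolding bf_inv_def by metis
  qed
  show "0 < fst \<sigma> ''r'' [u, y] \<longleftrightarrow> conn E u y" using S P by (auto simp: conn_def)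
  show "snd \<sigma> ''d'' [u, y] = dist v u y" if "conn E u y"
    using S P[OF that] dist_le_wlen[OF _ nn] by force
qed

lemma sim_bf:
  assumes env: "env n E \<sigma>" "vals ''v'' E v \<sigma>" and nn: "\<forall>e\<in>E. 0 \<le> v e"
  shows "sim (bf_time n) bf_com \<sigma> (return_pmf ()) (\<lambda>\<sigma>' _. table n E v \<sigma>')"
proof -
  have n: "fst \<sigma> ''n'' [] = n" using env by (simp add: env_def)
  let ?P = "\<lambda>A (\<sigma> :: store). \<forall>x y. (x, y) \<in> A \<longrightarrow> fst \<sigma> ''r'' [x, y] = of_bool (x = y) \<and> (x = y \<longrightarrow> snd \<sigma> ''d'' [x, y] = 0)"
  have "sim (grid_time n (time init_com)) (grid init_com) \<sigma> (return_pmf ()) (\<lambda>\<sigma>' _. ?P ({..<n} \<times> {..<n}) \<sigma>')"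
  proof (rule sim_grid[OF n])
    fix A \<sigma>' x y assume xy: "fst \<sigma>' ''x'' [] = x" "fst \<sigma>' ''y'' [] = y" and P: "?P A \<sigma>'"
    have r: "fst (exec init_com \<sigma>') ''r'' = (fst \<sigma>' ''r'')([x, y] := of_bool (x = y))"
      and d: "snd (exec init_com \<sigma>') ''d'' = (if x = y then (snd \<sigma>' ''d'')([x, y] := 0) else snd \<sigma>' ''d'')"
      using xy by (auto simp: init_com_def nput_def rput_def)
    have "?P (insert (x, y) A) (exec init_com \<sigma>')" unfolding r d using P by auto
    then show "sim (time init_com) init_com \<sigma>' (return_pmf ()) (\<lambda>\<sigma>'' _. ?P (insert (x, y) A) \<sigma>'')"
      by (intro sim_straight) (auto simp: init_com_def)
  qed (auto simp: init_com_def nput_def)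
  then have c: "sim (grid_time n 5) (grid init_com) \<sigma> (return_pmf ()) (\<lambda>\<sigma>' _. bf_inv v 0 {} \<sigma>')"
  proof (rule sim_weaken)
    fix \<sigma>' assume *: "?P ({..<n} \<times> {..<n}) \<sigma>'"
    have one: "p = [u] \<and> y = u" if "is_walk E u y p" "length p \<le> Suc 0" for u y p
      using that by (cases p) (auto simp: is_walk_def)
    show "bf_inv v 0 {} \<sigma>'" unfolding bf_inv_def
    proof (intro conjI allI impI)
      fix u y assume "u < n" "y < n" "0 < fst \<sigma>' ''r'' [u, y]"
      then have "u = y" "snd \<sigma>' ''d'' [u, y] = 0" using * by (auto split: if_splits simp: of_bool_def)
      then show "\<exists>p. is_walk E u y p \<and> wlen v p = snd \<sigma>' ''d'' [u, y]" by (intro exI[of _ "[u]"]) simp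
    next
      fix u y p assume "u < n" "is_walk E u y p \<and> length p \<le> Suc 0"
      then have "p = [u]" "y = u" "u < n" using one by auto
      then show "0 < fst \<sigma>' ''r'' [u, y]" "snd \<sigma>' ''d'' [u, y] \<le> wlen v p" using * by auto
    qed auto
  qed (simp add: time_init)
  have "sim (grid_time n 5 + (n * ((n * (grid_time n 5 + 3) + 3) + 3) + 3) + 1) bf_com \<sigma> (return_pmf ()) (\<lambda>\<sigma>' _. bf_inv v n {} \<sigma>')"
    unfolding bf_com_def
  proof (rule sim_Seq_det[OF c])
    fix \<sigma>1 assume inv1: "bf_inv v 0 {} \<sigma>1" and f1: "eqv (modN (grid init_com)) (modR (grid init_com)) \<sigma> \<sigma>1"
    have env1: "env n E \<sigma>1" "vals ''v'' E v \<sigma>1" "fst \<sigma>1 ''n'' [] = n"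
      using env f1 n by (auto simp: env_def vals_def eqv_def init_com_def)
    show "sim (n * ((n * (grid_time n 5 + 3) + 3) + 3) + 3) (For ''i'' (nvar ''n'') (For ''u'' (nvar ''n'') (grid relax_com))) \<sigma>1
       (return_pmf ()) (\<lambda>\<sigma>' _. bf_inv v n {} \<sigma>')"
    proof (rule sim_For_det[where I = "\<lambda>k \<sigma>'. bf_inv v k {} \<sigma>'"])
      fix i \<sigma>2 assume inv2: "bf_inv v i {} \<sigma>2"
        and f2: "eqv (insert ''i'' (modN (For ''u'' (nvar ''n'') (grid relax_com)))) (modR (For ''u'' (nvar ''n'') (grid relax_com))) \<sigma>1 \<sigma>2"
      have env2: "env n E \<sigma>2" "vals ''v'' E v \<sigma>2" "fst \<sigma>2 ''n'' [] = n"
        using env1 f2 by (auto simp: env_def vals_def eqv_def relax_com_def)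
      have "sim (n * (grid_time n 5 + 3) + 3) (For ''u'' (nvar ''n'') (grid relax_com)) \<sigma>2
        (return_pmf ()) (\<lambda>\<sigma>' _. bf_inv v i ({..<n} \<times> {..<n} \<times> {..<n}) \<sigma>')"
      proof (rule sim_For_det[where I = "\<lambda>k \<sigma>'. bf_inv v i ({..<k} \<times> {..<n} \<times> {..<n}) \<sigma>'"])
        fix u \<sigma>3 assume u: "u < n" "fst \<sigma>3 ''u'' [] = u" and inv3: "bf_inv v i ({..<u} \<times> {..<n} \<times> {..<n}) \<sigma>3"
          and f3: "eqv (insert ''u'' (modN (grid relax_com))) (modR (grid relax_com)) \<sigma>2 \<sigma>3"
        have env3: "env n E \<sigma>3" "vals ''v'' E v \<sigma>3" "fst \<sigma>3 ''n'' [] = n"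
          using env2 f3 by (auto simp: env_def vals_def eqv_def relax_com_def)
        have "sim (grid_time n (time relax_com)) (grid relax_com) \<sigma>3 (return_pmf ())
          (\<lambda>\<sigma>' _. bf_inv v i ({..<u} \<times> {..<n} \<times> {..<n} \<union> {u} \<times> ({..<n} \<times> {..<n})) \<sigma>')"
        proof (rule sim_grid[where P = "\<lambda>A \<sigma>'. bf_inv v i ({..<u} \<times> {..<n} \<times> {..<n} \<union> {u} \<times> A) \<sigma>'", OF env3(3)])
          fix A \<sigma>4 x y assume xy: "fst \<sigma>4 ''x'' [] = x" "fst \<sigma>4 ''y'' [] = y"
            and f4: "eqv (insert ''x'' (insert ''y'' (modN relax_com))) (modR relax_com) \<sigma>3 \<sigma>4"
            and inv4: "bf_inv v i ({..<u} \<times> {..<n} \<times> {..<n} \<union> {u} \<times> A) \<sigma>4"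
          have env4: "env n E \<sigma>4" "vals ''v'' E v \<sigma>4" "fst \<sigma>4 ''u'' [] = u"
            using env3 f4 u by (auto simp: env_def vals_def eqv_def relax_com_def)
          have "bf_inv v i (insert (u, x, y) ({..<u} \<times> {..<n} \<times> {..<n} \<union> {u} \<times> A)) (exec relax_com \<sigma>4)"
            using relax_step[OF inv4 env4(1,2) u(1) env4(3) xy] .
          then have "bf_inv v i ({..<u} \<times> {..<n} \<times> {..<n} \<union> {u} \<times> insert (x, y) A) (exec relax_com \<sigma>4)"
            by (simp add: Times_insert_right Un_commute)
          then show "sim (time relax_com) relax_com \<sigma>4 (return_pmf ())
            (\<lambda>\<sigma>'' _. bf_inv v i ({..<u} \<times> {..<n} \<times> {..<n} \<union> {u} \<times> insert (x, y) A) \<sigma>'')"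
            by (intro sim_straight) (auto simp: relax_com_def)
        qed (use inv3 in \<open>simp_all add: relax_com_def bf_inv_nput\<close>)
        moreover have "{..<u} \<times> {..<n} \<times> {..<n} \<union> {u} \<times> ({..<n} \<times> {..<n}) = {..<Suc u} \<times> {..<n} \<times> {..<n}" by auto
        ultimately show "sim (grid_time n 5) (grid relax_com) \<sigma>3 (return_pmf ()) (\<lambda>\<sigma>' _. bf_inv v i ({..<Suc u} \<times> {..<n} \<times> {..<n}) \<sigma>')"
          by (simp only: time_relax)
      qed (use inv2 env2(3) in \<open>simp_all add: relax_com_def bf_inv_nput eqv_def\<close>)
      then show "sim (n * (grid_time n 5 + 3) + 3) (For ''u'' (nvar ''n'') (grid relax_com)) \<sigma>2
        (return_pmf ()) (\<lambda>\<sigma>' _. bf_inv v (Suc i) {} \<sigma>')"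
        by (rule sim_weaken) (auto intro: bf_inv_round)
    qed (use inv1 env1(3) in \<open>simp_all add: relax_com_def bf_inv_nput eqv_def\<close>)
  qed
  then have "sim (bf_time n) bf_com \<sigma> (return_pmf ()) (\<lambda>\<sigma>' _. bf_inv v n {} \<sigma>')" by (simp add: bf_time_def)
  then show ?thesis by (rule sim_weaken) (use bf_inv_table[OF _ nn] in auto)
qed

end

section \<open>Sampling a split\<close>

text \<open>The total is increased before the coin is thrown, so the bias is \<open>q / S\<close>
  with the new total; the premises of \<open>sim_res\<close> ensure that this assignment does not
  disturb \<open>q\<close>.\<close>

definition res_com :: "rexp \<Rightarrow> com \<Rightarrow> com" where
  "res_com q upd = Seq (set_r ''S'' (RAdd (rvar ''S'') q))
     (Seq (Flip ''h'' [] (RDiv q (rvar ''S''))) (Cond (npos (nvar ''h'')) upd skip))"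

lemma sim_res:
  assumes q: "rval q \<sigma> = g z" "\<And>r. rval q (rput ''S'' [] r \<sigma>) = g z" and S: "snd \<sigma> ''S'' [] = S0" and upd: "straight upd"
    and R: "R (exec upd (nput ''h'' [] 1 (rput ''S'' [] (S0 + g z) \<sigma>))) (S0 + g z, z)"
      "R (exec skip (nput ''h'' [] 0 (rput ''S'' [] (S0 + g z) \<sigma>))) (S0 + g z, r)"
  shows "sim (time upd + 6) (res_com q upd) \<sigma> (rstep g z (S0, r)) R"
proof -
  let ?\<sigma> = "rput ''S'' [] (S0 + g z) \<sigma>"
  have 1: "sim (time (set_r ''S'' (RAdd (rvar ''S'') q))) (set_r ''S'' (RAdd (rvar ''S'') q)) \<sigma> (return_pmf ()) (\<lambda>\<sigma>' _. \<sigma>' = ?\<sigma>)"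
    using q S by (intro sim_straight) auto
  have rv: "rval (RDiv q (rvar ''S'')) ?\<sigma> = g z / (S0 + g z)" using q by (simp add: rput_def)
  have 2: "sim 1 (Flip ''h'' [] (RDiv q (rvar ''S''))) ?\<sigma> (bernoulli_pmf (g z / (S0 + g z)))
     (\<lambda>\<sigma>' h. \<sigma>' = nput ''h'' [] (if h then 1 else 0) ?\<sigma>)"
    using sim_Flip[of "\<lambda>\<sigma>' h. \<sigma>' = nput ''h'' [] (if h then 1 else 0) ?\<sigma>" "''h''" "[]" ?\<sigma> "RDiv q (rvar ''S'')"] unfolding rv by simp
  have 3: "sim (time upd + 1 + 1) (Cond (npos (nvar ''h'')) upd skip) (nput ''h'' [] (if h then 1 else 0) ?\<sigma>)
     (return_pmf (S0 + g z, if h then z else r)) R" for h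
  proof (rule sim_Cond)
    assume "bval (npos (nvar ''h'')) (nput ''h'' [] (if h then 1 else 0) ?\<sigma>)"
    then have h by (simp add: nput_def split: if_splits)
    then have "sim (time upd) upd (nput ''h'' [] (if h then 1 else 0) ?\<sigma>) (return_pmf (S0 + g z, if h then z else r)) R"
      using upd R(1) by (intro sim_straight) auto
    then show "sim (time upd + 1) upd (nput ''h'' [] (if h then 1 else 0) ?\<sigma>) (return_pmf (S0 + g z, if h then z else r)) R"
      by (rule sim_weaken) auto
  next
    assume "\<not> bval (npos (nvar ''h'')) (nput ''h'' [] (if h then 1 else 0) ?\<sigma>)"
    then have "\<not> h" by (simp add: nput_def split: if_splits)
    then have "sim (time skip) skip (nput ''h'' [] (if h then 1 else 0) ?\<sigma>) (return_pmf (S0 + g z, if h then z else r)) R"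
      using R(2) by (intro sim_straight) auto
    then show "sim (time upd + 1) skip (nput ''h'' [] (if h then 1 else 0) ?\<sigma>) (return_pmf (S0 + g z, if h then z else r)) R"
      by (rule sim_weaken) auto
  qed
  have "sim (1 + (time upd + 1 + 1) + 1) (Seq (Flip ''h'' [] (RDiv q (rvar ''S''))) (Cond (npos (nvar ''h'')) upd skip)) ?\<sigma>
     (bind_pmf (bernoulli_pmf (g z / (S0 + g z))) (\<lambda>h. return_pmf (S0 + g z, if h then z else r))) R"
    by (rule sim_Seq[OF 2]) (use 3 in auto)
  then have 4: "sim (1 + (time upd + 1 + 1) + 1) (Seq (Flip ''h'' [] (RDiv q (rvar ''S''))) (Cond (npos (nvar ''h'')) upd skip)) ?\<sigma> (rstep g z (S0, r)) R"
    by (simp add: rstep_def map_pmf_def)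
  have "sim (time (set_r ''S'' (RAdd (rvar ''S'') q)) + (1 + (time upd + 1 + 1) + 1) + 1) (res_com q upd) \<sigma> (rstep g z (S0, r)) R"
    unfolding res_com_def by (rule sim_Seq_det[OF 1]) (simp only: 4)
  then show ?thesis by (rule sim_weaken) auto
qed

definition uniform_com :: "nat \<Rightarrow> com" where
  "uniform_com J1 = Seq (Seq (set_r ''S'' (rnum 0)) (set_n ''g'' (NConst 0)))
     (For ''k'' (NAdd (nvar ''J'') (NConst J1)) (res_com (rnum 1) (set_n ''g'' (nvar ''k''))))"

text \<open>The machine has neither maximum nor power: each \<open>max\<close> becomes a
  conditional, and the exponent \<open>2 * lg n + 1\<close> a loop of multiplications.\<close>

definition weight_com :: com where
  "weight_com =
     Cond (BAnd (npos (NGet ''E'' [nvar ''x'', nvar ''y''])) (npos (NGet ''r'' [nvar ''a'', nvar ''x''])))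
      (Seq
       (Seq (set_r ''sc'' (RSub (RAdd (RAdd (RGet ''d'' [nvar ''a'', nvar ''x'']) (RGet ''v'' [nvar ''x'', nvar ''y''])) (RGet ''d'' [nvar ''y'', nvar ''b'']))
             (RGet ''d'' [nvar ''a'', nvar ''b''])))
       (Seq (Cond (RLess (rvar ''rho'') (RGet ''d'' [nvar ''a'', nvar ''x'']))
              (set_r ''sc'' (RAdd (rvar ''sc'') (RSub (RGet ''d'' [nvar ''a'', nvar ''x'']) (rvar ''rho'')))) skip)
       (Seq (Cond (RLess (RSub (RGet ''d'' [nvar ''a'', nvar ''b'']) (rvar ''rho'')) (RGet ''d'' [nvar ''y'', nvar ''b'']))
              (set_r ''sc'' (RAdd (rvar ''sc'') (RSub (RGet ''d'' [nvar ''y'', nvar ''b'']) (RSub (RGet ''d'' [nvar ''a'', nvar ''b'']) (rvar ''rho''))))) skip)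
       (Seq (set_r ''yv'' (RSub (rnum 1) (RDiv (rvar ''sc'') (RMul (rvar ''kap'') (RGet ''d'' [nvar ''a'', nvar ''b''])))))
       (Seq (Cond (RLess (rvar ''yv'') (rnum 0)) (set_r ''yv'' (rnum 0)) skip)
            (set_r ''pw'' (rnum 1)))))))
       (For ''k'' (NAdd (NAdd (nvar ''L'') (nvar ''L'')) (NConst 1)) (set_r ''pw'' (RMul (rvar ''pw'') (rvar ''yv'')))))
      (set_r ''pw'' (rnum 0))"

definition select_com :: com where
  "select_com = Seq (Seq (set_r ''S'' (rnum 0)) (Seq (set_n ''rx'' (NConst 0)) (set_n ''ry'' (NConst 0))))
     (For ''x'' (nvar ''n'') (For ''y'' (nvar ''n'')
       (Seq weight_com (res_com (rvar ''pw'') (Seq (set_n ''rx'' (nvar ''x'')) (set_n ''ry'' (nvar ''y'')))))))"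

text \<open>Starting the counter at \<open>f\<close> yields \<open>J1 - f\<close> multiplications,
  and none for \<open>f\<close> at least \<open>J1\<close>, in agreement with truncated
  subtraction.\<close>

definition slack_com :: "nat \<Rightarrow> com" where
  "slack_com J1 = Seq (Seq (set_r ''kap'' (RDiv (rvar ''eps'') (RMul (rnum 100) (ROfNat (nvar ''J''))))) (set_n ''k'' (nvar ''f'')))
     (Loop (NLess (nvar ''k'') (NConst J1))
       (Seq (set_r ''kap'' (RMul (rvar ''kap'') (RDiv (rnum 7) (rnum 6)))) (set_n ''k'' (NAdd (nvar ''k'') (NConst 1)))))"

definition radius_com :: "nat \<Rightarrow> com" where
  "radius_com J1 = set_r ''rho'' (RDiv (RMul (RGet ''d'' [nvar ''a'', nvar ''b''])
       (RAdd (ROfNat (NAdd (nvar ''J'') (NConst J1))) (ROfNat (nvar ''g''))))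
     (RMul (rnum 3) (ROfNat (NAdd (nvar ''J'') (NConst J1)))))"

text \<open>The right part goes below the left one, so that vertices are emitted in the order of the
  walk.\<close>

definition push_com :: com where
  "push_com =
     Seq (NAssign ''sa'' [nvar ''sp''] (nvar ''ry''))
    (Seq (NAssign ''sb'' [nvar ''sp''] (nvar ''b''))
    (Seq (NAssign ''sf'' [nvar ''sp''] (nvar ''f''))
    (Seq (NAssign ''sa'' [NAdd (nvar ''sp'') (NConst 1)] (nvar ''a''))
    (Seq (NAssign ''sb'' [NAdd (nvar ''sp'') (NConst 1)] (nvar ''rx''))
    (Seq (NAssign ''sf'' [NAdd (nvar ''sp'') (NConst 1)] (nvar ''f''))
         (set_n ''sp'' (NAdd (nvar ''sp'') (NConst 2))))))))"

definition pop_com :: com where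
  "pop_com =
     Seq (set_n ''sp'' (NSub (nvar ''sp'') (NConst 1)))
    (Seq (set_n ''a'' (NGet ''sa'' [nvar ''sp'']))
    (Seq (set_n ''b'' (NGet ''sb'' [nvar ''sp'']))
         (set_n ''f'' (NGet ''sf'' [nvar ''sp'']))))"

definition emit_com :: com where
  "emit_com = Seq (NAssign ''out'' [nvar ''len''] (nvar ''a'')) (set_n ''len'' (NAdd (nvar ''len'') (NConst 1)))"

definition split_com :: "nat \<Rightarrow> com" where
  "split_com J1 = Seq (set_n ''f'' (NSub (nvar ''f'') (NConst 1)))
     (Seq (slack_com J1) (Seq (uniform_com J1) (Seq (radius_com J1) (Seq select_com push_com))))"

definition node_com :: "nat \<Rightarrow> com" where
  "node_com J1 = Seq pop_com
     (Cond (BAnd (npos (nvar ''f'')) (BNot (BAnd (BNot (NLess (nvar ''a'') (nvar ''b''))) (BNot (NLess (nvar ''b'') (nvar ''a''))))))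
        (split_com J1) emit_com)"

definition dfs_com :: "nat \<Rightarrow> com" where
  "dfs_com J1 = Loop (npos (nvar ''sp'')) (node_com J1)"

definition slack_time :: "nat \<Rightarrow> nat" where "slack_time J1 = 4 * J1 + 5"
definition uniform_time :: "nat \<Rightarrow> nat \<Rightarrow> nat" where "uniform_time J1 n = (36 * lg n + J1) * 10 + 7"
definition weight_time :: "nat \<Rightarrow> nat" where "weight_time n = (2 * lg n + 1) * 4 + 26"
definition select_time :: "nat \<Rightarrow> nat" where "select_time n = n * ((n * ((weight_time n + 10) + 3) + 3) + 3) + 9"

definition node_time :: "nat \<Rightarrow> nat \<Rightarrow> nat" where
  "node_time J1 n = slack_time J1 + uniform_time J1 n + select_time n + 40"

lemma sim_slack:
  assumes "snd \<sigma> ''eps'' [] = \<epsilon>" "fst \<sigma> ''J'' [] = 36 * lg n" "fst \<sigma> ''f'' [] = f"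
  shows "sim (slack_time J1) (slack_com J1) \<sigma> (return_pmf ()) (\<lambda>\<sigma>' _. snd \<sigma>' ''kap'' [] = slack \<epsilon> J1 n f)"
proof -
  let ?body = "Seq (set_r ''kap'' (RMul (rvar ''kap'') (RDiv (rnum 7) (rnum 6)))) (set_n ''k'' (NAdd (nvar ''k'') (NConst 1)))"
  let ?b = "NLess (nvar ''k'') (NConst J1)"
  let ?init = "Seq (set_r ''kap'' (RDiv (rvar ''eps'') (RMul (rnum 100) (ROfNat (nvar ''J''))))) (set_n ''k'' (nvar ''f''))"
  have loop: "sim (4 * j + 1) (Loop ?b ?body) \<sigma> (return_pmf ()) (\<lambda>\<sigma>' _. snd \<sigma>' ''kap'' [] = c * (7/6) ^ j)"
    if "snd \<sigma> ''kap'' [] = c" "J1 - fst \<sigma> ''k'' [] = j" for j c \<sigma>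
    using that
  proof (induction j arbitrary: c \<sigma>)
    case 0
    then show ?case using sim_Loop_False[of ?b \<sigma> "\<lambda>\<sigma>' _. snd \<sigma>' ''kap'' [] = c" "()" ?body] by simp
  next
    case (Suc j)
    have b: "bval ?b \<sigma>" using Suc.prems by simp
    have c: "sim (time ?body) ?body \<sigma> (return_pmf ()) (\<lambda>\<sigma>' _. snd \<sigma>' ''kap'' [] = c * (7/6) \<and> J1 - fst \<sigma>' ''k'' [] = j)"
      using Suc.prems by (intro sim_straight) (auto simp: nput_def rput_def)
    have "sim (time ?body + (4 * j + 1) + 1) (Loop ?b ?body) \<sigma> (return_pmf ()) (\<lambda>\<sigma>' _. snd \<sigma>' ''kap'' [] = (c * (7/6)) * (7/6) ^ j)"
      by (rule sim_Loop_True_det[OF b c]) (rule Suc.IH, auto)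
    then show ?case by (rule sim_weaken) auto
  qed
  have c: "sim (time ?init) ?init \<sigma> (return_pmf ()) (\<lambda>\<sigma>' _. snd \<sigma>' ''kap'' [] = \<epsilon> / (100 * real (36 * lg n)) \<and> fst \<sigma>' ''k'' [] = f)"
    using assms by (intro sim_straight) (auto simp: nput_def rput_def)
  have "sim (time ?init + (4 * (J1 - f) + 1) + 1) (slack_com J1) \<sigma> (return_pmf ())
    (\<lambda>\<sigma>' _. snd \<sigma>' ''kap'' [] = \<epsilon> / (100 * real (36 * lg n)) * (7/6) ^ (J1 - f))"
    unfolding slack_com_def by (rule sim_Seq_det[OF c]) (rule loop, auto)
  then show ?thesis by (rule sim_weaken) (auto simp: slack_time_def slack_def)
qed

lemma sim_uniform:
  assumes "fst \<sigma> ''J'' [] = 36 * lg n"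
  shows "sim (uniform_time J1 n) (uniform_com J1) \<sigma> (uniform (36 * lg n + J1)) (\<lambda>\<sigma>' i. fst \<sigma>' ''g'' [] = i)"
proof -
  let ?init = "Seq (set_r ''S'' (rnum 0)) (set_n ''g'' (NConst 0))"
  let ?body = "res_com (rnum 1) (set_n ''g'' (nvar ''k''))"
  let ?I = "\<lambda>(k::nat) (\<sigma>::store) z. snd \<sigma> ''S'' [] = fst z \<and> fst \<sigma> ''g'' [] = snd z"
  have c: "sim (time ?init) ?init \<sigma> (return_pmf ()) (\<lambda>\<sigma>' _. ?I 0 \<sigma>' (0, 0))"
    by (intro sim_straight) (auto simp: nput_def rput_def)
  have "sim (time ?init + ((36 * lg n + J1) * (7 + 3) + 3) + 1) (uniform_com J1) \<sigma>
     (iterM (rstep (\<lambda>_. 1)) (36 * lg n + J1) (0, 0)) (\<lambda>\<sigma>' z. fst \<sigma>' ''g'' [] = snd z)"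
    unfolding uniform_com_def
  proof (rule sim_Seq_det[OF c])
    fix \<sigma>1 assume i1: "?I 0 \<sigma>1 (0, 0)" and f1: "eqv (modN ?init) (modR ?init) \<sigma> \<sigma>1"
    have J: "fst \<sigma>1 ''J'' [] = 36 * lg n" using f1 assms by (simp add: eqv_def)
    have "sim ((36 * lg n + J1) * (7 + 3) + 3) (For ''k'' (NAdd (nvar ''J'') (NConst J1)) ?body) \<sigma>1
      (iterM (rstep (\<lambda>_. 1)) (36 * lg n + J1) (0, 0)) (\<lambda>\<sigma>' z. ?I (36 * lg n + J1) \<sigma>' z)"
    proof (rule sim_For)
      fix k \<sigma>2 z assume k: "fst \<sigma>2 ''k'' [] = k" and i2: "?I k \<sigma>2 z"
      have "sim (time (set_n ''g'' (nvar ''k'')) + 6) ?body \<sigma>2 (rstep (\<lambda>_. 1) k (fst z, snd z)) (\<lambda>\<sigma>'' x'. ?I (Suc k) \<sigma>'' x')"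
        using i2 k by (intro sim_res) (auto simp: nput_def rput_def)
      then show "sim 7 ?body \<sigma>2 (rstep (\<lambda>_. 1) k z) (\<lambda>\<sigma>'' x'. ?I (Suc k) \<sigma>'' x')" by simp
    qed (use i1 J in \<open>auto simp: nput_def res_com_def eqv_def\<close>)
    then show "sim ((36 * lg n + J1) * (7 + 3) + 3) (For ''k'' (NAdd (nvar ''J'') (NConst J1)) ?body) \<sigma>1
      (iterM (rstep (\<lambda>_. 1)) (36 * lg n + J1) (0, 0)) (\<lambda>\<sigma>' z. fst \<sigma>' ''g'' [] = snd z)"
      by (rule sim_weaken) auto
  qed
  then have "sim (uniform_time J1 n) (uniform_com J1) \<sigma> (iterM (rstep (\<lambda>_. 1)) (36 * lg n + J1) (0, 0)) (\<lambda>\<sigma>' z. fst \<sigma>' ''g'' [] = snd z)"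
    by (rule sim_weaken) (auto simp: uniform_time_def)
  then show ?thesis unfolding uniform_def by (rule sim_map)
qed

definition context_ok :: "nat \<Rightarrow> nat set set \<Rightarrow> real \<Rightarrow> weight \<Rightarrow> store \<Rightarrow> bool" where
  "context_ok n E \<epsilon> v \<sigma> \<longleftrightarrow> env n E \<sigma> \<and> vals ''v'' E v \<sigma> \<and> table n E v \<sigma> \<and>
     fst \<sigma> ''L'' [] = lg n \<and> fst \<sigma> ''J'' [] = 36 * lg n \<and> snd \<sigma> ''eps'' [] = \<epsilon>"

lemma context_ok_eqv:
  "context_ok n E \<epsilon> v \<sigma> \<Longrightarrow> eqv X Y \<sigma> \<sigma>' \<Longrightarrow> X \<inter> {''n'', ''E'', ''r'', ''L'', ''J''} = {} \<Longrightarrow> Y \<inter> {''v'', ''d'', ''eps''} = {} \<Longrightarrow>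
   context_ok n E \<epsilon> v \<sigma>'"
  by (simp add: context_ok_def env_def vals_def table_def eqv_def)

context graph
begin

lemma sim_weight:
  assumes ctx: "context_ok n E \<epsilon> v \<sigma>" and ab: "conn E a b" "a < n" "b < n"
    and s: "fst \<sigma> ''a'' [] = a" "fst \<sigma> ''b'' [] = b" "fst \<sigma> ''x'' [] = x" "fst \<sigma> ''y'' [] = y" "x < n" "y < n"
      "snd \<sigma> ''kap'' [] = \<kappa>" "snd \<sigma> ''rho'' [] = \<rho>"
  shows "sim (weight_time n) weight_com \<sigma> (return_pmf ()) (\<lambda>\<sigma>' _. snd \<sigma>' ''pw'' [] = gain E v \<kappa> a b \<rho> (x, y) ^ (2 * lg n + 1))"
proof -
  have c: "env n E \<sigma>" "vals ''v'' E v \<sigma>" "table n E v \<sigma>" "fst \<sigma> ''L'' [] = lg n" using ctx by (auto simp: context_ok_def)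
  let ?g = "gain E v \<kappa> a b \<rho> (x, y)"
  have bv: "bval (BAnd (npos (NGet ''E'' [nvar ''x'', nvar ''y''])) (npos (NGet ''r'' [nvar ''a'', nvar ''x'']))) \<sigma> \<longleftrightarrow> {x, y} \<in> E \<and> conn E a x"
    using c s ab by (simp add: env_def table_def)
  have "sim ((21 + ((2 * lg n + 1) * (1 + 3) + 3) + 1) + 1) weight_com \<sigma> (return_pmf ()) (\<lambda>\<sigma>' _. snd \<sigma>' ''pw'' [] = ?g ^ (2 * lg n + 1))"
    unfolding weight_com_def
  proof (rule sim_Cond, unfold bv)
    assume xy: "{x, y} \<in> E \<and> conn E a x"
    have yb: "conn E y b" using ab(1) xy by (meson conn_edgeD conn_sym conn_trans)
    have d: "snd \<sigma> ''d'' [a, x] = dist v a x" "snd \<sigma> ''d'' [y, b] = dist v y b" "snd \<sigma> ''d'' [a, b] = dist v a b"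
      "snd \<sigma> ''v'' [x, y] = v {x, y}"
      using c xy yb ab s by (auto simp: table_def vals_def)
    let ?calc = "Seq (set_r ''sc'' (RSub (RAdd (RAdd (RGet ''d'' [nvar ''a'', nvar ''x'']) (RGet ''v'' [nvar ''x'', nvar ''y''])) (RGet ''d'' [nvar ''y'', nvar ''b'']))
             (RGet ''d'' [nvar ''a'', nvar ''b''])))
       (Seq (Cond (RLess (rvar ''rho'') (RGet ''d'' [nvar ''a'', nvar ''x'']))
              (set_r ''sc'' (RAdd (rvar ''sc'') (RSub (RGet ''d'' [nvar ''a'', nvar ''x'']) (rvar ''rho'')))) skip)
       (Seq (Cond (RLess (RSub (RGet ''d'' [nvar ''a'', nvar ''b'']) (rvar ''rho'')) (RGet ''d'' [nvar ''y'', nvar ''b'']))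
              (set_r ''sc'' (RAdd (rvar ''sc'') (RSub (RGet ''d'' [nvar ''y'', nvar ''b'']) (RSub (RGet ''d'' [nvar ''a'', nvar ''b'']) (rvar ''rho''))))) skip)
       (Seq (set_r ''yv'' (RSub (rnum 1) (RDiv (rvar ''sc'') (RMul (rvar ''kap'') (RGet ''d'' [nvar ''a'', nvar ''b''])))))
       (Seq (Cond (RLess (rvar ''yv'') (rnum 0)) (set_r ''yv'' (rnum 0)) skip)
            (set_r ''pw'' (rnum 1))))))"
    define D1 D2 D3 V where "D1 = dist v a x" "D2 = dist v y b" "D3 = dist v a b" "V = v {x, y}"
    have gv: "?g = max 0 (1 - ((D1 + V + D2 - D3) + max 0 (D1 - \<rho>) + max 0 (D2 - (D3 - \<rho>))) / (\<kappa> * D3))"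
      using xy by (simp add: gain_def score_def D1_D2_D3_V_def)
    have cc: "sim (time ?calc) ?calc \<sigma> (return_pmf ()) (\<lambda>\<sigma>' _. snd \<sigma>' ''yv'' [] = ?g \<and> snd \<sigma>' ''pw'' [] = 1)"
      using s d unfolding gv D1_D2_D3_V_def[symmetric]
      by (intro sim_straight) (auto simp: nput_def rput_def max_def not_less)
    have "sim (time ?calc + ((2 * lg n + 1) * (1 + 3) + 3) + 1)
       (Seq ?calc (For ''k'' (NAdd (NAdd (nvar ''L'') (nvar ''L'')) (NConst 1)) (set_r ''pw'' (RMul (rvar ''pw'') (rvar ''yv''))))) \<sigma>
       (return_pmf ()) (\<lambda>\<sigma>' _. snd \<sigma>' ''pw'' [] = ?g ^ (2 * lg n + 1))"
    proof (rule sim_Seq_det[OF cc])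
      fix \<sigma>1 assume *: "snd \<sigma>1 ''yv'' [] = ?g \<and> snd \<sigma>1 ''pw'' [] = 1" and f: "eqv (modN ?calc) (modR ?calc) \<sigma> \<sigma>1"
      have L: "fst \<sigma>1 ''L'' [] = lg n" using f c(4) by (simp add: eqv_def)
      show "sim ((2 * lg n + 1) * (1 + 3) + 3) (For ''k'' (NAdd (NAdd (nvar ''L'') (nvar ''L'')) (NConst 1)) (set_r ''pw'' (RMul (rvar ''pw'') (rvar ''yv'')))) \<sigma>1
        (return_pmf ()) (\<lambda>\<sigma>' _. snd \<sigma>' ''pw'' [] = ?g ^ (2 * lg n + 1))"
      proof (rule sim_For_det[where I = "\<lambda>k \<sigma>'. snd \<sigma>' ''pw'' [] = ?g ^ k"])
        fix k \<sigma>2 assume "eqv (insert ''k'' (modN (set_r ''pw'' (RMul (rvar ''pw'') (rvar ''yv''))))) (modR (set_r ''pw'' (RMul (rvar ''pw'') (rvar ''yv'')))) \<sigma>1 \<sigma>2"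
          "snd \<sigma>2 ''pw'' [] = ?g ^ k"
        then have "snd \<sigma>2 ''yv'' [] = ?g" "snd \<sigma>2 ''pw'' [] = ?g ^ k" using * by (auto simp: eqv_def)
        then have "sim (time (set_r ''pw'' (RMul (rvar ''pw'') (rvar ''yv'')))) (set_r ''pw'' (RMul (rvar ''pw'') (rvar ''yv''))) \<sigma>2 (return_pmf ())
           (\<lambda>\<sigma>'' _. snd \<sigma>'' ''pw'' [] = ?g ^ Suc k)"
          by (intro sim_straight) (auto simp: rput_def)
        then show "sim 1 (set_r ''pw'' (RMul (rvar ''pw'') (rvar ''yv''))) \<sigma>2 (return_pmf ()) (\<lambda>\<sigma>'' _. snd \<sigma>'' ''pw'' [] = ?g ^ Suc k)" by simp
      qed (use * L in \<open>auto simp: nput_def eqv_def\<close>)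
    qed
    then show "sim (21 + ((2 * lg n + 1) * (1 + 3) + 3) + 1)
       (Seq ?calc (For ''k'' (NAdd (NAdd (nvar ''L'') (nvar ''L'')) (NConst 1)) (set_r ''pw'' (RMul (rvar ''pw'') (rvar ''yv''))))) \<sigma>
       (return_pmf ()) (\<lambda>\<sigma>' _. snd \<sigma>' ''pw'' [] = ?g ^ (2 * lg n + 1))"
      by (rule sim_weaken) auto
  next
    assume "\<not> ({x, y} \<in> E \<and> conn E a x)"
    then have "?g = 0" by (auto simp: gain_def)
    then have "?g ^ (2 * lg n + 1) = 0" by simp
    then have "sim (time (set_r ''pw'' (rnum 0))) (set_r ''pw'' (rnum 0)) \<sigma> (return_pmf ()) (\<lambda>\<sigma>' _. snd \<sigma>' ''pw'' [] = ?g ^ (2 * lg n + 1))"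
      by (intro sim_straight) (auto simp: rput_def)
    then show "sim (21 + ((2 * lg n + 1) * (1 + 3) + 3) + 1) (set_r ''pw'' (rnum 0)) \<sigma> (return_pmf ()) (\<lambda>\<sigma>' _. snd \<sigma>' ''pw'' [] = ?g ^ (2 * lg n + 1))"
      by (rule sim_weaken) auto
  qed
  then show ?thesis by (rule sim_weaken) (auto simp: weight_time_def)
qed

lemma sim_select:
  assumes ctx: "context_ok n E \<epsilon> v \<sigma>" and ab: "conn E a b" "a < n" "b < n"
    and s: "fst \<sigma> ''a'' [] = a" "fst \<sigma> ''b'' [] = b" "snd \<sigma> ''kap'' [] = \<kappa>" "snd \<sigma> ''rho'' [] = \<rho>"
  shows "sim (select_time n) select_com \<sigma> (select (\<lambda>z. gain E v \<kappa> a b \<rho> z ^ (2 * lg n + 1)) n)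
    (\<lambda>\<sigma>' z. fst \<sigma>' ''rx'' [] = fst z \<and> fst \<sigma>' ''ry'' [] = snd z)"
proof -
  define g where "g z = gain E v \<kappa> a b \<rho> z ^ (2 * lg n + 1)" for z
  let ?init = "Seq (set_r ''S'' (rnum 0)) (Seq (set_n ''rx'' (NConst 0)) (set_n ''ry'' (NConst 0)))"
  let ?upd = "Seq (set_n ''rx'' (nvar ''x'')) (set_n ''ry'' (nvar ''y''))"
  let ?body = "Seq weight_com (res_com (rvar ''pw'') ?upd)"
  \<comment> \<open>The round does not occur in this invariant; all progress is in the abstract
    reservoir state.\<close>
  let ?I = "\<lambda>(k::nat) (\<sigma>::store) z. snd \<sigma> ''S'' [] = fst z \<and> fst \<sigma> ''rx'' [] = fst (snd z) \<and> fst \<sigma> ''ry'' [] = snd (snd z)"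
  let ?X = "{''x'', ''y'', ''k'', ''skip'', ''h'', ''rx'', ''ry''}" and ?Y = "{''S'', ''sc'', ''yv'', ''pw''}"
  have mb: "modN ?body = {''k'', ''skip'', ''h'', ''rx'', ''ry''}" "modR ?body = ?Y"
    by (auto simp: weight_com_def res_com_def)
  have mw: "modN weight_com = {''k'', ''skip''}" "modR weight_com = {''sc'', ''yv'', ''pw''}"
    by (auto simp: weight_com_def)
  have c: "sim (time ?init) ?init \<sigma> (return_pmf ()) (\<lambda>\<sigma>' _. ?I 0 \<sigma>' (0, (0, 0)))"
    by (intro sim_straight) (auto simp: nput_def rput_def)
  have body: "sim (weight_time n + 10) ?body \<sigma>' (rstep g (x, y) z) (\<lambda>\<sigma>'' z'. ?I 0 \<sigma>'' z')"
    if f: "eqv ?X ?Y \<sigma> \<sigma>'" and xy: "x < n" "y < n" "fst \<sigma>' ''x'' [] = x" "fst \<sigma>' ''y'' [] = y" and i: "?I 0 \<sigma>' z" for \<sigma>' x y z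
  proof -
    have ctx': "context_ok n E \<epsilon> v \<sigma>'" by (rule context_ok_eqv[OF ctx f]) auto
    have s': "fst \<sigma>' ''a'' [] = a" "fst \<sigma>' ''b'' [] = b" "snd \<sigma>' ''kap'' [] = \<kappa>" "snd \<sigma>' ''rho'' [] = \<rho>"
      using f s by (auto simp: eqv_def)
    have "sim (weight_time n + (time ?upd + 6) + 1) ?body \<sigma>' (rstep g (x, y) z) (\<lambda>\<sigma>'' z'. ?I 0 \<sigma>'' z')"
    proof (rule sim_Seq_det[OF sim_weight[OF ctx' ab s'(1,2) xy(3,4,1,2) s'(3,4)]])
      fix \<sigma>2 assume pw: "snd \<sigma>2 ''pw'' [] = gain E v \<kappa> a b \<rho> (x, y) ^ (2 * lg n + 1)"
        and f2: "eqv (modN weight_com) (modR weight_com) \<sigma>' \<sigma>2"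
      have i2: "?I 0 \<sigma>2 z" "fst \<sigma>2 ''x'' [] = x" "fst \<sigma>2 ''y'' [] = y" using f2 i xy unfolding mw by (auto simp: eqv_def)
      have "sim (time ?upd + 6) (res_com (rvar ''pw'') ?upd) \<sigma>2 (rstep g (x, y) (fst z, snd z)) (\<lambda>\<sigma>'' z'. ?I 0 \<sigma>'' z')"
        using i2 pw by (intro sim_res) (auto simp: nput_def rput_def g_def)
      then show "sim (time ?upd + 6) (res_com (rvar ''pw'') ?upd) \<sigma>2 (rstep g (x, y) z) (\<lambda>\<sigma>'' z'. ?I 0 \<sigma>'' z')" by simp
    qed
    then show ?thesis by (rule sim_weaken) auto
  qed
  have "sim (time ?init + (n * ((n * ((weight_time n + 10) + 3) + 3) + 3) + 3) + 1) select_com \<sigma>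
     (iterM (\<lambda>x. iterM (\<lambda>y. rstep g (x, y)) n) n (0, (0, 0))) (\<lambda>\<sigma>' z. ?I 0 \<sigma>' z)"
    unfolding select_com_def
  proof (rule sim_Seq_det[OF c])
    fix \<sigma>1 assume i1: "?I 0 \<sigma>1 (0, (0, 0))" and f1: "eqv (modN ?init) (modR ?init) \<sigma> \<sigma>1"
    have f1': "eqv ?X ?Y \<sigma> \<sigma>1" by (rule eqv_mono[OF f1]) auto
    have n1: "fst \<sigma>1 ''n'' [] = n" using f1 ctx by (auto simp: eqv_def context_ok_def env_def)
    show "sim (n * ((n * ((weight_time n + 10) + 3) + 3) + 3) + 3) (For ''x'' (nvar ''n'') (For ''y'' (nvar ''n'') ?body)) \<sigma>1
       (iterM (\<lambda>x. iterM (\<lambda>y. rstep g (x, y)) n) n (0, (0, 0))) (\<lambda>\<sigma>' z. ?I 0 \<sigma>' z)"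
    proof (rule sim_For[where I = ?I])
      fix x \<sigma>2 z assume x: "x < n" "fst \<sigma>2 ''x'' [] = x" "?I x \<sigma>2 z"
        and f2: "eqv (insert ''x'' (modN (For ''y'' (nvar ''n'') ?body))) (modR (For ''y'' (nvar ''n'') ?body)) \<sigma>1 \<sigma>2"
      have f2': "eqv ?X ?Y \<sigma> \<sigma>2" by (rule eqv_trans[OF f1' eqv_mono[OF f2]], unfold mod_For mb) auto
      have n2: "fst \<sigma>2 ''n'' [] = n" using f2' ctx by (auto simp: eqv_def context_ok_def env_def)
      show "sim (n * ((weight_time n + 10) + 3) + 3) (For ''y'' (nvar ''n'') ?body) \<sigma>2
        (iterM (\<lambda>y. rstep g (x, y)) n z) (\<lambda>\<sigma>' z. ?I (Suc x) \<sigma>' z)"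
      proof (rule sim_For[where I = ?I])
        fix y \<sigma>3 z assume y: "y < n" "fst \<sigma>3 ''y'' [] = y" "?I y \<sigma>3 z"
          and f3: "eqv (insert ''y'' (modN ?body)) (modR ?body) \<sigma>2 \<sigma>3"
        have f3': "eqv ?X ?Y \<sigma> \<sigma>3" by (rule eqv_trans[OF f2' eqv_mono[OF f3]], unfold mb) auto
        have "fst \<sigma>3 ''x'' [] = x" using f3 x(2) unfolding mb by (simp add: eqv_def)
        then show "sim (weight_time n + 10) ?body \<sigma>3 (rstep g (x, y) z) (\<lambda>\<sigma>'' x'. ?I (Suc y) \<sigma>'' x')"
          using body[OF f3' x(1) y(1)] y by blast
      next
        show "''y'' \<notin> modN ?body" unfolding mb by simp
        show "nval (nvar ''n'') \<sigma>' = n" if "eqv (insert ''y'' (modN ?body)) (modR ?body) \<sigma>2 \<sigma>'" for \<sigma>'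
          using that n2 unfolding mb by (simp add: eqv_def)
      qed (use x in \<open>auto simp: nput_def\<close>)
    next
      show "''x'' \<notin> modN (For ''y'' (nvar ''n'') ?body)" unfolding mod_For mb by simp
      show "nval (nvar ''n'') \<sigma>' = n"
        if "eqv (insert ''x'' (modN (For ''y'' (nvar ''n'') ?body))) (modR (For ''y'' (nvar ''n'') ?body)) \<sigma>1 \<sigma>'" for \<sigma>'
        using that n1 unfolding mod_For mb by (simp add: eqv_def)
    qed (use i1 in \<open>auto simp: nput_def\<close>)
  qed
  then have "sim (select_time n) select_com \<sigma>
     (iterM (\<lambda>x. iterM (\<lambda>y. rstep g (x, y)) n) n (0, (0, 0))) (\<lambda>\<sigma>' z. ?I 0 \<sigma>' z)"
    by (rule sim_weaken) (auto simp: select_time_def)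
  then show ?thesis unfolding select_def g_def[symmetric] by (rule sim_map) auto
qed

end

section \<open>Depth-first expansion\<close>

text \<open>The head of the list is the top of the stack while the arrays grow upwards, hence
  \<open>rev\<close>.\<close>

definition stack_ok :: "store \<Rightarrow> (nat \<times> nat \<times> nat) list \<Rightarrow> bool" where
  "stack_ok \<sigma> st \<longleftrightarrow> fst \<sigma> ''sp'' [] = length st \<and>
     (\<forall>i<length st. (fst \<sigma> ''sa'' [i], fst \<sigma> ''sb'' [i], fst \<sigma> ''sf'' [i]) = rev st ! i)"

lemma stack_ok_Cons:
  "stack_ok \<sigma> ((a, b, f) # st) \<longleftrightarrow> fst \<sigma> ''sp'' [] = Suc (length st) \<and>
     fst \<sigma> ''sa'' [length st] = a \<and> fst \<sigma> ''sb'' [length st] = b \<and> fst \<sigma> ''sf'' [length st] = f \<and>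
     (\<forall>i<length st. (fst \<sigma> ''sa'' [i], fst \<sigma> ''sb'' [i], fst \<sigma> ''sf'' [i]) = rev st ! i)"
  by (auto simp: stack_ok_def less_Suc_eq nth_append)

text \<open>The full binary tree as a crude bound: a node with fuel \<open>Suc f\<close> has two
  subtrees of fuel \<open>f\<close>.\<close>

primrec dfs_time :: "nat \<Rightarrow> nat \<Rightarrow> nat" where
  "dfs_time t 0 = t + 1"
| "dfs_time t (Suc f) = 2 * dfs_time t f + t + 1"

text \<open>Adding \<open>t + 1\<close> turns the recursion into exact doubling.\<close>

lemma dfs_time_le: "dfs_time t f + (t + 1) \<le> (t + 1) * 2 ^ Suc f"
  by (induction f) auto

context instance_params
begin

definition node_ok :: "weight \<Rightarrow> (nat \<times> nat \<times> nat) list \<Rightarrow> nat list \<Rightarrow> store \<Rightarrow> bool" where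
  "node_ok v st acc \<sigma> \<longleftrightarrow> context_ok n E \<epsilon> v \<sigma> \<and> stack_ok \<sigma> st \<and> sp_output \<sigma> = acc"

lemma node_ok_eqv:
  assumes "node_ok v st acc \<sigma>" "eqv X Y \<sigma> \<sigma>'"
    "X \<inter> {''n'', ''E'', ''r'', ''L'', ''J'', ''sp'', ''sa'', ''sb'', ''sf'', ''out'', ''len''} = {}" "Y \<inter> {''v'', ''d'', ''eps''} = {}"
  shows "node_ok v st acc \<sigma>'"
proof -
  have "context_ok n E \<epsilon> v \<sigma>'" using assms context_ok_eqv[of n E \<epsilon> v \<sigma> X Y \<sigma>'] by (auto simp: node_ok_def)
  moreover have "stack_ok \<sigma>' st" "sp_output \<sigma>' = acc"
    using assms by (auto simp: node_ok_def stack_ok_def sp_output_def eqv_def)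
  ultimately show ?thesis by (simp add: node_ok_def)
qed

lemma sim_pop:
  assumes "node_ok v ((a, b, f) # st) acc \<sigma>"
  shows "sim 7 pop_com \<sigma> (return_pmf ())
    (\<lambda>\<sigma>' _. node_ok v st acc \<sigma>' \<and> fst \<sigma>' ''a'' [] = a \<and> fst \<sigma>' ''b'' [] = b \<and> fst \<sigma>' ''f'' [] = f)"
proof -
  have st: "stack_ok \<sigma> ((a, b, f) # st)" and ctx: "context_ok n E \<epsilon> v \<sigma>" and out: "sp_output \<sigma> = acc"
    using assms by (auto simp: node_ok_def)
  have "sim (time pop_com) pop_com \<sigma> (return_pmf ())
    (\<lambda>\<sigma>' _. stack_ok \<sigma>' st \<and> sp_output \<sigma>' = acc \<and> fst \<sigma>' ''a'' [] = a \<and> fst \<sigma>' ''b'' [] = b \<and> fst \<sigma>' ''f'' [] = f)"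
    using st out unfolding stack_ok_Cons
    by (intro sim_straight) (auto simp: pop_com_def nput_def stack_ok_def sp_output_def)
  then show ?thesis
  proof (rule sim_weaken)
    fix \<sigma>' assume "eqv (modN pop_com) (modR pop_com) \<sigma> \<sigma>'"
    then have "context_ok n E \<epsilon> v \<sigma>'" by (rule context_ok_eqv[OF ctx]) (auto simp: pop_com_def)
    moreover assume "stack_ok \<sigma>' st \<and> sp_output \<sigma>' = acc \<and> fst \<sigma>' ''a'' [] = a \<and> fst \<sigma>' ''b'' [] = b \<and> fst \<sigma>' ''f'' [] = f"
    ultimately show "node_ok v st acc \<sigma>' \<and> fst \<sigma>' ''a'' [] = a \<and> fst \<sigma>' ''b'' [] = b \<and> fst \<sigma>' ''f'' [] = f"
      by (simp add: node_ok_def)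
  qed (simp add: pop_com_def)
qed

lemma sim_emit:
  assumes "node_ok v st acc \<sigma>" "fst \<sigma> ''a'' [] = a"
  shows "sim 3 emit_com \<sigma> (return_pmf ()) (\<lambda>\<sigma>' _. node_ok v st (acc @ [a]) \<sigma>')"
proof -
  have st: "stack_ok \<sigma> st" and ctx: "context_ok n E \<epsilon> v \<sigma>" and out: "sp_output \<sigma> = acc"
    using assms by (auto simp: node_ok_def)
  have o: "map (\<lambda>i. ((fst \<sigma> ''out'')([fst \<sigma> ''len'' []] := a)) [i]) [0..<Suc (fst \<sigma> ''len'' [])] = acc @ [a]"
    using out by (auto simp: sp_output_def)
  have "sp_output (exec emit_com \<sigma>) = acc @ [a]"
    using o assms(2) by (simp add: sp_output_def emit_com_def nput_def)
  moreover have "stack_ok (exec emit_com \<sigma>) st" using st by (simp add: stack_ok_def emit_com_def nput_def)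
  ultimately have "sim (time emit_com) emit_com \<sigma> (return_pmf ()) (\<lambda>\<sigma>' _. stack_ok \<sigma>' st \<and> sp_output \<sigma>' = acc @ [a])"
    by (intro sim_straight) (auto simp: emit_com_def)
  then show ?thesis
  proof (rule sim_weaken)
    fix \<sigma>' assume "eqv (modN emit_com) (modR emit_com) \<sigma> \<sigma>'"
    then have "context_ok n E \<epsilon> v \<sigma>'" by (rule context_ok_eqv[OF ctx]) (auto simp: emit_com_def)
    moreover assume "stack_ok \<sigma>' st \<and> sp_output \<sigma>' = acc @ [a]"
    ultimately show "node_ok v st (acc @ [a]) \<sigma>'" by (simp add: node_ok_def)
  qed (simp add: emit_com_def)
qed

lemma sim_push:
  assumes "node_ok v st acc \<sigma>" "fst \<sigma> ''a'' [] = a" "fst \<sigma> ''b'' [] = b" "fst \<sigma> ''f'' [] = f" "fst \<sigma> ''rx'' [] = x" "fst \<sigma> ''ry'' [] = y"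
  shows "sim 13 push_com \<sigma> (return_pmf z) (\<lambda>\<sigma>' z'. z' = z \<and> node_ok v ((a, x, f) # (y, b, f) # st) acc \<sigma>')"
proof -
  have st: "stack_ok \<sigma> st" and ctx: "context_ok n E \<epsilon> v \<sigma>" and out: "sp_output \<sigma> = acc"
    using assms by (auto simp: node_ok_def)
  have sp: "fst \<sigma> ''sp'' [] = length st" using st by (simp add: stack_ok_def)
  have "sp_output (exec push_com \<sigma>) = acc" using out by (simp add: sp_output_def push_com_def nput_def)
  moreover have "stack_ok (exec push_com \<sigma>) ((a, x, f) # (y, b, f) # st)"
    using st assms(2-) sp unfolding stack_ok_Cons
    by (auto simp: push_com_def nput_def stack_ok_def nth_append less_Suc_eq)
  ultimately have "sim (time push_com) push_com \<sigma> (return_pmf z)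
      (\<lambda>\<sigma>' z'. z' = z \<and> stack_ok \<sigma>' ((a, x, f) # (y, b, f) # st) \<and> sp_output \<sigma>' = acc)"
    by (intro sim_straight) (auto simp: push_com_def)
  then show ?thesis
  proof (rule sim_weaken)
    fix \<sigma>' z' assume "eqv (modN push_com) (modR push_com) \<sigma> \<sigma>'"
    then have "context_ok n E \<epsilon> v \<sigma>'" by (rule context_ok_eqv[OF ctx]) (auto simp: push_com_def)
    moreover assume "z' = z \<and> stack_ok \<sigma>' ((a, x, f) # (y, b, f) # st) \<and> sp_output \<sigma>' = acc"
    ultimately show "z' = z \<and> node_ok v ((a, x, f) # (y, b, f) # st) acc \<sigma>'" by (simp add: node_ok_def)
  qed (simp add: push_com_def)
qed

lemma sim_split:
  assumes ok: "node_ok v st acc \<sigma>" and s: "fst \<sigma> ''a'' [] = a" "fst \<sigma> ''b'' [] = b" "fst \<sigma> ''f'' [] = Suc f"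
    and ab: "conn E a b" "a < n" "b < n"
  shows "sim (slack_time J1 + uniform_time J1 n + select_time n + 20) (split_com J1) \<sigma>
    (bind_pmf (uniform J) (\<lambda>i. select (\<lambda>z. gain E v (sl f) a b (radius (dist v a b) J i) z ^ (2 * lg n + 1)) n))
    (\<lambda>\<sigma>' z. node_ok v ((a, fst z, f) # (snd z, b, f) # st) acc \<sigma>')"
proof -
  let ?B = "\<lambda>\<sigma>. node_ok v st acc \<sigma> \<and> fst \<sigma> ''a'' [] = a \<and> fst \<sigma> ''b'' [] = b \<and> fst \<sigma> ''f'' [] = f"
  have B_eqv: "?B \<sigma>'" if "?B \<sigma>" "eqv X Y \<sigma> \<sigma>'"
    "X \<inter> {''n'', ''E'', ''r'', ''L'', ''J'', ''sp'', ''sa'', ''sb'', ''sf'', ''out'', ''len'', ''a'', ''b'', ''f''} = {}" "Y \<inter> {''v'', ''d'', ''eps''} = {}"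
    for \<sigma> \<sigma>' X Y
  proof -
    have "node_ok v st acc \<sigma>'" by (rule node_ok_eqv[OF _ that(2)]) (use that in auto)
    then show ?thesis using that by (auto simp: eqv_def)
  qed
  have J: "fst \<sigma>' ''J'' [] = 36 * lg n" "snd \<sigma>' ''eps'' [] = \<epsilon>" "context_ok n E \<epsilon> v \<sigma>'" if "?B \<sigma>'" for \<sigma>'
    using that by (auto simp: node_ok_def context_ok_def)
  have JJ: "36 * lg n + J1 = J" by (simp add: J_def J0_def)
  let ?dec = "set_n ''f'' (NSub (nvar ''f'') (NConst 1))"
  have 1: "sim (time ?dec) ?dec \<sigma> (return_pmf ()) (\<lambda>\<sigma>' _. ?B \<sigma>')"
  proof -
    have "sim (time ?dec) ?dec \<sigma> (return_pmf ()) (\<lambda>\<sigma>' _. fst \<sigma>' ''a'' [] = a \<and> fst \<sigma>' ''b'' [] = b \<and> fst \<sigma>' ''f'' [] = f)"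
      using s by (intro sim_straight) (auto simp: nput_def)
    then show ?thesis by (rule sim_weaken) (auto intro: node_ok_eqv[OF ok])
  qed
  have mods: "modN (slack_com J1) = {''k''}" "modR (slack_com J1) = {''kap''}"
    "modN (uniform_com J1) = {''k'', ''g'', ''h'', ''skip''}" "modR (uniform_com J1) = {''S''}"
    "modN select_com = {''x'', ''y'', ''k'', ''skip'', ''h'', ''rx'', ''ry''}" "modR select_com = {''S'', ''sc'', ''yv'', ''pw''}"
    "modN (radius_com J1) = {}" "modR (radius_com J1) = {''rho''}"
    by (auto simp: slack_com_def uniform_com_def res_com_def select_com_def weight_com_def radius_com_def)
  let ?M = "\<lambda>i. select (\<lambda>z. gain E v (sl f) a b (radius (dist v a b) J i) z ^ (2 * lg n + 1)) n"
  let ?R = "\<lambda>\<sigma>' z. node_ok v ((a, fst z, f) # (snd z, b, f) # st) acc \<sigma>'"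
  have 5: "sim (select_time n + 13 + 1) (Seq select_com push_com) \<sigma>' (?M i) ?R"
    if B: "?B \<sigma>'" and k: "snd \<sigma>' ''kap'' [] = sl f" "snd \<sigma>' ''rho'' [] = radius (dist v a b) J i" for \<sigma>' i
  proof -
    have "sim (select_time n + 13 + 1) (Seq select_com push_com) \<sigma>' (bind_pmf (?M i) return_pmf) ?R"
    proof (rule sim_Seq[OF sim_select[OF J(3)[OF B] ab _ _ k]])
      fix \<sigma>2 z assume z: "fst \<sigma>2 ''rx'' [] = fst z \<and> fst \<sigma>2 ''ry'' [] = snd z"
        and f2: "eqv (modN select_com) (modR select_com) \<sigma>' \<sigma>2"
      have B2: "?B \<sigma>2" by (rule B_eqv[OF B f2]) (auto simp: mods)
      then have "sim 13 push_com \<sigma>2 (return_pmf z) (\<lambda>\<sigma>' z'. z' = z \<and> node_ok v ((a, fst z, f) # (snd z, b, f) # st) acc \<sigma>')"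
        using z by (intro sim_push) auto
      then show "sim 13 push_com \<sigma>2 (return_pmf z) ?R" by (rule sim_weaken) auto
    qed (use B in auto)
    then show ?thesis by (simp add: bind_return_pmf')
  qed
  have 4: "sim (1 + (select_time n + 13 + 1) + 1) (Seq (radius_com J1) (Seq select_com push_com)) \<sigma>' (?M i) ?R"
    if B: "?B \<sigma>'" and k: "snd \<sigma>' ''kap'' [] = sl f" "fst \<sigma>' ''g'' [] = i" for \<sigma>' i
  proof (rule sim_Seq_det)
    have d: "snd \<sigma>' ''d'' [a, b] = dist v a b" using J(3)[OF B] ab by (simp add: context_ok_def table_def)
    have "sim (time (radius_com J1)) (radius_com J1) \<sigma>' (return_pmf ()) (\<lambda>\<sigma>'' _. snd \<sigma>'' ''rho'' [] = radius (dist v a b) J i)"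
      using B k d J(1)[OF B] unfolding JJ[symmetric]
      by (intro sim_straight) (auto simp: radius_com_def rput_def radius_def)
    then show "sim 1 (radius_com J1) \<sigma>' (return_pmf ()) (\<lambda>\<sigma>'' _. snd \<sigma>'' ''rho'' [] = radius (dist v a b) J i)"
      by (simp add: radius_com_def)
    fix \<sigma>2 assume r: "snd \<sigma>2 ''rho'' [] = radius (dist v a b) J i" and f2: "eqv (modN (radius_com J1)) (modR (radius_com J1)) \<sigma>' \<sigma>2"
    have B2: "?B \<sigma>2" by (rule B_eqv[OF B f2]) (auto simp: mods)
    have "snd \<sigma>2 ''kap'' [] = sl f" using f2 k unfolding mods by (simp add: eqv_def)
    then show "sim (select_time n + 13 + 1) (Seq select_com push_com) \<sigma>2 (?M i) ?R" using 5[OF B2 _ r] by blast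
  qed
  have 3: "sim (uniform_time J1 n + (1 + (select_time n + 13 + 1) + 1) + 1) (Seq (uniform_com J1) (Seq (radius_com J1) (Seq select_com push_com))) \<sigma>'
     (bind_pmf (uniform J) ?M) ?R"
    if B: "?B \<sigma>'" and k: "snd \<sigma>' ''kap'' [] = sl f" for \<sigma>'
  proof (rule sim_Seq[OF sim_uniform[OF J(1)[OF B], of J1, unfolded JJ]])
    fix \<sigma>2 i assume g: "fst \<sigma>2 ''g'' [] = i" and f2: "eqv (modN (uniform_com J1)) (modR (uniform_com J1)) \<sigma>' \<sigma>2"
    have B2: "?B \<sigma>2" by (rule B_eqv[OF B f2]) (auto simp: mods)
    have "snd \<sigma>2 ''kap'' [] = sl f" using f2 k unfolding mods by (simp add: eqv_def)
    then show "sim (1 + (select_time n + 13 + 1) + 1) (Seq (radius_com J1) (Seq select_com push_com)) \<sigma>2 (?M i) ?R"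
      using 4[OF B2 _ g] by blast
  qed
  have 2: "sim (slack_time J1 + (uniform_time J1 n + (1 + (select_time n + 13 + 1) + 1) + 1) + 1)
     (Seq (slack_com J1) (Seq (uniform_com J1) (Seq (radius_com J1) (Seq select_com push_com)))) \<sigma>' (bind_pmf (uniform J) ?M) ?R"
    if B: "?B \<sigma>'" for \<sigma>'
  proof (rule sim_Seq_det[OF sim_slack[OF J(2,1)[OF B]]])
    show "fst \<sigma>' ''f'' [] = f" using B by blast
    fix \<sigma>2 assume k: "snd \<sigma>2 ''kap'' [] = sl f" and f2: "eqv (modN (slack_com J1)) (modR (slack_com J1)) \<sigma>' \<sigma>2"
    have B2: "?B \<sigma>2" by (rule B_eqv[OF B f2]) (auto simp: mods)
    show "sim (uniform_time J1 n + (1 + (select_time n + 13 + 1) + 1) + 1)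
      (Seq (uniform_com J1) (Seq (radius_com J1) (Seq select_com push_com))) \<sigma>2 (bind_pmf (uniform J) ?M) ?R"
      using 3[OF B2 k] .
  qed
  have "sim (time ?dec + (slack_time J1 + (uniform_time J1 n + (1 + (select_time n + 13 + 1) + 1) + 1) + 1) + 1) (split_com J1) \<sigma>
     (bind_pmf (uniform J) ?M) ?R"
    unfolding split_com_def by (rule sim_Seq_det[OF 1 2])
  then show ?thesis by (rule sim_weaken) auto
qed

lemma sim_node_leaf:
  assumes ok: "node_ok v ((a, b, f) # st) acc \<sigma>" and leaf: "f = 0 \<or> a = b"
  shows "sim (node_time J1 n) (node_com J1) \<sigma> (return_pmf ()) (\<lambda>\<sigma>' _. node_ok v st (acc @ [a]) \<sigma>')"
proof -
  have "sim (7 + (3 + 1) + 1) (node_com J1) \<sigma> (return_pmf ()) (\<lambda>\<sigma>' _. node_ok v st (acc @ [a]) \<sigma>')"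
    unfolding node_com_def
  proof (rule sim_Seq_det[OF sim_pop[OF ok]])
    fix \<sigma>1 assume *: "node_ok v st acc \<sigma>1 \<and> fst \<sigma>1 ''a'' [] = a \<and> fst \<sigma>1 ''b'' [] = b \<and> fst \<sigma>1 ''f'' [] = f"
    show "sim (3 + 1) (Cond (BAnd (npos (nvar ''f'')) (BNot (BAnd (BNot (NLess (nvar ''a'') (nvar ''b''))) (BNot (NLess (nvar ''b'') (nvar ''a''))))))
        (split_com J1) emit_com) \<sigma>1 (return_pmf ()) (\<lambda>\<sigma>' _. node_ok v st (acc @ [a]) \<sigma>')"
      by (rule sim_Cond) (use * leaf in \<open>auto intro: sim_emit\<close>)
  qed
  then show ?thesis by (rule sim_weaken) (auto simp: node_time_def)
qed

lemma sim_node_split: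
  assumes ok: "node_ok v ((a, b, Suc f) # st) acc \<sigma>" and ab: "a \<noteq> b" "conn E a b" "a < n" "b < n"
  shows "sim (node_time J1 n) (node_com J1) \<sigma>
    (bind_pmf (uniform J) (\<lambda>i. select (\<lambda>z. gain E v (sl f) a b (radius (dist v a b) J i) z ^ (2 * lg n + 1)) n))
    (\<lambda>\<sigma>' z. node_ok v ((a, fst z, f) # (snd z, b, f) # st) acc \<sigma>')"
    (is "sim _ _ _ ?M ?R")
proof -
  let ?T = "slack_time J1 + uniform_time J1 n + select_time n + 20"
  have "sim (7 + (?T + 1) + 1) (node_com J1) \<sigma> ?M ?R"
    unfolding node_com_def
  proof (rule sim_Seq_det[OF sim_pop[OF ok]])
    fix \<sigma>1 assume *: "node_ok v st acc \<sigma>1 \<and> fst \<sigma>1 ''a'' [] = a \<and> fst \<sigma>1 ''b'' [] = b \<and> fst \<sigma>1 ''f'' [] = Suc f"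
    show "sim (?T + 1) (Cond (BAnd (npos (nvar ''f'')) (BNot (BAnd (BNot (NLess (nvar ''a'') (nvar ''b''))) (BNot (NLess (nvar ''b'') (nvar ''a''))))))
        (split_com J1) emit_com) \<sigma>1 ?M ?R"
    proof (rule sim_Cond)
      show "sim ?T (split_com J1) \<sigma>1 ?M ?R" using * ab by (intro sim_split) auto
    qed (use * ab in auto)
  qed
  then show ?thesis by (rule sim_weaken) (auto simp: node_time_def)
qed

text \<open>The flat loop forces a continuation form: the same loop expands the left part, the right
  part and whatever lies below on the stack. \<open>M l\<close> is the outcome of the remaining
  stack once the top entry has produced the walk \<open>l\<close>, so the induction hypothesis is
  used twice, nested.\<close>

lemma sim_dfs:
  assumes m: "0 < m" "\<forall>e\<in>E. m \<le> v e"
    and ok: "node_ok v ((a, b, f) # st) acc \<sigma>" and ab: "conn E a b" "a < n" "b < n"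
    and cont: "\<And>l \<sigma>'. l \<in> set_pmf (G v f a b) \<Longrightarrow> node_ok v st (acc @ l) \<sigma>' \<Longrightarrow> sim T (dfs_com J1) \<sigma>' (M l) R"
  shows "sim (dfs_time (node_time J1 n) f + T) (dfs_com J1) \<sigma> (bind_pmf (G v f a b) M) R"
  using ok ab cont
proof (induction f arbitrary: a b st acc \<sigma> T M R)
  case 0
  have b: "bval (npos (nvar ''sp'')) \<sigma>" using 0(1) by (simp add: node_ok_def stack_ok_def)
  have "sim (node_time J1 n + T + 1) (dfs_com J1) \<sigma> (M [a]) R"
    unfolding dfs_com_def
    by (rule sim_Loop_True_det[OF b sim_node_leaf[OF 0(1)]]) (use 0(5) in \<open>auto simp: dfs_com_def\<close>)
  then show ?case by (simp add: bind_return_pmf add_ac)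
next
  case (Suc f)
  have b: "bval (npos (nvar ''sp'')) \<sigma>" using Suc.prems(1) by (simp add: node_ok_def stack_ok_def)
  show ?case
  proof (cases "a = b")
    case True
    have "sim (node_time J1 n + T + 1) (dfs_com J1) \<sigma> (M [a]) R"
      unfolding dfs_com_def
      by (rule sim_Loop_True_det[OF b sim_node_leaf[OF Suc.prems(1)]]) (use Suc.prems(5) True in \<open>auto simp: dfs_com_def\<close>)
    then have "sim (dfs_time (node_time J1 n) (Suc f) + T) (dfs_com J1) \<sigma> (M [a]) R" by (rule sim_weaken) auto
    then show ?thesis using True by (simp add: bind_return_pmf)
  next
    case False
    let ?t = "dfs_time (node_time J1 n) f"
    let ?S = "\<lambda>i. select (\<lambda>z. gain E v (sl f) a b (radius (dist v a b) J i) z ^ (2 * lg n + 1)) n"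
    let ?N = "\<lambda>z. bind_pmf (G v f a (fst z)) (\<lambda>l. bind_pmf (G v f (snd z) b) (\<lambda>r. M (l @ r)))"
    have "sim (node_time J1 n + (?t + (?t + T)) + 1) (dfs_com J1) \<sigma> (bind_pmf (bind_pmf (uniform J) ?S) ?N) R"
      unfolding dfs_com_def
    proof (rule sim_Loop_True[OF b sim_node_split[OF Suc.prems(1) False Suc.prems(2-4)]])
      fix \<sigma>1 z assume z: "z \<in> set_pmf (bind_pmf (uniform J) ?S)" and ok1: "node_ok v ((a, fst z, f) # (snd z, b, f) # st) acc \<sigma>1"
      have "set_pmf (uniform J) = {..<J}" using N by (simp add: uniform_eq lessThan_empty_iff)
      then obtain i where i: "i < J" "z \<in> set_pmf (?S i)" using z by auto
      have g: "conn E a (fst z)" "conn E (snd z) b" "fst z < n" "snd z < n"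
        using set_sel[OF m Suc.prems(2) False i] by (auto simp: good_def[OF m])
      have "sim (?t + (?t + T)) (dfs_com J1) \<sigma>1 (?N z) R"
      proof (rule Suc.IH[OF ok1 g(1) Suc.prems(3) g(3)])
        fix l \<sigma>2 assume l: "l \<in> set_pmf (G v f a (fst z))" and ok2: "node_ok v ((snd z, b, f) # st) (acc @ l) \<sigma>2"
        show "sim (?t + T) (dfs_com J1) \<sigma>2 (bind_pmf (G v f (snd z) b) (\<lambda>r. M (l @ r))) R"
        proof (rule Suc.IH[OF ok2 g(2,4) Suc.prems(4)])
          fix r \<sigma>3 assume r: "r \<in> set_pmf (G v f (snd z) b)" and ok3: "node_ok v st ((acc @ l) @ r) \<sigma>3"
          have "l @ r \<in> set_pmf (G v (Suc f) a b)"
            using l r i False N by (auto simp: uniform_eq lessThan_empty_iff intro!: bexI[of _ i] bexI[of _ z])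
          then show "sim T (dfs_com J1) \<sigma>3 (M (l @ r)) R" using Suc.prems(5) ok3 by simp
        qed
      qed
      then show "sim (?t + (?t + T)) (Loop (npos (nvar ''sp'')) (node_com J1)) \<sigma>1 (?N z) R" by (simp add: dfs_com_def)
    qed
    moreover have "bind_pmf (bind_pmf (uniform J) ?S) ?N = bind_pmf (G v (Suc f) a b) M"
      using False by (simp add: bind_assoc_pmf map_bind_pmf bind_map_pmf pair_pmf_def bind_return_pmf)
    ultimately have "sim (node_time J1 n + (?t + (?t + T)) + 1) (dfs_com J1) \<sigma> (bind_pmf (G v (Suc f) a b) M) R" by simp
    then show ?thesis by (rule sim_weaken) auto
  qed
qed

end

section \<open>The program\<close>

definition copy_com :: com where
  "copy_com = RAssign ''v'' [nvar ''x'', nvar ''y''] (RGet ''w'' [nvar ''x'', nvar ''y''])"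

definition smooth_com :: com where
  "smooth_com = Cond (RLess (rnum 0) (rvar ''opt''))
     (RAssign ''v'' [nvar ''x'', nvar ''y''] (RAdd (RGet ''w'' [nvar ''x'', nvar ''y''])
        (RDiv (RMul (rvar ''eps'') (rvar ''opt'')) (RMul (RMul (rnum 4) (ROfNat (nvar ''n''))) (ROfNat (nvar ''n''))))))
     (Cond (RLess (rnum 0) (RGet ''w'' [nvar ''x'', nvar ''y'']))
        (RAssign ''v'' [nvar ''x'', nvar ''y''] (RMul (rnum 4) (ROfNat (nvar ''n''))))
        (RAssign ''v'' [nvar ''x'', nvar ''y''] (rnum 1)))"

definition start_com :: "nat \<Rightarrow> com" where
  "start_com J1 = Seq (NAssign ''sa'' [NConst 0] (nvar ''s'')) (Seq (NAssign ''sb'' [NConst 0] (nvar ''t''))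
     (Seq (NAssign ''sf'' [NConst 0] (NAdd (nvar ''J'') (NConst J1))) (set_n ''sp'' (NConst 1))))"

definition sp_com :: "nat \<Rightarrow> com" where
  "sp_com J1 = Seq lg_com (Seq (grid copy_com) (Seq bf_com (Seq (set_r ''opt'' (RGet ''d'' [nvar ''s'', nvar ''t'']))
     (Seq (grid smooth_com) (Seq bf_com (Seq (start_com J1) (dfs_com J1)))))))"

definition sp_time :: "nat \<Rightarrow> nat \<Rightarrow> nat" where
  "sp_time J1 n = (6 * lg n + 7) + (grid_time n 1 + (bf_time n + (1 + (grid_time n 5 + (bf_time n +
     (7 + ((node_time J1 n + 1) * 2 ^ Suc (36 * lg n + J1) + 1) + 1) + 1) + 1) + 1) + 1) + 1) + 1"

section \<open>Polynomial bounds on the running time\<close>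

definition poly_bounded :: "(nat \<Rightarrow> nat) \<Rightarrow> bool" where
  "poly_bounded g \<longleftrightarrow> (\<exists>q :: nat poly. \<forall>n. g n \<le> poly q n)"

lemma poly_bounded_const: "poly_bounded (\<lambda>n. k)"
  unfolding poly_bounded_def by (rule exI[of _ "[:k:]"]) simp

lemma poly_bounded_id: "poly_bounded (\<lambda>n. n)"
  unfolding poly_bounded_def by (rule exI[of _ "[:0, 1:]"]) simp

lemma poly_bounded_add: "poly_bounded f \<Longrightarrow> poly_bounded g \<Longrightarrow> poly_bounded (\<lambda>n. f n + g n)"
  unfolding poly_bounded_def by (metis add_mono poly_add)

lemma poly_bounded_mult: "poly_bounded f \<Longrightarrow> poly_bounded g \<Longrightarrow> poly_bounded (\<lambda>n. f n * g n)"
  unfolding poly_bounded_def by (metis mult_le_mono poly_mult)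

lemma poly_bounded_mono: "poly_bounded g \<Longrightarrow> (\<And>n. f n \<le> g n) \<Longrightarrow> poly_bounded f"
  unfolding poly_bounded_def by (meson order_trans)

lemma poly_bounded_power: "poly_bounded f \<Longrightarrow> poly_bounded (\<lambda>n. f n ^ k)"
  by (induction k) (simp_all add: poly_bounded_const poly_bounded_mult)

lemma poly_bounded_two_power_lg: "poly_bounded (\<lambda>n. 2 ^ lg n)"
proof (rule poly_bounded_mono)
  show "poly_bounded (\<lambda>n. 2 * n + 2)" by (intro poly_bounded_add poly_bounded_mult poly_bounded_const poly_bounded_id)
  show "2 ^ lg n \<le> 2 * n + 2" for n
  proof (cases "n = 0")
    case True
    have "lg 0 = 1" by (rule lg_eqI) auto
    then show ?thesis using True by simp
  next
    case False
    then show ?thesis using two_power_lg_le[of n] by simp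
  qed
qed

lemma poly_bounded_lg: "poly_bounded lg"
  by (rule poly_bounded_mono[OF poly_bounded_two_power_lg]) (simp add: less_imp_le)

text \<open>The only term that looks exponential is \<open>2 ^ (36 * lg n + J1)\<close>: its first
  factor is the 36th power of \<open>2 ^ lg n\<close>, which is linear in \<open>n\<close>, and
  \<open>2 ^ J1\<close> is a constant for fixed \<open>\<epsilon>\<close>.\<close>

lemma poly_bounded_sp_time: "poly_bounded (sp_time J1)"
proof -
  have "(2::nat) ^ Suc (36 * lg n + J1) = (2 ^ lg n) ^ 36 * 2 ^ Suc J1" for n
    unfolding power_mult[symmetric] power_add[symmetric] by (simp add: mult.commute)
  then have "(\<lambda>n. (2::nat) ^ Suc (36 * lg n + J1)) = (\<lambda>n. (2 ^ lg n) ^ 36 * 2 ^ Suc J1)" by (rule ext)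
  then have p: "poly_bounded (\<lambda>n. 2 ^ Suc (36 * lg n + J1))"
    by (simp only:) (intro poly_bounded_mult poly_bounded_power poly_bounded_two_power_lg poly_bounded_const)
  show ?thesis
    unfolding sp_time_def[abs_def] grid_time_def bf_time_def node_time_def slack_time_def uniform_time_def select_time_def weight_time_def
    by (intro poly_bounded_add poly_bounded_mult poly_bounded_const poly_bounded_id poly_bounded_lg p)
qed

context instance_params
begin

lemma sim_fill:
  assumes n: "fst \<sigma> ''n'' [] = n" and c: "straight c" "modN c = {}" "modR c = {''v''}"
    and cell: "\<And>\<sigma>' x y. x < n \<Longrightarrow> y < n \<Longrightarrow> {x, y} \<in> E \<Longrightarrow> fst \<sigma>' ''x'' [] = x \<Longrightarrow> fst \<sigma>' ''y'' [] = y \<Longrightarrow>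
       eqv {''x'', ''y''} {''v''} \<sigma> \<sigma>' \<Longrightarrow> snd (exec c \<sigma>') ''v'' [x, y] = h {x, y}"
    and off: "\<And>\<sigma>' z. z \<noteq> [fst \<sigma>' ''x'' [], fst \<sigma>' ''y'' []] \<Longrightarrow> snd (exec c \<sigma>') ''v'' z = snd \<sigma>' ''v'' z"
  shows "sim (grid_time n (time c)) (grid c) \<sigma> (return_pmf ()) (\<lambda>\<sigma>' _. vals ''v'' E h \<sigma>')"
proof -
  let ?P = "\<lambda>A (\<sigma>::store). \<forall>x y. (x, y) \<in> A \<and> {x, y} \<in> E \<longrightarrow> snd \<sigma> ''v'' [x, y] = h {x, y}"
  have "sim (grid_time n (time c)) (grid c) \<sigma> (return_pmf ()) (\<lambda>\<sigma>' _. ?P ({..<n} \<times> {..<n}) \<sigma>')"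
  proof (rule sim_grid[OF n])
    fix A \<sigma>' x y assume xy: "x < n" "y < n" "fst \<sigma>' ''x'' [] = x" "fst \<sigma>' ''y'' [] = y" and P: "?P A \<sigma>'"
      and f: "eqv (insert ''x'' (insert ''y'' (modN c))) (modR c) \<sigma> \<sigma>'"
    have "?P (insert (x, y) A) (exec c \<sigma>')"
    proof (intro allI impI)
      fix x' y' assume *: "(x', y') \<in> insert (x, y) A \<and> {x', y'} \<in> E"
      show "snd (exec c \<sigma>') ''v'' [x', y'] = h {x', y'}"
      proof (cases "x' = x \<and> y' = y")
        case True
        then show ?thesis using cell[OF xy(1,2) _ xy(3,4)] f * c by auto
      next
        case False
        then show ?thesis using off[of "[x', y']" \<sigma>'] xy P * by auto
      qed
    qed
    then show "sim (time c) c \<sigma>' (return_pmf ()) (\<lambda>\<sigma>'' _. ?P (insert (x, y) A) \<sigma>'')"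
      using c(1) by (intro sim_straight) auto
  qed (use c in \<open>auto simp: nput_def\<close>)
  then show ?thesis by (rule sim_weaken) (use edge_less in \<open>auto simp: vals_def\<close>)
qed

lemma sim_sp_com:
  assumes w: "w \<in> weights E"
  shows "sim (sp_time J1 n) (sp_com J1) (sp_input \<epsilon> n E s t w) (sp_spec J1 \<epsilon> n E s t w) (\<lambda>\<sigma>' p. sp_output \<sigma>' = p)"
proof -
  let ?R = "\<lambda>\<sigma>' p. sp_output \<sigma>' = (p :: nat list)" and ?M = "sp_spec J1 \<epsilon> n E s t w"
  have JJ: "36 * lg n + J1 = J" by (simp add: J_def J0_def)
  \<comment> \<open>The bound differs between zero and positive optimum, but the program argument
    needs only some positive one, so that selection reaches connected end points.\<close>
  obtain m where m: "0 < m" "\<forall>e\<in>E. m \<le> sm w e"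
  proof (cases "0 < opt w")
    case True
    have "0 < \<epsilon> * opt w / (4 * real n * real n)" using True eps n_pos by simp
    moreover have "\<forall>e\<in>E. \<epsilon> * opt w / (4 * real n * real n) \<le> sm w e" using True weightsD(1)[OF w] by (auto simp: sm_pos_eq)
    ultimately show ?thesis using that by blast
  next
    case False
    have "\<forall>e\<in>E. 1 \<le> sm w e" using False n_pos by (auto simp: smoothed_def)
    then show ?thesis using that[of 1] by simp
  qed
  let ?A = "\<lambda>\<sigma>. env n E \<sigma> \<and> vals ''w'' E w \<sigma> \<and> fst \<sigma> ''s'' [] = s \<and> fst \<sigma> ''t'' [] = t \<and> snd \<sigma> ''eps'' [] = \<epsilon> \<and> fst \<sigma> ''len'' [] = 0"
  have A_eqv: "?A \<sigma>'" if "?A \<sigma>" "eqv X Y \<sigma> \<sigma>'" "X \<inter> {''n'', ''E'', ''s'', ''t'', ''len''} = {}" "Y \<inter> {''w'', ''eps''} = {}" for \<sigma> \<sigma>' X Y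
    using that by (simp add: env_def vals_def eqv_def)
  let ?LJ = "\<lambda>\<sigma>. fst \<sigma> ''L'' [] = lg n \<and> fst \<sigma> ''J'' [] = 36 * lg n"
  have LJ_eqv: "?LJ \<sigma>'" if "?LJ \<sigma>" "eqv X Y \<sigma> \<sigma>'" "X \<inter> {''L'', ''J''} = {}" for \<sigma> \<sigma>' X Y
    using that by (simp add: eqv_def)
  have A0: "?A (sp_input \<epsilon> n E s t w)" by (simp add: sp_input_def env_def vals_def)
  let ?td = "(node_time J1 n + 1) * 2 ^ Suc (36 * lg n + J1) + 1"
  have dfs: "sim (7 + ?td + 1) (Seq (start_com J1) (dfs_com J1)) \<sigma> ?M ?R"
    if ctx: "context_ok n E \<epsilon> (sm w) \<sigma>" and A: "?A \<sigma>" for \<sigma>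
  proof (rule sim_Seq_det)
    have J: "fst \<sigma> ''J'' [] = 36 * lg n" using ctx by (simp add: context_ok_def)
    have "sim (time (start_com J1)) (start_com J1) \<sigma> (return_pmf ()) (\<lambda>\<sigma>' _. stack_ok \<sigma>' [(s, t, J)] \<and> sp_output \<sigma>' = [])"
      using A J JJ by (intro sim_straight) (auto simp: start_com_def nput_def stack_ok_def sp_output_def)
    then show "sim 7 (start_com J1) \<sigma> (return_pmf ()) (\<lambda>\<sigma>' _. node_ok (sm w) [(s, t, J)] [] \<sigma>')"
    proof (rule sim_weaken)
      fix \<sigma>' assume "eqv (modN (start_com J1)) (modR (start_com J1)) \<sigma> \<sigma>'"
      then have "context_ok n E \<epsilon> (sm w) \<sigma>'" by (rule context_ok_eqv[OF ctx]) (auto simp: start_com_def)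
      moreover assume "stack_ok \<sigma>' [(s, t, J)] \<and> sp_output \<sigma>' = []"
      ultimately show "node_ok (sm w) [(s, t, J)] [] \<sigma>'" by (simp add: node_ok_def)
    qed (simp add: start_com_def)
    fix \<sigma>1 assume ok: "node_ok (sm w) [(s, t, J)] [] \<sigma>1"
    have "sim (dfs_time (node_time J1 n) J + 1) (dfs_com J1) \<sigma>1 (bind_pmf (G (sm w) J s t) return_pmf) ?R"
    proof (rule sim_dfs[OF m ok st(3,1,2)])
      fix l \<sigma>' assume "node_ok (sm w) [] ([] @ l) \<sigma>'"
      then show "sim 1 (dfs_com J1) \<sigma>' (return_pmf l) ?R"
        unfolding dfs_com_def by (intro sim_Loop_False) (auto simp: node_ok_def stack_ok_def)
    qed
    then show "sim ?td (dfs_com J1) \<sigma>1 ?M ?R"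
      unfolding sp_spec_eq JJ bind_return_pmf'
    proof (rule sim_weaken)
      show "dfs_time (node_time J1 n) J + 1 \<le> (node_time J1 n + 1) * 2 ^ Suc J + 1"
        using dfs_time_le[of "node_time J1 n" J] by linarith
    qed
  qed
  have 6: "sim (bf_time n + (7 + ?td + 1) + 1) (Seq bf_com (Seq (start_com J1) (dfs_com J1))) \<sigma> ?M ?R"
    if A: "?A \<sigma>" "?LJ \<sigma>" and v: "vals ''v'' E (sm w) \<sigma>" for \<sigma>
  proof (rule sim_Seq_det[OF sim_bf[OF _ v]])
    show "env n E \<sigma>" using A by blast
    show "\<forall>e\<in>E. 0 \<le> sm w e" using m by force
    fix \<sigma>' assume tb: "table n E (sm w) \<sigma>'" and f: "eqv (modN bf_com) (modR bf_com) \<sigma> \<sigma>'"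
    have A': "?A \<sigma>'" by (rule A_eqv[OF A(1) f]) (auto simp: mod_bf)
    moreover have "?LJ \<sigma>'" by (rule LJ_eqv[OF A(2) f]) (auto simp: mod_bf)
    moreover have "vals ''v'' E (sm w) \<sigma>'" by (rule vals_eqv[OF v f]) (simp add: mod_bf)
    ultimately have "context_ok n E \<epsilon> (sm w) \<sigma>'" using tb by (simp add: context_ok_def)
    then show "sim (7 + ?td + 1) (Seq (start_com J1) (dfs_com J1)) \<sigma>' ?M ?R" using dfs A' by blast
  qed
  have 5: "sim (grid_time n 5 + (bf_time n + (7 + ?td + 1) + 1) + 1) (Seq (grid smooth_com) (Seq bf_com (Seq (start_com J1) (dfs_com J1)))) \<sigma> ?M ?R"
    if A: "?A \<sigma>" "?LJ \<sigma>" and o: "snd \<sigma> ''opt'' [] = opt w" for \<sigma>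
  proof (rule sim_Seq_det)
    have nn: "fst \<sigma> ''n'' [] = n" using A by (simp add: env_def)
    have "sim (grid_time n (time smooth_com)) (grid smooth_com) \<sigma> (return_pmf ()) (\<lambda>\<sigma>' _. vals ''v'' E (sm w) \<sigma>')"
    proof (rule sim_fill[OF nn])
      fix \<sigma>' x y assume xy: "{x, y} \<in> E" "fst \<sigma>' ''x'' [] = x" "fst \<sigma>' ''y'' [] = y" and f: "eqv {''x'', ''y''} {''v''} \<sigma> \<sigma>'"
      have "fst \<sigma>' ''n'' [] = n" "snd \<sigma>' ''w'' [x, y] = w {x, y}" "snd \<sigma>' ''opt'' [] = opt w" "snd \<sigma>' ''eps'' [] = \<epsilon>"
        using f A o xy nn by (auto simp: eqv_def vals_def)
      then show "snd (exec smooth_com \<sigma>') ''v'' [x, y] = sm w {x, y}"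
        using xy by (simp add: smooth_com_def rput_def smoothed_def)
    qed (auto simp: smooth_com_def rput_def)
    then show "sim (grid_time n 5) (grid smooth_com) \<sigma> (return_pmf ()) (\<lambda>\<sigma>' _. vals ''v'' E (sm w) \<sigma>')"
    proof (rule sim_weaken)
      have "time smooth_com = 5" by (simp add: smooth_com_def)
      then show "grid_time n (time smooth_com) \<le> grid_time n 5" by simp
    qed
    fix \<sigma>' assume v: "vals ''v'' E (sm w) \<sigma>'" and f: "eqv (modN (grid smooth_com)) (modR (grid smooth_com)) \<sigma> \<sigma>'"
    have "?A \<sigma>'" by (rule A_eqv[OF A(1) f]) (auto simp: smooth_com_def)
    moreover have "?LJ \<sigma>'" by (rule LJ_eqv[OF A(2) f]) (auto simp: smooth_com_def)
    ultimately show "sim (bf_time n + (7 + ?td + 1) + 1) (Seq bf_com (Seq (start_com J1) (dfs_com J1))) \<sigma>' ?M ?R"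
      using 6 v by blast
  qed
  let ?opt = "set_r ''opt'' (RGet ''d'' [nvar ''s'', nvar ''t''])"
  have 4: "sim (1 + (grid_time n 5 + (bf_time n + (7 + ?td + 1) + 1) + 1) + 1)
     (Seq ?opt (Seq (grid smooth_com) (Seq bf_com (Seq (start_com J1) (dfs_com J1))))) \<sigma> ?M ?R"
    if A: "?A \<sigma>" "?LJ \<sigma>" and tb: "table n E w \<sigma>" for \<sigma>
  proof (rule sim_Seq_det)
    have "snd \<sigma> ''d'' [s, t] = opt w" using tb st by (simp add: table_def)
    then have "sim (time ?opt) ?opt \<sigma> (return_pmf ()) (\<lambda>\<sigma>' _. snd \<sigma>' ''opt'' [] = opt w)"
      using A by (intro sim_straight) (auto simp: rput_def)
    then show "sim 1 ?opt \<sigma> (return_pmf ()) (\<lambda>\<sigma>' _. snd \<sigma>' ''opt'' [] = opt w)" by simp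
    fix \<sigma>' assume o: "snd \<sigma>' ''opt'' [] = opt w" and f: "eqv (modN ?opt) (modR ?opt) \<sigma> \<sigma>'"
    have "?A \<sigma>'" by (rule A_eqv[OF A(1) f]) auto
    moreover have "?LJ \<sigma>'" by (rule LJ_eqv[OF A(2) f]) auto
    ultimately show "sim (grid_time n 5 + (bf_time n + (7 + ?td + 1) + 1) + 1)
      (Seq (grid smooth_com) (Seq bf_com (Seq (start_com J1) (dfs_com J1)))) \<sigma>' ?M ?R" using 5 o by blast
  qed
  have 3: "sim (bf_time n + (1 + (grid_time n 5 + (bf_time n + (7 + ?td + 1) + 1) + 1) + 1) + 1)
     (Seq bf_com (Seq ?opt (Seq (grid smooth_com) (Seq bf_com (Seq (start_com J1) (dfs_com J1)))))) \<sigma> ?M ?R"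
    if A: "?A \<sigma>" "?LJ \<sigma>" and v: "vals ''v'' E w \<sigma>" for \<sigma>
  proof (rule sim_Seq_det[OF sim_bf[OF _ v weightsD(1)[OF w]]])
    show "env n E \<sigma>" using A by blast
    fix \<sigma>' assume tb: "table n E w \<sigma>'" and f: "eqv (modN bf_com) (modR bf_com) \<sigma> \<sigma>'"
    have "?A \<sigma>'" by (rule A_eqv[OF A(1) f]) (auto simp: mod_bf)
    moreover have "?LJ \<sigma>'" by (rule LJ_eqv[OF A(2) f]) (auto simp: mod_bf)
    ultimately show "sim (1 + (grid_time n 5 + (bf_time n + (7 + ?td + 1) + 1) + 1) + 1)
      (Seq ?opt (Seq (grid smooth_com) (Seq bf_com (Seq (start_com J1) (dfs_com J1))))) \<sigma>' ?M ?R" using 4 tb by blast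
  qed
  have 2: "sim (grid_time n 1 + (bf_time n + (1 + (grid_time n 5 + (bf_time n + (7 + ?td + 1) + 1) + 1) + 1) + 1) + 1)
     (Seq (grid copy_com) (Seq bf_com (Seq ?opt (Seq (grid smooth_com) (Seq bf_com (Seq (start_com J1) (dfs_com J1))))))) \<sigma> ?M ?R"
    if A: "?A \<sigma>" "?LJ \<sigma>" for \<sigma>
  proof (rule sim_Seq_det)
    have nn: "fst \<sigma> ''n'' [] = n" using A by (simp add: env_def)
    have "sim (grid_time n (time copy_com)) (grid copy_com) \<sigma> (return_pmf ()) (\<lambda>\<sigma>' _. vals ''v'' E w \<sigma>')"
    proof (rule sim_fill[OF nn])
      fix \<sigma>' x y assume xy: "{x, y} \<in> E" "fst \<sigma>' ''x'' [] = x" "fst \<sigma>' ''y'' [] = y" and f: "eqv {''x'', ''y''} {''v''} \<sigma> \<sigma>'"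
      have "snd \<sigma>' ''w'' [x, y] = w {x, y}" using f A xy by (auto simp: eqv_def vals_def)
      then show "snd (exec copy_com \<sigma>') ''v'' [x, y] = w {x, y}" using xy by (simp add: copy_com_def rput_def)
    qed (auto simp: copy_com_def rput_def)
    then show "sim (grid_time n 1) (grid copy_com) \<sigma> (return_pmf ()) (\<lambda>\<sigma>' _. vals ''v'' E w \<sigma>')" by (simp add: copy_com_def)
    fix \<sigma>' assume v: "vals ''v'' E w \<sigma>'" and f: "eqv (modN (grid copy_com)) (modR (grid copy_com)) \<sigma> \<sigma>'"
    have "?A \<sigma>'" by (rule A_eqv[OF A(1) f]) (auto simp: copy_com_def)
    moreover have "?LJ \<sigma>'" by (rule LJ_eqv[OF A(2) f]) (auto simp: copy_com_def)
    ultimately show "sim (bf_time n + (1 + (grid_time n 5 + (bf_time n + (7 + ?td + 1) + 1) + 1) + 1) + 1)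
      (Seq bf_com (Seq ?opt (Seq (grid smooth_com) (Seq bf_com (Seq (start_com J1) (dfs_com J1)))))) \<sigma>' ?M ?R" using 3 v by blast
  qed
  have n0: "fst (sp_input \<epsilon> n E s t w) ''n'' [] = n" using A0 by (simp add: env_def)
  show ?thesis unfolding sp_com_def sp_time_def
  proof (rule sim_Seq_det[OF sim_lg[OF n0]])
    fix \<sigma>' assume LJ: "?LJ \<sigma>'" and f: "eqv (modN lg_com) (modR lg_com) (sp_input \<epsilon> n E s t w) \<sigma>'"
    have "?A \<sigma>'" by (rule A_eqv[OF A0 f]) (auto simp: lg_com_def)
    then show "sim (grid_time n 1 + (bf_time n + (1 + (grid_time n 5 + (bf_time n + (7 + ?td + 1) + 1) + 1) + 1) + 1) + 1)
     (Seq (grid copy_com) (Seq bf_com (Seq ?opt (Seq (grid smooth_com) (Seq bf_com (Seq (start_com J1) (dfs_com J1))))))) \<sigma>' ?M ?R"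
      using 2 LJ by blast
  qed
qed

end

text \<open>The least exponent that reaches \<open>\<epsilon>\<close> works: it is positive because
  \<open>\<epsilon> < 1\<close>, and its predecessor still exceeds
  \<open>\<epsilon>\<close>.\<close>

lemma ex_levels:
  fixes \<epsilon> :: real assumes "0 < \<epsilon>" "\<epsilon> < 1"
  shows "\<exists>J1. (3/4) ^ J1 \<le> \<epsilon> \<and> \<epsilon> \<le> 4/3 * (3/4) ^ J1"
proof -
  obtain k where k: "(3/4 :: real) ^ k < \<epsilon>" using real_arch_pow_inv[OF assms(1), of "3/4"] by auto
  define J1 where "J1 = (LEAST k. (3/4 :: real) ^ k \<le> \<epsilon>)"
  have le: "(3/4) ^ J1 \<le> \<epsilon>" unfolding J1_def using LeastI[of "\<lambda>k. (3/4 :: real) ^ k \<le> \<epsilon>", OF less_imp_le[OF k]] .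
  have "J1 \<noteq> 0" using le assms(2) by (cases "J1 = 0") auto
  then obtain j where j: "J1 = Suc j" using not0_implies_Suc by blast
  have "\<not> (3/4) ^ j \<le> \<epsilon>" using not_less_Least[of j "\<lambda>k. (3/4 :: real) ^ k \<le> \<epsilon>"] j by (simp add: J1_def)
  then have "\<epsilon> \<le> 4/3 * (3/4) ^ J1" by (simp add: j)
  then show ?thesis using le by blast
qed

theorem theorem4p1:
  "\<exists>C :: real. \<forall>\<epsilon> :: real. 0 < \<epsilon> \<and> \<epsilon> < 1 \<longrightarrow>
     (\<exists>A :: com.
        sp_poly_time A \<epsilon> \<and>
        sp_approximation A \<epsilon> (1 + \<epsilon>) \<and>
        (\<forall>n E s t. sp_instance n E s t \<longrightarrow>
           sp_lipschitz_const A \<epsilon> n E s t \<le> ennreal (C * (1 / \<epsilon>) * (ln (real n)) ^ 3)))"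
proof (rule exI[of _ "3 * (27 * 433 * 3 * 259200) * 27"], intro allI impI)
  \<comment> \<open>The last factor \<open>27 = 3 ^ 3\<close> stems from
    \<open>lg n \<le> 3 * ln n\<close>, the others from \<open>lip\<close>.\<close>
  let ?C = "3 * (27 * 433 * 3 * 259200) * 27 :: real"
  fix \<epsilon> :: real assume eps: "0 < \<epsilon> \<and> \<epsilon> < 1"
  obtain J1 where J1: "(3/4) ^ J1 \<le> \<epsilon>" "\<epsilon> \<le> 4/3 * (3/4) ^ J1" using ex_levels eps by blast
  have params: "instance_params n E s t J1 \<epsilon>" if "sp_instance n E s t" for n E s t
    using that eps J1 by unfold_locales (auto simp: sp_instance_def conn_def)
  have result: "halts_within (sp_time J1 n) (sp_com J1) (sp_input \<epsilon> n E s t w)"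
    "sp_result (sp_com J1) \<epsilon> n E s t w = sp_spec J1 \<epsilon> n E s t w"
    if "sp_instance n E s t" "w \<in> weights E" for n E s t w
    using sim_final[OF instance_params.sim_sp_com[OF params[OF that(1)] that(2)]] by (auto simp: sp_result_def)
  have "sp_poly_time (sp_com J1) \<epsilon>"
  proof -
    obtain q where q: "\<And>n. sp_time J1 n \<le> poly q n" using poly_bounded_sp_time[of J1] by (auto simp: poly_bounded_def)
    have "halts_within (poly q n) (sp_com J1) (sp_input \<epsilon> n E s t w)" if "sp_instance n E s t" "w \<in> weights E" for n E s t w
      using sim_final(1)[OF sim_weaken[OF instance_params.sim_sp_com[OF params[OF that(1)] that(2)] q[of n]]] by blast
    then show ?thesis unfolding sp_poly_time_def by blast
  qed
  moreover have "sp_approximation (sp_com J1) \<epsilon> (1 + \<epsilon>)"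
    unfolding sp_approximation_def
    using result(2) instance_params.spec_approx[OF params] by metis
  moreover have "sp_lipschitz_const (sp_com J1) \<epsilon> n E s t \<le> ennreal (?C * (1 / \<epsilon>) * (ln (real n)) ^ 3)"
    if inst: "sp_instance n E s t" for n E s t
  proof -
    interpret instance_params n E s t J1 \<epsilon> by (rule params[OF inst])
    have eq: "sp_lipschitz_const (sp_com J1) \<epsilon> n E s t = lipschitz_const E (\<lambda>w. map_pmf walk_edges (sp_spec J1 \<epsilon> n E s t w))"
      unfolding sp_lipschitz_const_def lipschitz_const_def
      by (rule SUP_cong) (auto simp: result(2)[OF inst])
    show ?thesis
    proof (cases "2 \<le> n")
      case True
      have "lip = 3 * (27 * 433 * 3 * 259200) * (1 / \<epsilon>) * real (lg n) ^ 3" by (simp add: lip_def)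
      also have "\<dots> \<le> 3 * (27 * 433 * 3 * 259200) * (1 / \<epsilon>) * (3 * ln (real n)) ^ 3"
        using lg_le_ln[OF True] eps by (intro mult_left_mono power_mono) auto
      also have "\<dots> = ?C * (1 / \<epsilon>) * (ln (real n)) ^ 3" by (simp add: power_mult_distrib)
      finally have "ennreal lip \<le> ennreal (?C * (1 / \<epsilon>) * (ln (real n)) ^ 3)" by (rule ennreal_leI)
      then show ?thesis unfolding eq using spec_lipschitz_const by (rule order_trans[rotated])
    next
      case False
      \<comment> \<open>With a single vertex the right-hand side is \<open>0\<close>, as
        \<open>ln 1 = 0\<close>. There are no edges and only one weighting, so the supremum is over
        the empty set.\<close>
      have "E = {}" using False edge_ex by fastforce
      then have "weights E = {\<lambda>_. undefined}" by (auto simp: weights_def)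
      then have "{(w, w'). w \<in> weights E \<and> w' \<in> weights E \<and> w \<noteq> w'} = {}" by auto
      then show ?thesis unfolding eq lipschitz_const_def by (simp only: image_empty Sup_empty) (simp add: bot_ennreal)
    qed
  qed
  ultimately show "\<exists>A. sp_poly_time A \<epsilon> \<and> sp_approximation A \<epsilon> (1 + \<epsilon>) \<and>
      (\<forall>n E s t. sp_instance n E s t \<longrightarrow> sp_lipschitz_const A \<epsilon> n E s t \<le> ennreal (?C * (1 / \<epsilon>) * (ln (real n)) ^ 3))"
    by blast
qed

end
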